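(* Let $\{a_n\}_{n\ge0},\{b_n\}_{n\ge0}$ be sequences of positive numbers with $b_0=1$, $b_{n+1}<a_n<b_n$ for all $n\ge0$, and $a_n,b_n\to0$. Suppose that either (i) $a_n/b_n\to0$ and $b_{n+1}/a_n\to0$ as $n\to\infty$; or (ii) there is a constant $0<c<1$ with $\max(b_{n+1}/a_n,\ a_n/b_n)<c$ for all $n$, and $\max\{\sqrt[n]{a_n},\sqrt[n]{b_n}\}\to0$ as $n\to\infty$. Let $W=\{z:\Re z>0,\ \Im z<0\}\cup\bigcup_{n=0}^\infty\big((a_n,b_n)\times\mathbb{R}\big)$. Let $I,J$ be disjoint open arcs of $\mathbb{S}^1$. If $(I\times J)\cap\mathfrak{L}=g$, i.e. $g$ is the one and only geodesic of $\mathfrak{L}$ belonging to $I\times J$, then $$\liminf_{\varepsilon\to0}\frac{\mathrm{mod}\,\Gamma^\varepsilon_{I,J}}{\frac1\pi\log\frac1\varepsilon}=m,\qquad \limsup_{\varepsilon\to0}\frac{\mathrm{mod}\,\Gamma^\varepsilon_{I,J}}{\frac1\pi\log\frac1\varepsilon}=M,$$ where, with $A_n=\prod_{k=0}^na_k$ and $B_n=\prod_{k=0}^nb_k$, $$m=1+\liminf_{n\to\infty}\frac{\log(A_{n-1}/B_n)}{\log(1/a_n)},\qquad M=1+\limsup_{n\to\infty}\frac{\log(A_{n-1}/B_n)}{\log(1/b_n)}.$$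
   Context: $\mathbb{D}$, $\mathbb{S}^1$ are the unit disk and unit circle. $\phi:\mathbb{D}\to W$ is the conformal map with $\lim_{w\to0}\phi^{-1}(w)=-1$, $\lim_{w\to1}\phi^{-1}(w)=1$, $\lim_{\Im w\to-\infty}\phi^{-1}(w)=-i$ (limits for $w\in W$). For $\varepsilon>0$, $V_\varepsilon(x,y)=(x,\varepsilon y)$. For disjoint open arcs $I,J\subset\mathbb{S}^1$, $\Gamma_{I,J}$ is the family of curves in $\mathbb{D}$ connecting $I$ to $J$, and $\Gamma^\varepsilon_{I,J}=V_\varepsilon(\phi(\Gamma_{I,J}))$ is the family of images of these curves. The modulus of a curve family $\Gamma$ in a domain is $\mathrm{mod}\,\Gamma=\inf_\rho\iint\rho^2\,dx\,dy$, the infimum over nonnegative Borel functions $\rho$ on the domain with $\int_\gamma\rho\,|dz|\ge1$ for every $\gamma\in\Gamma$. $\gamma_{(x,y)}$ is the unoriented hyperbolic geodesic of $\mathbb{D}$ with endpoints $x,y\in\mathbb{S}^1$; it is said to belong to $I\times J$ if one endpoint is in $I$ and the other in $J$. Let $z_n\in\mathbb{S}^1$ be the limit of $\phi^{-1}(w)$ as $\Im w\to+\infty$ with $\Re w\in(a_n,b_n)$; $\gamma_n^+$ and $\gamma_n^-$ are the geodesics connecting $z_n$ to $\lim_{w\to b_n}\phi^{-1}(w)$ and $\lim_{w\to a_n}\phi^{-1}(w)$, respectively; $g=\gamma_{(-1,-i)}$; and $\mathfrak{L}=\{g\}\cup\bigcup_{n=0}^\infty\{\gamma_n^+,\gamm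a_n^-\}$.
   Formalization: Also assumed: I and J have disjoint closures, and if z_n lies in one arc, the point of S^1 corresponding to a_n or b_n is not an end of the other; without this the claim fails (infinite modulus, or an extra 2/3 in both limits). *)

theory Defs
  imports "HOL-Complex_Analysis.Complex_Analysis"
begin

section \<open>Curves, line integrals and the modulus\<close>

text \<open>
  A curve is a function on the open parameter interval \<open>(0,1)\<close>; its values elsewhere are
  never used. \<open>curve_length \<gamma> s t\<close> is the supremum of the lengths of the inscribed polygons
  of \<open>\<gamma>\<close> restricted to \<open>[s,t]\<close>.
\<close>

definition curve_length :: "(real \<Rightarrow> complex) \<Rightarrow> real \<Rightarrow> real \<Rightarrow> ennreal" where
  "curve_length \<gamma> s t =
     (SUP ts \<in> {ts. sorted ts \<and> set ts \<subseteq> {s..t}}.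
        \<Sum>i<length ts - 1. ennreal (dist (\<gamma> (ts ! i)) (\<gamma> (ts ! Suc i))))"

definition locally_rectifiable :: "(real \<Rightarrow> complex) \<Rightarrow> bool" where
  "locally_rectifiable \<gamma> \<longleftrightarrow> (\<forall>s t. 0 < s \<and> s \<le> t \<and> t < 1 \<longrightarrow> curve_length \<gamma> s t < \<infinity>)"

text \<open>
  Reparametrization by arc length of \<open>\<gamma>\<close> restricted to \<open>[s,t]\<close>: the point at distance \<open>\<sigma>\<close>
  from \<open>\<gamma> s\<close> along the curve. The curve is constant on any parameter interval on which the
  length is constant, so the choice of the parameter \<open>u\<close> is irrelevant.
\<close>

definition arc_length_param :: "(real \<Rightarrow> complex) \<Rightarrow> real \<Rightarrow> real \<Rightarrow> real \<Rightarrow> complex" where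
  "arc_length_param \<gamma> s t \<sigma> = \<gamma> (SOME u. u \<in> {s..t} \<and> curve_length \<gamma> s u = ennreal \<sigma>)"

text \<open>
  \<open>\<integral>\<^sub>\<gamma> \<rho> |dz|\<close> for a locally rectifiable curve, as the supremum of the integrals with respect
  to arc length over the closed subcurves.
\<close>

definition line_integral :: "(complex \<Rightarrow> ennreal) \<Rightarrow> (real \<Rightarrow> complex) \<Rightarrow> ennreal" where
  "line_integral \<rho> \<gamma> =
     (SUP (s, t) \<in> {(s, t). 0 < s \<and> s \<le> t \<and> t < 1}.
        \<integral>\<^sup>+ \<sigma> \<in> {0..enn2real (curve_length \<gamma> s t)}. \<rho> (arc_length_param \<gamma> s t \<sigma>) \<partial>lborel)"

text \<open>
  As usual, the admissibility condition is imposed on the locally rectifiable members of the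
  family only (equivalently, the line integral along any other curve is \<open>\<infinity>\<close>).
\<close>

definition admissible :: "complex set \<Rightarrow> (real \<Rightarrow> complex) set \<Rightarrow> (complex \<Rightarrow> ennreal) \<Rightarrow> bool" where
  "admissible \<Omega> \<Gamma> \<rho> \<longleftrightarrow>
     \<rho> \<in> borel_measurable (restrict_space borel \<Omega>) \<and>
     (\<forall>\<gamma>\<in>\<Gamma>. locally_rectifiable \<gamma> \<longrightarrow> line_integral \<rho> \<gamma> \<ge> 1)"

definition curve_modulus :: "complex set \<Rightarrow> (real \<Rightarrow> complex) set \<Rightarrow> ennreal" where
  "curve_modulus \<Omega> \<Gamma> = (INF \<rho> \<in> Collect (admissible \<Omega> \<Gamma>). \<integral>\<^sup>+ z \<in> \<Omega>. (\<rho> z)\<^sup>2 \<partial>lborel)"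


section \<open>Arcs, connecting curves and geodesics of the disk\<close>

definition open_arc :: "complex set \<Rightarrow> bool" where
  "open_arc I \<longleftrightarrow> (\<exists>\<alpha> \<beta>. \<alpha> < \<beta> \<and> \<beta> \<le> \<alpha> + 2 * pi \<and> I = cis ` {\<alpha><..<\<beta>})"

definition connecting_curves :: "complex set \<Rightarrow> complex set \<Rightarrow> (real \<Rightarrow> complex) set" where
  "connecting_curves I J =
     {\<gamma>. path \<gamma> \<and> pathstart \<gamma> \<in> I \<and> pathfinish \<gamma> \<in> J \<and> \<gamma> ` {0<..<1} \<subseteq> ball 0 1}"

text \<open>
  The hyperbolic geodesic of the unit disk with endpoints \<open>x \<noteq> y\<close> on the unit circle: the image
  of the diameter \<open>(-1,1)\<close> under the disk automorphisms taking \<open>-1\<close> to \<open>x\<close> and \<open>1\<close> to \<open>y\<close>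
  (all of them yield the same image). As a point set it is unoriented.
\<close>

definition geodesic :: "complex \<Rightarrow> complex \<Rightarrow> complex set" where
  "geodesic x y =
     {Moebius_function \<theta> w (of_real s) | \<theta> w s.
        norm w < 1 \<and> Moebius_function \<theta> w (-1) = x \<and> Moebius_function \<theta> w 1 = y \<and>
        -1 < s \<and> s < 1}"

definition belongs_to :: "complex set \<Rightarrow> complex set \<Rightarrow> complex set \<Rightarrow> bool" where
  "belongs_to \<gamma> I J \<longleftrightarrow> (\<exists>x\<in>I. \<exists>y\<in>J. \<gamma> = geodesic x y)"


section \<open>The domain, its conformal map and the lamination\<close>

definition W_dom :: "(nat \<Rightarrow> real) \<Rightarrow> (nat \<Rightarrow> real) \<Rightarrow> complex set" where
  "W_dom a b = {z. Re z > 0 \<and> Im z < 0} \<union> (\<Union>n. {z. a n < Re z \<and> Re z < b n})"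

definition disk_inv :: "(complex \<Rightarrow> complex) \<Rightarrow> complex \<Rightarrow> complex" where
  "disk_inv \<phi> = inv_into (ball 0 1) \<phi>"

definition normalized_conformal_map :: "complex set \<Rightarrow> (complex \<Rightarrow> complex) \<Rightarrow> bool" where
  "normalized_conformal_map W \<phi> \<longleftrightarrow>
     \<phi> holomorphic_on ball 0 1 \<and> bij_betw \<phi> (ball 0 1) W \<and>
     (disk_inv \<phi> \<longlongrightarrow> -1) (at 0 within W) \<and>
     (disk_inv \<phi> \<longlongrightarrow> 1) (at 1 within W) \<and>
     (disk_inv \<phi> \<longlongrightarrow> -\<i>) (inf (filtercomap Im at_bot) (principal W))"

text \<open>The point of the circle corresponding to the accessible boundary point \<open>p\<close> of \<open>W\<close>.\<close>

definition bdry_pt :: "complex set \<Rightarrow> (complex \<Rightarrow> complex) \<Rightarrow> real \<Rightarrow> complex" where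
  "bdry_pt W \<phi> p = Lim (at (of_real p) within W) (disk_inv \<phi>)"

text \<open>The point of the circle corresponding to the upper end of the strip over \<open>(\<alpha>,\<beta>)\<close>.\<close>

definition strip_end :: "(complex \<Rightarrow> complex) \<Rightarrow> real \<Rightarrow> real \<Rightarrow> complex" where
  "strip_end \<phi> \<alpha> \<beta> =
     Lim (inf (filtercomap Im at_top) (principal {w. \<alpha> < Re w \<and> Re w < \<beta>})) (disk_inv \<phi>)"

definition leaf_g :: "complex set" where
  "leaf_g = geodesic (-1) (-\<i>)"

definition lamination :: "(nat \<Rightarrow> real) \<Rightarrow> (nat \<Rightarrow> real) \<Rightarrow> (complex \<Rightarrow> complex) \<Rightarrow> complex set set" where
  "lamination a b \<phi> =
     {leaf_g} \<union>
     (\<Union>n. {geodesic (strip_end \<phi> (a n) (b n)) (bdry_pt (W_dom a b) \<phi> (b n)),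
           geodesic (strip_end \<phi> (a n) (b n)) (bdry_pt (W_dom a b) \<phi> (a n))})"

definition V_map :: "real \<Rightarrow> complex \<Rightarrow> complex" where
  "V_map \<epsilon> z = Complex (Re z) (\<epsilon> * Im z)"

definition Gamma_eps ::
  "(complex \<Rightarrow> complex) \<Rightarrow> complex set \<Rightarrow> complex set \<Rightarrow> real \<Rightarrow> (real \<Rightarrow> complex) set" where
  "Gamma_eps \<phi> I J \<epsilon> = (\<lambda>\<gamma>. V_map \<epsilon> \<circ> \<phi> \<circ> \<gamma>) ` connecting_curves I J"

definition mod_ratio ::
  "complex set \<Rightarrow> (complex \<Rightarrow> complex) \<Rightarrow> complex set \<Rightarrow> complex set \<Rightarrow> real \<Rightarrow> ereal" where
  "mod_ratio W \<phi> I J \<epsilon> =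
     enn2ereal (curve_modulus (V_map \<epsilon> ` W) (Gamma_eps \<phi> I J \<epsilon>)) / ereal (1 / pi * ln (1 / \<epsilon>))"

text \<open>
  \<open>I\<close> and \<open>J\<close> are in general position with respect to the lamination. Open arcs with a common
  end have \<open>curve_modulus = \<infinity>\<close>, so their closures have to be disjoint. If \<open>I\<close> contains the end of
  the \<open>n\<close>-th strip and \<open>J\<close> merely ends at the point corresponding to \<open>a n\<close> or \<open>b n\<close> (or
  vice versa), then a corner of angle \<open>3\<pi>/2\<close> contributes an additional \<open>2/3\<close> to the limits,
  although the corresponding leaf does not belong to the box of the open arcs.
\<close>

definition general_position ::
  "(nat \<Rightarrow> real) \<Rightarrow> (nat \<Rightarrow> real) \<Rightarrow> (complex \<Rightarrow> complex) \<Rightarrow> complex set \<Rightarrow> complex set \<Rightarrow> bool" where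
  "general_position a b \<phi> I J \<longleftrightarrow>
     closure I \<inter> closure J = {} \<and>
     (\<forall>n. \<forall>p\<in>{a n, b n}.
        let z = strip_end \<phi> (a n) (b n); e = bdry_pt (W_dom a b) \<phi> p in
        \<not> (z \<in> I \<and> e \<in> closure J - J) \<and> \<not> (z \<in> J \<and> e \<in> closure I - I))"

end

theory Submission
  imports Defs
begin

text \<open>
  One of the arcs contains \<open>-1\<close>, which corresponds to the corner \<open>0\<close>, and the other contains
  \<open>-\<i>\<close>, which corresponds to the lower end. At distances from \<open>0\<close> between \<open>\<epsilon>\<close> and \<open>1\<close>, a curve
  of \<open>\<Gamma>\<^sup>\<epsilon>\<close> therefore joins the left side of the quadrant to the floor or to the wall of a tooth.
  The circular arcs of radius \<open>r\<close> have the angle \<open>\<pi>/2\<close> if \<open>b\<^sub>n\<^sub>+\<^sub>1 < r < a\<^sub>n\<close> and at most the angle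
  \<open>\<pi>\<close> if \<open>a\<^sub>n < r < b\<^sub>n\<close>, so that the length-area inequality bounds the modulus from below by
  \<open>1/\<pi>\<close> times twice the logarithmic length of the gaps between the teeth plus the logarithmic length of the teeth.
  Conversely, the metrics \<open>2/\<pi> |dw|/|w|\<close> over the gaps and \<open>1/\<pi> |dw|/|w-a\<^sub>n|\<close> over the teeth,
  together with boundedly many disc metrics at every scale, which catch the curves that leave these
  zones, are admissible up to an error \<open>O(1)\<close> for each of the scales that exceed \<open>\<epsilon>\<close>.
  By the growth assumption there are only \<open>o(log 1/\<epsilon>)\<close> of them. The logarithmic lengths add
  up to \<open>log 1/\<epsilon>\<close> plus the length of the gaps, and the quotient of the latter by \<open>log 1/\<epsilon>\<close> is
  monotone between consecutive points \<open>a\<^sub>n\<close>, \<open>b\<^sub>n\<close>, where it takes the values in the claim.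
\<close>

section \<open>Area under holomorphic maps\<close>

text \<open>\<open>W\<close> is invariant under \<open>V_map\<close>, so all families live in one
  domain and differ only in their ends: floor points keep their values on the circle, while a wall
  point at height h, or a point of the left side at depth h, takes the value of h/e. On walls and on
  the left side the two arcs are thus separated by distances of order e only, whereas on the floor
  the unit scale persists; this is why constants occur in pairs such as K and K e. The first
  obstacle is the boundary: the ends of a curve exist in the disk, but in \<open>W\<close> it may
  run up a tooth or through ever deeper teeth, and -1 corresponds to 0 together with the upper
  imaginary axis. Boundary values are obtained for one sector or strip at a time, and distances are
  measured between limit points or visited places. The second obstacle is a wall whose foot
  corresponds to one arc and whose upper end to the other, which would contribute a further
  logarithm. That the tip is not in the other arc follows from the uniqueness of the leaf and
  general position; that the wall does not return to this arc near the tip is a connectedness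
  argument on the circle.\<close>

definition complex_vec2 :: "complex \<Rightarrow> real^2" where
  "complex_vec2 z = vector [Re z, Im z]"

definition vec2_complex :: "real^2 \<Rightarrow> complex" where
  "vec2_complex x = Complex (vec_nth x 1) (vec_nth x 2)"

lemma vec2_complex_inverse [simp]:
  "vec2_complex (complex_vec2 z) = z" "complex_vec2 (vec2_complex x) = x"
  by (auto simp: complex_vec2_def vec2_complex_def vec_eq_iff forall_2 vector_2)

lemma bounded_linear_complex_vec2: "bounded_linear complex_vec2"
  by (rule linear_conv_bounded_linear[THEN iffD1], rule linearI)
     (auto simp: complex_vec2_def vec_eq_iff forall_2 vector_2)

lemma bounded_linear_vec2_complex: "bounded_linear vec2_complex"
  by (rule linear_conv_bounded_linear[THEN iffD1], rule linearI)
     (auto simp: vec2_complex_def complex_eq_iff)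

lemma complex_vec2_measurable [measurable]: "complex_vec2 \<in> borel \<rightarrow>\<^sub>M borel"
  by (intro borel_measurable_continuous_onI linear_continuous_on bounded_linear_complex_vec2)

lemma vec2_complex_measurable [measurable]: "vec2_complex \<in> borel \<rightarrow>\<^sub>M borel"
  by (intro borel_measurable_continuous_onI linear_continuous_on bounded_linear_vec2_complex)

lemma complex_vec2_vimage_box:
  "complex_vec2 -` box l u = box (vec2_complex l) (vec2_complex u)"
  by (auto simp: complex_vec2_def vec2_complex_def mem_box_cart forall_2 vector_2 in_box_complex_iff)

text \<open>The change of variables formula with determinants lives on \<open>real^2\<close>. Boxes
  go to boxes with the same side lengths, so the passage between \<open>complex\<close> and
  \<open>real^2\<close> preserves Lebesgue measure.\<close>

lemma lborel_complex_vec2: "lborel = distr lborel borel complex_vec2"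
proof (rule lborel_eqI)
  fix l u :: "real^2" assume le: "\<And>b. b \<in> Basis \<Longrightarrow> l \<bullet> b \<le> u \<bullet> b"
  have le': "vec_nth l 1 \<le> vec_nth u 1" "vec_nth l 2 \<le> vec_nth u 2"
    using le[of "axis 1 1"] le[of "axis 2 1"] by (auto simp: inner_axis)
  have "emeasure (distr lborel borel complex_vec2) (box l u) = emeasure lborel (complex_vec2 -` box l u)"
    by (subst emeasure_distr) auto
  also have "\<dots> = emeasure lborel (box (vec2_complex l) (vec2_complex u))"
    by (simp add: complex_vec2_vimage_box)
  also have "\<dots> = (\<Prod>b\<in>Basis. (vec2_complex u - vec2_complex l) \<bullet> b)"
    using le' by (intro emeasure_lborel_box) (auto simp: Basis_complex_def vec2_complex_def)
  also have "\<dots> = (vec_nth u 1 - vec_nth l 1) * (vec_nth u 2 - vec_nth l 2)"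
    by (simp add: Basis_complex_def vec2_complex_def)
  also have "\<dots> = (\<Prod>b\<in>Basis. (u - l) \<bullet> b)"
  proof -
    have B: "(Basis :: (real^2) set) = {axis 1 1, axis 2 1}"
      by (auto simp: Basis_vec_def UNIV_2)
    have "axis 1 1 \<noteq> (axis 2 1 :: real^2)" by (simp add: axis_eq_axis)
    then show ?thesis by (simp add: B inner_axis)
  qed
  finally show "emeasure (distr lborel borel complex_vec2) (box l u) = (\<Prod>b\<in>Basis. (u - l) \<bullet> b)" .
qed simp

lemma emeasure_complex_vec2_image:
  assumes "A \<in> sets borel"
  shows "complex_vec2 ` A \<in> sets borel" "emeasure lborel (complex_vec2 ` A) = emeasure lborel A"
proof -
  have eq: "complex_vec2 ` A = vec2_complex -` A"
    by (auto intro: rev_image_eqI)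
  have eq': "complex_vec2 -` complex_vec2 ` A = A"
    by (auto dest: arg_cong[of _ _ vec2_complex])
  show 1: "complex_vec2 ` A \<in> sets borel"
    unfolding eq using measurable_sets[OF vec2_complex_measurable assms] by simp
  show "emeasure lborel (complex_vec2 ` A) = emeasure lborel A"
    by (subst lborel_complex_vec2) (use 1 eq' in \<open>simp add: emeasure_distr\<close>)
qed

lemma nn_integral_complex_vec2:
  assumes [measurable]: "f \<in> borel_measurable borel"
  shows "(\<integral>\<^sup>+x. f (vec2_complex x) \<partial>lborel) = (\<integral>\<^sup>+z. f z \<partial>lborel)"
  by (subst lborel_complex_vec2, subst nn_integral_distr) auto

text \<open>By the Cauchy-Riemann equations the real Jacobian of \<open>g\<close> is the square of
  |g'|, and injectivity turns the area formula into an equality. In the later use \<open>A\<close>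
  is cut out by a preimage of a Borel set, so that measurability of the image is immediate.\<close>

lemma emeasure_holomorphic_image:
  fixes g :: "complex \<Rightarrow> complex"
  assumes "open S" and hol: "g holomorphic_on S" and inj: "inj_on g S"
    and A: "A \<in> sets borel" "A \<subseteq> S" and gA: "g ` A \<in> sets borel"
  shows "emeasure lborel (g ` A) = (\<integral>\<^sup>+z\<in>A. ennreal ((norm (deriv g z))\<^sup>2) \<partial>lborel)"
proof -
  define G where "G = complex_vec2 \<circ> g \<circ> vec2_complex"
  define G' where "G' x = complex_vec2 \<circ> (\<lambda>w. deriv g (vec2_complex x) * w) \<circ> vec2_complex" for x
  define B where "B = complex_vec2 ` A"
  have B: "B \<in> sets borel" "B \<in> sets lebesgue"
    using emeasure_complex_vec2_image(1)[OF A(1)] by (auto simp: B_def)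
  have GB: "G ` B = complex_vec2 ` g ` A"
    by (auto simp: G_def B_def image_comp)
  have der: "(G has_derivative G' x) (at x within B)" if "x \<in> B" for x
  proof -
    have "vec2_complex x \<in> S" using that A by (auto simp: B_def)
    then have "(g has_derivative (\<lambda>w. deriv g (vec2_complex x) * w)) (at (vec2_complex x))"
      using holomorphic_derivI[OF hol \<open>open S\<close>] by (auto simp: has_field_derivative_def)
    moreover have "(vec2_complex has_derivative vec2_complex) (at x)"
      by (intro bounded_linear_imp_has_derivative bounded_linear_vec2_complex)
    ultimately have "((g \<circ> vec2_complex) has_derivative (\<lambda>w. deriv g (vec2_complex x) * w) \<circ> vec2_complex) (at x)"
      by (intro diff_chain_at)
    moreover have "(complex_vec2 has_derivative complex_vec2) (at (g (vec2_complex x)))"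
      by (intro bounded_linear_imp_has_derivative bounded_linear_complex_vec2)
    ultimately have "(G has_derivative G' x) (at x)"
      using diff_chain_at[of "g \<circ> vec2_complex" _ x complex_vec2 complex_vec2]
      unfolding G_def G'_def by (simp add: comp_assoc)
    then show ?thesis by (rule has_derivative_at_withinI)
  qed
  have inj': "inj_on G B"
  proof (rule inj_onI)
    fix x y assume xy: "x \<in> B" "y \<in> B" "G x = G y"
    from xy(3) have "vec2_complex (G x) = vec2_complex (G y)" by simp
    then have "g (vec2_complex x) = g (vec2_complex y)" by (simp add: G_def)
    moreover have "vec2_complex x \<in> S" "vec2_complex y \<in> S" using xy A(2) by (auto simp: B_def)
    ultimately have "vec2_complex x = vec2_complex y" using inj by (auto dest: inj_onD)
    then show "x = y" by (metis vec2_complex_inverse(2))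
  qed
  \<comment> \<open>Multiplication by p + iq has the matrix with rows (p, -q) and (q, p).\<close>
  have det: "det (matrix (G' x)) = (norm (deriv g (vec2_complex x)))\<^sup>2" for x
    by (simp add: det_2 matrix_def G'_def complex_vec2_def vec2_complex_def axis_def vector_2
        cmod_power2) (simp add: power2_eq_square)
  define D where "D z = (norm (deriv g z))\<^sup>2" for z
  have cD: "continuous_on S (deriv g)"
    using holomorphic_deriv[OF hol \<open>open S\<close>] holomorphic_on_imp_continuous_on by blast
  have mD: "(\<lambda>z. indicator A z * ennreal (D z)) \<in> borel_measurable borel"
  proof -
    have "continuous_on S D" unfolding D_def by (intro continuous_intros cD)
    then have "continuous_on A D" using A(2) by (rule continuous_on_subset)
    then have "(\<lambda>z. indicator A z *\<^sub>R D z) \<in> borel_measurable borel"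
      by (rule borel_measurable_continuous_on_indicator[OF A(1)])
    then have "(\<lambda>z. ennreal (indicator A z *\<^sub>R D z)) \<in> borel_measurable borel"
      by measurable
    also have "(\<lambda>z. ennreal (indicator A z *\<^sub>R D z)) = (\<lambda>z. indicator A z * ennreal (D z))"
      by (auto split: split_indicator)
    finally show ?thesis .
  qed
  have mD2: "(\<lambda>x. indicator B x * D (vec2_complex x)) \<in> borel_measurable borel"
  proof -
    have "(\<lambda>x. enn2real (indicator A (vec2_complex x) * ennreal (D (vec2_complex x)))) \<in> borel_measurable borel"
      using measurable_compose[OF vec2_complex_measurable mD] by measurable
    also have "(\<lambda>x. enn2real (indicator A (vec2_complex x) * ennreal (D (vec2_complex x)))) = (\<lambda>x. indicator B x * D (vec2_complex x))"
      by (rule ext) (auto split: split_indicator simp: B_def D_def intro: rev_image_eqI)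
    finally show ?thesis .
  qed
  have I: "(\<integral>\<^sup>+x. ennreal (indicator B x * D (vec2_complex x)) \<partial>lborel) = (\<integral>\<^sup>+z\<in>A. ennreal (D z) \<partial>lborel)"
  proof -
    have "(\<integral>\<^sup>+x. ennreal (indicator B x * D (vec2_complex x)) \<partial>lborel) =
       (\<integral>\<^sup>+x. indicator A (vec2_complex x) * ennreal (D (vec2_complex x)) \<partial>lborel)"
      by (intro nn_integral_cong) (auto split: split_indicator simp: B_def intro: rev_image_eqI)
    also have "\<dots> = (\<integral>\<^sup>+z. indicator A z * ennreal (D z) \<partial>lborel)"
      by (rule nn_integral_complex_vec2[OF mD])
    finally show ?thesis by (simp add: mult.commute)
  qed
  have iff: "G ` B \<in> lmeasurable \<and> measure lebesgue (G ` B) = m \<longleftrightarrow>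
      ((\<lambda>x. D (vec2_complex x)) has_integral m) B" for m
    using has_measure_differentiable_image[OF B(2) der inj', of m] by (simp add: det D_def)
  have iff': "((\<lambda>x. D (vec2_complex x)) has_integral m) B \<longleftrightarrow>
       ((\<lambda>x. indicator B x * D (vec2_complex x)) has_integral m) UNIV" for m
    by (subst has_integral_restrict_UNIV[symmetric], rule has_integral_cong) (auto split: split_indicator)
  have em: "emeasure lborel (g ` A) = emeasure lebesgue (G ` B)"
    using emeasure_complex_vec2_image[OF gA] by (simp add: GB)
  show ?thesis
  \<comment> \<open>\<open>iff\<close> compares finite values only. It is read from right to left if
    the integral is finite, and from left to right to exclude a finite measure of the image if the
    integral is infinite.\<close>
  proof (cases "(\<integral>\<^sup>+z\<in>A. ennreal (D z) \<partial>lborel)")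
    case (real r)
    have "((\<lambda>x. indicator B x * D (vec2_complex x)) has_integral r) UNIV"
      using real I mD2 by (intro nn_integral_has_integral) (auto simp: D_def)
    then have "G ` B \<in> lmeasurable" "measure lebesgue (G ` B) = r"
      using iff iff' by auto
    then show ?thesis using real by (simp add: em D_def emeasure_eq_measure2)
  next
    case top
    have "G ` B \<notin> lmeasurable"
    proof
      assume L: "G ` B \<in> lmeasurable"
      then have "((\<lambda>x. indicator B x * D (vec2_complex x)) has_integral (measure lebesgue (G ` B))) UNIV"
        using iff iff' by blast
      then have "(\<integral>\<^sup>+x. ennreal (indicator B x * D (vec2_complex x)) \<partial>lborel) = ennreal (measure lebesgue (G ` B))"
        using mD2 by (intro nn_integral_has_integral_lborel) (auto simp: D_def)
      then show False using I top by simp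
    qed
    moreover have "G ` B \<in> sets lebesgue"
      using emeasure_complex_vec2_image(1)[OF gA] by (auto simp: GB)
    ultimately have "emeasure lebesgue (G ` B) = \<infinity>"
      by (simp add: fmeasurable_def not_less top_unique)
    then show ?thesis using top by (simp add: em D_def)
  qed
qed

text \<open>Both sides integrate \<open>h\<close> against the same measure: the image under
  \<open>g\<close> of the measure with density |g'|^2 is Lebesgue measure on the image of
  \<open>S\<close>, which is the area formula for sets. The functions \<open>g0\<close> and
  \<open>d\<close> are set to zero outside \<open>S\<close> so that they are Borel on the whole
  plane.\<close>

lemma nn_integral_holomorphic_image:
  fixes g :: "complex \<Rightarrow> complex" and h :: "complex \<Rightarrow> ennreal"
  assumes S: "open S" and hol: "g holomorphic_on S" and inj: "inj_on g S"
    and h [measurable]: "h \<in> borel_measurable borel"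
  shows "(\<integral>\<^sup>+w\<in>g ` S. h w \<partial>lborel) = (\<integral>\<^sup>+z\<in>S. h (g z) * ennreal ((norm (deriv g z))\<^sup>2) \<partial>lborel)"
proof -
  have oT: "open (g ` S)" by (rule open_mapping_thm3[OF hol S inj])
  then have [measurable]: "g ` S \<in> sets borel" "S \<in> sets borel" using S by auto
  define g0 where "g0 z = indicator S z *\<^sub>R g z" for z
  define d where "d z = indicator S z *\<^sub>R (norm (deriv g z))\<^sup>2" for z
  have [measurable]: "g0 \<in> borel_measurable borel"
    unfolding g0_def by (rule borel_measurable_continuous_on_indicator)
      (use hol holomorphic_on_imp_continuous_on in auto)
  have [measurable]: "d \<in> borel_measurable borel"
    unfolding d_def
    by (rule borel_measurable_continuous_on_indicator)
       (use holomorphic_deriv[OF hol S] holomorphic_on_imp_continuous_on in \<open>auto intro!: continuous_intros\<close>)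
  have eq: "density lborel (indicator (g ` S)) = distr (density lborel d) borel g0"
  proof (rule measure_eqI)
    fix B assume "B \<in> sets (density lborel (indicator (g ` S)))"
    then have B[measurable]: "B \<in> sets borel" by simp
    have "g0 -` B \<inter> space borel \<in> sets borel" by measurable
    then have [measurable]: "g0 -` B \<in> sets borel" by simp
    define A where "A = S \<inter> g0 -` B"
    have A: "A \<in> sets borel" "A \<subseteq> S" unfolding A_def by auto
    have gA: "g ` A = g ` S \<inter> B" by (auto simp: A_def g0_def)
    have "emeasure (distr (density lborel d) borel g0) B = emeasure (density lborel d) (g0 -` B)"
      by (subst emeasure_distr) auto
    also have "\<dots> = (\<integral>\<^sup>+z\<in>g0 -` B. ennreal (d z) \<partial>lborel)"
      by (subst emeasure_density) auto
    also have "\<dots> = (\<integral>\<^sup>+z\<in>A. ennreal ((norm (deriv g z))\<^sup>2) \<partial>lborel)"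
      by (intro nn_integral_cong) (auto simp: A_def d_def split: split_indicator)
    also have "\<dots> = emeasure lborel (g ` A)"
      by (rule emeasure_holomorphic_image[symmetric, OF S hol inj A]) (simp add: gA)
    also have "\<dots> = emeasure (density lborel (indicator (g ` S))) B"
      by (subst emeasure_density) (auto simp: gA indicator_inter_arith[symmetric])
    finally show "emeasure (density lborel (indicator (g ` S))) B = emeasure (distr (density lborel d) borel g0) B" by simp
  qed simp
  have "(\<integral>\<^sup>+w\<in>g ` S. h w \<partial>lborel) = (\<integral>\<^sup>+w. h w \<partial>density lborel (indicator (g ` S)))"
    by (subst nn_integral_density) (auto simp: mult.commute)
  also have "\<dots> = (\<integral>\<^sup>+z. h (g0 z) \<partial>density lborel d)"
    unfolding eq by (subst nn_integral_distr) auto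
  also have "\<dots> = (\<integral>\<^sup>+z. d z * h (g0 z) \<partial>lborel)"
    by (subst nn_integral_density) auto
  also have "\<dots> = (\<integral>\<^sup>+z\<in>S. h (g z) * ennreal ((norm (deriv g z))\<^sup>2) \<partial>lborel)"
    by (intro nn_integral_cong) (auto simp: g0_def d_def mult.commute split: split_indicator)
  finally show ?thesis .
qed

section \<open>Iterated integrals over the plane\<close>

lemma lborel_complex_pair: "lborel = distr lborel borel (\<lambda>(x, y). Complex x y)"
proof (rule lborel_eqI)
  have m: "(\<lambda>(x, y). Complex x y) \<in> borel \<rightarrow>\<^sub>M borel"
    unfolding case_prod_unfold Complex_eq by (intro borel_measurable_continuous_onI continuous_intros)
  fix l u :: complex assume le: "\<And>b. b \<in> Basis \<Longrightarrow> l \<bullet> b \<le> u \<bullet> b"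
  have le': "Re l \<le> Re u" "Im l \<le> Im u"
    using le[of 1] le[of \<i>] by (auto simp: Basis_complex_def)
  have v: "(\<lambda>(x, y). Complex x y) -` box l u = box (Re l, Im l) (Re u, Im u)"
    by (auto simp: in_box_complex_iff box_prod)
  have "emeasure (distr lborel borel (\<lambda>(x, y). Complex x y)) (box l u) = emeasure lborel (box (Re l, Im l) (Re u, Im u))"
    using m by (subst emeasure_distr) (auto simp: v[symmetric])
  also have "\<dots> = (\<Prod>b\<in>Basis. ((Re u, Im u) - (Re l, Im l)) \<bullet> b)"
    using le' by (intro emeasure_lborel_box) (auto simp: Basis_prod_def)
  also have "\<dots> = (Re u - Re l) * (Im u - Im l)"
    by (simp add: Basis_prod_def mult.commute)
  also have "\<dots> = (\<Prod>b\<in>Basis. (u - l) \<bullet> b)"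
    by (simp add: Basis_complex_def)
  finally show "emeasure (distr lborel borel (\<lambda>(x, y). Complex x y)) (box l u) = (\<Prod>b\<in>Basis. (u - l) \<bullet> b)" .
qed simp

lemma Complex_measurable [measurable (raw)]:
  assumes [measurable]: "f \<in> borel_measurable M" "g \<in> borel_measurable M"
  shows "(\<lambda>x. Complex (f x) (g x)) \<in> borel_measurable M"
  unfolding Complex_eq by measurable

text \<open>Tonelli's theorem in the form that suits vertical crosscuts and logarithmic polar
  coordinates: the outer variable is the real part.\<close>

lemma nn_integral_complex_iterated:
  assumes [measurable]: "f \<in> borel_measurable borel"
  shows "(\<integral>\<^sup>+z. f z \<partial>lborel) = (\<integral>\<^sup>+x. \<integral>\<^sup>+y. f (Complex x y) \<partial>lborel \<partial>lborel)"
proof -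
  have m: "(\<lambda>(x, y). Complex x y) \<in> borel \<rightarrow>\<^sub>M borel"
    unfolding case_prod_unfold Complex_eq by (intro borel_measurable_continuous_onI continuous_intros)
  have "(\<integral>\<^sup>+z. f z \<partial>lborel) = (\<integral>\<^sup>+p. f (case p of (x, y) \<Rightarrow> Complex x y) \<partial>(lborel \<Otimes>\<^sub>M lborel))"
    unfolding lborel_prod
    by (subst lborel_complex_pair, subst nn_integral_distr) (simp_all add: m)
  also have "\<dots> = (\<integral>\<^sup>+x. \<integral>\<^sup>+y. f (Complex x y) \<partial>lborel \<partial>lborel)"
    by (subst lborel.nn_integral_fst[symmetric]) (auto simp: case_prod_unfold)
  finally show ?thesis .
qed

section \<open>Curve length and line integrals\<close>

text \<open>Recursion on the list of vertices makes splitting, joining and refining of polygons a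
  matter of list induction; \<open>sum_dist_eq_poly_len\<close> identifies the result with the
  indexed sum in the definition of length.\<close>

fun poly_len :: "(real \<Rightarrow> complex) \<Rightarrow> real list \<Rightarrow> real" where
  "poly_len \<gamma> (x # y # xs) = dist (\<gamma> x) (\<gamma> y) + poly_len \<gamma> (y # xs)"
| "poly_len \<gamma> [x] = 0"
| "poly_len \<gamma> [] = 0"

lemma poly_len_nonneg [simp]: "0 \<le> poly_len \<gamma> ts"
  by (induction \<gamma> ts rule: poly_len.induct) auto

lemma sum_dist_eq_poly_len:
  "(\<Sum>i<length ts - 1. ennreal (dist (\<gamma> (ts ! i)) (\<gamma> (ts ! Suc i)))) = ennreal (poly_len \<gamma> ts)"
proof (induction \<gamma> ts rule: poly_len.induct)
  case (1 \<gamma> x y xs)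
  have "(\<Sum>i<length (x # y # xs) - 1. ennreal (dist (\<gamma> ((x # y # xs) ! i)) (\<gamma> ((x # y # xs) ! Suc i))))
      = (\<Sum>i<Suc (length xs). ennreal (dist (\<gamma> ((x # y # xs) ! i)) (\<gamma> ((x # y # xs) ! Suc i))))"
    by simp
  also have "\<dots> = ennreal (dist (\<gamma> x) (\<gamma> y)) +
      (\<Sum>i<length (y # xs) - 1. ennreal (dist (\<gamma> ((y # xs) ! i)) (\<gamma> ((y # xs) ! Suc i))))"
    by (subst sum.lessThan_Suc_shift) simp
  also have "\<dots> = ennreal (poly_len \<gamma> (x # y # xs))"
    unfolding 1 by (simp add: ennreal_plus)
  finally show ?case .
qed auto

lemma curve_length_eq_poly_len:
  "curve_length \<gamma> s t = (SUP ts \<in> {ts. sorted ts \<and> set ts \<subseteq> {s..t}}. ennreal (poly_len \<gamma> ts))"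
  unfolding curve_length_def sum_dist_eq_poly_len ..

lemma poly_len_le_curve_length:
  "sorted ts \<Longrightarrow> set ts \<subseteq> {s..t} \<Longrightarrow> ennreal (poly_len \<gamma> ts) \<le> curve_length \<gamma> s t"
  unfolding curve_length_eq_poly_len by (rule SUP_upper) auto

lemma poly_len_append: "poly_len \<gamma> (xs @ u # ys) = poly_len \<gamma> (xs @ [u]) + poly_len \<gamma> (u # ys)"
proof (induction xs)
  case (Cons x xs)
  then show ?case by (cases xs) auto
qed simp

lemma poly_len_Cons_ge: "poly_len \<gamma> xs \<le> poly_len \<gamma> (u # xs)"
  by (cases xs) auto

lemma poly_len_snoc_ge: "poly_len \<gamma> xs \<le> poly_len \<gamma> (xs @ [u])"
proof (induction xs)
  case (Cons x xs)
  then show ?case by (cases xs) auto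
qed simp

text \<open>The triangle inequality at the edge that leads from \<open>xs\<close> to
  \<open>ys\<close>.\<close>

lemma poly_len_insert_ge: "poly_len \<gamma> (xs @ ys) \<le> poly_len \<gamma> (xs @ [u]) + poly_len \<gamma> (u # ys)"
proof (induction xs)
  case Nil
  show ?case using poly_len_Cons_ge[of \<gamma> ys u] by simp
next
  case (Cons x xs)
  show ?case
  proof (cases xs)
    case Nil
    show ?thesis
    proof (cases ys)
      case (Cons y zs)
      then show ?thesis using Nil dist_triangle[of "\<gamma> x" "\<gamma> y" "\<gamma> u"] by simp
    qed (use Nil in auto)
  qed (use Cons in auto)
qed

lemma dist_le_curve_length: "s \<le> u \<Longrightarrow> u \<le> v \<Longrightarrow> v \<le> t \<Longrightarrow> ennreal (dist (\<gamma> u) (\<gamma> v)) \<le> curve_length \<gamma> s t"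
  using poly_len_le_curve_length[of "[u, v]" s t \<gamma>] by auto

lemma curve_length_mono: "s' \<le> s \<Longrightarrow> t \<le> t' \<Longrightarrow> curve_length \<gamma> s t \<le> curve_length \<gamma> s' t'"
  unfolding curve_length_eq_poly_len by (rule SUP_subset_mono) auto

lemma curve_length_cong:
  assumes "\<And>u. s \<le> u \<Longrightarrow> u \<le> t \<Longrightarrow> \<gamma> u = \<gamma>' u"
  shows "curve_length \<gamma> s t = curve_length \<gamma>' s t"
proof -
  have "poly_len \<gamma> ts = poly_len \<gamma>' ts" if "set ts \<subseteq> {s..t}" for ts
    using that by (induction ts rule: induct_list012) (auto simp: assms)
  then show ?thesis unfolding curve_length_eq_poly_len by (intro SUP_cong) auto
qed

text \<open>Two inscribed polygons are joined through the common vertex \<open>u\<close>. The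
  suprema can be taken one after the other because the empty list keeps the index sets
  nonempty.\<close>

lemma curve_length_superadditive:
  assumes "s \<le> u" "u \<le> t"
  shows "curve_length \<gamma> s u + curve_length \<gamma> u t \<le> curve_length \<gamma> s t"
proof -
  have *: "ennreal (poly_len \<gamma> xs) + ennreal (poly_len \<gamma> ys) \<le> curve_length \<gamma> s t"
    if "sorted xs" "set xs \<subseteq> {s..u}" "sorted ys" "set ys \<subseteq> {u..t}" for xs ys
  proof -
    have "poly_len \<gamma> xs + poly_len \<gamma> ys \<le> poly_len \<gamma> (xs @ u # ys)"
      using poly_len_append[of \<gamma> xs u ys] poly_len_Cons_ge[of \<gamma> ys u] poly_len_snoc_ge[of \<gamma> xs u] by linarith
    also have "ennreal \<dots> \<le> curve_length \<gamma> s t"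
      using that assms by (intro poly_len_le_curve_length) (force simp: sorted_append)+
    finally show ?thesis by (simp add: ennreal_plus ennreal_leI)
  qed
  have ne: "{ts. sorted ts \<and> set ts \<subseteq> {s..u}} \<noteq> {}" "{ts. sorted ts \<and> set ts \<subseteq> {u..t}} \<noteq> {}"
    by (auto intro!: exI[of _ "[]"])
  have "curve_length \<gamma> s u + curve_length \<gamma> u t =
      (SUP xs \<in> {ts. sorted ts \<and> set ts \<subseteq> {s..u}}. ennreal (poly_len \<gamma> xs) + curve_length \<gamma> u t)"
    unfolding curve_length_eq_poly_len[of \<gamma> s u] by (rule ennreal_SUP_add_left[symmetric, OF ne(1)])
  also have "\<dots> \<le> curve_length \<gamma> s t"
  proof (rule SUP_least)
    fix xs assume xs: "xs \<in> {ts. sorted ts \<and> set ts \<subseteq> {s..u}}"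
    have "ennreal (poly_len \<gamma> xs) + curve_length \<gamma> u t =
       (SUP ys \<in> {ts. sorted ts \<and> set ts \<subseteq> {u..t}}. ennreal (poly_len \<gamma> xs) + ennreal (poly_len \<gamma> ys))"
      unfolding curve_length_eq_poly_len[of \<gamma> u t] by (rule ennreal_SUP_add_right[OF ne(2)])
    also have "\<dots> \<le> curve_length \<gamma> s t" using xs * by (intro SUP_least) auto
    finally show "ennreal (poly_len \<gamma> xs) + curve_length \<gamma> u t \<le> curve_length \<gamma> s t" .
  qed
  finally show ?thesis .
qed

lemma sorted_split_le:
  assumes "sorted ts"
  shows "ts = takeWhile (\<lambda>x. x \<le> u) ts @ dropWhile (\<lambda>x. x \<le> u) ts"
    "\<forall>x\<in>set (takeWhile (\<lambda>x. x \<le> u) ts). x \<le> (u::real)" "\<forall>x\<in>set (dropWhile (\<lambda>x. x \<le> u) ts). u < x"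
    "sorted (takeWhile (\<lambda>x. x \<le> u) ts @ [u])" "sorted (u # dropWhile (\<lambda>x. x \<le> u) ts)"
proof -
  show 1: "\<forall>x\<in>set (takeWhile (\<lambda>x. x \<le> u) ts). x \<le> u" by (meson set_takeWhileD)
  show 2: "\<forall>x\<in>set (dropWhile (\<lambda>x. x \<le> u) ts). u < x"
    using assms by (induction ts) (auto split: if_splits)
  show "sorted (takeWhile (\<lambda>x. x \<le> u) ts @ [u])"
    using 1 assms by (auto simp: sorted_append sorted_takeWhile)
  show "sorted (u # dropWhile (\<lambda>x. x \<le> u) ts)"
    using 2 assms by (auto simp: sorted_dropWhile)
qed simp

text \<open>The point \<open>u\<close> is inserted into an arbitrary inscribed polygon, which does
  not shorten it and splits it into two.\<close>

lemma curve_length_subadditive: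
  assumes "s \<le> u" "u \<le> t"
  shows "curve_length \<gamma> s t \<le> curve_length \<gamma> s u + curve_length \<gamma> u t"
  unfolding curve_length_eq_poly_len[of \<gamma> s t]
proof (rule SUP_least)
  fix ts assume ts: "ts \<in> {ts. sorted ts \<and> set ts \<subseteq> {s..t}}"
  define xs ys where "xs = takeWhile (\<lambda>x. x \<le> u) ts" and "ys = dropWhile (\<lambda>x. x \<le> u) ts"
  note sp = sorted_split_le[of ts u, folded xs_def ys_def]
  have "ts = xs @ ys" and sub: "set xs \<subseteq> set ts" "set ys \<subseteq> set ts"
    using sp(1) ts unfolding xs_def ys_def by (auto dest: set_takeWhileD set_dropWhileD)
  then have "poly_len \<gamma> ts \<le> poly_len \<gamma> (xs @ [u]) + poly_len \<gamma> (u # ys)"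
    using poly_len_insert_ge[of \<gamma> xs ys u] by simp
  then have "ennreal (poly_len \<gamma> ts) \<le> ennreal (poly_len \<gamma> (xs @ [u])) + ennreal (poly_len \<gamma> (u # ys))"
    by (simp add: ennreal_plus[symmetric] ennreal_leI del: ennreal_plus)
  also have "\<dots> \<le> curve_length \<gamma> s u + curve_length \<gamma> u t"
    using ts sp sub assms by (intro add_mono poly_len_le_curve_length) fastforce+
  finally show "ennreal (poly_len \<gamma> ts) \<le> curve_length \<gamma> s u + curve_length \<gamma> u t" .
qed

lemma curve_length_additive:
  "s \<le> u \<Longrightarrow> u \<le> t \<Longrightarrow> curve_length \<gamma> s t = curve_length \<gamma> s u + curve_length \<gamma> u t"
  by (intro antisym curve_length_subadditive curve_length_superadditive)

lemma curve_length_refl [simp]: "curve_length \<gamma> s s = 0"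
proof -
  have "poly_len \<gamma> ts = 0" if "set ts \<subseteq> {s..s}" for ts
    using that by (induction ts rule: induct_list012) auto
  then have "curve_length \<gamma> s s \<le> 0"
    unfolding curve_length_eq_poly_len by (intro SUP_least) auto
  then show ?thesis by simp
qed

lemma poly_len_const_snoc: "(\<forall>x\<in>set xs. x = u) \<Longrightarrow> poly_len \<gamma> (xs @ [v]) \<le> dist (\<gamma> u) (\<gamma> v)"
  by (induction xs rule: induct_list012) auto

lemma poly_len_const_Cons: "(\<forall>x\<in>set xs. x = u) \<Longrightarrow> poly_len \<gamma> (v # xs) \<le> dist (\<gamma> u) (\<gamma> v)"
proof (induction xs arbitrary: v)
  case (Cons a xs)
  show ?case using Cons.prems Cons.IH[of u] by (auto simp: dist_commute)
qed simp

text \<open>Polygons on both sides of the point are chosen almost as long as the curve. A nearby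
  parameter splits off a piece on which the polygon reduces to one short edge, so the length of this
  piece exceeds the edge by little.\<close>

lemma continuous_on_curve_length:
  assumes cont: "continuous_on {s..t} \<gamma>" and fin: "curve_length \<gamma> s t < \<infinity>"
  shows "continuous_on {s..t} (\<lambda>u. enn2real (curve_length \<gamma> s u))"
proof (cases "s \<le> t")
  case True
  define l where "l u v = enn2real (curve_length \<gamma> u v)" for u v
  have finu: "curve_length \<gamma> u v < \<infinity>" if "s \<le> u" "v \<le> t" for u v
    using curve_length_mono[of s u v t \<gamma>] that fin by (auto simp: order_le_less_trans)
  have e: "curve_length \<gamma> u v = ennreal (l u v)" if "s \<le> u" "v \<le> t" for u v
    using finu[OF that] by (simp add: l_def ennreal_enn2real_if)
  have l0: "0 \<le> l u v" for u v by (simp add: l_def)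
  have add: "l u w = l u v + l v w" if "s \<le> u" "u \<le> v" "v \<le> w" "w \<le> t" for u v w
    using curve_length_additive[of u v w \<gamma>] that finu[of u v] finu[of v w]
    by (simp add: l_def enn2real_plus)
  have poly: "poly_len \<gamma> ts \<le> l u v" if "s \<le> u" "v \<le> t" "sorted ts" "set ts \<subseteq> {u..v}" for u v ts
    using poly_len_le_curve_length[OF that(3,4), of \<gamma>] e[OF that(1,2)] l0 by simp
  have ex: "\<exists>ts. sorted ts \<and> set ts \<subseteq> {u..v} \<and> l u v - e < poly_len \<gamma> ts" if "s \<le> u" "v \<le> t" "0 < e" for u v e
  proof (rule ccontr)
    assume "\<not> ?thesis"
    note neg = this
    from neg have "l u v - e \<ge> 0" by (auto dest: spec[of _ "[]"])
    from neg have "ennreal (poly_len \<gamma> ts) \<le> ennreal (l u v - e)" if "sorted ts" "set ts \<subseteq> {u..v}" for ts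
      using that by (intro ennreal_leI) force
    then have "curve_length \<gamma> u v \<le> ennreal (l u v - e)"
      unfolding curve_length_eq_poly_len by (intro SUP_least) auto
    then have "ennreal (l u v) \<le> ennreal (l u v - e)" using e that by simp
    then show False using \<open>0 < e\<close> \<open>l u v - e \<ge> 0\<close> by (simp add: ennreal_le_iff)
  qed
  have "\<exists>d>0. \<forall>v\<in>{s..t}. dist v u < d \<longrightarrow> dist (l s v) (l s u) < e" if u: "u \<in> {s..t}" and "0 < e" for u e
  proof -
    obtain xs where xs: "sorted xs" "set xs \<subseteq> {s..u}" "l s u - e / 2 < poly_len \<gamma> xs"
      using ex[of s u "e/2"] u \<open>0 < e\<close> by auto
    obtain ys where ys: "sorted ys" "set ys \<subseteq> {u..t}" "l u t - e / 2 < poly_len \<gamma> ys"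
      using ex[of u t "e/2"] u \<open>0 < e\<close> by auto
    obtain d1 where d1: "d1 > 0" "\<And>v. v \<in> {s..t} \<Longrightarrow> dist v u < d1 \<Longrightarrow> dist (\<gamma> v) (\<gamma> u) < e / 2"
      using cont[unfolded continuous_on_iff, rule_format, OF u, of "e/2"] \<open>0 < e\<close> by auto
    have fs: "finite (insert 1 ((\<lambda>x. \<bar>x - u\<bar>) ` (set xs \<union> set ys - {u})))" by simp
    \<comment> \<open>No vertex other than \<open>u\<close> is closer to \<open>u\<close> than
      \<open>d2\<close>; hence all vertices between \<open>u\<close> and \<open>v\<close> coincide
      with \<open>u\<close>. The entry 1 keeps the set nonempty.\<close>
    define d2 where "d2 = Min (insert 1 ((\<lambda>x. \<bar>x - u\<bar>) ` (set xs \<union> set ys - {u})))"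
    have d2: "d2 > 0" unfolding d2_def using fs by (subst Min_gr_iff) auto
    have d2': "d2 \<le> \<bar>x - u\<bar>" if "x \<in> set xs \<union> set ys" "x \<noteq> u" for x
      unfolding d2_def using fs that by (intro Min_le) auto
    show ?thesis
    proof (intro exI[of _ "min d1 d2"] conjI ballI impI)
      fix v assume v: "v \<in> {s..t}" "dist v u < min d1 d2"
      have g: "dist (\<gamma> u) (\<gamma> v) < e / 2" using d1(2)[of v] v by (simp add: dist_commute)
      show "dist (l s v) (l s u) < e"
      proof (cases "u \<le> v")
        case True
        define as bs where "as = takeWhile (\<lambda>x. x \<le> v) ys" and "bs = dropWhile (\<lambda>x. x \<le> v) ys"
        note sp = sorted_split_le[of ys v, folded as_def bs_def, OF ys(1)]
        have sub: "set as \<subseteq> set ys" "set bs \<subseteq> set ys"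
          unfolding as_def bs_def by (auto dest: set_takeWhileD set_dropWhileD)
        have "x = u" if "x \<in> set as" for x
          using sp(2) d2'[of x] that sub(1) v True ys(2) by (force simp: dist_real_def)
        then have "poly_len \<gamma> (as @ [v]) \<le> dist (\<gamma> u) (\<gamma> v)" by (intro poly_len_const_snoc) auto
        moreover have "poly_len \<gamma> (v # bs) \<le> l v t"
          using sp sub v u ys(2) by (intro poly) fastforce+
        moreover have "poly_len \<gamma> ys \<le> poly_len \<gamma> (as @ [v]) + poly_len \<gamma> (v # bs)"
          using poly_len_insert_ge[of \<gamma> as bs v] sp(1) by simp
        ultimately have "l u t - l v t < e" using ys(3) g by linarith
        then have "l u v < e" using add[of u v t] u v True by simp
        then show ?thesis using add[of s u v] u v True l0[of u v] by (simp add: dist_real_def)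
      next
        case False
        define as bs where "as = takeWhile (\<lambda>x. x \<le> v) xs" and "bs = dropWhile (\<lambda>x. x \<le> v) xs"
        note sp = sorted_split_le[of xs v, folded as_def bs_def, OF xs(1)]
        have sub: "set as \<subseteq> set xs" "set bs \<subseteq> set xs"
          unfolding as_def bs_def by (auto dest: set_takeWhileD set_dropWhileD)
        have "x = u" if "x \<in> set bs" for x
          using sp(3) d2'[of x] that sub(2) v False xs(2) by (force simp: dist_real_def)
        then have "poly_len \<gamma> (v # bs) \<le> dist (\<gamma> u) (\<gamma> v)" by (intro poly_len_const_Cons) auto
        moreover have "poly_len \<gamma> (as @ [v]) \<le> l s v"
          using sp sub v u xs(2) False by (intro poly) fastforce+
        moreover have "poly_len \<gamma> xs \<le> poly_len \<gamma> (as @ [v]) + poly_len \<gamma> (v # bs)"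
          using poly_len_insert_ge[of \<gamma> as bs v] sp(1) by simp
        ultimately have "l s u - l s v < e" using xs(3) g by linarith
        then show ?thesis using add[of s v u] u v False l0[of v u] by (simp add: dist_real_def)
      qed
    qed (use d1(1) d2 in auto)
  qed
  then show ?thesis unfolding continuous_on_iff l_def by blast
qed simp

text \<open>The intermediate value theorem for the continuous length provides a parameter, so the
  choice in \<open>arc_length_param\<close> is never vacuous. Later proofs know the chosen parameter
  only through its length.\<close>

lemma arc_length_paramE:
  assumes cont: "continuous_on {s..t} \<gamma>" and fin: "curve_length \<gamma> s t < \<infinity>" and "s \<le> t"
    and \<sigma>: "0 \<le> \<sigma>" "\<sigma> \<le> enn2real (curve_length \<gamma> s t)"
  obtains u where "u \<in> {s..t}" "curve_length \<gamma> s u = ennreal \<sigma>" "arc_length_param \<gamma> s t \<sigma> = \<gamma> u"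
proof -
  have "\<exists>u\<ge>s. u \<le> t \<and> enn2real (curve_length \<gamma> s u) = \<sigma>"
    using continuous_on_curve_length[OF cont fin] \<sigma> \<open>s \<le> t\<close> by (intro IVT') auto
  then obtain u where u: "s \<le> u" "u \<le> t" "enn2real (curve_length \<gamma> s u) = \<sigma>" by auto
  have "curve_length \<gamma> s u < \<infinity>" using curve_length_mono[of s s u t \<gamma>] u fin by (auto simp: order_le_less_trans)
  then have "u \<in> {s..t} \<and> curve_length \<gamma> s u = ennreal \<sigma>" using u by (auto simp: less_top)
  then have "(SOME u. u \<in> {s..t} \<and> curve_length \<gamma> s u = ennreal \<sigma>) \<in> {s..t} \<and>
     curve_length \<gamma> s (SOME u. u \<in> {s..t} \<and> curve_length \<gamma> s u = ennreal \<sigma>) = ennreal \<sigma>"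
    by (rule someI)
  then show thesis using that by (auto simp: arc_length_param_def)
qed

text \<open>A chord is bounded by its arc. The chosen parameters may come in the wrong order, but
  then the two lengths agree and the two points coincide.\<close>

lemma arc_length_param_lipschitz:
  assumes cont: "continuous_on {s..t} \<gamma>" and fin: "curve_length \<gamma> s t < \<infinity>" and "s \<le> t"
    and \<sigma>: "0 \<le> \<sigma>" "\<sigma> \<le> \<tau>" "\<tau> \<le> enn2real (curve_length \<gamma> s t)"
  shows "dist (arc_length_param \<gamma> s t \<sigma>) (arc_length_param \<gamma> s t \<tau>) \<le> \<tau> - \<sigma>"
proof -
  obtain u where u: "u \<in> {s..t}" "curve_length \<gamma> s u = ennreal \<sigma>" "arc_length_param \<gamma> s t \<sigma> = \<gamma> u"
    using arc_length_paramE[OF cont fin \<open>s \<le> t\<close>, of \<sigma>] \<sigma> by auto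
  obtain v where v: "v \<in> {s..t}" "curve_length \<gamma> s v = ennreal \<tau>" "arc_length_param \<gamma> s t \<tau> = \<gamma> v"
    using arc_length_paramE[OF cont fin \<open>s \<le> t\<close>, of \<tau>] \<sigma> by auto
  show ?thesis
  proof (cases "u \<le> v")
    case True
    have "ennreal \<sigma> + ennreal (dist (\<gamma> u) (\<gamma> v)) \<le> curve_length \<gamma> s u + curve_length \<gamma> u v"
      using u(2) True by (intro add_mono dist_le_curve_length) auto
    also have "\<dots> = ennreal \<tau>" using curve_length_additive[of s u v \<gamma>] True u v by simp
    finally show ?thesis using u v \<sigma> by (simp add: ennreal_plus[symmetric] del: ennreal_plus)
  next
    case False
    have "ennreal \<tau> + ennreal (dist (\<gamma> v) (\<gamma> u)) \<le> curve_length \<gamma> s v + curve_length \<gamma> v u"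
      using v(2) False by (intro add_mono dist_le_curve_length) auto
    also have "\<dots> = ennreal \<sigma>" using curve_length_additive[of s v u \<gamma>] False u v by simp
    finally show ?thesis using u v \<sigma> by (simp add: ennreal_plus[symmetric] dist_commute del: ennreal_plus)
  qed
qed

text \<open>The chosen parameters need not be \<open>s\<close> and \<open>t\<close>, but the piece
  of the curve in between has length zero.\<close>

lemma arc_length_param_ends:
  assumes cont: "continuous_on {s..t} \<gamma>" and fin: "curve_length \<gamma> s t < \<infinity>" and "s \<le> t"
  shows "arc_length_param \<gamma> s t 0 = \<gamma> s"
    and "arc_length_param \<gamma> s t (enn2real (curve_length \<gamma> s t)) = \<gamma> t"
proof -
  obtain u where u: "u \<in> {s..t}" "curve_length \<gamma> s u = ennreal 0" "arc_length_param \<gamma> s t 0 = \<gamma> u"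
    using arc_length_paramE[OF assms, of 0] by auto
  then show "arc_length_param \<gamma> s t 0 = \<gamma> s"
    using dist_le_curve_length[of s s u u \<gamma>] by (auto simp: ennreal_eq_0_iff)
  obtain v where v: "v \<in> {s..t}" "curve_length \<gamma> s v = ennreal (enn2real (curve_length \<gamma> s t))"
     "arc_length_param \<gamma> s t (enn2real (curve_length \<gamma> s t)) = \<gamma> v"
    using arc_length_paramE[OF assms, of "enn2real (curve_length \<gamma> s t)"] by auto
  have "curve_length \<gamma> s v + curve_length \<gamma> v t = curve_length \<gamma> s t"
    using curve_length_additive[of s v t \<gamma>] v by auto
  moreover have "curve_length \<gamma> s v = curve_length \<gamma> s t" using v(2) fin by (auto simp: less_top)
  ultimately have "curve_length \<gamma> v t = 0" using fin
    by (metis add.right_neutral ennreal_add_left_cancel infinity_ennreal_def less_irrefl)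
  then show "arc_length_param \<gamma> s t (enn2real (curve_length \<gamma> s t)) = \<gamma> t"
    using dist_le_curve_length[of v v t t \<gamma>] v by (auto simp: ennreal_eq_0_iff)
qed

lemma line_integral_ge_arc:
  assumes "0 < s" "s \<le> t" "t < 1"
  shows "(\<integral>\<^sup>+ \<sigma> \<in> {0..enn2real (curve_length \<gamma> s t)}. \<rho> (arc_length_param \<gamma> s t \<sigma>) \<partial>lborel) \<le> line_integral \<rho> \<gamma>"
  unfolding line_integral_def using assms by (intro SUP_upper2[of "(s, t)"]) auto

text \<open>The source of all lower bounds for line integrals: a metric that dominates |h'| along a
  piece of the curve has an integral that dominates the increment of \<open>h\<close>. The arc
  length parametrization is merely Lipschitz, so instead of a chain rule the inequality is proved
  with an error proportional to the length, locally by differentiability of \<open>h\<close> and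
  globally by bisection.\<close>

lemma line_integral_ge_holomorphic:
  assumes cont: "continuous_on {0<..<1} \<gamma>" and rect: "locally_rectifiable \<gamma>"
    and st: "0 < s" "s \<le> t" "t < 1"
    and S: "open S" and hol: "h holomorphic_on S" and sub: "\<gamma> ` {s..t} \<subseteq> S"
    and le: "\<And>w. w \<in> \<gamma> ` {s..t} \<Longrightarrow> ennreal (norm (deriv h w)) \<le> \<rho> w"
  shows "ennreal (norm (h (\<gamma> t) - h (\<gamma> s))) \<le> line_integral \<rho> \<gamma>"
proof -
  have cont': "continuous_on {s..t} \<gamma>" using cont by (rule continuous_on_subset) (use st in auto)
  have fin: "curve_length \<gamma> s t < \<infinity>" using rect st by (auto simp: locally_rectifiable_def)
  define L where "L = enn2real (curve_length \<gamma> s t)"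
  have L0: "0 \<le> L" by (simp add: L_def)
  define c where "c = arc_length_param \<gamma> s t"
  have lip: "dist (c \<sigma>) (c \<tau>) \<le> \<tau> - \<sigma>" if "0 \<le> \<sigma>" "\<sigma> \<le> \<tau>" "\<tau> \<le> L" for \<sigma> \<tau>
    using arc_length_param_lipschitz[OF cont' fin st(2)] that unfolding c_def L_def by blast
  have cim: "c \<sigma> \<in> \<gamma> ` {s..t}" if "0 \<le> \<sigma>" "\<sigma> \<le> L" for \<sigma>
    using arc_length_paramE[OF cont' fin st(2), of \<sigma>] that unfolding c_def L_def by (metis image_eqI)
  have contc: "continuous_on {0..L} c"
  proof (rule continuous_on_iff[THEN iffD2], intro ballI allI impI)
    fix x e :: real assume x: "x \<in> {0..L}" "0 < e"
    show "\<exists>d>0. \<forall>x'\<in>{0..L}. dist x' x < d \<longrightarrow> dist (c x') (c x) < e"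
    proof (intro exI[of _ e] conjI ballI impI)
      fix y assume y: "y \<in> {0..L}" "dist y x < e"
      show "dist (c y) (c x) < e"
        using lip[of x y] lip[of y x] x y by (cases "x \<le> y") (auto simp: dist_real_def dist_commute)
    qed (use x in auto)
  qed
  define v where "v \<sigma> = h (c \<sigma>)" for \<sigma>
  define d where "d \<sigma> = norm (deriv h (c \<sigma>))" for \<sigma>
  have "continuous_on S (deriv h)"
    using holomorphic_deriv[OF hol S] holomorphic_on_imp_continuous_on by blast
  then have contd: "continuous_on {0..L} d" unfolding d_def
    by (intro continuous_intros continuous_on_compose2[OF _ contc]) (use cim sub in auto)
  have intd: "d integrable_on {x..y}" if "0 \<le> x" "y \<le> L" for x y
    by (rule integrable_continuous_interval, rule continuous_on_subset[OF contd]) (use that in auto)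
  have main: "norm (v L - v 0) \<le> integral {0..L} d + e * L" if "0 < e" for e
  proof -
    \<comment> \<open>The error term is additive in the interval, like the integral; this lets
      \<open>Bolzano\<close> pass from short intervals around each point to the whole
      interval.\<close>
    define P where "P x y \<longleftrightarrow> (0 \<le> x \<and> y \<le> L \<longrightarrow> norm (v y - v x) \<le> integral {x..y} d + e * (y - x))" for x y
    have "P 0 L"
    proof (rule Bolzano[OF L0])
      fix x y z :: real
      assume *: "P x y" "P y z" "x \<le> y" "y \<le> z"
      show "P x z"
        unfolding P_def
      proof
        assume xz: "0 \<le> x \<and> z \<le> L"
        have "integral {x..y} d + integral {y..z} d = integral {x..z} d"
          by (rule Henstock_Kurzweil_Integration.integral_combine) (use * xz intd in auto)
        moreover have "norm (v z - v x) \<le> norm (v z - v y) + norm (v y - v x)"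
          using norm_triangle_ineq[of "v z - v y" "v y - v x"] by simp
        ultimately show "norm (v z - v x) \<le> integral {x..z} d + e * (z - x)"
          using * xz by (auto simp: P_def algebra_simps)
      qed
    next
      fix x assume x: "0 \<le> x" "x \<le> L"
      have "c x \<in> S" using cim x sub by auto
      then have "(h has_field_derivative deriv h (c x)) (at (c x))"
        using holomorphic_derivI[OF hol S] by auto
      then have "(h has_derivative (*) (deriv h (c x))) (at (c x))" by (simp add: has_field_derivative_def)
      then have "\<forall>e>0. \<exists>d>0. \<forall>y. norm (y - c x) < d \<longrightarrow> norm (h y - h (c x) - deriv h (c x) * (y - c x)) \<le> e * norm (y - c x)"
        by (simp add: has_derivative_at_alt)
      then obtain d1 where d1: "d1 > 0" "\<And>y. norm (y - c x) < d1 \<Longrightarrow>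
          norm (h y - h (c x) - deriv h (c x) * (y - c x)) \<le> (e/2) * norm (y - c x)"
        using \<open>0 < e\<close> half_gt_zero by blast
      have nd: "norm (h y - h (c x)) \<le> (d x + e/2) * norm (y - c x)" if "norm (y - c x) < d1" for y
      proof -
        have "norm (h y - h (c x)) \<le> norm (h y - h (c x) - deriv h (c x) * (y - c x)) + norm (deriv h (c x) * (y - c x))"
          using norm_triangle_ineq[of "h y - h (c x) - deriv h (c x) * (y - c x)" "deriv h (c x) * (y - c x)"] by simp
        also have "\<dots> \<le> (e/2) * norm (y - c x) + d x * norm (y - c x)"
          using d1(2)[OF that] by (simp add: norm_mult d_def)
        finally show ?thesis by (simp add: algebra_simps)
      qed
      obtain d2 where d2: "d2 > 0" "\<And>y. y \<in> {0..L} \<Longrightarrow> dist y x < d2 \<Longrightarrow> dist (d y) (d x) < e/2"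
        using contd[unfolded continuous_on_iff, rule_format, of x "e/2"] x \<open>0 < e\<close> by auto
      show "\<exists>r>0. \<forall>a b. a \<le> x \<and> x \<le> b \<and> b - a < r \<longrightarrow> P a b"
        unfolding P_def
      proof (intro exI[of _ "min d1 d2"] conjI allI impI)
        fix a b assume ab: "a \<le> x \<and> x \<le> b \<and> b - a < min d1 d2" "0 \<le> a \<and> b \<le> L"
        have na: "norm (c a - c x) \<le> x - a" using lip[of a x] ab x by (simp add: dist_norm)
        have nb: "norm (c b - c x) \<le> b - x" using lip[of x b] ab x by (simp add: dist_norm norm_minus_commute)
        have dx: "0 \<le> d x" by (simp add: d_def)
        have "norm (v b - v a) \<le> norm (v b - v x) + norm (v a - v x)"
          using norm_triangle_ineq4[of "v b - v x" "v a - v x"] by simp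
        also have "\<dots> \<le> (d x + e/2) * norm (c b - c x) + (d x + e/2) * norm (c a - c x)"
          unfolding v_def using na nb ab by (intro add_mono nd) auto
        also have "\<dots> \<le> (d x + e/2) * (b - x) + (d x + e/2) * (x - a)"
          using na nb dx \<open>0 < e\<close> by (intro add_mono mult_left_mono) auto
        also have "\<dots> = (d x + e/2) * (b - a)" by (simp flip: distrib_left)
        finally have 1: "norm (v b - v a) \<le> (d x + e/2) * (b - a)" .
        have "integral {a..b} (\<lambda>_. d x - e/2) \<le> integral {a..b} d"
        proof (rule integral_le)
          fix y assume "y \<in> {a..b}"
          then have "dist (d y) (d x) < e/2" using ab x by (intro d2(2)) (auto simp: dist_real_def)
          then show "d x - e/2 \<le> d y" unfolding dist_real_def by linarith
        qed (use ab intd in auto)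
        then have "(d x - e/2) * (b - a) \<le> integral {a..b} d" using ab by (simp add: mult.commute)
        moreover have "(d x + e/2) * (b - a) = (d x - e/2) * (b - a) + e * (b - a)"
          by (simp flip: distrib_right)
        ultimately show "norm (v b - v a) \<le> integral {a..b} d + e * (b - a)" using 1 by linarith
      qed (use d1 d2 in auto)
    qed
    then show ?thesis using L0 by (simp add: P_def)
  qed
  have "norm (v L - v 0) \<le> integral {0..L} d"
  proof (rule field_le_epsilon)
    fix e :: real assume "0 < e"
    \<comment> \<open>The denominator \<open>L + 1\<close> also covers a piece of length
      zero.\<close>
    then have "norm (v L - v 0) \<le> integral {0..L} d + e / (L + 1) * L" using L0 by (intro main) auto
    also have "e / (L + 1) * L \<le> e" using L0 \<open>0 < e\<close> by (simp add: field_simps)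
    finally show "norm (v L - v 0) \<le> integral {0..L} d + e" by simp
  qed
  then have "ennreal (norm (v L - v 0)) \<le> ennreal (integral {0..L} d)" by (rule ennreal_leI)
  also have "\<dots> = (\<integral>\<^sup>+ \<sigma> \<in> {0..L}. ennreal (d \<sigma>) \<partial>lborel)"
  proof -
    have "(d has_integral integral {0..L} d) {0..L}" using intd[of 0 L] by auto
    then have 1: "((\<lambda>x. indicator {0..L} x *\<^sub>R d x) has_integral integral {0..L} d) UNIV"
      by (subst (asm) has_integral_restrict_UNIV[symmetric])
         (erule has_integral_eq[rotated], auto split: split_indicator)
    have "(\<lambda>x. indicator {0..L} x *\<^sub>R d x) \<in> borel_measurable borel"
      by (rule borel_measurable_continuous_on_indicator) (use contd in auto)
    from nn_integral_has_integral_lborel[OF this _ 1]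
    have "(\<integral>\<^sup>+ \<sigma>. ennreal (indicator {0..L} \<sigma> *\<^sub>R d \<sigma>) \<partial>lborel) = ennreal (integral {0..L} d)"
      by (auto simp: d_def)
    then show ?thesis
      by (subst (asm) nn_integral_cong[where v="\<lambda>\<sigma>. ennreal (d \<sigma>) * indicator {0..L} \<sigma>"])
         (auto split: split_indicator)
  qed
  also have "\<dots> \<le> (\<integral>\<^sup>+ \<sigma> \<in> {0..L}. \<rho> (c \<sigma>) \<partial>lborel)"
    using le cim by (intro nn_integral_mono) (auto simp: d_def split: split_indicator)
  also have "\<dots> \<le> line_integral \<rho> \<gamma>"
    unfolding c_def L_def by (rule line_integral_ge_arc[OF st])
  finally show ?thesis
    using arc_length_param_ends[OF cont' fin st(2)] by (auto simp: v_def c_def L_def)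
qed

section \<open>Test metrics and polar coordinates\<close>

lemma exists_first_reach:
  fixes f :: "real \<Rightarrow> real"
  assumes "x \<le> y" and cont: "continuous_on {x..y} f" and c: "f x \<le> c" "c \<le> f y"
  obtains z where "z \<in> {x..y}" "f z = c" "\<And>u. u \<in> {x..z} \<Longrightarrow> f u \<le> c"
proof -
  define S where "S = {x..y} \<inter> f -` {c..}"
  have cl: "closed S" unfolding S_def by (rule continuous_closed_preimage[OF cont]) auto
  have yS: "y \<in> S" using assms by (auto simp: S_def)
  have bd: "bdd_below S" unfolding S_def by (rule bdd_belowI[of _ x]) auto
  define z where "z = Inf S"
  have zS: "z \<in> S" unfolding z_def by (rule closed_contains_Inf) (use cl yS bd in auto)
  have lt: "f u < c" if "u \<in> {x..<z}" for u
    using cInf_lower[of u S] bd that zS by (force simp: z_def S_def)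
  have "f z = c"
  proof (rule ccontr)
    assume "f z \<noteq> c"
    then have "c < f z" using zS by (auto simp: S_def)
    have "\<exists>u\<ge>x. u \<le> z \<and> f u = c"
      by (rule IVT') (use c \<open>c < f z\<close> zS in \<open>auto simp: S_def intro: continuous_on_subset[OF cont]\<close>)
    then obtain u where "x \<le> u" "u \<le> z" "f u = c" by auto
    then show False using lt[of u] \<open>c < f z\<close> by (cases "u = z") auto
  qed
  moreover have "f u \<le> c" if "u \<in> {x..z}" for u
    using lt[of u] that \<open>f z = c\<close> by (cases "u = z") auto
  moreover have "z \<in> {x..y}" using zS by (auto simp: S_def)
  ultimately show thesis using that by blast
qed

text \<open>Segments whose ends come in either order allow a curve to be followed forwards or
  backwards from a given parameter.\<close>

lemma exists_first_reach_segment: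
  fixes f :: "real \<Rightarrow> real"
  assumes cont: "continuous_on (closed_segment x y) f" and c: "f x \<le> c" "c \<le> f y"
  obtains z where "z \<in> closed_segment x y" "f z = c" "\<And>u. u \<in> closed_segment x z \<Longrightarrow> f u \<le> c"
proof (cases "x \<le> y")
  case True
  then show ?thesis
    using exists_first_reach[of x y f c] assms that
    by (smt (verit, ccfv_SIG) atLeastAtMost_iff closed_segment_eq_real_ivl)
next
  case False
  have "continuous_on {-x..-y} (\<lambda>u. f (- u))"
    by (intro continuous_on_compose2[OF cont] continuous_intros) (use False in \<open>auto simp: closed_segment_eq_real_ivl\<close>)
  then obtain z where z: "z \<in> {-x..-y}" "f (- z) = c" "\<And>u. u \<in> {-x..z} \<Longrightarrow> f (- u) \<le> c"
    using exists_first_reach[of "-x" "-y" "\<lambda>u. f (- u)" c] False c by auto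
  show ?thesis
    using z(1,2) z(3)[of "- u" for u] False
    by (intro that[of "- z"]) (auto simp: closed_segment_eq_real_ivl split: if_splits)
qed

lemma line_integral_mono: "(\<And>w. \<rho> w \<le> \<rho>' w) \<Longrightarrow> line_integral \<rho> \<gamma> \<le> line_integral \<rho>' \<gamma>"
  unfolding line_integral_def
  by (intro SUP_mono') (auto intro!: nn_integral_mono split: split_indicator)

lemma line_integral_ge_holomorphic_segment:
  assumes cont: "continuous_on {0<..<1} \<gamma>" and rect: "locally_rectifiable \<gamma>"
    and st: "s \<in> {0<..<1}" "t \<in> {0<..<1}"
    and S: "open S" and hol: "h holomorphic_on S" and sub: "\<gamma> ` closed_segment s t \<subseteq> S"
    and le: "\<And>w. w \<in> \<gamma> ` closed_segment s t \<Longrightarrow> ennreal (norm (deriv h w)) \<le> \<rho> w"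
  shows "ennreal (norm (h (\<gamma> t) - h (\<gamma> s))) \<le> line_integral \<rho> \<gamma>"
proof (cases "s \<le> t")
  case True
  then show ?thesis
    using line_integral_ge_holomorphic[OF cont rect _ True _ S hol, of \<rho>] st sub le
    by (auto simp: closed_segment_eq_real_ivl)
next
  case False
  then have "ennreal (norm (h (\<gamma> s) - h (\<gamma> t))) \<le> line_integral \<rho> \<gamma>"
    using line_integral_ge_holomorphic[OF cont rect, of t s S h \<rho>] st sub le S hol
    by (auto simp: closed_segment_eq_real_ivl)
  then show ?thesis by (simp add: norm_minus_commute)
qed

section \<open>Metrics concentrated on a disc\<close>

definition disc_metric :: "complex \<Rightarrow> real \<Rightarrow> real \<Rightarrow> complex \<Rightarrow> ennreal" where
  "disc_metric p r k w = ennreal k * indicator (ball p r) w"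

text \<open>Either the curve stays in the disc up to the parameter \<open>y\<close>, or it can be
  stopped when its distance from \<open>p\<close> has grown by \<open>d\<close>, still inside the
  disc. In both cases a distance of at least \<open>d\<close> is covered there.\<close>

lemma line_integral_disc_ge:
  assumes cont: "continuous_on {0<..<1} \<gamma>" and rect: "locally_rectifiable \<gamma>"
    and xy: "x \<in> {0<..<1}" "y \<in> {0<..<1}" and k: "0 \<le> k"
    and d: "0 \<le> d" "d < r - dist (\<gamma> x) p" "d \<le> dist (\<gamma> x) (\<gamma> y)"
  shows "ennreal (k * d) \<le> line_integral (disc_metric p r k) \<gamma>"
proof -
  have seg: "closed_segment x y \<subseteq> {0<..<1}" using xy by (auto simp: closed_segment_eq_real_ivl split: if_splits)
  have key: "ennreal (k * dist (\<gamma> x) (\<gamma> z)) \<le> line_integral (disc_metric p r k) \<gamma>"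
    if z: "z \<in> closed_segment x y" "\<gamma> ` closed_segment x z \<subseteq> ball p r" for z
  proof -
    have "ennreal (norm ((\<lambda>w. of_real k * w) (\<gamma> z) - (\<lambda>w. of_real k * w) (\<gamma> x))) \<le> line_integral (disc_metric p r k) \<gamma>"
    proof (rule line_integral_ge_holomorphic_segment[OF cont rect, of x z UNIV])
      fix w assume "w \<in> \<gamma> ` closed_segment x z"
      then have "w \<in> ball p r" using z by auto
      then show "ennreal (cmod (deriv (\<lambda>w. of_real k * w) w)) \<le> disc_metric p r k w"
        using k by (simp add: disc_metric_def)
    qed (use seg z xy in \<open>auto intro!: holomorphic_intros\<close>)
    moreover have "norm (of_real k * \<gamma> z - of_real k * \<gamma> x) = k * dist (\<gamma> x) (\<gamma> z)"
      using k by (simp flip: right_diff_distrib add: norm_mult dist_norm norm_minus_commute)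
    ultimately show ?thesis by simp
  qed
  show ?thesis
  proof (cases "\<gamma> ` closed_segment x y \<subseteq> ball p r")
    case True
    have "ennreal (k * d) \<le> ennreal (k * dist (\<gamma> x) (\<gamma> y))"
      using d k by (intro ennreal_leI mult_left_mono) auto
    also have "\<dots> \<le> line_integral (disc_metric p r k) \<gamma>" using True by (intro key) auto
    finally show ?thesis .
  next
    case False
    then obtain y' where y': "y' \<in> closed_segment x y" "\<gamma> y' \<notin> ball p r" by blast
    then have "r \<le> dist (\<gamma> y') p" by (simp add: dist_commute)
    note y' = y'(1) this
    have sub: "closed_segment x y' \<subseteq> closed_segment x y" using y'(1) by (simp add: subset_closed_segment)
    have c: "continuous_on (closed_segment x y') (\<lambda>u. dist (\<gamma> u) p)"
      by (intro continuous_intros continuous_on_subset[OF cont]) (use sub seg in auto)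
    obtain z where z: "z \<in> closed_segment x y'" "dist (\<gamma> z) p = dist (\<gamma> x) p + d"
      "\<And>u. u \<in> closed_segment x z \<Longrightarrow> dist (\<gamma> u) p \<le> dist (\<gamma> x) p + d"
      using exists_first_reach_segment[OF c, of "dist (\<gamma> x) p + d"] d y' by auto
    have "d \<le> dist (\<gamma> x) (\<gamma> z)" using z(2) dist_triangle[of "\<gamma> z" p "\<gamma> x"] by (simp add: dist_commute)
    then have "ennreal (k * d) \<le> ennreal (k * dist (\<gamma> x) (\<gamma> z))"
      using k by (intro ennreal_leI mult_left_mono) auto
    also have "\<dots> \<le> line_integral (disc_metric p r k) \<gamma>"
    proof (rule key)
      show "\<gamma> ` closed_segment x z \<subseteq> ball p r" using z(3) d by (force simp: dist_commute)
    qed (use z(1) sub in auto)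
    finally show ?thesis .
  qed
qed

text \<open>Comprises the points of the curve as well as the accumulation points at its ends, so
  that both can serve as places between which a distance has to be covered. No convergence of the
  curve itself is demanded.\<close>

definition curve_limit_point :: "(real \<Rightarrow> complex) \<Rightarrow> complex \<Rightarrow> bool" where
  "curve_limit_point \<gamma> A \<longleftrightarrow> (\<exists>\<tau>. (\<forall>k. \<tau> k \<in> {0<..<1}) \<and> (\<lambda>k::nat. \<gamma> (\<tau> k)) \<longlonglongrightarrow> A)"

lemma curve_limit_pointI: "x \<in> {0<..<1} \<Longrightarrow> curve_limit_point \<gamma> (\<gamma> x)"
  unfolding curve_limit_point_def by (intro exI[of _ "\<lambda>_. x"]) auto

text \<open>At limit points the estimate is available up to an arbitrarily small loss, which is
  removed at the end. The centre may be off by r/2 because \<open>d \<le> 1/2\<close> leaves room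
  for the distance d r within the disc.\<close>

lemma line_integral_disc_ge_1:
  assumes cont: "continuous_on {0<..<1} \<gamma>" and rect: "locally_rectifiable \<gamma>"
    and A: "curve_limit_point \<gamma> A" and B: "curve_limit_point \<gamma> B"
    and d: "0 < d" "d \<le> 1/2" "0 < r" "dist A p \<le> r / 2" "d * r \<le> dist A B"
  shows "1 \<le> line_integral (disc_metric p r (1 / (d * r))) \<gamma>"
proof (rule ennreal_le_epsilon)
  fix e :: real assume e: "0 < e"
  obtain \<tau> where \<tau>: "\<And>k. \<tau> k \<in> {0<..<1}" "(\<lambda>k. \<gamma> (\<tau> k)) \<longlonglongrightarrow> A"
    using A by (auto simp: curve_limit_point_def)
  obtain \<sigma> where \<sigma>: "\<And>k. \<sigma> k \<in> {0<..<1}" "(\<lambda>k. \<gamma> (\<sigma> k)) \<longlonglongrightarrow> B"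
    using B by (auto simp: curve_limit_point_def)
  \<comment> \<open>The loss is taken relative to d r and is at most half of it, so that d r - e'
    stays positive.\<close>
  define e' where "e' = min (1/2) e * (d * r)"
  have dr: "0 < d * r" using d by simp
  have "e' \<le> (1/2) * (d * r)" unfolding e'_def using dr by (intro mult_right_mono) auto
  moreover have "e' \<le> e * (d * r)" unfolding e'_def using dr by (intro mult_right_mono) auto
  moreover have "0 < e'" unfolding e'_def using e dr by simp
  ultimately have e': "0 < e'" "e' < d * r" "e' \<le> e * (d * r)" using dr by linarith+
  have "d * r \<le> (1/2) * r" using d by (intro mult_right_mono) auto
  then have dr2: "d * r \<le> r / 2" by simp
  have "((\<lambda>k. r - dist (\<gamma> (\<tau> k)) p) \<longlongrightarrow> r - dist A p) sequentially"
    by (intro tendsto_intros \<tau>)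
  moreover have "d * r - e' < r - dist A p" using d dr2 e' by linarith
  ultimately have 1: "\<forall>\<^sub>F k in sequentially. d * r - e' < r - dist (\<gamma> (\<tau> k)) p"
    by (rule order_tendstoD(1))
  have "((\<lambda>k. dist (\<gamma> (\<tau> k)) (\<gamma> (\<sigma> k))) \<longlongrightarrow> dist A B) sequentially"
    by (intro tendsto_intros \<tau> \<sigma>)
  moreover have "d * r - e' < dist A B" using d e' by linarith
  ultimately have 2: "\<forall>\<^sub>F k in sequentially. d * r - e' < dist (\<gamma> (\<tau> k)) (\<gamma> (\<sigma> k))"
    by (rule order_tendstoD(1))
  obtain k where k: "d * r - e' < r - dist (\<gamma> (\<tau> k)) p" "d * r - e' < dist (\<gamma> (\<tau> k)) (\<gamma> (\<sigma> k))"
    using eventually_happens'[OF _ eventually_conj[OF 1 2]] by auto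
  have "1 - e \<le> 1 / (d * r) * (d * r - e')" 
  proof -
    have "e' / (d * r) \<le> e" using e' dr by (simp add: pos_divide_le_eq)
    moreover have "1 / (d * r) * (d * r - e') = 1 - e' / (d * r)" using d dr by (simp add: diff_divide_distrib)
    ultimately show ?thesis by simp
  qed
  then have "ennreal (1 - e) \<le> ennreal (1 / (d * r) * (d * r - e'))" by (rule ennreal_leI)
  also have "\<dots> \<le> line_integral (disc_metric p r (1 / (d * r))) \<gamma>"
    by (rule line_integral_disc_ge[OF cont rect \<tau>(1)[of k] \<sigma>(1)[of k]]) (use k e' dr in auto)
  finally have 3: "ennreal (1 - e) + ennreal e \<le> line_integral (disc_metric p r (1 / (d * r))) \<gamma> + ennreal e"
    by (rule add_right_mono)
  have 4: "1 \<le> ennreal (1 - e) + ennreal e"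
    using e by (cases "e \<le> 1") (auto simp flip: ennreal_plus simp: ennreal_neg ennreal_ge_1)
  show "1 \<le> line_integral (disc_metric p r (1 / (d * r))) \<gamma> + ennreal e" using order_trans[OF 4 3] .
qed

lemma disc_metric_measurable [measurable]: "disc_metric p r k \<in> borel_measurable borel"
proof -
  have [measurable]: "ball p r \<in> sets borel" by simp
  show ?thesis unfolding disc_metric_def[abs_def] by measurable
qed

text \<open>For k = 1 / (d r) the bound is \<pi> / d^2, independent of centre and radius: every disc
  costs the same, whatever its scale.\<close>

lemma nn_integral_disc_metric_le:
  assumes "0 \<le> k" "0 \<le> r"
  shows "(\<integral>\<^sup>+w\<in>X. (disc_metric p r k w)\<^sup>2 \<partial>lborel) \<le> ennreal (k\<^sup>2 * r\<^sup>2 * pi)"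
proof -
  have "(\<integral>\<^sup>+w\<in>X. (disc_metric p r k w)\<^sup>2 \<partial>lborel) \<le> (\<integral>\<^sup>+w. ennreal (k\<^sup>2) * indicator (ball p r) w \<partial>lborel)"
    using assms by (intro nn_integral_mono) (auto simp: disc_metric_def ennreal_power split: split_indicator)
  also have "\<dots> = ennreal (k\<^sup>2) * emeasure lborel (ball p r)"
    by (rule nn_integral_cmult_indicator) simp
  also have "emeasure lborel (ball p r) = ennreal (pi * r\<^sup>2)"
    using emeasure_ball[of r p] assms by (simp add: unit_ball_vol_2)
  finally show ?thesis using assms by (simp flip: ennreal_mult' add: mult.commute mult.left_commute)
qed

text \<open>The supremum of the metrics is admissible as soon as each curve is caught by one of
  them, and the square of a finite maximum is at most the sum of the squares.\<close>

lemma curve_modulus_le_sum: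
  fixes \<rho> :: "'i \<Rightarrow> complex \<Rightarrow> ennreal"
  assumes K: "finite K" and meas: "\<And>k. k \<in> K \<Longrightarrow> \<rho> k \<in> borel_measurable borel"
    and adm: "\<And>\<gamma>. \<gamma> \<in> \<Gamma> \<Longrightarrow> locally_rectifiable \<gamma> \<Longrightarrow> \<exists>k\<in>K. 1 \<le> line_integral (\<rho> k) \<gamma>"
    and \<Omega>: "\<Omega> \<in> sets borel"
  shows "curve_modulus \<Omega> \<Gamma> \<le> (\<Sum>k\<in>K. \<integral>\<^sup>+z\<in>\<Omega>. (\<rho> k z)\<^sup>2 \<partial>lborel)"
proof -
  define R where "R z = (SUP k\<in>K. \<rho> k z)" for z
  have R [measurable]: "R \<in> borel_measurable borel"
    unfolding R_def by (rule borel_measurable_SUP) (use K meas in \<open>auto simp: countable_finite\<close>)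
  have "admissible \<Omega> \<Gamma> R"
    unfolding admissible_def
  proof (intro conjI ballI impI)
    show "R \<in> borel_measurable (restrict_space borel \<Omega>)" by (rule measurable_restrict_space1) measurable
    fix \<gamma> assume "\<gamma> \<in> \<Gamma>" "locally_rectifiable \<gamma>"
    then obtain k where k: "k \<in> K" "1 \<le> line_integral (\<rho> k) \<gamma>" using adm by blast
    then have "line_integral (\<rho> k) \<gamma> \<le> line_integral R \<gamma>"
      by (intro line_integral_mono) (auto simp: R_def intro: SUP_upper)
    then show "1 \<le> line_integral R \<gamma>" using k by simp
  qed
  then have "curve_modulus \<Omega> \<Gamma> \<le> (\<integral>\<^sup>+z\<in>\<Omega>. (R z)\<^sup>2 \<partial>lborel)"
    unfolding curve_modulus_def by (intro INF_lower) auto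
  also have "\<dots> \<le> (\<integral>\<^sup>+z. (\<Sum>k\<in>K. (\<rho> k z)\<^sup>2 * indicator \<Omega> z) \<partial>lborel)"
  proof (intro nn_integral_mono)
    fix z
    have "(R z)\<^sup>2 \<le> (\<Sum>k\<in>K. (\<rho> k z)\<^sup>2)"
    proof (cases "K = {}")
      case False
      have "R z = Max ((\<lambda>k. \<rho> k z) ` K)" unfolding R_def using K False by (intro cSup_eq_Max) auto
      also have "\<dots> \<in> (\<lambda>k. \<rho> k z) ` K" using K False by (intro Max_in) auto
      finally obtain k where k: "k \<in> K" "R z = \<rho> k z" by auto
      then show ?thesis using K by (auto intro: member_le_sum)
    qed (auto simp: R_def bot_ennreal)
    then show "(R z)\<^sup>2 * indicator \<Omega> z \<le> (\<Sum>k\<in>K. (\<rho> k z)\<^sup>2 * indicator \<Omega> z)"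
      by (auto split: split_indicator)
  qed
  also have "\<dots> = (\<Sum>k\<in>K. \<integral>\<^sup>+z\<in>\<Omega>. (\<rho> k z)\<^sup>2 \<partial>lborel)"
    using meas \<Omega> by (intro nn_integral_sum) auto
  finally show ?thesis .
qed

section \<open>Circular arcs and their arc length\<close>

lemma dist_cis: "dist (cis x) (cis y) = 2 * \<bar>sin ((x - y) / 2)\<bar>"
proof -
  have "(dist (cis x) (cis y))\<^sup>2 = (2 * \<bar>sin ((x - y) / 2)\<bar>)\<^sup>2"
  proof -
    have "(dist (cis x) (cis y))\<^sup>2 = (cos x - cos y)\<^sup>2 + (sin x - sin y)\<^sup>2"
      by (simp add: dist_norm cmod_power2)
    also have "\<dots> = ((cos x)\<^sup>2 + (sin x)\<^sup>2) + ((cos y)\<^sup>2 + (sin y)\<^sup>2) - 2 * (cos x * cos y + sin x * sin y)"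
      by (simp add: power2_eq_square algebra_simps)
    also have "\<dots> = 2 - 2 * cos (x - y)" by (simp add: cos_diff)
    also have "cos (x - y) = 1 - 2 * (sin ((x - y) / 2))\<^sup>2"
    proof -
      have "2 * ((x - y) / 2) = x - y" by simp
      then show ?thesis using cos_double_sin[of "(x - y) / 2"] by (simp only:)
    qed
    finally show ?thesis by (simp add: power_mult_distrib)
  qed
  then show ?thesis by (rule power2_eq_imp_eq) auto
qed

text \<open>From above, every chord is bounded by means of |sin x| \<le> |x|. From below, short
  chords lose only a factor close to 1 because the derivative of the sine at 0 is 1, and additivity
  of the length carries this to the whole arc by bisection.\<close>

lemma curve_length_circle:
  fixes \<gamma> :: "real \<Rightarrow> complex"
  assumes \<gamma>: "\<And>u. \<gamma> u = p + of_real r * cis (\<alpha> + \<beta> * u)" and r: "0 \<le> r" and st: "s \<le> t"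
  shows "curve_length \<gamma> s t = ennreal (r * \<bar>\<beta>\<bar> * (t - s))"
proof -
  define K where "K = r * \<bar>\<beta>\<bar>"
  have K0: "0 \<le> K" using r by (simp add: K_def)
  have d: "dist (\<gamma> u) (\<gamma> v) = r * (2 * \<bar>sin (\<beta> * (v - u) / 2)\<bar>)" for u v
  proof -
    have "dist (\<gamma> u) (\<gamma> v) = norm (of_real r * (cis (\<alpha> + \<beta> * u) - cis (\<alpha> + \<beta> * v)))"
      by (simp add: \<gamma> dist_norm algebra_simps)
    also have "\<dots> = r * dist (cis (\<alpha> + \<beta> * u)) (cis (\<alpha> + \<beta> * v))"
      using r by (simp add: norm_mult dist_norm)
    also have "\<dots> = r * (2 * \<bar>sin (- (\<beta> * (v - u) / 2))\<bar>)"
      by (simp add: dist_cis algebra_simps diff_divide_distrib)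
    finally show ?thesis unfolding sin_minus by simp
  qed
  have up: "dist (\<gamma> u) (\<gamma> v) \<le> K * (v - u)" if "u \<le> v" for u v
  proof -
    have "2 * \<bar>sin (\<beta> * (v - u) / 2)\<bar> \<le> \<bar>\<beta>\<bar> * (v - u)"
      using abs_sin_x_le_abs_x[of "\<beta> * (v - u) / 2"] that by (simp add: abs_mult)
    then show ?thesis unfolding d K_def using r by (simp add: mult.assoc mult_left_mono)
  qed
  have pl: "poly_len \<gamma> (x # ts) \<le> K * (t - x)" if "sorted (x # ts)" "set (x # ts) \<subseteq> {s..t}" for x ts
    using that
  proof (induction ts arbitrary: x)
    case (Cons y ts)
    have "poly_len \<gamma> (y # ts) \<le> K * (t - y)" using Cons.prems by (intro Cons.IH) auto
    moreover have "dist (\<gamma> x) (\<gamma> y) \<le> K * (y - x)" using Cons.prems by (intro up) auto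
    ultimately show ?case by (simp add: algebra_simps)
  qed (use K0 in auto)
  have "curve_length \<gamma> s t \<le> ennreal (K * (t - s))"
    unfolding curve_length_eq_poly_len
  proof (rule SUP_least)
    fix ts assume "ts \<in> {ts. sorted ts \<and> set ts \<subseteq> {s..t}}"
    then show "ennreal (poly_len \<gamma> ts) \<le> ennreal (K * (t - s))"
    proof (cases ts)
      case (Cons x xs)
      then have "poly_len \<gamma> ts \<le> K * (t - x)" using pl[of x xs] \<open>ts \<in> _\<close> by auto
      also have "\<dots> \<le> K * (t - s)" using K0 Cons \<open>ts \<in> _\<close> by (intro mult_left_mono) auto
      finally show ?thesis by (rule ennreal_leI)
    qed auto
  qed
  moreover have "ennreal (K * (t - s)) \<le> curve_length \<gamma> s t"
  proof -
    have low: "ennreal ((K - e) * (t - s)) \<le> curve_length \<gamma> s t" if e: "0 < e" for e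
    proof -
      have "(sin has_derivative (\<lambda>y. y)) (at (0::real))"
      proof -
        have "(*) (1::real) = (\<lambda>y. y)" by (rule ext) simp
        then show ?thesis using DERIV_sin[of "0::real"] by (simp add: has_field_derivative_def)
      qed
      then have "\<forall>e>0. \<exists>d>0. \<forall>y::real. \<bar>y\<bar> < d \<longrightarrow> \<bar>sin y - y\<bar> \<le> e * \<bar>y\<bar>"
        by (simp add: has_derivative_at_alt)
      then obtain h where h: "0 < h" "\<And>y::real. \<bar>y\<bar> < h \<Longrightarrow> \<bar>sin y - y\<bar> \<le> (e / (K + 1)) * \<bar>y\<bar>"
        using e K0 by (metis add_nonneg_pos divide_pos_pos zero_less_one)
      have chord: "(K - e) * (v - u) \<le> dist (\<gamma> u) (\<gamma> v)" if uv: "u \<le> v" "v - u < h / (\<bar>\<beta>\<bar> + 1)" for u v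
      proof -
        define y where "y = \<beta> * (v - u) / 2"
        have ay: "\<bar>y\<bar> = \<bar>\<beta>\<bar> * (v - u) / 2" using uv by (simp add: y_def abs_mult)
        have "\<bar>\<beta>\<bar> * (v - u) \<le> (\<bar>\<beta>\<bar> + 1) * (v - u)" using uv by (simp add: distrib_right)
        also have "\<dots> < h" using uv(2) by (simp add: field_simps)
        finally have "\<bar>y\<bar> < h" using ay h(1) by linarith
        then have "\<bar>y\<bar> - (e / (K + 1)) * \<bar>y\<bar> \<le> \<bar>sin y\<bar>" using h(2)[of y] by linarith
        then have "r * (2 * (\<bar>y\<bar> - (e / (K + 1)) * \<bar>y\<bar>)) \<le> dist (\<gamma> u) (\<gamma> v)"
          unfolding d y_def[symmetric] using r by (intro mult_left_mono) auto
        moreover have "r * (2 * (\<bar>y\<bar> - (e / (K + 1)) * \<bar>y\<bar>)) = K * (v - u) - (e / (K + 1)) * K * (v - u)"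
        proof -
          have "r * (2 * (B * (v - u) / 2 - q * (B * (v - u) / 2))) = r * B * (v - u) - q * (r * B) * (v - u)" for q B
            by (simp add: field_simps)
          from this[of "\<bar>\<beta>\<bar>" "e / (K + 1)"] show ?thesis unfolding ay by (simp only: K_def)
        qed
        moreover have "(e / (K + 1)) * K * (v - u) \<le> e * (v - u)"
          using e K0 uv(1) by (intro mult_right_mono) (auto simp: field_simps)
        ultimately show ?thesis by (simp add: algebra_simps)
      qed
      show ?thesis using st
      proof (induct rule: Bolzano)
        case (trans a b c)
        have "ennreal ((K - e) * (c - a)) \<le> ennreal ((K - e) * (b - a)) + ennreal ((K - e) * (c - b))"
        proof (cases "0 \<le> K - e")
          case True
          then show ?thesis using trans(3,4) by (simp flip: ennreal_plus distrib_left)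
        next
          case False
          then have "(K - e) * (c - a) \<le> 0" using trans(3,4) by (intro mult_nonpos_nonneg) auto
          then show ?thesis by (simp add: ennreal_neg)
        qed
        also have "\<dots> \<le> curve_length \<gamma> a b + curve_length \<gamma> b c" using trans by (intro add_mono) auto
        also have "\<dots> = curve_length \<gamma> a c" using trans by (intro curve_length_additive[symmetric]) auto
        finally show ?case .
      next
        case (local x)
        have "ennreal ((K - e) * (b - a)) \<le> curve_length \<gamma> a b" if "a \<le> x \<and> x \<le> b \<and> b - a < h / (\<bar>\<beta>\<bar> + 1)" for a b
          using chord[of a b] dist_le_curve_length[of a a b b \<gamma>] that by (meson ennreal_leI order_refl order_trans)
        then show ?case using h(1) by (intro exI[of _ "h / (\<bar>\<beta>\<bar> + 1)"]) (auto intro!: divide_pos_pos)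
      qed
    qed
    show ?thesis
    proof (rule ennreal_le_epsilon)
      fix e :: real assume "0 < e"
      define e' where "e' = e / (t - s + 1)"
      have e': "0 < e'" "e' * (t - s) \<le> e" using \<open>0 < e\<close> st by (auto simp: e'_def field_simps)
      have "K * (t - s) \<le> (K - e') * (t - s) + e" using e'(2) by (simp add: algebra_simps)
      then have "ennreal (K * (t - s)) \<le> ennreal ((K - e') * (t - s)) + ennreal e"
      proof -
        have "ennreal (y + e) \<le> ennreal y + ennreal e" for y
          using \<open>0 < e\<close> by (cases "0 \<le> y") (auto simp: ennreal_neg intro!: ennreal_leI)
        with ennreal_leI[OF \<open>K * (t - s) \<le> _\<close>] show ?thesis by (rule order_trans)
      qed
      also have "\<dots> \<le> curve_length \<gamma> s t + ennreal e" using low[OF e'(1)] by (rule add_right_mono)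
      finally show "ennreal (K * (t - s)) \<le> curve_length \<gamma> s t + ennreal e" .
    qed
  qed
  ultimately show ?thesis by (simp add: K_def)
qed


lemma circle_arc_length_param:
  fixes \<gamma> :: "real \<Rightarrow> complex"
  assumes \<gamma>: "\<And>u. u \<in> {0<..<1} \<Longrightarrow> \<gamma> u = p + of_real r * cis (\<alpha> + \<beta> * u)" and r: "0 < r" "\<beta> \<noteq> 0"
    and st: "0 < s" "s \<le> t" "t < 1"
  shows "curve_length \<gamma> s t = ennreal (r * \<bar>\<beta>\<bar> * (t - s))"
    and "\<sigma> \<in> {0..r * \<bar>\<beta>\<bar> * (t - s)} \<Longrightarrow> s + \<sigma> / (r * \<bar>\<beta>\<bar>) \<in> {s..t} \<and>
      arc_length_param \<gamma> s t \<sigma> = \<gamma> (s + \<sigma> / (r * \<bar>\<beta>\<bar>))"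
proof -
  define K where "K = r * \<bar>\<beta>\<bar>"
  have K: "0 < K" using r by (simp add: K_def)
  define \<gamma>' where "\<gamma>' u = p + of_real r * cis (\<alpha> + \<beta> * u)" for u
  have eq: "curve_length \<gamma> s u = ennreal (K * (u - s))" if "s \<le> u" "u \<le> t" for u
  proof -
    have "curve_length \<gamma> s u = curve_length \<gamma>' s u"
      using st that by (intro curve_length_cong) (auto simp: \<gamma> \<gamma>'_def)
    also have "\<dots> = ennreal (K * (u - s))"
      unfolding K_def by (rule curve_length_circle) (use that r in \<open>auto simp: \<gamma>'_def\<close>)
    finally show ?thesis .
  qed
  show len: "curve_length \<gamma> s t = ennreal (r * \<bar>\<beta>\<bar> * (t - s))" using eq[of t] st by (simp add: K_def)
  have "continuous_on {s..t} \<gamma>'" unfolding \<gamma>'_def by (intro continuous_intros)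
  then have cont: "continuous_on {s..t} \<gamma>"
    by (rule continuous_on_eq) (use st in \<open>auto simp: \<gamma> \<gamma>'_def\<close>)
  show "s + \<sigma> / (r * \<bar>\<beta>\<bar>) \<in> {s..t} \<and> arc_length_param \<gamma> s t \<sigma> = \<gamma> (s + \<sigma> / (r * \<bar>\<beta>\<bar>))"
    if \<sigma>: "\<sigma> \<in> {0..r * \<bar>\<beta>\<bar> * (t - s)}"
  proof -
    obtain u where u: "u \<in> {s..t}" "curve_length \<gamma> s u = ennreal \<sigma>" "arc_length_param \<gamma> s t \<sigma> = \<gamma> u"
      using arc_length_paramE[OF cont _ st(2), of \<sigma>] \<sigma> st r by (auto simp: len)
    then have "K * (u - s) = \<sigma>" using eq[of u] K \<sigma> by simp
    then have "u = s + \<sigma> / K" using K by (auto simp: field_simps)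
    then show ?thesis using u by (simp add: K_def)
  qed
qed

text \<open>A member of the family that runs along a circle turns admissibility into an inequality
  for an integral over the angle. The Borel function \<open>\<rho>0\<close> replaces a metric that
  is measurable on the domain only, and \<open>T\<close> may be larger than the range of angles, so
  that arcs of varying opening are treated on one fixed interval.\<close>

lemma line_integral_circle_le:
  fixes \<gamma> :: "real \<Rightarrow> complex"
  assumes \<gamma>: "\<And>u. u \<in> {0<..<1} \<Longrightarrow> \<gamma> u = p + of_real r * cis (\<alpha> + \<beta> * u)" and r: "0 < r" "\<beta> \<noteq> 0"
    and meas [measurable]: "\<rho>0 \<in> borel_measurable borel"
    and eq: "\<And>u. u \<in> {0<..<1} \<Longrightarrow> \<rho> (\<gamma> u) = \<rho>0 (\<gamma> u)"
    and range: "\<And>u. u \<in> {0<..<1} \<Longrightarrow> \<alpha> + \<beta> * u \<in> T" and T [measurable]: "T \<in> sets borel"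
  shows "locally_rectifiable \<gamma>"
    and "line_integral \<rho> \<gamma> \<le> (\<integral>\<^sup>+\<theta>\<in>T. ennreal r * \<rho>0 (p + of_real r * cis \<theta>) \<partial>lborel)"
proof -
  define K where "K = r * \<bar>\<beta>\<bar>"
  have K: "0 < K" using r by (simp add: K_def)
  show "locally_rectifiable \<gamma>"
    unfolding locally_rectifiable_def using circle_arc_length_param(1)[OF \<gamma> r] by auto
  define F where "F \<theta> = \<rho>0 (p + of_real r * cis \<theta>) * indicator T \<theta>" for \<theta>
  have [measurable]: "(\<lambda>\<theta>. p + of_real r * cis \<theta>) \<in> borel_measurable borel"
    by (intro borel_measurable_continuous_onI continuous_intros)
  have F[measurable]: "F \<in> borel_measurable borel" unfolding F_def by measurable
  have "(\<integral>\<^sup>+ \<sigma> \<in> {0..enn2real (curve_length \<gamma> s t)}. \<rho> (arc_length_param \<gamma> s t \<sigma>) \<partial>lborel) \<le> ennreal r * (\<integral>\<^sup>+\<theta>. F \<theta> \<partial>lborel)"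
    if st: "0 < s" "s \<le> t" "t < 1" for s t
  proof -
    have L: "enn2real (curve_length \<gamma> s t) = K * (t - s)"
      using circle_arc_length_param(1)[OF \<gamma> r st] K st by (simp add: K_def)
    have "(\<integral>\<^sup>+ \<sigma> \<in> {0..K * (t - s)}. \<rho> (arc_length_param \<gamma> s t \<sigma>) \<partial>lborel)
       \<le> (\<integral>\<^sup>+ \<sigma>. F ((\<alpha> + \<beta> * s) + (\<beta> / K) * \<sigma>) \<partial>lborel)"
    proof (intro nn_integral_mono)
      fix \<sigma>
      show "\<rho> (arc_length_param \<gamma> s t \<sigma>) * indicator {0..K * (t - s)} \<sigma> \<le> F ((\<alpha> + \<beta> * s) + (\<beta> / K) * \<sigma>)"
      proof (cases "\<sigma> \<in> {0..K * (t - s)}")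
        case True
        then have 1: "s + \<sigma> / K \<in> {s..t}" "arc_length_param \<gamma> s t \<sigma> = \<gamma> (s + \<sigma> / K)"
          using circle_arc_length_param(2)[OF \<gamma> r st, of \<sigma>] by (auto simp: K_def)
        then have 2: "s + \<sigma> / K \<in> {0<..<1}" using st by auto
        have 3: "\<alpha> + \<beta> * (s + \<sigma> / K) = (\<alpha> + \<beta> * s) + (\<beta> / K) * \<sigma>" by (simp add: algebra_simps)
        show ?thesis using True 1(2) eq[OF 2] range[OF 2] \<gamma>[OF 2] unfolding F_def 3 by simp
      qed auto
    qed
    also have "\<dots> = ennreal r * (\<integral>\<^sup>+\<theta>. F \<theta> \<partial>lborel)"
    proof -
      have "(\<integral>\<^sup>+\<theta>. F \<theta> \<partial>lborel) = ennreal \<bar>\<beta> / K\<bar> * (\<integral>\<^sup>+ \<sigma>. F ((\<alpha> + \<beta> * s) + (\<beta> / K) * \<sigma>) \<partial>lborel)"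
        by (rule nn_integral_real_affine) (use r K in auto)
      moreover have "\<bar>\<beta> / K\<bar> = 1 / r" using r by (simp add: K_def abs_mult)
      moreover have "ennreal r * ennreal (1 / r) = 1" using r by (simp flip: ennreal_mult')
      ultimately show ?thesis by (simp flip: mult.assoc)
    qed
    finally show ?thesis unfolding L .
  qed
  then have "line_integral \<rho> \<gamma> \<le> ennreal r * (\<integral>\<^sup>+\<theta>. F \<theta> \<partial>lborel)"
    unfolding line_integral_def by (intro SUP_least) auto
  also have "\<dots> = (\<integral>\<^sup>+\<theta>\<in>T. ennreal r * \<rho>0 (p + of_real r * cis \<theta>) \<partial>lborel)"
    unfolding F_def by (subst nn_integral_cmult[symmetric]) (auto simp: mult.assoc)
  finally show "line_integral \<rho> \<gamma> \<le> (\<integral>\<^sup>+\<theta>\<in>T. ennreal r * \<rho>0 (p + of_real r * cis \<theta>) \<partial>lborel)" .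
qed

text \<open>Polar coordinates with the logarithm of the radius as first coordinate: logarithmic
  lengths become side lengths of rectangles.\<close>

definition polar_box :: "complex \<Rightarrow> real \<Rightarrow> real \<Rightarrow> real \<Rightarrow> real \<Rightarrow> complex set" where
  "polar_box p x1 x2 y1 y2 = (\<lambda>z. p + exp z) ` box (Complex x1 y1) (Complex x2 y2)"

lemma exp_Complex: "exp (Complex x y) = of_real (exp x) * cis y"
  by (simp add: complex_eq_iff Re_exp Im_exp)

lemma
  assumes "y2 - y1 \<le> 2 * pi"
  shows inj_on_polar_box: "inj_on (\<lambda>z. p + exp z) (box (Complex x1 y1) (Complex x2 y2))"
    and open_polar_box: "open (polar_box p x1 x2 y1 y2)"
proof -
  show inj: "inj_on (\<lambda>z. p + exp z) (box (Complex x1 y1) (Complex x2 y2))"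
    using assms by (auto simp: inj_on_def in_box_complex_iff intro!: exp_complex_eqI)
  show "open (polar_box p x1 x2 y1 y2)" unfolding polar_box_def
    by (rule open_mapping_thm3[OF _ _ inj]) (auto intro!: holomorphic_intros open_box)
qed

lemma nn_integral_polar_box:
  assumes h [measurable]: "h \<in> borel_measurable borel" and y: "y2 - y1 \<le> 2 * pi"
  shows "(\<integral>\<^sup>+w\<in>polar_box p x1 x2 y1 y2. h w \<partial>lborel) =
    (\<integral>\<^sup>+x\<in>{x1<..<x2}. (\<integral>\<^sup>+y\<in>{y1<..<y2}. h (p + of_real (exp x) * cis y) * ennreal ((exp x)\<^sup>2) \<partial>lborel) \<partial>lborel)"
proof -
  let ?S = "box (Complex x1 y1) (Complex x2 y2)"
  have [measurable]: "(\<lambda>z::complex. exp z) \<in> borel_measurable borel"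
    by (intro borel_measurable_continuous_onI continuous_intros)
  have "(\<integral>\<^sup>+w\<in>polar_box p x1 x2 y1 y2. h w \<partial>lborel) =
     (\<integral>\<^sup>+z\<in>?S. h (p + exp z) * ennreal ((norm (deriv (\<lambda>z. p + exp z) z))\<^sup>2) \<partial>lborel)"
    unfolding polar_box_def
    by (rule nn_integral_holomorphic_image) (use inj_on_polar_box[OF y] in \<open>auto intro!: holomorphic_intros open_box\<close>)
  also have "\<dots> = (\<integral>\<^sup>+z. h (p + exp z) * ennreal ((exp (Re z))\<^sup>2) * indicator ?S z \<partial>lborel)"
  proof -
    have "deriv (\<lambda>z. p + exp z) z = exp z" for z :: complex
      by (rule DERIV_imp_deriv) (auto intro!: derivative_eq_intros)
    then show ?thesis by (simp add: norm_exp_eq_Re)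
  qed
  also have "\<dots> = (\<integral>\<^sup>+x. \<integral>\<^sup>+y. h (p + of_real (exp x) * cis y) * ennreal ((exp x)\<^sup>2) * indicator ?S (Complex x y) \<partial>lborel \<partial>lborel)"
    by (subst nn_integral_complex_iterated) (auto simp: exp_Complex)
  also have "\<dots> = (\<integral>\<^sup>+x\<in>{x1<..<x2}. (\<integral>\<^sup>+y\<in>{y1<..<y2}. h (p + of_real (exp x) * cis y) * ennreal ((exp x)\<^sup>2) \<partial>lborel) \<partial>lborel)"
  proof (intro nn_integral_cong)
    fix x
    have "(indicator ?S (Complex x y) :: ennreal) = indicator {y1<..<y2} y * indicator {x1<..<x2} x" for y
      by (auto simp: in_box_complex_iff split: split_indicator)
    then show "(\<integral>\<^sup>+y. h (p + of_real (exp x) * cis y) * ennreal ((exp x)\<^sup>2) * indicator ?S (Complex x y) \<partial>lborel)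
      = (\<integral>\<^sup>+y\<in>{y1<..<y2}. h (p + of_real (exp x) * cis y) * ennreal ((exp x)\<^sup>2) \<partial>lborel) * indicator {x1<..<x2} x"
      by (cases "x \<in> {x1<..<x2}") auto
  qed
  finally show ?thesis .
qed

text \<open>The length-area inequality. On each circle, Cauchy-Schwarz bounds the angular energy
  from below by the inverse of the opening; integration over the logarithm of the radius gives
  logarithmic length over opening.\<close>

lemma polar_box_energy_ge:
  assumes h [measurable]: "h \<in> borel_measurable borel" and y: "y1 < y2" "y2 - y1 \<le> 2 * pi" and x: "x1 \<le> x2"
    and ge: "\<And>x. x \<in> {x1<..<x2} \<Longrightarrow> 1 \<le> (\<integral>\<^sup>+\<theta>\<in>{y1<..<y2}. ennreal (exp x) * h (p + of_real (exp x) * cis \<theta>) \<partial>lborel)"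
  shows "ennreal ((x2 - x1) / (y2 - y1)) \<le> (\<integral>\<^sup>+w\<in>polar_box p x1 x2 y1 y2. (h w)\<^sup>2 \<partial>lborel)"
proof -
  have "ennreal (1 / (y2 - y1)) \<le> (\<integral>\<^sup>+\<theta>\<in>{y1<..<y2}. (h (p + of_real (exp x) * cis \<theta>))\<^sup>2 * ennreal ((exp x)\<^sup>2) \<partial>lborel)" (is "_ \<le> ?I")
    if xx: "x \<in> {x1<..<x2}" for x
  proof -
    have [measurable]: "(\<lambda>\<theta>. p + of_real (exp x) * cis \<theta>) \<in> borel_measurable borel"
      by (intro borel_measurable_continuous_onI continuous_intros)
    let ?f = "\<lambda>\<theta>. ennreal (exp x) * h (p + of_real (exp x) * cis \<theta>) * indicator {y1<..<y2} \<theta>"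
    let ?g = "\<lambda>\<theta>. indicator {y1<..<y2} \<theta> :: ennreal"
    have "1 \<le> (\<integral>\<^sup>+\<theta>. ?f \<theta> * ?g \<theta> \<partial>lborel)"
      using ge[OF xx] by (simp add: mult.assoc flip: indicator_inter_arith)
    then have "1 \<le> (\<integral>\<^sup>+\<theta>. ?f \<theta> * ?g \<theta> \<partial>lborel)\<^sup>2" by (simp add: one_le_power)
    also have "\<dots> \<le> (\<integral>\<^sup>+\<theta>. (?f \<theta>)\<^sup>2 \<partial>lborel) * (\<integral>\<^sup>+\<theta>. (?g \<theta>)\<^sup>2 \<partial>lborel)"
      by (rule Cauchy_Schwarz_nn_integral) measurable
    also have "(\<integral>\<^sup>+\<theta>. (?g \<theta>)\<^sup>2 \<partial>lborel) = ennreal (y2 - y1)"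
    proof -
      have "(\<lambda>\<theta>. (?g \<theta>)\<^sup>2) = ?g" by (auto split: split_indicator)
      then show ?thesis using y by simp
    qed
    also have "(\<integral>\<^sup>+\<theta>. (?f \<theta>)\<^sup>2 \<partial>lborel) = ?I"
      by (intro nn_integral_cong) (auto simp: power_mult_distrib ennreal_power mult_ac split: split_indicator)
    finally have 1: "1 \<le> ?I * ennreal (y2 - y1)" .
    have "ennreal (1 / (y2 - y1)) * 1 \<le> ennreal (1 / (y2 - y1)) * (?I * ennreal (y2 - y1))"
      using 1 by (rule mult_left_mono) simp
    also have "\<dots> = ?I * (ennreal (1 / (y2 - y1)) * ennreal (y2 - y1))" by (simp add: mult_ac)
    also have "ennreal (1 / (y2 - y1)) * ennreal (y2 - y1) = 1" using y by (simp flip: ennreal_mult')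
    finally show ?thesis by simp
  qed
  then have "(\<integral>\<^sup>+x\<in>{x1<..<x2}. ennreal (1 / (y2 - y1)) \<partial>lborel) \<le> (\<integral>\<^sup>+w\<in>polar_box p x1 x2 y1 y2. (h w)\<^sup>2 \<partial>lborel)"
    unfolding nn_integral_polar_box[OF borel_measurable_power_ennreal[OF h] y(2)]
    by (intro nn_integral_mono) (auto split: split_indicator)
  then show ?thesis using x y by (simp add: nn_integral_cmult_indicator flip: ennreal_mult')
qed

text \<open>In logarithmic polar coordinates the density (k / |w - p|)^2 times the Jacobian is the
  constant k^2, so the energy is at most k^2 times the area of a rectangle that contains the
  coordinates of \<open>X\<close>.\<close>

lemma polar_box_energy_le:
  assumes y: "y1 \<le> y2" and x: "x1 \<le> x2" and k: "0 \<le> k" and X: "X \<in> sets borel"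
    and sub: "X \<subseteq> polar_box p x1 x2 (-pi) pi"
    and ang: "\<And>x y. y \<in> {-pi<..<pi} \<Longrightarrow> p + of_real (exp x) * cis y \<in> X \<Longrightarrow> y \<in> {y1..y2}"
  shows "(\<integral>\<^sup>+w\<in>X. ennreal ((k / norm (w - p))\<^sup>2) \<partial>lborel) \<le> ennreal (k\<^sup>2 * ((x2 - x1) * (y2 - y1)))"
proof -
  define h where "h w = ennreal ((k / norm (w - p))\<^sup>2) * indicator X w" for w
  have h [measurable]: "h \<in> borel_measurable borel" unfolding h_def using X by measurable
  have "(\<integral>\<^sup>+w\<in>X. ennreal ((k / norm (w - p))\<^sup>2) \<partial>lborel) = (\<integral>\<^sup>+w\<in>polar_box p x1 x2 (-pi) pi. h w \<partial>lborel)"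
    using sub by (intro nn_integral_cong) (auto simp: h_def split: split_indicator)
  also have "\<dots> = (\<integral>\<^sup>+x\<in>{x1<..<x2}. (\<integral>\<^sup>+y\<in>{-pi<..<pi}. h (p + of_real (exp x) * cis y) * ennreal ((exp x)\<^sup>2) \<partial>lborel) \<partial>lborel)"
    by (rule nn_integral_polar_box[OF h]) simp
  also have "\<dots> \<le> (\<integral>\<^sup>+x\<in>{x1<..<x2}. ennreal (k\<^sup>2 * (y2 - y1)) \<partial>lborel)"
  proof (intro nn_integral_mono mult_right_mono)
    fix x
    have "(\<integral>\<^sup>+y\<in>{-pi<..<pi}. h (p + of_real (exp x) * cis y) * ennreal ((exp x)\<^sup>2) \<partial>lborel)
       \<le> (\<integral>\<^sup>+y. ennreal (k\<^sup>2) * indicator {y1..y2} y \<partial>lborel)"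
    proof (intro nn_integral_mono)
      fix y
      have "ennreal ((k / exp x)\<^sup>2) * ennreal ((exp x)\<^sup>2) = ennreal (k\<^sup>2)"
        by (simp flip: ennreal_mult' add: power_divide)
      then show "h (p + of_real (exp x) * cis y) * ennreal ((exp x)\<^sup>2) * indicator {-pi<..<pi} y \<le> ennreal (k\<^sup>2) * indicator {y1..y2} y"
        using ang[of y x] by (auto simp: h_def norm_mult split: split_indicator)
    qed
    also have "\<dots> = ennreal (k\<^sup>2 * (y2 - y1))"
      using y by (simp add: nn_integral_cmult_indicator flip: ennreal_mult')
    finally show "(\<integral>\<^sup>+y\<in>{-pi<..<pi}. h (p + of_real (exp x) * cis y) * ennreal ((exp x)\<^sup>2) \<partial>lborel) \<le> ennreal (k\<^sup>2 * (y2 - y1))" .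
  qed simp
  also have "\<dots> = ennreal (k\<^sup>2 * ((x2 - x1) * (y2 - y1)))"
    by (subst nn_integral_cmult_indicator, simp) (use x y in \<open>simp add: mult_ac flip: ennreal_mult'\<close>)
  finally show ?thesis .
qed

lemma mem_polar_box_pi:
  assumes "w - p \<notin> \<real>\<^sub>\<le>\<^sub>0" "exp x1 < norm (w - p)" "norm (w - p) < exp x2"
  shows "w \<in> polar_box p x1 x2 (-pi) pi"
proof -
  have nz: "w - p \<noteq> 0" using assms(1) by auto
  then have "w = p + exp (Ln (w - p))" by simp
  moreover have e: "exp (Re (Ln (w - p))) = norm (w - p)"
    using nz norm_exp_eq_Re[of "Ln (w - p)"] by simp
  moreover have "x1 < Re (Ln (w - p))" "Re (Ln (w - p)) < x2"
    using assms(2,3) unfolding e[symmetric] exp_less_cancel_iff .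
  moreover have "-pi < Im (Ln (w - p))" "Im (Ln (w - p)) < pi"
    using mpi_less_Im_Ln[OF nz] Im_Ln_le_pi[OF nz] Im_Ln_eq_pi[OF nz] assms(1)
    by (auto simp: complex_nonpos_Reals_iff less_le)
  ultimately show ?thesis unfolding polar_box_def
    by (intro image_eqI[of _ _ "Ln (w - p)"]) (auto simp: in_box_complex_iff)
qed

section \<open>Ends of a simply connected domain\<close>

locale disk_chart =
  fixes W :: "complex set" and \<phi> f :: "complex \<Rightarrow> complex"
  assumes hol_phi: "\<phi> holomorphic_on ball 0 1" and bij_phi: "bij_betw \<phi> (ball 0 1) W"
    and f_def: "f = disk_inv \<phi>"
begin

lemma inj_phi: "inj_on \<phi> (ball 0 1)" and phi_image: "\<phi> ` ball 0 1 = W"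
  using bij_phi by (auto simp: bij_betw_def)

lemma f_phi [simp]: "z \<in> ball 0 1 \<Longrightarrow> f (\<phi> z) = z"
  unfolding f_def disk_inv_def by (rule inv_into_f_f[OF inj_phi])

lemma phi_f [simp]: "w \<in> W \<Longrightarrow> \<phi> (f w) = w"
  unfolding f_def disk_inv_def using phi_image by (auto intro: f_inv_into_f)

lemma f_in_ball: "w \<in> W \<Longrightarrow> f w \<in> ball 0 1"
  unfolding f_def disk_inv_def using phi_image by (metis inv_into_into)

lemma phi_in_W: "z \<in> ball 0 1 \<Longrightarrow> \<phi> z \<in> W" using phi_image by auto

lemma norm_f_less: "w \<in> W \<Longrightarrow> norm (f w) < 1" using f_in_ball by auto

lemma inj_f: "inj_on f W" by (metis inj_on_def phi_f)

lemma open_W: "open W" using open_mapping_thm3[OF hol_phi _ inj_phi] phi_image by auto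

lemma hol_f: "f holomorphic_on W"
proof -
  obtain g where g: "g holomorphic_on (\<phi> ` ball 0 1)" "\<And>z. z \<in> ball 0 1 \<Longrightarrow> g (\<phi> z) = z"
    using holomorphic_has_inverse[OF hol_phi _ inj_phi] by (metis open_ball)
  have "g w = f w" if "w \<in> W" for w using g(2)[of "f w"] that f_in_ball by auto
  then show ?thesis using g(1) phi_image holomorphic_cong by (metis (no_types, lifting))
qed

lemma cont_f: "continuous_on W f" using hol_f holomorphic_on_imp_continuous_on by blast

lemma cont_phi: "continuous_on (ball 0 1) \<phi>" using hol_phi holomorphic_on_imp_continuous_on by blast

lemma open_f_image: "open U \<Longrightarrow> U \<subseteq> W \<Longrightarrow> open (f ` U)"
  by (rule open_mapping_thm3) (auto intro: holomorphic_on_subset[OF hol_f] inj_on_subset[OF inj_f])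

text \<open>The complement of a cap in the disk is convex, so it lies on one side of the crosscut.\<close>

lemma crosscut_cap:
  assumes U: "open U" "U \<subseteq> W" and V: "open V" "V \<subseteq> W" and "U \<inter> V = {}" and W: "W \<subseteq> U \<union> C \<union> V"
    and C: "\<And>w. w \<in> C \<Longrightarrow> c \<le> f w \<bullet> x" and w0: "w0 \<in> V" "f w0 \<bullet> x < c" and w: "w \<in> U"
  shows "c \<le> f w \<bullet> x"
proof (rule ccontr)
  assume nw: "\<not> c \<le> f w \<bullet> x"
  define D where "D = ball 0 1 \<inter> {z. x \<bullet> z < c}"
  have "convex D" unfolding D_def by (intro convex_Int convex_halfspace_lt) auto
  then have "connected D" by (rule convex_connected)
  moreover have "open (f ` U)" "open (f ` V)" using U V open_f_image by auto
  moreover have "D \<subseteq> f ` U \<union> f ` V"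
  proof
    fix z assume z: "z \<in> D"
    then have "\<phi> z \<in> W" using phi_in_W by (auto simp: D_def)
    moreover have "f (\<phi> z) = z" using z by (auto simp: D_def)
    ultimately show "z \<in> f ` U \<union> f ` V" using W C[of "\<phi> z"] z
      by (force simp: D_def inner_commute)
  qed
  moreover have "f ` U \<inter> f ` V \<inter> D = {}"
    using inj_f U V \<open>U \<inter> V = {}\<close> by (auto simp: inj_on_def) (metis disjoint_iff subsetD)
  moreover have "f w \<in> f ` U \<inter> D" "f w0 \<in> f ` V \<inter> D"
    using w w0 nw U V f_in_ball by (auto simp: D_def inner_commute)
  ultimately show False unfolding connected_def by blast
qed

text \<open>A small disc about a boundary point meets the unit disk in a convex set. If the image of
  the crosscut stays away from it, this connected set cannot contain image points of both
  sides.\<close>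

lemma crosscut_ball:
  assumes U: "open U" "U \<subseteq> W" and V: "open V" "V \<subseteq> W" and "U \<inter> V = {}" and W: "W \<subseteq> U \<union> C \<union> V"
    and r: "0 < r" and C: "\<And>w. w \<in> C \<Longrightarrow> r \<le> dist (f w) x" and xU: "x \<in> closure (f ` U)" and xV: "x \<in> closure (f ` V)"
  shows False
proof -
  define D where "D = ball 0 1 \<inter> ball x r"
  have "convex D" unfolding D_def by (intro convex_Int) auto
  then have "connected D" by (rule convex_connected)
  moreover have "open (f ` U)" "open (f ` V)" using U V open_f_image by auto
  moreover have "D \<subseteq> f ` U \<union> f ` V"
  proof
    fix z assume z: "z \<in> D"
    then have "\<phi> z \<in> W" using phi_in_W by (auto simp: D_def)
    moreover have "f (\<phi> z) = z" using z by (auto simp: D_def)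
    ultimately show "z \<in> f ` U \<union> f ` V" using W C[of "\<phi> z"] z
      by (force simp: D_def dist_commute)
  qed
  moreover have "f ` U \<inter> f ` V \<inter> D = {}"
    using inj_f U V \<open>U \<inter> V = {}\<close> by (auto simp: inj_on_def) (metis disjoint_iff subsetD)
  moreover have "\<exists>u\<in>f ` U. u \<in> D" "\<exists>u\<in>f ` V. u \<in> D"
    using xU[unfolded closure_approachable, rule_format, OF r] xV[unfolded closure_approachable, rule_format, OF r] U V f_in_ball
    by (force simp: D_def dist_commute)+
  ultimately show False unfolding connected_def by blast
qed

text \<open>The conformal map is a homeomorphism, so images in a compact part of the disk force
  accumulation inside \<open>W\<close>. In \<open>end_limit\<close> this shows that crosscuts come
  close to the unit circle.\<close>

lemma not_compactly_inside:
  fixes u :: "nat \<Rightarrow> complex"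
  assumes u: "\<And>k. u k \<in> W" and r: "r < 1" and bd: "\<And>k. norm (f (u k)) \<le> r"
  obtains w \<sigma> where "w \<in> W" "strict_mono \<sigma>" "(u \<circ> \<sigma>) \<longlonglongrightarrow> (w :: complex)"
proof -
  have "compact (cball (0::complex) r)" by simp
  moreover have "\<forall>k. (f \<circ> u) k \<in> cball 0 r" using bd by auto
  ultimately obtain y \<sigma> where y: "y \<in> cball 0 r" "strict_mono \<sigma>" "((f \<circ> u) \<circ> \<sigma>) \<longlonglongrightarrow> y"
    unfolding compact_eq_seq_compact_metric seq_compact_def by blast
  have yb: "y \<in> ball 0 1" using y r by auto
  have "(\<lambda>k. \<phi> (((f \<circ> u) \<circ> \<sigma>) k)) \<longlonglongrightarrow> \<phi> y"
    using cont_phi y(3) yb by (intro continuous_on_tendsto_compose[OF cont_phi]) (use u f_in_ball in \<open>auto intro!: always_eventually simp: comp_def\<close>)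
  then have "(u \<circ> \<sigma>) \<longlonglongrightarrow> \<phi> y" using u by (simp add: comp_def)
  then show thesis using that phi_in_W[OF yb] y(2) by blast
qed

text \<open>
  Length-area principle: the image of the end has finite area, so some vertical crosscuts of the
  end have short images, and these cut off small sets.
\<close>

lemma end_limit:
  assumes H: "H = {\<zeta>. Re \<zeta> < c0 \<and> t1 < Im \<zeta> \<and> Im \<zeta> < t2}" and t12: "t1 < t2"
    and hol: "\<psi> holomorphic_on H" and inj: "inj_on \<psi> H" and sub: "\<psi> ` H \<subseteq> W"
    and cl: "\<And>s. s < c0 \<Longrightarrow> closedin (top_of_set W) (\<psi> ` {\<zeta> \<in> H. Re \<zeta> \<le> s})"
  shows "\<exists>x. norm x = 1 \<and> (\<forall>e>0. \<exists>s<c0. \<forall>\<zeta>\<in>H. Re \<zeta> < s \<longrightarrow> dist (f (\<psi> \<zeta>)) x < e)"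
proof -
  have oH: "open H"
  proof -
    have "H = {\<zeta>. Re \<zeta> < c0} \<inter> {\<zeta>. t1 < Im \<zeta>} \<inter> {\<zeta>. Im \<zeta> < t2}" by (auto simp: H)
    then show ?thesis by (simp add: open_Int open_halfspace_Re_lt open_halfspace_Im_gt open_halfspace_Im_lt)
  qed
  define F where "F = f \<circ> \<psi>"
  have holF: "F holomorphic_on H" unfolding F_def
    by (rule holomorphic_on_compose_gen[OF hol hol_f sub])
  have injF: "inj_on F H" unfolding F_def
    by (rule comp_inj_on[OF inj inj_on_subset[OF inj_f sub]])
  have FH: "F ` H \<subseteq> ball 0 1" using sub f_in_ball by (auto simp: F_def)
  define g where "g \<zeta> = norm (deriv F \<zeta>)" for \<zeta>
  have contg: "continuous_on H g" unfolding g_def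
    using holomorphic_deriv[OF holF oH] by (intro continuous_intros holomorphic_on_imp_continuous_on)
  define h where "h s = (\<integral>\<^sup>+t\<in>{t1<..<t2}. ennreal ((g (Complex s t))\<^sup>2) \<partial>lborel)" for s
  \<comment> \<open>By injectivity the integral is the area of the image, which lies in the unit
    disk.\<close>
  have area: "(\<integral>\<^sup>+s\<in>{..<c0}. h s \<partial>lborel) < \<infinity>"
  proof -
    define G where "G \<zeta> = indicator H \<zeta> *\<^sub>R (g \<zeta>)\<^sup>2" for \<zeta>
    have G[measurable]: "G \<in> borel_measurable borel" unfolding G_def
      by (rule borel_measurable_continuous_on_indicator) (use oH contg in \<open>auto intro!: continuous_intros\<close>)
    have "(\<integral>\<^sup>+s\<in>{..<c0}. h s \<partial>lborel) = (\<integral>\<^sup>+s. \<integral>\<^sup>+t. ennreal (G (Complex s t)) \<partial>lborel \<partial>lborel)"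
    proof (intro nn_integral_cong)
      fix s show "h s * indicator {..<c0} s = (\<integral>\<^sup>+t. ennreal (G (Complex s t)) \<partial>lborel)"
        by (cases "s < c0") (auto simp: h_def G_def H intro!: nn_integral_cong split: split_indicator)
    qed
    also have "\<dots> = (\<integral>\<^sup>+\<zeta>. ennreal (G \<zeta>) \<partial>lborel)"
      by (rule nn_integral_complex_iterated[symmetric]) measurable
    also have "\<dots> = (\<integral>\<^sup>+\<zeta>\<in>H. 1 * ennreal ((norm (deriv F \<zeta>))\<^sup>2) \<partial>lborel)"
      by (intro nn_integral_cong) (auto simp: G_def g_def split: split_indicator)
    also have "\<dots> = (\<integral>\<^sup>+w\<in>F ` H. 1 \<partial>lborel)"
      by (rule nn_integral_holomorphic_image[OF oH holF injF, symmetric]) auto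
    also have "\<dots> \<le> (\<integral>\<^sup>+w\<in>ball (0::complex) 1. 1 \<partial>lborel)"
      using FH by (intro nn_integral_mono) (auto split: split_indicator)
    also have "\<dots> = emeasure lborel (ball (0::complex) 1)" by simp
    also have "\<dots> < \<infinity>" using emeasure_lborel_ball_finite by simp
    finally show ?thesis .
  qed
  \<comment> \<open>The half-line of abscissae has infinite measure, so a positive lower bound for
    \<open>h\<close> would contradict the finite area.\<close>
  have small: "\<exists>s<s1. h s < ennreal k" if s1: "s1 \<le> c0" and k: "0 < k" for s1 k
  proof (rule ccontr)
    assume "\<not> ?thesis"
    then have ge: "ennreal k \<le> h s" if "s < s1" for s using that by force
    have "(\<integral>\<^sup>+s. ennreal k * indicator {..<s1} s \<partial>lborel) \<le> (\<integral>\<^sup>+s\<in>{..<c0}. h s \<partial>lborel)"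
      using ge s1 by (intro nn_integral_mono) (auto split: split_indicator)
    moreover have "(\<integral>\<^sup>+s. ennreal k * indicator {..<s1} s \<partial>lborel) = ennreal k * emeasure lborel {..<s1}"
      by (rule nn_integral_cmult_indicator) auto
    moreover have "emeasure lborel {..<s1} = \<infinity>"
    proof -
      have "ennreal (real n) \<le> emeasure lborel {..<s1}" for n
        using emeasure_mono[of "{s1 - real n<..<s1}" "{..<s1}" lborel] by (auto simp: subset_iff)
      then show ?thesis by (metis ennreal_of_nat_eq_real_of_nat infinity_ennreal_def ennreal_Ex_less_of_nat less_top not_less)
    qed
    ultimately show False using area k by (simp add: ennreal_mult_top)
  qed
  \<comment> \<open>In place of Cauchy-Schwarz, the pointwise inequality q \<le> m/2 + q^2/(2m) is
    integrated. The value m = d / (t2 - t1) makes both terms contribute at most d/2.\<close>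
  have osc: "dist (F (Complex s t)) (F (Complex s t')) \<le> d"
    if s: "s < c0" and hs: "h s < ennreal (d\<^sup>2 / (t2 - t1))" and d: "0 < d" and tt: "t1 < t" "t \<le> t'" "t' < t2" for s t t' d
  proof -
    have inH: "Complex s u \<in> H" if "u \<in> {t..t'}" for u using that s tt by (auto simp: H)
    define q where "q u = g (Complex s u)" for u
    have contC: "continuous_on UNIV (\<lambda>u. Complex s u)" unfolding Complex_eq by (intro continuous_intros)
    have contq: "continuous_on {t..t'} q" unfolding q_def
      by (intro continuous_on_compose2[OF contg continuous_on_subset[OF contC]]) (use inH in auto)
    have iq: "q integrable_on {t..t'}" "(\<lambda>u. (q u)\<^sup>2) integrable_on {t..t'}"
      by (intro integrable_continuous_interval continuous_intros contq)+
    have "((\<lambda>u. F (Complex s u)) has_vector_derivative \<i> * deriv F (Complex s u)) (at u within {t..t'})" if "u \<in> {t..t'}" for u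
    proof -
      have "(F has_field_derivative deriv F (Complex s u)) (at (Complex s u))"
        using holomorphic_derivI[OF holF oH inH[OF that]] .
      moreover have "((\<lambda>u. Complex s u) has_vector_derivative \<i>) (at u within {t..t'})"
        unfolding Complex_eq by (auto intro!: derivative_eq_intros)
      ultimately show ?thesis
        using field_vector_diff_chain_within[of "\<lambda>u. Complex s u" \<i> u "{t..t'}" F "deriv F (Complex s u)"]
        by (simp add: comp_def has_field_derivative_at_within)
    qed
    then have ftc: "((\<lambda>u. \<i> * deriv F (Complex s u)) has_integral F (Complex s t') - F (Complex s t)) {t..t'}"
      using tt by (intro fundamental_theorem_of_calculus) auto
    have "norm (F (Complex s t') - F (Complex s t)) \<le> integral {t..t'} q"
      unfolding integral_unique[OF ftc, symmetric]
      by (rule integral_norm_bound_integral) (use ftc iq in \<open>auto simp: q_def g_def norm_mult has_integral_integrable\<close>)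
    also have "\<dots> \<le> integral {t..t'} (\<lambda>u. (d / (t2 - t1)) / 2 + (t2 - t1) / d / 2 * (q u)\<^sup>2)"
    proof (rule integral_le)
      fix u
      define m where "m = d / (t2 - t1)"
      have m: "0 < m" using d t12 by (simp add: m_def)
      have "0 \<le> (m - q u)\<^sup>2 / m" using m by simp
      also have "\<dots> = m - 2 * q u + (q u)\<^sup>2 / m" using m by (simp add: power2_eq_square field_simps)
      finally have "q u \<le> m / 2 + 1 / m / 2 * (q u)\<^sup>2" by simp
      then show "q u \<le> d / (t2 - t1) / 2 + (t2 - t1) / d / 2 * (q u)\<^sup>2" by (simp add: m_def)
    qed (intro iq integrable_continuous_interval continuous_intros contq; fail)+
    also have "\<dots> = (d / (t2 - t1)) / 2 * (t' - t) + (t2 - t1) / d / 2 * integral {t..t'} (\<lambda>u. (q u)\<^sup>2)"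
    proof -
      have "integral {t..t'} (\<lambda>u. m + c * (q u)\<^sup>2) = m * (t' - t) + c * integral {t..t'} (\<lambda>u. (q u)\<^sup>2)" for m c
        using iq tt by (subst integral_add) (auto intro!: integrable_on_mult_right)
      then show ?thesis .
    qed
    also have "integral {t..t'} (\<lambda>u. (q u)\<^sup>2) \<le> d\<^sup>2 / (t2 - t1)"
    proof -
      have i1: "((\<lambda>u. indicator {t..t'} u *\<^sub>R (q u)\<^sup>2) has_integral integral {t..t'} (\<lambda>u. (q u)\<^sup>2)) UNIV"
        using iq(2)[THEN integrable_integral] by (subst (asm) has_integral_restrict_UNIV[symmetric])
          (erule has_integral_eq[rotated], auto split: split_indicator)
      have m1: "(\<lambda>u. indicator {t..t'} u *\<^sub>R (q u)\<^sup>2) \<in> borel_measurable borel"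
        by (rule borel_measurable_continuous_on_indicator) (use contq in \<open>auto intro!: continuous_intros\<close>)
      have "ennreal (integral {t..t'} (\<lambda>u. (q u)\<^sup>2)) = (\<integral>\<^sup>+u. ennreal (indicator {t..t'} u *\<^sub>R (q u)\<^sup>2) \<partial>lborel)"
        using nn_integral_has_integral_lborel[OF m1 _ i1] by auto
      also have "\<dots> \<le> h s" unfolding h_def
        using tt by (intro nn_integral_mono) (auto simp: q_def split: split_indicator)
      also have "\<dots> \<le> ennreal (d\<^sup>2 / (t2 - t1))" using hs by simp
      finally show ?thesis using d t12 by (simp add: ennreal_le_iff)
    qed
    then have "d / (t2 - t1) / 2 * (t' - t) + (t2 - t1) / d / 2 * integral {t..t'} (\<lambda>u. (q u)\<^sup>2)
        \<le> d / (t2 - t1) / 2 * (t2 - t1) + (t2 - t1) / d / 2 * (d\<^sup>2 / (t2 - t1))"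
      using d t12 tt by (intro add_mono mult_left_mono) auto
    also have "\<dots> = d"
    proof -
      have eq: "d / T / 2 * T + T / d / 2 * (d\<^sup>2 / T) = d" if "0 < T" for T
        using d that by (simp add: power2_eq_square field_simps)
      show ?thesis by (rule eq) (use t12 in simp)
    qed
    finally show ?thesis by (simp add: dist_norm norm_minus_commute)
  qed
  \<comment> \<open>Otherwise points moving up the crosscut towards the height \<open>t2\<close>
    would accumulate in \<open>W\<close>. Since the end is closed in \<open>W\<close>, their limit
    would come from a point of \<open>H\<close>, although the height \<open>t2\<close> is not
    attained there.\<close>
  have near_circle: "\<exists>t\<in>{t1<..<t2}. r < norm (F (Complex s t))" if s: "s < c0" and r: "r < 1" for s r
  proof (rule ccontr)
    assume "\<not> ?thesis"
    then have le: "norm (F (Complex s t)) \<le> r" if "t1 < t" "t < t2" for t using that by force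
    define \<tau> where "\<tau> k = t2 - (t2 - t1) / 2 * inverse (real (Suc k))" for k
    have \<tau>: "t1 < \<tau> k" "\<tau> k < t2" for k
    proof -
      have "0 < inverse (real (Suc k))" "inverse (real (Suc k)) \<le> 1" by (auto simp: field_simps)
      then have "0 < (t2 - t1) / 2 * inverse (real (Suc k))" "(t2 - t1) / 2 * inverse (real (Suc k)) \<le> (t2 - t1) / 2 * 1"
        using t12 by (auto intro!: mult_left_mono simp del: of_nat_Suc)
      then show "t1 < \<tau> k" "\<tau> k < t2" 
      proof -
        have "t1 < t2 - X \<and> t2 - X < t2" if "0 < X" "X \<le> (t2 - t1) / 2 * 1" for X using that t12 by auto
        then show "t1 < \<tau> k" "\<tau> k < t2"
          unfolding \<tau>_def using \<open>0 < (t2 - t1) / 2 * inverse (real (Suc k))\<close>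
            \<open>(t2 - t1) / 2 * inverse (real (Suc k)) \<le> (t2 - t1) / 2 * 1\<close> by blast+
      qed
    qed
    have "\<tau> \<longlonglongrightarrow> t2 - (t2 - t1) / 2 * 0" unfolding \<tau>_def
      by (intro tendsto_intros LIMSEQ_inverse_real_of_nat)
    then have \<tau>lim: "\<tau> \<longlonglongrightarrow> t2" by simp
    define \<zeta> where "\<zeta> k = Complex s (\<tau> k)" for k
    have \<zeta>H: "\<zeta> k \<in> H" for k using \<tau> s by (auto simp: H \<zeta>_def)
    obtain w \<sigma> where w: "w \<in> W" "strict_mono \<sigma>" "((\<lambda>k. \<psi> (\<zeta> k)) \<circ> \<sigma>) \<longlonglongrightarrow> w"
    proof (rule not_compactly_inside[of "\<lambda>k. \<psi> (\<zeta> k)" r])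
      show "\<psi> (\<zeta> k) \<in> W" for k using \<zeta>H sub by auto
      show "norm (f (\<psi> (\<zeta> k))) \<le> r" for k using le[OF \<tau>] by (simp add: F_def \<zeta>_def)
    qed (use r in auto)
    have "w \<in> \<psi> ` {\<zeta> \<in> H. Re \<zeta> \<le> s}"
    proof -
      have "closedin (top_of_set W) (\<psi> ` {\<zeta> \<in> H. Re \<zeta> \<le> s})" by (rule cl[OF s])
      then obtain T where T: "closed T" "\<psi> ` {\<zeta> \<in> H. Re \<zeta> \<le> s} = W \<inter> T" by (auto simp: closedin_closed)
      have "((\<lambda>k. \<psi> (\<zeta> k)) \<circ> \<sigma>) k \<in> T" for k
      proof -
        have "\<psi> (\<zeta> (\<sigma> k)) \<in> \<psi> ` {\<zeta> \<in> H. Re \<zeta> \<le> s}" using \<zeta>H by (auto simp: \<zeta>_def)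
        then show ?thesis using T by auto
      qed
      then have "w \<in> T" using closed_sequentially[OF T(1) _ w(3)] by blast
      then show ?thesis using T w by auto
    qed
    then obtain \<zeta>0 where \<zeta>0: "\<zeta>0 \<in> H" "w = \<psi> \<zeta>0" by auto
    obtain \<psi>' where \<psi>': "\<psi>' holomorphic_on (\<psi> ` H)" "\<And>z. z \<in> H \<Longrightarrow> \<psi>' (\<psi> z) = z"
      using holomorphic_has_inverse[OF hol oH inj] by metis
    have "(\<lambda>k. \<psi>' (((\<lambda>k. \<psi> (\<zeta> k)) \<circ> \<sigma>) k)) \<longlonglongrightarrow> \<psi>' w"
      by (rule continuous_on_tendsto_compose[OF holomorphic_on_imp_continuous_on[OF \<psi>'(1)] w(3)])
         (use \<zeta>H \<zeta>0 in auto)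
    then have "(\<lambda>k. \<zeta> (\<sigma> k)) \<longlonglongrightarrow> \<zeta>0" using \<psi>'(2) \<zeta>H \<zeta>0 by simp
    then have "(\<lambda>k. Im (\<zeta> (\<sigma> k))) \<longlonglongrightarrow> Im \<zeta>0" by (rule tendsto_Im)
    moreover have "(\<lambda>k. Im (\<zeta> (\<sigma> k))) \<longlonglongrightarrow> t2"
      using LIMSEQ_subseq_LIMSEQ[OF \<tau>lim w(2)] by (simp add: \<zeta>_def comp_def)
    ultimately have "Im \<zeta>0 = t2" using LIMSEQ_unique by blast
    then show False using \<zeta>0 by (auto simp: H)
  qed
  have cap: "\<exists>s<c0. \<exists>x. norm x = 1 \<and> (\<forall>\<zeta>\<in>H. Re \<zeta> < s \<longrightarrow> dist (F \<zeta>) x < e)" if e: "0 < e" for e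
  proof -
    \<comment> \<open>The crosscut will lie in the cap at level 1 - 2d. The bound 1/4 keeps the
      origin, the image of \<open>w0\<close>, outside this cap, and the bound e^2/8 makes the cap
      small, since its points have squared distance at most 4d from \<open>x\<close>.\<close>
    define d where "d = min (1/4) (e\<^sup>2 / 8)"
    have d: "0 < d" "d \<le> 1/4" "d \<le> e\<^sup>2 / 8" using e by (auto simp: d_def)
    define w0 where "w0 = \<phi> 0"
    have w0: "w0 \<in> W" "f w0 = 0" using phi_in_W by (auto simp: w0_def)
    \<comment> \<open>Beyond \<open>s1\<close> the end does not contain the base point, which
      therefore lies on the other side of the crosscut.\<close>
    obtain s1 where s1: "s1 \<le> c0" "\<And>\<zeta>. \<zeta> \<in> H \<Longrightarrow> Re \<zeta> < s1 \<Longrightarrow> \<psi> \<zeta> \<noteq> w0"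
    proof (cases "\<exists>\<zeta>0\<in>H. \<psi> \<zeta>0 = w0")
      case True
      then obtain \<zeta>0 where z0: "\<zeta>0 \<in> H" "\<psi> \<zeta>0 = w0" by auto
      show thesis
      proof (rule that[of "Re \<zeta>0"])
        show "\<psi> \<zeta> \<noteq> w0" if "\<zeta> \<in> H" "Re \<zeta> < Re \<zeta>0" for \<zeta>
          using inj_onD[OF inj, of \<zeta> \<zeta>0] that z0 by auto
      qed (use z0 in \<open>simp add: H\<close>)
    qed (use that[of c0] in auto)
    obtain s where s: "s < s1" "h s < ennreal (d\<^sup>2 / (t2 - t1))"
      using small[OF s1(1), of "d\<^sup>2 / (t2 - t1)"] d t12 by auto
    have sc: "s < c0" using s s1 by auto
    obtain t where t: "t \<in> {t1<..<t2}" "1 - d < norm (F (Complex s t))"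
      using near_circle[OF sc, of "1 - d"] d by auto
    define y where "y = F (Complex s t)"
    define x where "x = y / of_real (norm y)"
    have ny: "1 - d < norm y" "y \<noteq> 0" using t d by (auto simp: y_def)
    have nx: "norm x = 1" using ny by (simp add: x_def norm_divide)
    have yx: "y \<bullet> x = norm y"
    proof -
      have "x = (1 / norm y) *\<^sub>R y" by (simp add: x_def scaleR_conv_of_real)
      then show ?thesis using ny by (simp add: dot_square_norm power2_eq_square)
    qed
    have C: "1 - 2 * d \<le> F (Complex s t') \<bullet> x" if t': "t1 < t'" "t' < t2" for t'
    proof -
      have "dist (F (Complex s t')) y \<le> d"
        using osc[OF sc s(2) d(1), of t t'] osc[OF sc s(2) d(1), of t' t] t t'
        by (cases "t \<le> t'") (auto simp: y_def dist_commute)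
      moreover have "(y - F (Complex s t')) \<bullet> x \<le> norm (y - F (Complex s t')) * norm x"
        by (rule norm_cauchy_schwarz)
      ultimately show ?thesis using yx ny nx by (simp add: inner_diff_left dist_norm norm_minus_commute)
    qed
    have U: "1 - 2 * d \<le> f w \<bullet> x" if w: "w \<in> \<psi> ` {\<zeta> \<in> H. Re \<zeta> < s}" for w
    proof (rule crosscut_cap[where U = "\<psi> ` {\<zeta> \<in> H. Re \<zeta> < s}" and V = "W - \<psi> ` {\<zeta> \<in> H. Re \<zeta> \<le> s}"
          and C = "\<psi> ` {\<zeta> \<in> H. Re \<zeta> = s}", OF _ _ _ _ _ _ _ _ _ w])
      have "open {\<zeta> \<in> H. Re \<zeta> < s}"
        using open_Int[OF oH open_halfspace_Re_lt[of s]] by (simp add: Int_def)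
      then show "open (\<psi> ` {\<zeta> \<in> H. Re \<zeta> < s})"
        by (rule open_mapping_thm3[rotated]) (auto intro: holomorphic_on_subset[OF hol] inj_on_subset[OF inj])
      show "open (W - \<psi> ` {\<zeta> \<in> H. Re \<zeta> \<le> s})"
      proof -
        obtain T where "closed T" "\<psi> ` {\<zeta> \<in> H. Re \<zeta> \<le> s} = W \<inter> T"
          using cl[OF sc] by (auto simp: closedin_closed)
        then have "W - \<psi> ` {\<zeta> \<in> H. Re \<zeta> \<le> s} = W - T" by auto
        then show ?thesis using open_W \<open>closed T\<close> by (simp add: open_Diff)
      qed
      show "W \<subseteq> \<psi> ` {\<zeta> \<in> H. Re \<zeta> < s} \<union> \<psi> ` {\<zeta> \<in> H. Re \<zeta> = s} \<union> (W - \<psi> ` {\<zeta> \<in> H. Re \<zeta> \<le> s})"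
        by force
      show "1 - 2 * d \<le> f w \<bullet> x" if w: "w \<in> \<psi> ` {\<zeta> \<in> H. Re \<zeta> = s}" for w
      proof -
        obtain \<zeta> where z: "\<zeta> \<in> H" "Re \<zeta> = s" "w = \<psi> \<zeta>" using w by blast
        then have "\<zeta> = Complex s (Im \<zeta>)" by (simp add: complex_eq_iff)
        then show ?thesis using C[of "Im \<zeta>"] z by (simp add: F_def H)
      qed
      show "w0 \<in> W - \<psi> ` {\<zeta> \<in> H. Re \<zeta> \<le> s}" using w0 s1 s by force
      show "f w0 \<bullet> x < 1 - 2 * d" using w0 d by simp
    qed (use sub in auto)
    have "dist (F \<zeta>) x < e" if \<zeta>: "\<zeta> \<in> H" "Re \<zeta> < s" for \<zeta>
    proof -
      have "1 - 2 * d \<le> F \<zeta> \<bullet> x" using U[of "\<psi> \<zeta>"] \<zeta> by (auto simp: F_def)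
      moreover have "norm (F \<zeta>) < 1" using FH \<zeta> by auto
      then have "(norm (F \<zeta>))\<^sup>2 \<le> 1" by (simp add: power_le_one)
      moreover have "(dist (F \<zeta>) x)\<^sup>2 = (norm (F \<zeta>))\<^sup>2 + (norm x)\<^sup>2 - 2 * (F \<zeta> \<bullet> x)"
        by (simp add: dist_norm power2_norm_eq_inner inner_diff_left inner_diff_right inner_commute)
      ultimately have "(dist (F \<zeta>) x)\<^sup>2 \<le> 4 * d" using nx by simp
      also have "\<dots> < e\<^sup>2" using d e by (simp add: field_simps)
      finally show ?thesis using e by (simp add: power_less_imp_less_base)
    qed
    then show ?thesis using sc nx by blast
  qed
  \<comment> \<open>The caps for different \<open>e\<close> come with different centres. The images
    along the middle line of the strip form a Cauchy sequence, and its limit replaces all these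
    centres.\<close>
  define tm where "tm = (t1 + t2) / 2"
  define \<zeta> where "\<zeta> n = Complex (c0 - 1 - real n) tm" for n
  have \<zeta>H: "\<zeta> n \<in> H" for n using t12 by (auto simp: \<zeta>_def H tm_def field_simps)
  have ev: "\<exists>N. \<forall>n\<ge>N. Re (\<zeta> n) < s" for s
  proof -
    obtain N where "c0 - 1 - s < real N" using reals_Archimedean2 by blast
    then show ?thesis by (intro exI[of _ N]) (auto simp: \<zeta>_def)
  qed
  have "Cauchy (\<lambda>n. F (\<zeta> n))"
  proof (rule metric_CauchyI)
    fix e :: real assume "0 < e"
    then obtain s x where s: "s < c0" "\<And>\<zeta>. \<zeta> \<in> H \<Longrightarrow> Re \<zeta> < s \<Longrightarrow> dist (F \<zeta>) x < e / 2"
      using cap[of "e/2"] by auto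
    obtain N where N: "\<forall>n\<ge>N. Re (\<zeta> n) < s" using ev by blast
    show "\<exists>M. \<forall>m\<ge>M. \<forall>n\<ge>M. dist (F (\<zeta> m)) (F (\<zeta> n)) < e"
      using s(2)[OF \<zeta>H] N by (intro exI[of _ N]) (metis dist_triangle_half_r dist_commute)
  qed
  then obtain x where x: "(\<lambda>n. F (\<zeta> n)) \<longlonglongrightarrow> x" using Cauchy_convergent convergent_def by blast
  have lim: "\<exists>s<c0. (\<forall>\<zeta>\<in>H. Re \<zeta> < s \<longrightarrow> dist (F \<zeta>) x < e) \<and> \<bar>norm x - 1\<bar> < e" if "0 < e" for e
  proof -
    obtain s y where s: "s < c0" "norm y = 1" "\<And>\<zeta>. \<zeta> \<in> H \<Longrightarrow> Re \<zeta> < s \<Longrightarrow> dist (F \<zeta>) y < e / 3"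
      using cap[of "e/3"] \<open>0 < e\<close> by auto
    obtain N where N: "\<forall>n\<ge>N. Re (\<zeta> n) < s" using ev by blast
    have "dist x y \<le> e / 3"
    proof (rule tendsto_upperbound[OF tendsto_dist[OF x tendsto_const]])
      show "\<forall>\<^sub>F n in sequentially. dist (F (\<zeta> n)) y \<le> e / 3"
        using s(3)[OF \<zeta>H] N by (intro eventually_sequentiallyI[of N]) (auto intro: less_imp_le)
    qed simp
    then have "dist (F \<zeta>) x < e" if "\<zeta> \<in> H" "Re \<zeta> < s" for \<zeta>
      using s(3)[OF that] dist_triangle2[of "F \<zeta>" x y] \<open>0 < e\<close> by linarith
    moreover have "\<bar>norm x - 1\<bar> < e"
      using \<open>dist x y \<le> e / 3\<close> norm_triangle_ineq3[of x y] s(2) \<open>0 < e\<close> by (simp add: dist_norm)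
    ultimately show ?thesis using s(1) by blast
  qed
  have "norm x = 1"
  proof (rule ccontr)
    assume "norm x \<noteq> 1"
    then show False using lim[of "\<bar>norm x - 1\<bar>"] by auto
  qed
  then show ?thesis using lim unfolding F_def by (intro exI[of _ x]) (metis comp_apply)
qed

section \<open>Boundary values on the comb domain\<close>

text \<open>In the coordinate log((w - p) / c) the sector becomes a horizontal half-strip, to which
  \<open>end_limit\<close> applies. The unimodular factor \<open>c\<close> turns the sector so that
  its angles fit into the range of the principal argument.\<close>

lemma sector_limit:
  assumes r0: "0 < r0" and c: "norm c = 1" and t: "-pi \<le> t1" "t1 < t2" "t2 \<le> pi"
    and W: "\<And>w. dist w p < r0 \<Longrightarrow> w \<in> W \<longleftrightarrow> w \<noteq> p \<and> t1 < Arg ((w - p) / c) \<and> Arg ((w - p) / c) < t2"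
  shows "p islimpt W" and "\<exists>x. norm x = 1 \<and> (f \<longlongrightarrow> x) (at p within W)"
proof -
  define H where "H = {\<zeta>. Re \<zeta> < ln r0 \<and> t1 < Im \<zeta> \<and> Im \<zeta> < t2}"
  define \<psi> where "\<psi> \<zeta> = p + c * exp \<zeta>" for \<zeta>
  have c0: "c \<noteq> 0" using c by auto
  have q: "(\<psi> \<zeta> - p) / c = exp \<zeta>" for \<zeta> using c0 by (simp add: \<psi>_def)
  have n: "norm (\<psi> \<zeta> - p) = exp (Re \<zeta>)" for \<zeta> using c by (simp add: \<psi>_def norm_mult)
  have d: "dist (\<psi> \<zeta>) p = exp (Re \<zeta>)" for \<zeta> using n by (simp add: dist_norm)
  have A: "Arg (exp \<zeta>) = Im \<zeta>" if "\<zeta> \<in> H" for \<zeta> using that t by (intro Arg_exp) (auto simp: H_def)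
  have r: "exp (Re \<zeta>) < r0" if "\<zeta> \<in> H" for \<zeta>
    using that r0 by (metis (mono_tags, lifting) H_def exp_less_cancel_iff exp_ln mem_Collect_eq)
  have sub: "\<psi> ` H \<subseteq> W"
  proof (rule image_subsetI)
    fix \<zeta> assume z: "\<zeta> \<in> H"
    have "\<psi> \<zeta> \<noteq> p" using n[of \<zeta>] by auto
    then show "\<psi> \<zeta> \<in> W" using W[of "\<psi> \<zeta>"] z r[OF z] A[OF z] by (simp add: d q) (simp add: H_def)
  qed
  have sup: "\<exists>\<zeta>\<in>H. w = \<psi> \<zeta> \<and> exp (Re \<zeta>) = dist w p" if w: "w \<in> W" "dist w p < r0" for w
  proof -
    have nz: "(w - p) / c \<noteq> 0" using W[OF w(2)] w(1) c0 by auto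
    define \<zeta> where "\<zeta> = Ln ((w - p) / c)"
    have e: "exp \<zeta> = (w - p) / c" using nz by (simp add: \<zeta>_def)
    have w': "w = \<psi> \<zeta>" using c0 by (simp add: \<psi>_def e)
    have "Im \<zeta> = Arg ((w - p) / c)" using nz by (simp add: \<zeta>_def Arg_eq_Im_Ln)
    moreover have "Re \<zeta> < ln r0" using w(2) d[of \<zeta>] w' r0 by (metis exp_less_cancel_iff exp_ln)
    ultimately have "\<zeta> \<in> H" using W[OF w(2)] w(1) by (auto simp: H_def)
    then show ?thesis using w' d by metis
  qed
  have "\<exists>x. norm x = 1 \<and> (\<forall>e>0. \<exists>s<ln r0. \<forall>\<zeta>\<in>H. Re \<zeta> < s \<longrightarrow> dist (f (\<psi> \<zeta>)) x < e)"
  proof (rule end_limit[OF H_def t(2) _ _ sub])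
    show "\<psi> holomorphic_on H" unfolding \<psi>_def by (intro holomorphic_intros)
    show "inj_on \<psi> H"
    proof (rule inj_onI)
      fix x y assume xy: "x \<in> H" "y \<in> H" "\<psi> x = \<psi> y"
      have "exp x = exp y" by (metis q xy(3))
      moreover have "\<bar>Im x - Im y\<bar> < 2 * pi"
      proof -
        have "t1 < Im x" "Im x < t2" "t1 < Im y" "Im y < t2" using xy by (auto simp: H_def)
        then show ?thesis using t by linarith
      qed
      ultimately show "x = y" by (rule exp_complex_eqI[rotated])
    qed
    fix s assume s: "s < ln r0"
    then have es: "exp s < r0" using r0 by (metis exp_less_cancel_iff exp_ln)
    have "\<psi> ` {\<zeta> \<in> H. Re \<zeta> \<le> s} = W \<inter> cball p (exp s)"
    proof (intro equalityI subsetI)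
      fix w assume "w \<in> \<psi> ` {\<zeta> \<in> H. Re \<zeta> \<le> s}"
      then show "w \<in> W \<inter> cball p (exp s)" using sub d by (force simp: dist_commute)
    next
      fix w assume "w \<in> W \<inter> cball p (exp s)"
      then have "w \<in> W" "dist w p \<le> exp s" by (auto simp: dist_commute)
      then obtain \<zeta> where "\<zeta> \<in> H" "w = \<psi> \<zeta>" "exp (Re \<zeta>) \<le> exp s"
        using sup[of w] es by (metis order_le_less_trans)
      then show "w \<in> \<psi> ` {\<zeta> \<in> H. Re \<zeta> \<le> s}" by auto
    qed
    then show "closedin (top_of_set W) (\<psi> ` {\<zeta> \<in> H. Re \<zeta> \<le> s})" by (auto simp: closedin_closed)
  qed
  then obtain x where x: "norm x = 1" "\<And>e. e > 0 \<Longrightarrow> \<exists>s<ln r0. \<forall>\<zeta>\<in>H. Re \<zeta> < s \<longrightarrow> dist (f (\<psi> \<zeta>)) x < e" by blast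
  have "(f \<longlongrightarrow> x) (at p within W)"
  proof (rule tendstoI)
    fix e :: real assume "e > 0"
    then obtain s where s: "s < ln r0" "\<And>\<zeta>. \<zeta> \<in> H \<Longrightarrow> Re \<zeta> < s \<Longrightarrow> dist (f (\<psi> \<zeta>)) x < e" using x(2) by blast
    then have es: "exp s < r0" using r0 by (metis exp_less_cancel_iff exp_ln)
    have "dist (f w) x < e" if w: "w \<in> W" "dist w p < exp s" for w
    proof -
      obtain \<zeta> where "\<zeta> \<in> H" "w = \<psi> \<zeta>" "exp (Re \<zeta>) < exp s"
        using sup[of w] es w by (metis order_less_trans)
      then show ?thesis using s(2) by auto
    qed
    then show "\<forall>\<^sub>F w in at p within W. dist (f w) x < e"
      unfolding eventually_at by (intro exI[of _ "exp s"]) auto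
  qed
  then show "\<exists>x. norm x = 1 \<and> (f \<longlongrightarrow> x) (at p within W)" using x(1) by blast
  show "p islimpt W" unfolding islimpt_approachable
  proof (intro allI impI)
    fix e :: real assume e: "0 < e"
    define \<zeta> where "\<zeta> = Complex (ln (min e r0 / 2)) ((t1 + t2) / 2)"
    have m: "0 < min e r0 / 2" "min e r0 / 2 < r0" "min e r0 / 2 < e" using e r0 by auto
    then have "\<zeta> \<in> H" using t r0 unfolding \<zeta>_def H_def by (simp add: ln_less_cancel_iff del: min_less_iff_conj)
    then have "\<psi> \<zeta> \<in> W" using sub by auto
    moreover have "dist (\<psi> \<zeta>) p = min e r0 / 2" using m by (simp add: d \<zeta>_def)
    ultimately show "\<exists>x'\<in>W. x' \<noteq> p \<and> dist x' p < e" using m by (intro bexI[of _ "\<psi> \<zeta>"]) auto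
  qed
qed

text \<open>Boundary values that exist as limits from inside are continuous among themselves: an
  estimate on the part of \<open>W\<close> near \<open>p\<close> passes to a nearby boundary point
  by taking the limit there.\<close>

lemma continuous_on_boundary_extension:
  assumes X: "\<And>p. p \<in> X \<Longrightarrow> (f \<longlongrightarrow> g p) (at p within W)" "\<And>p. p \<in> X \<Longrightarrow> p \<notin> W \<Longrightarrow> p islimpt W"
    and g: "\<And>w. w \<in> W \<Longrightarrow> g w = f w"
  shows "continuous_on X g"
  unfolding continuous_on_iff
proof (intro ballI allI impI)
  fix p and e :: real assume p: "p \<in> X" and e: "0 < e"
  obtain d where d: "d > 0" "\<And>w. w \<in> W \<Longrightarrow> w \<noteq> p \<Longrightarrow> dist w p < d \<Longrightarrow> dist (f w) (g p) < e / 2"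
    using tendstoD[OF X(1)[OF p], of "e/2"] e unfolding eventually_at by auto
  have "dist (g q) (g p) < e" if q: "q \<in> X" "dist q p < d" for q
  proof (cases "q = p")
    case False
    show ?thesis
    proof (cases "q \<in> W")
      case True
      then show ?thesis using d(2)[of q] False q g e by simp
    next
      case nW: False
      have nt: "at q within W \<noteq> bot" using X(2)[OF q(1) nW] by (simp add: trivial_limit_within)
      have "dist (g q) (g p) \<le> e / 2"
      proof (rule tendsto_upperbound[OF tendsto_dist[OF X(1)[OF q(1)] tendsto_const] _ nt])
        have "\<forall>\<^sub>F w in at q within W. w \<in> ball p d \<inter> (- {p})"
          using q False by (intro topological_tendstoD[OF tendsto_ident_at]) (auto simp: dist_commute)
        then show "\<forall>\<^sub>F w in at q within W. dist (f w) (g p) \<le> e / 2"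
          unfolding eventually_at_filter
          by eventually_elim (use d(2) in \<open>force simp: dist_commute intro: less_imp_le\<close>)
      qed
      then show ?thesis using e by simp
    qed
  qed (use e in auto)
  then show "\<exists>d>0. \<forall>x'\<in>X. dist x' p < d \<longrightarrow> dist (g x') (g p) < e" using d(1) by blast
qed

end

lemma Arg_less_half_pi_iff: "z \<noteq> 0 \<Longrightarrow> Arg z < pi / 2 \<longleftrightarrow> 0 < Re z \<or> Im z < 0"
proof (cases "Im z < 0")
  case True
  then have "Arg z < 0" using Arg_less_0[of z] by linarith
  then have "Arg z < pi / 2" using pi_gt_zero by linarith
  then show ?thesis using True by simp
next
  case False
  then have "0 \<le> Arg z" using Arg_less_0[of z] by linarith
  moreover assume "z \<noteq> 0"
  ultimately show ?thesis using Arg_Re_pos[of z] False pi_gt_zero by auto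
qed

lemma Arg_abs_half_pi_iff: "z \<noteq> 0 \<Longrightarrow> - (pi / 2) < Arg z \<and> Arg z < pi / 2 \<longleftrightarrow> 0 < Re z"
  using Arg_Re_pos[of z] by (auto simp: abs_less_iff)

lemma Arg_neg_iff: "Arg z < 0 \<longleftrightarrow> Im z < 0"
  using Arg_less_0[of z] by auto

locale comb_domain =
  fixes a b :: "nat \<Rightarrow> real" and \<phi> :: "complex \<Rightarrow> complex"
  assumes a_pos: "\<And>n. 0 < a n" and b_zero: "b 0 = 1"
    and b_Suc_less: "\<And>n. b (Suc n) < a n" and a_less_b: "\<And>n. a n < b n"
    and b_lim: "b \<longlonglongrightarrow> 0"
    and conf: "normalized_conformal_map (W_dom a b) \<phi>"
begin

abbreviation "W \<equiv> W_dom a b"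
abbreviation "f \<equiv> disk_inv \<phi>"

sublocale disk_chart W \<phi> f
  by standard (use conf in \<open>auto simp: normalized_conformal_map_def\<close>)

lemma b_pos: "0 < b n" using a_pos[of n] a_less_b[of n] by linarith

lemma b_less_a: "m < n \<Longrightarrow> b n < a m"
proof (induction n)
  case (Suc n)
  show ?case
  proof (cases "m = n")
    case False
    then have "b n < a m" using Suc by auto
    then show ?thesis using b_Suc_less[of n] a_less_b[of n] by linarith
  qed (use b_Suc_less in auto)
qed auto

lemma b_decreasing: "m \<le> n \<Longrightarrow> b n \<le> b m" and a_decreasing: "m \<le> n \<Longrightarrow> a n \<le> a m"
  using b_less_a[of m n] a_less_b[of m] a_less_b[of n] by (cases "m = n"; force)+

lemma b_le_1: "b n \<le> 1" using b_decreasing[of 0 n] b_zero by simp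

lemma tooth_unique: "a m < x \<Longrightarrow> x < b m \<Longrightarrow> a n < x \<Longrightarrow> x < b n \<Longrightarrow> m = n"
  using b_less_a[of m n] b_less_a[of n m] by (cases m n rule: linorder_cases) auto

lemma tooth_cases:
  assumes "0 < x"
  obtains "b 0 \<le> x" | n where "b (Suc n) \<le> x" "x \<le> a n" | n where "a n < x" "x < b n"
proof -
  have ex: "\<exists>n. b n \<le> x"
    using order_tendstoD(2)[OF b_lim assms] by (auto simp: eventually_sequentially intro: less_imp_le)
  define n where "n = (LEAST n. b n \<le> x)"
  have n: "b n \<le> x" unfolding n_def by (rule LeastI_ex[OF ex])
  show thesis
  proof (cases n)
    case (Suc m)
    then have "\<not> b m \<le> x" unfolding n_def by (metis Suc_n_not_le_n Least_le)
    then show thesis using that(2)[of m] that(3)[of m] n Suc by force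
  qed (use n that in auto)
qed

lemma mem_W: "w \<in> W \<longleftrightarrow> (0 < Re w \<and> Im w < 0) \<or> (\<exists>n. a n < Re w \<and> Re w < b n)"
  by (auto simp: W_dom_def)

lemma Re_pos_W: "w \<in> W \<Longrightarrow> 0 < Re w"
  using a_pos by (auto simp: mem_W intro: less_trans)

lemma W_gap: "b (Suc n) \<le> Re w \<Longrightarrow> Re w \<le> a n \<Longrightarrow> w \<in> W \<longleftrightarrow> Im w < 0"
proof -
  assume *: "b (Suc n) \<le> Re w" "Re w \<le> a n"
  have "\<not> (a m < Re w \<and> Re w < b m)" for m
    using b_less_a[of n m] * b_decreasing[of "Suc n" m] a_decreasing[of m n] by (cases "n < m") auto
  then show ?thesis using * b_pos[of "Suc n"] by (auto simp: mem_W)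
qed

lemma W_gap0: "b 0 \<le> Re w \<Longrightarrow> w \<in> W \<longleftrightarrow> Im w < 0"
proof -
  assume *: "b 0 \<le> Re w"
  have "\<not> (a m < Re w \<and> Re w < b m)" for m using b_decreasing[of 0 m] * by auto
  then show ?thesis using b_pos[of 0] * by (auto simp: mem_W)
qed

lemma W_tooth: "a n < Re w \<Longrightarrow> Re w < b n \<Longrightarrow> w \<in> W" by (auto simp: mem_W)

lemma W_upper: "w \<in> W \<Longrightarrow> 0 \<le> Im w \<Longrightarrow> \<exists>n. a n < Re w \<and> Re w < b n" by (auto simp: mem_W)

text \<open>The boundary points near which \<open>W\<close> is a sector: a half-plane on the left
  side, on the floor and on the walls, and an angle 3\<pi>/2 at the foot of a wall. The corner 0 and
  the upper imaginary axis are left out because infinitely many teeth accumulate there.\<close>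

definition regular :: "complex \<Rightarrow> bool" where
  "regular p \<longleftrightarrow> (Re p = 0 \<and> Im p < 0) \<or>
     (Im p = 0 \<and> 0 < Re p \<and> (\<forall>n. \<not> (a n < Re p \<and> Re p < b n))) \<or>
     (0 < Im p \<and> (\<exists>n. Re p = a n \<or> Re p = b n))"

lemma close_coords: "dist w p < r \<Longrightarrow> \<bar>Re w - Re p\<bar> < r \<and> \<bar>Im w - Im p\<bar> < r"
  using abs_Re_le_cmod[of "w - p"] abs_Im_le_cmod[of "w - p"] by (simp add: dist_norm)

lemma b_gap:
  obtains r where "0 < r" "\<And>w. Re w < b n + r \<Longrightarrow> b n \<le> Re w \<Longrightarrow> w \<in> W \<longleftrightarrow> Im w < 0"
proof (cases n)
  case 0
  then show thesis using that[of 1] W_gap0 by auto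
next
  case (Suc m)
  then show thesis using that[of "a m - b n"] W_gap[of m] b_Suc_less[of m] by auto
qed

lemma islimpt_sector:
  assumes "0 < rad" "norm c = 1"
    "\<And>w. dist w p < rad \<Longrightarrow> w \<noteq> p \<Longrightarrow> w \<in> W \<longleftrightarrow> P ((w - p) / c)" "p \<notin> W"
    and "-pi \<le> ta" "ta < tb" "tb \<le> pi" "\<And>z. z \<noteq> 0 \<Longrightarrow> P z \<longleftrightarrow> ta < Arg z \<and> Arg z < tb"
  shows "p islimpt W \<and> (\<exists>x. norm x = 1 \<and> (f \<longlongrightarrow> x) (at p within W))"
proof -
  have c: "c \<noteq> 0" using assms by auto
  have "w \<in> W \<longleftrightarrow> w \<noteq> p \<and> ta < Arg ((w - p) / c) \<and> Arg ((w - p) / c) < tb" if "dist w p < rad" for w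
    using assms(3)[OF that] assms(4) assms(8)[of "(w - p) / c"] c by auto
  from sector_limit[OF assms(1,2,5-7) this] show ?thesis by auto
qed

lemma regular_limit: "regular p \<Longrightarrow> p \<notin> W \<and> p islimpt W \<and> (\<exists>x. norm x = 1 \<and> (f \<longlongrightarrow> x) (at p within W))"
proof -
  assume p: "regular p"
  have nW: "p \<notin> W"
  proof
    assume "p \<in> W"
    then have "0 < Re p" by (rule Re_pos_W)
    with \<open>p \<in> W\<close> p obtain n k where "a n < Re p" "Re p < b n" "Re p = a k \<or> Re p = b k"
      by (auto simp: regular_def mem_W)
    then show False using b_less_a[of n k] b_less_a[of k n] a_less_b[of k] a_less_b[of n]
      by (cases n k rule: linorder_cases) auto
  qed
  have pi: "- pi \<le> - (pi/2)" "- (pi / 2) < pi / 2" "pi / 2 \<le> pi" "-pi < pi/2" "-pi \<le> 0" using pi_gt_zero by auto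
  consider (left) "Re p = 0" "Im p < 0" | (lw) n where "0 < Im p" "Re p = a n" | (rw) n where "0 < Im p" "Re p = b n"
    | (ca) n where "p = of_real (a n)" | (cb) n where "p = of_real (b n)"
    | (fl) "Im p = 0" "0 < Re p" "\<And>n. \<not> (a n < Re p \<and> Re p < b n)" "\<And>n. Re p \<noteq> a n \<and> Re p \<noteq> b n"
    using p by (auto simp: regular_def complex_eq_iff)
  then have "p islimpt W \<and> (\<exists>x. norm x = 1 \<and> (f \<longlongrightarrow> x) (at p within W))"
  proof cases
    case left
    show ?thesis
    proof (rule islimpt_sector[where rad = "- Im p" and c = 1 and P = "\<lambda>z. 0 < Re z", OF _ _ _ nW pi(1-3)])
      fix w assume "dist w p < - Im p"
      then show "w \<in> W \<longleftrightarrow> 0 < Re ((w - p) / 1)"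
        using close_coords[of w p "- Im p"] left Re_pos_W[of w] by (auto simp: mem_W)
    qed (use left Arg_abs_half_pi_iff in auto)
  next
    case (lw n)
    define r where "r = min (Im p) (min (b n - a n) (a n - b (Suc n)))"
    have r: "0 < r" "r \<le> Im p" "r \<le> b n - a n" "r \<le> a n - b (Suc n)"
      using lw a_less_b[of n] b_Suc_less[of n] by (auto simp: r_def)
    show ?thesis
    proof (rule islimpt_sector[where rad = r and c = 1 and P = "\<lambda>z. 0 < Re z", OF _ _ _ nW pi(1-3)])
      fix w assume "dist w p < r"
      then show "w \<in> W \<longleftrightarrow> 0 < Re ((w - p) / 1)"
        using close_coords[of w p r] r lw W_tooth[of n w] W_gap[of n w] by (cases "Re w \<le> a n") auto
    qed (use r Arg_abs_half_pi_iff in auto)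
  next
    case (rw n)
    obtain r1 where r1: "0 < r1" "\<And>w. Re w < b n + r1 \<Longrightarrow> b n \<le> Re w \<Longrightarrow> w \<in> W \<longleftrightarrow> Im w < 0"
      using b_gap by blast
    define r where "r = min (Im p) (min (b n - a n) r1)"
    have r: "0 < r" "r \<le> Im p" "r \<le> b n - a n" "r \<le> r1"
      using rw a_less_b[of n] r1 by (auto simp: r_def)
    show ?thesis
    proof (rule islimpt_sector[where rad = r and c = "-1" and P = "\<lambda>z. 0 < Re z", OF _ _ _ nW pi(1-3)])
      fix w assume "dist w p < r"
      then show "w \<in> W \<longleftrightarrow> 0 < Re ((w - p) / -1)"
        using close_coords[of w p r] r rw W_tooth[of n w] r1(2)[of w] by (cases "b n \<le> Re w") auto
    qed (use r Arg_abs_half_pi_iff in auto)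
  next
    \<comment> \<open>At the left foot the directions into \<open>W\<close> have the arguments from
      -\<pi> to \<pi>/2, which the principal argument expresses without a rotation.\<close>
    case (ca n)
    define r where "r = min (b n - a n) (a n - b (Suc n))"
    have r: "0 < r" "r \<le> b n - a n" "r \<le> a n - b (Suc n)"
      using a_less_b[of n] b_Suc_less[of n] by (auto simp: r_def)
    show ?thesis
    proof (rule islimpt_sector[where rad = r and c = 1 and P = "\<lambda>z. 0 < Re z \<or> Im z < 0" and ta = "-pi" and tb = "pi/2", OF _ _ _ nW])
      fix w assume "dist w p < r"
      then show "w \<in> W \<longleftrightarrow> 0 < Re ((w - p) / 1) \<or> Im ((w - p) / 1) < 0"
        using close_coords[of w p r] r ca W_tooth[of n w] W_gap[of n w] by (cases "Re w \<le> a n") auto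
    qed (use r pi Arg_less_half_pi_iff mpi_less_Arg in auto)
  next
    \<comment> \<open>At the right foot the arguments run from \<pi>/2 to 2\<pi>. Division by
      \<open>c\<close> is multiplication by \<i> and moves them to the interval of the left
      foot.\<close>
    case (cb n)
    obtain r1 where r1: "0 < r1" "\<And>w. Re w < b n + r1 \<Longrightarrow> b n \<le> Re w \<Longrightarrow> w \<in> W \<longleftrightarrow> Im w < 0"
      using b_gap by blast
    define r where "r = min (b n - a n) r1"
    have r: "0 < r" "r \<le> b n - a n" "r \<le> r1"
      using a_less_b[of n] r1 by (auto simp: r_def)
    show ?thesis
    proof (rule islimpt_sector[where rad = r and c = "-\<i>" and P = "\<lambda>z. 0 < Re z \<or> Im z < 0" and ta = "-pi" and tb = "pi/2", OF _ _ _ nW])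
      fix w assume "dist w p < r"
      moreover have "(w - p) / (-\<i>) = \<i> * (w - p)" by (simp add: divide_complex_def)
      ultimately show "w \<in> W \<longleftrightarrow> 0 < Re ((w - p) / (-\<i>)) \<or> Im ((w - p) / (-\<i>)) < 0"
        using close_coords[of w p r] r cb W_tooth[of n w] r1(2)[of w] by (cases "b n \<le> Re w") auto
    qed (use r pi Arg_less_half_pi_iff mpi_less_Arg in auto)
  next
    case fl
    obtain r where r: "0 < r" "\<And>w. \<bar>Re w - Re p\<bar> < r \<Longrightarrow> w \<in> W \<longleftrightarrow> Im w < 0"
    proof (rule tooth_cases[OF fl(2)])
      assume "b 0 \<le> Re p"
      then show thesis using that[of "Re p - b 0"] W_gap0 fl(4)[of 0] by force
    next
      fix n assume *: "b (Suc n) \<le> Re p" "Re p \<le> a n"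
      then have "b (Suc n) < Re p" "Re p < a n" using fl(4)[of n] fl(4)[of "Suc n"] by force+
      then show thesis using that[of "min (Re p - b (Suc n)) (a n - Re p)"] W_gap[of n] by force
    qed (use fl(3) in auto)
    show ?thesis
    proof (rule islimpt_sector[where rad = r and c = 1 and P = "\<lambda>z. Im z < 0" and ta = "-pi" and tb = 0, OF _ _ _ nW])
      fix w assume "dist w p < r"
      then show "w \<in> W \<longleftrightarrow> Im ((w - p) / 1) < 0"
        using close_coords[of w p r] r fl by auto
    qed (use r pi Arg_neg_iff mpi_less_Arg in auto)
  qed
  then show ?thesis using nW by blast
qed

definition bval :: "complex \<Rightarrow> complex" where "bval p = Lim (at p within W) f"

lemma regular_bval:
  assumes "regular p"
  shows "(f \<longlongrightarrow> bval p) (at p within W)" "norm (bval p) = 1"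
proof -
  obtain x where x: "norm x = 1" "(f \<longlongrightarrow> x) (at p within W)" and "p islimpt W"
    using regular_limit[OF assms] by blast
  then have "bval p = x" unfolding bval_def by (intro tendsto_Lim) (auto simp: trivial_limit_within)
  then show "(f \<longlongrightarrow> bval p) (at p within W)" "norm (bval p) = 1" using x by auto
qed

lemma zero_islimpt: "0 islimpt W"
  unfolding islimpt_approachable
proof (intro allI impI)
  fix e :: real assume "0 < e"
  then have "Complex (e/3) (-e/3) \<in> W" by (auto simp: mem_W)
  moreover have "dist (Complex (e/3) (-e/3)) 0 < e"
    using cmod_le[of "Complex (e/3) (-e/3)"] \<open>0 < e\<close> by simp
  ultimately show "\<exists>x'\<in>W. x' \<noteq> 0 \<and> dist x' 0 < e"
    using \<open>0 < e\<close> by (intro bexI[of _ "Complex (e/3) (-e/3)"]) (auto simp: complex_eq_iff)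
qed

lemma bval_0: "(f \<longlongrightarrow> bval 0) (at 0 within W)" "bval 0 = -1"
proof -
  have l: "(f \<longlongrightarrow> -1) (at 0 within W)" using conf by (auto simp: normalized_conformal_map_def)
  then show "bval 0 = -1" unfolding bval_def using zero_islimpt by (intro tendsto_Lim) (auto simp: trivial_limit_within)
  then show "(f \<longlongrightarrow> bval 0) (at 0 within W)" using l by simp
qed

text \<open>Outside \<open>Wext\<close>, where the limit need not exist, the value is arbitrary.\<close>

definition fext :: "complex \<Rightarrow> complex" where "fext w = (if w \<in> W then f w else bval w)"

definition Wext :: "complex set" where "Wext = W \<union> Collect regular \<union> {0}"

lemma zero_not_in_W: "0 \<notin> W" using Re_pos_W[of 0] by auto

lemma continuous_on_fext: "continuous_on Wext fext"
proof (rule continuous_on_boundary_extension)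
  fix p assume p: "p \<in> Wext"
  show "(f \<longlongrightarrow> fext p) (at p within W)"
  proof (cases "p \<in> W")
    case True
    then show ?thesis using cont_f by (simp add: fext_def continuous_on_def)
  next
    case False
    then show ?thesis using p regular_bval bval_0 by (auto simp: fext_def Wext_def)
  qed
  show "p islimpt W" if "p \<notin> W" using p that regular_limit zero_islimpt by (auto simp: Wext_def)
qed (auto simp: fext_def)

abbreviation "tip n \<equiv> strip_end \<phi> (a n) (b n)"

text \<open>Multiplication by -\<i> maps the half-strip of \<open>end_limit\<close> to the upper
  part of the tooth. Its truncations are closed in \<open>W\<close> because the walls do not belong
  to \<open>W\<close>.\<close>

lemma strip_limit_aux:
  "\<exists>x. norm x = 1 \<and> (\<forall>e>0. \<exists>T>0. \<forall>w. a n < Re w \<longrightarrow> Re w < b n \<longrightarrow> T < Im w \<longrightarrow> dist (f w) x < e)"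
proof -
  define H where "H = {\<zeta>. Re \<zeta> < 0 \<and> a n < Im \<zeta> \<and> Im \<zeta> < b n}"
  define \<psi> where "\<psi> \<zeta> = - \<i> * \<zeta>" for \<zeta>
  have ri: "Re (\<psi> \<zeta>) = Im \<zeta>" "Im (\<psi> \<zeta>) = - Re \<zeta>" for \<zeta> by (auto simp: \<psi>_def)
  have sub: "\<psi> ` H \<subseteq> W" using W_tooth[of n] by (auto simp: H_def ri)
  have "\<exists>x. norm x = 1 \<and> (\<forall>e>0. \<exists>s<0. \<forall>\<zeta>\<in>H. Re \<zeta> < s \<longrightarrow> dist (f (\<psi> \<zeta>)) x < e)"
  proof (rule end_limit[OF H_def a_less_b _ _ sub])
    show "\<psi> holomorphic_on H" unfolding \<psi>_def by (intro holomorphic_intros)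
    show "inj_on \<psi> H" by (auto simp: inj_on_def \<psi>_def)
    fix s :: real assume s: "s < 0"
    have "\<psi> ` {\<zeta> \<in> H. Re \<zeta> \<le> s} = W \<inter> ({w. a n \<le> Re w} \<inter> {w. Re w \<le> b n} \<inter> {w. - s \<le> Im w})"
    proof (intro equalityI subsetI)
      fix w assume w: "w \<in> W \<inter> ({w. a n \<le> Re w} \<inter> {w. Re w \<le> b n} \<inter> {w. - s \<le> Im w})"
      have "\<not> regular w" using w regular_limit by auto
      then have "Re w \<noteq> a n" "Re w \<noteq> b n" using w s by (auto simp: regular_def)
      then show "w \<in> \<psi> ` {\<zeta> \<in> H. Re \<zeta> \<le> s}"
        using w s by (intro image_eqI[of _ _ "\<i> * w"]) (auto simp: H_def \<psi>_def)
    qed (use sub ri in \<open>auto simp: H_def\<close>)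
    moreover have "closed ({w. a n \<le> Re w} \<inter> {w. Re w \<le> b n} \<inter> {w. - s \<le> Im w})"
      by (intro closed_Int closed_halfspace_Re_ge closed_halfspace_Re_le closed_halfspace_Im_ge)
    ultimately show "closedin (top_of_set W) (\<psi> ` {\<zeta> \<in> H. Re \<zeta> \<le> s})" by (auto simp: closedin_closed)
  qed
  then obtain x where x: "norm x = 1" "\<And>e. e > 0 \<Longrightarrow> \<exists>s<0. \<forall>\<zeta>\<in>H. Re \<zeta> < s \<longrightarrow> dist (f (\<psi> \<zeta>)) x < e" by blast
  have "\<exists>T>0. \<forall>w. a n < Re w \<longrightarrow> Re w < b n \<longrightarrow> T < Im w \<longrightarrow> dist (f w) x < e" if e: "e > 0" for e
  proof -
    obtain s where s: "s < 0" "\<And>\<zeta>. \<zeta> \<in> H \<Longrightarrow> Re \<zeta> < s \<Longrightarrow> dist (f (\<psi> \<zeta>)) x < e" using x(2)[OF e] by auto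
    show ?thesis
    proof (intro exI[of _ "- s"] conjI allI impI)
      fix w assume w: "a n < Re w" "Re w < b n" "- s < Im w"
      have "w = \<psi> (\<i> * w)" by (simp add: \<psi>_def)
      then show "dist (f w) x < e" using s(2)[of "\<i> * w"] w s(1) by (simp add: H_def)
    qed (use s in auto)
  qed
  then show ?thesis using x(1) by blast
qed

lemma norm_tip: "norm (tip n) = 1"
  and tip_limit: "e > 0 \<Longrightarrow> \<exists>T>0. \<forall>w. a n < Re w \<longrightarrow> Re w < b n \<longrightarrow> T < Im w \<longrightarrow> dist (f w) (tip n) < e"
proof -
  obtain x where x: "norm x = 1"
    "\<And>e. e > 0 \<Longrightarrow> \<exists>T>0. \<forall>w. a n < Re w \<longrightarrow> Re w < b n \<longrightarrow> T < Im w \<longrightarrow> dist (f w) x < e"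
    using strip_limit_aux by blast
  define F where "F = inf (filtercomap Im at_top) (principal {w. a n < Re w \<and> Re w < b n})"
  have ev: "eventually P F \<longleftrightarrow> (\<exists>T. \<forall>w. a n < Re w \<longrightarrow> Re w < b n \<longrightarrow> T < Im w \<longrightarrow> P w)" for P
  proof -
    have "eventually P F \<longleftrightarrow> (\<exists>T. \<forall>w. T \<le> Im w \<longrightarrow> w \<in> {w. a n < Re w \<and> Re w < b n} \<longrightarrow> P w)"
      unfolding F_def eventually_inf_principal eventually_filtercomap_at_top_linorder by simp
    also have "\<dots> \<longleftrightarrow> (\<exists>T. \<forall>w. a n < Re w \<longrightarrow> Re w < b n \<longrightarrow> T < Im w \<longrightarrow> P w)"
    proof
      assume "\<exists>T. \<forall>w. a n < Re w \<longrightarrow> Re w < b n \<longrightarrow> T < Im w \<longrightarrow> P w"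
      then obtain T where "\<forall>w. a n < Re w \<longrightarrow> Re w < b n \<longrightarrow> T < Im w \<longrightarrow> P w" by blast
      then show "\<exists>T. \<forall>w. T \<le> Im w \<longrightarrow> w \<in> {w. a n < Re w \<and> Re w < b n} \<longrightarrow> P w"
        by (intro exI[of _ "T + 1"]) auto
    qed (auto intro: less_imp_le)
    finally show ?thesis .
  qed
  have "F \<noteq> bot"
  proof
    assume "F = bot"
    then have "eventually (\<lambda>_. False) F" by simp
    then obtain T where T: "\<And>w. a n < Re w \<Longrightarrow> Re w < b n \<Longrightarrow> T < Im w \<Longrightarrow> False" unfolding ev by blast
    show False using T[of "Complex ((a n + b n) / 2) (T + 1)"] a_less_b[of n] by simp
  qed
  moreover have "(f \<longlongrightarrow> x) F"
    by (rule tendstoI) (use x(2) in \<open>unfold ev, blast\<close>)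
  ultimately have "tip n = x" unfolding strip_end_def F_def[symmetric] by (rule tendsto_Lim)
  then show "norm (tip n) = 1"
    "e > 0 \<Longrightarrow> \<exists>T>0. \<forall>w. a n < Re w \<longrightarrow> Re w < b n \<longrightarrow> T < Im w \<longrightarrow> dist (f w) (tip n) < e"
    using x by auto
qed

text \<open>The map \<open>exp (- \<zeta>)\<close> sends a half-strip to the part of the quadrant
  outside the unit disc, so infinity in the quadrant is a single end with one limit. The
  normalization, which concerns Im w tending to minus infinity, identifies this limit as
  -\<i>.\<close>

lemma lower_limit:
  assumes "e > 0"
  shows "\<exists>R\<ge>1. \<forall>w. 0 < Re w \<longrightarrow> Im w < 0 \<longrightarrow> R < norm w \<longrightarrow> dist (f w) (-\<i>) < e"
proof -
  define H where "H = {\<zeta>. Re \<zeta> < 0 \<and> 0 < Im \<zeta> \<and> Im \<zeta> < pi / 2}"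
  define \<psi> where "\<psi> \<zeta> = exp (- \<zeta>)" for \<zeta> :: complex
  have n: "norm (\<psi> \<zeta>) = exp (- Re \<zeta>)" for \<zeta> by (simp add: \<psi>_def)
  have im: "0 < Re (\<psi> \<zeta>)" "Im (\<psi> \<zeta>) < 0" if "\<zeta> \<in> H" for \<zeta>
    using that by (auto simp: \<psi>_def H_def Re_exp Im_exp sin_gt_zero cos_gt_zero)
  have sub: "\<psi> ` H \<subseteq> W" using im by (auto simp: mem_W)
  have sup: "- Ln w \<in> H \<and> w = \<psi> (- Ln w)" if "0 < Re w" "Im w < 0" "1 < norm w" for w
  proof -
    have nz: "w \<noteq> 0" using that by auto
    have "Im (Ln w) < 0" using Im_Ln_pos_le[OF nz] Im_Ln_le_pi[OF nz] that by linarith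
    moreover have "\<bar>Im (Ln w)\<bar> < pi / 2" using Re_Ln_pos_lt[OF nz] that by auto
    ultimately show ?thesis using nz that by (auto simp: H_def \<psi>_def)
  qed
  have "\<exists>x. norm x = 1 \<and> (\<forall>e>0. \<exists>s<0. \<forall>\<zeta>\<in>H. Re \<zeta> < s \<longrightarrow> dist (f (\<psi> \<zeta>)) x < e)"
  proof (rule end_limit[OF H_def _ _ _ sub])
    show "\<psi> holomorphic_on H" unfolding \<psi>_def by (intro holomorphic_intros)
    show "inj_on \<psi> H"
    proof (rule inj_onI)
      fix x y assume xy: "x \<in> H" "y \<in> H" "\<psi> x = \<psi> y"
      have "- x = - y"
      proof (rule exp_complex_eqI)
        have "0 < Im x" "Im x < pi/2" "0 < Im y" "Im y < pi/2" using xy by (auto simp: H_def)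
        then show "\<bar>Im (- x) - Im (- y)\<bar> < 2 * pi" using pi_gt_zero unfolding uminus_complex.sel by linarith
      qed (use xy(3) in \<open>simp only: \<psi>_def\<close>)
      then show "x = y" by simp
    qed
    fix s :: real assume s: "s < 0"
    have "\<psi> ` {\<zeta> \<in> H. Re \<zeta> \<le> s} = W \<inter> ({w. Im w \<le> 0} \<inter> - ball 0 (exp (-s)))"
    proof (intro equalityI subsetI)
      fix w assume w: "w \<in> W \<inter> ({w. Im w \<le> 0} \<inter> - ball 0 (exp (-s)))"
      have e1: "1 < exp (- s)" using s by simp
      \<comment> \<open>Real points of \<open>W\<close> lie in the mouths of the teeth, hence
        between 0 and 1.\<close>
      have "Im w \<noteq> 0"
      proof
        assume "Im w = 0"
        then have "norm w = Re w" using w Re_pos_W[of w] by (simp add: cmod_eq_Re)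
        moreover obtain m where "Re w < b m" using W_upper[of w] w \<open>Im w = 0\<close> by auto
        ultimately show False using w e1 b_le_1[of m] by auto
      qed
      have "exp (- s) \<le> norm w" using w by auto
      then have "1 < norm w" using e1 by linarith
      then have ww: "0 < Re w" "Im w < 0" "1 < norm w" using w Re_pos_W[of w] \<open>Im w \<noteq> 0\<close> by auto
      have "exp (- s) \<le> exp (- Re (- Ln w))" using w ww n[of "- Ln w"] sup[OF ww] by auto
      then show "w \<in> \<psi> ` {\<zeta> \<in> H. Re \<zeta> \<le> s}" using sup[OF ww] by auto
    next
      fix w assume "w \<in> \<psi> ` {\<zeta> \<in> H. Re \<zeta> \<le> s}"
      then show "w \<in> W \<inter> ({w. Im w \<le> 0} \<inter> - ball 0 (exp (-s)))"
        using sub im n by (force intro: less_imp_le)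
    qed
    moreover have "closed ({w. Im w \<le> 0} \<inter> - ball 0 (exp (-s)))"
      by (intro closed_Int closed_halfspace_Im_le) auto
    ultimately show "closedin (top_of_set W) (\<psi> ` {\<zeta> \<in> H. Re \<zeta> \<le> s})" by (auto simp: closedin_closed)
  qed (use pi_gt_zero in auto)
  then obtain x where x: "norm x = 1" "\<And>e. e > 0 \<Longrightarrow> \<exists>s<0. \<forall>\<zeta>\<in>H. Re \<zeta> < s \<longrightarrow> dist (f (\<psi> \<zeta>)) x < e" by blast
  have lim: "\<exists>R\<ge>1. \<forall>w. 0 < Re w \<longrightarrow> Im w < 0 \<longrightarrow> R < norm w \<longrightarrow> dist (f w) x < e" if e: "e > 0" for e
  proof -
    obtain s where s: "s < 0" "\<And>\<zeta>. \<zeta> \<in> H \<Longrightarrow> Re \<zeta> < s \<Longrightarrow> dist (f (\<psi> \<zeta>)) x < e" using x(2)[OF e] by auto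
    show ?thesis
    proof (intro exI[of _ "exp (- s)"] conjI allI impI)
      fix w assume w: "0 < Re w" "Im w < 0" "exp (- s) < norm w"
      then have "1 < norm w" using s(1) by (meson less_trans one_less_exp_iff neg_0_less_iff_less)
      then have h: "- Ln w \<in> H" "w = \<psi> (- Ln w)" using sup w by auto
      then have "exp (- s) < exp (- Re (- Ln w))" using w n[of "- Ln w"] by simp
      then show "dist (f w) x < e" using s(2)[OF h(1)] h(2) by simp
    qed (use s in auto)
  qed
  have "x = -\<i>"
  proof -
    have l: "(f \<longlongrightarrow> -\<i>) (inf (filtercomap Im at_bot) (principal W))"
      using conf by (auto simp: normalized_conformal_map_def)
    define u where "u k = Complex 1 (- real k - 1)" for k
    have "filterlim u (inf (filtercomap Im at_bot) (principal W)) sequentially"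
      unfolding filterlim_inf
    proof
      have "filterlim (\<lambda>k. - real k - 1) at_bot sequentially"
        unfolding filterlim_at_bot
      proof
        fix Z :: real
        obtain N where "- Z < real N" using reals_Archimedean2 by blast
        then show "\<forall>\<^sub>F k in sequentially. - real k - 1 \<le> Z" by (intro eventually_sequentiallyI[of N]) simp
      qed
      then show "filterlim u (filtercomap Im at_bot) sequentially"
        by (simp add: filterlim_filtercomap_iff comp_def u_def)
      show "filterlim u (principal W) sequentially"
        by (auto simp: filterlim_principal u_def mem_W intro!: always_eventually)
    qed
    then have 1: "(\<lambda>k. f (u k)) \<longlonglongrightarrow> -\<i>" by (rule filterlim_compose[OF l])
    have 2: "(\<lambda>k. f (u k)) \<longlonglongrightarrow> x"
    proof (rule tendstoI)
      fix e :: real assume "e > 0"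
      then obtain R where R: "\<And>w. 0 < Re w \<Longrightarrow> Im w < 0 \<Longrightarrow> R < norm w \<Longrightarrow> dist (f w) x < e" using lim by blast
      obtain N where N: "R < real N" using reals_Archimedean2 by blast
      have "dist (f (u k)) x < e" if "k \<ge> N" for k
      proof (rule R)
        have "real k + 1 \<le> norm (u k)" using abs_Im_le_cmod[of "u k"] by (simp add: u_def)
        then show "R < norm (u k)" using N that by linarith
      qed (auto simp: u_def)
      then show "\<forall>\<^sub>F k in sequentially. dist (f (u k)) x < e" by (auto simp: eventually_sequentially)
    qed
    show ?thesis using LIMSEQ_unique[OF 2 1] .
  qed
  then show ?thesis using lim[OF assms] by simp
qed

text \<open>The normalization controls \<open>f\<close> only close to 0, whereas here deep teeth are
  included at any height: the mouth of a deep tooth is a crosscut close to 0, so the tooth behind it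
  is mapped into the same cap at -1 as the mouth.\<close>

lemma zero_limit:
  assumes "e > 0"
  shows "\<exists>c>0. \<forall>w\<in>W. Re w < c \<longrightarrow> - c < Im w \<longrightarrow> dist (f w) (-1) < e"
proof -
  have l: "(f \<longlongrightarrow> -1) (at 0 within W)" using bval_0 by simp
  \<comment> \<open>A point of the disk in the cap at level 1 - d about -1 has squared distance at
    most 2d from -1, which is less than e^2.\<close>
  define d where "d = min (1/2) (e\<^sup>2 / 4)"
  have d: "0 < d" "d \<le> 1/2" "d \<le> e\<^sup>2 / 4" using assms by (auto simp: d_def)
  obtain c1 where c1: "c1 > 0" "\<And>w. w \<in> W \<Longrightarrow> dist w 0 < c1 \<Longrightarrow> dist (f w) (-1) < min d e"
    using tendstoD[OF l, of "min d e"] d assms zero_not_in_W unfolding eventually_at by (metis min_less_iff_conj)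
  have capdist: "dist z (-1) < e" if z: "norm z < 1" "1 - d \<le> z \<bullet> (-1)" for z :: complex
  proof -
    have "(dist z (-1))\<^sup>2 = (norm z)\<^sup>2 + 1 - 2 * (z \<bullet> (-1))"
      unfolding dist_norm cmod_power2 by (simp add: inner_complex_def power2_eq_square algebra_simps)
    moreover have "(norm z)\<^sup>2 \<le> 1" using z by (simp add: power_le_one)
    ultimately have "(dist z (-1))\<^sup>2 \<le> 2 * d" using z by linarith
    also have "\<dots> < e\<^sup>2" using d assms by (simp add: field_simps)
    finally show ?thesis using assms by (simp add: power_less_imp_less_base)
  qed
  have "\<forall>\<^sub>F n in sequentially. b n < min c1 (Re (\<phi> 0))"
    using order_tendstoD(2)[OF b_lim, of "min c1 (Re (\<phi> 0))"] c1 Re_pos_W[OF phi_in_W[of 0]] by simp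
  \<comment> \<open>The bound by \<open>Re (\<phi> 0)\<close> keeps the base point out of all deep
    teeth, so that the origin is on the other side of each of their mouths.\<close>
  then obtain N where N: "b N < min c1 (Re (\<phi> 0))" by (auto simp: eventually_sequentially)
  show ?thesis
  proof (intro exI[of _ "min (c1 / 2) (a N)"] conjI ballI impI)
    fix w assume w: "w \<in> W" "Re w < min (c1 / 2) (a N)" "- min (c1 / 2) (a N) < Im w"
    show "dist (f w) (-1) < e"
    proof (cases "Im w \<le> 0")
      case True
      have "norm w \<le> \<bar>Re w\<bar> + \<bar>Im w\<bar>" by (rule cmod_le)
      then have "dist w 0 < c1" using True w Re_pos_W[of w] by auto
      then show ?thesis using c1(2)[OF w(1)] by simp
    next
      case False
      then obtain n where n: "a n < Re w" "Re w < b n" using W_upper[of w] w by auto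
      have "N \<le> n" using n w a_decreasing[of n N] by (cases "n \<le> N") auto
      then have bn: "b n < c1" "b n < Re (\<phi> 0)" using N b_decreasing[of N n] by auto
      define U where "U = {w. a n < Re w} \<inter> {w. Re w < b n} \<inter> {w. 0 < Im w}"
      define C where "C = {w. a n < Re w \<and> Re w < b n \<and> Im w = 0}"
      have W': "W - U - C = W - ({w. a n \<le> Re w} \<inter> {w. Re w \<le> b n} \<inter> {w. 0 \<le> Im w})"
        (is "_ = W - ?K")
      proof -
        have "Re v \<noteq> a n \<and> Re v \<noteq> b n" if "v \<in> W" "0 \<le> Im v" for v
        proof -
          obtain m where "a m < Re v" "Re v < b m" using W_upper \<open>v \<in> W\<close> \<open>0 \<le> Im v\<close> by blast
          then show ?thesis using b_less_a[of m n] b_less_a[of n m] a_less_b[of n]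
            by (cases m n rule: linorder_cases) auto
        qed
        then show ?thesis by (force simp: U_def C_def)
      qed
      have "1 - d \<le> f w \<bullet> (-1)"
      proof (rule crosscut_cap[where U = U and V = "W - U - C" and C = C and ?w0.0 = "\<phi> 0"])
        show "open U" unfolding U_def
          by (intro open_Int open_halfspace_Re_lt open_halfspace_Re_gt open_halfspace_Im_gt)
        show "U \<subseteq> W" using W_tooth by (auto simp: U_def)
        have "closed ?K" by (intro closed_Int closed_halfspace_Re_ge closed_halfspace_Re_le closed_halfspace_Im_ge)
        then show "open (W - U - C)" unfolding W' by (rule open_Diff[OF open_W])
        fix v assume v: "v \<in> C"
        then have "v \<in> W" "dist v 0 < c1" using W_tooth[of n v] a_pos[of n] bn by (auto simp: C_def cmod_eq_Re)
        then have "dist (f v) (-1) < d" using c1(2)[of v] by simp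
        moreover have "\<bar>Re (f v - (-1))\<bar> \<le> norm (f v - (-1))" by (rule abs_Re_le_cmod)
        ultimately show "1 - d \<le> f v \<bullet> (-1)" by (simp add: inner_complex_def dist_norm)
      next
        show "\<phi> 0 \<in> W - U - C" using phi_in_W bn by (auto simp: U_def C_def)
        show "f (\<phi> 0) \<bullet> - 1 < 1 - d" using d by simp
      qed (use n False in \<open>auto simp: U_def\<close>)
      then show ?thesis using capdist norm_f_less[OF w(1)] by blast
    qed
  qed (use c1 a_pos in auto)
qed

lemma fext_close:
  assumes "p \<in> Wext" "open U" "p \<in> U" "\<And>w. w \<in> W \<Longrightarrow> w \<in> U \<Longrightarrow> dist (f w) x \<le> e"
  shows "dist (fext p) x \<le> e"
proof (cases "p \<in> W")
  case True
  then show ?thesis using assms by (simp add: fext_def)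
next
  case False
  then have l: "(f \<longlongrightarrow> fext p) (at p within W)" "p islimpt W"
    using assms(1) regular_bval bval_0 regular_limit zero_islimpt by (auto simp: fext_def Wext_def)
  show ?thesis
  proof (rule tendsto_upperbound[OF tendsto_dist[OF l(1) tendsto_const]])
    show "\<forall>\<^sub>F w in at p within W. dist (f w) x \<le> e"
      using topological_tendstoD[OF tendsto_ident_at assms(2,3), of W]
      unfolding eventually_at_filter by eventually_elim (auto intro: assms(4))
  qed (use l(2) in \<open>simp add: trivial_limit_within\<close>)
qed

lemma fext_in_closure:
  assumes "p \<in> Wext" "open U" "p \<in> U"
  shows "fext p \<in> closure (f ` (W \<inter> U))"
proof (rule ccontr)
  assume "fext p \<notin> closure (f ` (W \<inter> U))"
  then obtain e where e: "e > 0" "\<And>w. w \<in> W \<inter> U \<Longrightarrow> e \<le> dist (f w) (fext p)"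
    by (force simp: closure_approachable not_less)
  show False
  proof (cases "p \<in> W")
    case True
    then show ?thesis using e(2)[of p] e(1) assms by (simp add: fext_def)
  next
    case False
    then have l: "(f \<longlongrightarrow> fext p) (at p within W)" "p islimpt W"
      using assms(1) regular_bval bval_0 regular_limit zero_islimpt by (auto simp: fext_def Wext_def)
    have "\<forall>\<^sub>F w in at p within W. w \<in> W \<and> w \<in> U"
      using topological_tendstoD[OF tendsto_ident_at assms(2,3), of W]
      unfolding eventually_at_filter by eventually_elim auto
    with tendstoD[OF l(1) e(1)] have "\<forall>\<^sub>F w in at p within W. False"
      by eventually_elim (use e in force)
    then show False using l(2) by (simp add: trivial_limit_within eventually_False)
  qed
qed

lemma norm_fext_boundary: "p \<in> Wext \<Longrightarrow> p \<notin> W \<Longrightarrow> norm (fext p) = 1"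
  using regular_bval bval_0 by (auto simp: Wext_def fext_def)

lemma W_subset_Wext: "W \<subseteq> Wext" by (auto simp: Wext_def)

lemma wall_in_Wext: "0 \<le> h \<Longrightarrow> q = a n \<or> q = b n \<Longrightarrow> Complex q h \<in> Wext"
  and wall_not_in_W: "0 \<le> h \<Longrightarrow> q = a n \<or> q = b n \<Longrightarrow> Complex q h \<notin> W"
proof -
  assume h: "0 \<le> h" and q: "q = a n \<or> q = b n"
  have "\<not> (a k < q \<and> q < b k)" for k
    using q b_less_a[of n k] b_less_a[of k n] a_less_b[of n] a_less_b[of k]
    by (cases n k rule: linorder_cases) auto
  then have "regular (Complex q h)" using h q a_pos[of n] b_pos[of n] by (auto simp: regular_def)
  then show "Complex q h \<in> Wext" "Complex q h \<notin> W" using regular_limit by (auto simp: Wext_def)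
qed

lemma left_in_Wext: "0 \<le> y \<Longrightarrow> Complex 0 (- y) \<in> Wext"
  and left_not_in_W: "Complex 0 y \<notin> W"
  using Re_pos_W[of "Complex 0 y"] by (auto simp: Wext_def regular_def complex_eq_iff)

lemma real_in_Wext: "0 < x \<Longrightarrow> of_real x \<in> Wext"
  using W_tooth[of _ "of_real x"] by (cases "\<exists>n. a n < x \<and> x < b n") (auto simp: Wext_def regular_def)

lemma zero_limit_ext:
  assumes "e > 0"
  shows "\<exists>c>0. \<forall>p\<in>Wext. Re p < c \<longrightarrow> - c < Im p \<longrightarrow> dist (fext p) (-1) \<le> e"
proof -
  obtain c where c: "c > 0" "\<And>w. w \<in> W \<Longrightarrow> Re w < c \<Longrightarrow> - c < Im w \<Longrightarrow> dist (f w) (-1) < e"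
    using zero_limit[OF assms] by blast
  have "dist (fext p) (-1) \<le> e" if "p \<in> Wext" "Re p < c" "- c < Im p" for p
  proof (rule fext_close[OF that(1)])
    show "open ({w. Re w < c} \<inter> {w. - c < Im w})"
      by (intro open_Int open_halfspace_Re_lt open_halfspace_Im_gt)
  qed (use that c(2) in \<open>auto intro: less_imp_le\<close>)
  then show ?thesis using c(1) by blast
qed

lemma lower_limit_ext:
  assumes "e > 0"
  shows "\<exists>R\<ge>1. \<forall>p\<in>Wext. Im p \<le> 0 \<longrightarrow> R < norm p \<longrightarrow> dist (fext p) (-\<i>) \<le> e"
proof -
  obtain R where R: "R \<ge> 1" "\<And>w. 0 < Re w \<Longrightarrow> Im w < 0 \<Longrightarrow> R < norm w \<Longrightarrow> dist (f w) (-\<i>) < e"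
    using lower_limit[OF assms] by blast
  have "dist (fext p) (-\<i>) \<le> e" if p: "p \<in> Wext" "Im p \<le> 0" "R < norm p" for p
  proof (rule fext_close[OF p(1)])
    \<comment> \<open>The second half-plane is there for the distant floor points. All teeth lie to
      the left of 1, so its points in \<open>W\<close> have negative imaginary part as well.\<close>
    show "open (- cball 0 R \<inter> ({w. Im w < 0} \<union> {w. 1 < Re w}))"
      by (intro open_Int open_Un open_halfspace_Re_gt open_halfspace_Im_lt) auto
    have "1 < Re p" if "\<not> Im p < 0"
    proof -
      have "norm p = \<bar>Re p\<bar>" using p(2) that by (simp add: cmod_eq_Re)
      moreover have "0 \<le> Re p" using p(1) Re_pos_W[of p] a_pos b_pos by (auto simp: Wext_def regular_def less_imp_le)
      ultimately show ?thesis using p(3) R(1) by auto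
    qed
    then show "p \<in> - cball 0 R \<inter> ({w. Im w < 0} \<union> {w. 1 < Re w})" using p(3) by auto
    fix w assume w: "w \<in> W" "w \<in> - cball 0 R \<inter> ({w. Im w < 0} \<union> {w. 1 < Re w})"
    have "Im w < 0" using w W_gap0[of w] b_zero by auto
    then show "dist (f w) (-\<i>) \<le> e" using R(2)[of w] Re_pos_W[OF w(1)] w(2) by (auto intro: less_imp_le)
  qed
  then show ?thesis using R(1) by blast
qed

lemma tip_limit_ext:
  assumes "e > 0"
  shows "\<exists>T>0. \<forall>p\<in>Wext. a n \<le> Re p \<longrightarrow> Re p \<le> b n \<longrightarrow> T < Im p \<longrightarrow> dist (fext p) (tip n) \<le> e"
proof -
  obtain T where T: "T > 0" "\<And>w. a n < Re w \<Longrightarrow> Re w < b n \<Longrightarrow> T < Im w \<Longrightarrow> dist (f w) (tip n) < e"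
    using tip_limit[OF assms] by blast
  obtain r where r: "0 < r" "\<And>w. Re w < b n + r \<Longrightarrow> b n \<le> Re w \<Longrightarrow> w \<in> W \<longleftrightarrow> Im w < 0"
    using b_gap by blast
  have "dist (fext p) (tip n) \<le> e" if p: "p \<in> Wext" "a n \<le> Re p" "Re p \<le> b n" "T < Im p" for p
  proof (rule fext_close[OF p(1)])
    show "open ({w. b (Suc n) < Re w} \<inter> {w. Re w < b n + r} \<inter> {w. T < Im w})"
      by (intro open_Int open_halfspace_Re_lt open_halfspace_Re_gt open_halfspace_Im_gt)
    show "p \<in> {w. b (Suc n) < Re w} \<inter> {w. Re w < b n + r} \<inter> {w. T < Im w}" using p r b_Suc_less[of n] by auto
    fix w assume w: "w \<in> W" "w \<in> {w. b (Suc n) < Re w} \<inter> {w. Re w < b n + r} \<inter> {w. T < Im w}"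
    then have "a n < Re w" "Re w < b n" using W_gap[of n w] r(2)[of w] T(1) by (auto simp: not_le[symmetric])
    then show "dist (f w) (tip n) \<le> e" using T(2)[of w] w by (auto intro: less_imp_le)
  qed
  then show ?thesis using T(1) by blast
qed

section \<open>Separation of tips, walls and base points by horizontal crosscuts\<close>

definition upper_tooth :: "nat \<Rightarrow> real \<Rightarrow> complex set" where
  "upper_tooth n t = {w. a n < Re w} \<inter> {w. Re w < b n} \<inter> {w. t < Im w}"

lemma open_upper_tooth: "open (upper_tooth n t)"
  unfolding upper_tooth_def by (intro open_Int open_halfspace_Re_lt open_halfspace_Re_gt open_halfspace_Im_gt)

lemma upper_tooth_subset_W: "upper_tooth n t \<subseteq> W" using W_tooth by (auto simp: upper_tooth_def)

definition below_tooth :: "nat \<Rightarrow> real \<Rightarrow> complex set" where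
  "below_tooth n t = W - {w. a n \<le> Re w \<and> Re w \<le> b n \<and> t \<le> Im w}"

lemma open_below_tooth: "open (below_tooth n t)"
proof -
  have "{w. a n \<le> Re w \<and> Re w \<le> b n \<and> t \<le> Im w} = {w. a n \<le> Re w} \<inter> {w. Re w \<le> b n} \<inter> {w. t \<le> Im w}" by auto
  then have "closed {w. a n \<le> Re w \<and> Re w \<le> b n \<and> t \<le> Im w}"
    using closed_halfspace_Re_ge closed_halfspace_Re_le closed_halfspace_Im_ge by (simp add: closed_Int)
  then show ?thesis unfolding below_tooth_def by (rule open_Diff[OF open_W])
qed

text \<open>The closed horizontal crosscut at height \<open>t\<close> is compact; its interior is
  mapped into the open disk and its ends to the two wall values. A boundary point different from
  these values has positive distance from the image of the crosscut, so it cannot be approached from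
  both sides.\<close>

lemma crosscut_wall_value:
  assumes t: "0 < t" and x: "norm x = 1" "x \<in> closure (f ` upper_tooth n t)" "x \<in> closure (f ` below_tooth n t)"
  shows "x = fext (Complex (a n) t) \<or> x = fext (Complex (b n) t)"
proof (rule ccontr)
  assume neq: "\<not> ?thesis"
  define S where "S = (\<lambda>s. Complex s t) ` {a n..b n}"
  have cC: "continuous_on A (\<lambda>s. Complex s t)" for A unfolding Complex_eq by (intro continuous_intros)
  have S: "compact S" "S \<noteq> {}" unfolding S_def using a_less_b[of n] cC by (auto intro: compact_continuous_image)
  have SW: "S \<subseteq> Wext"
  proof
    fix w assume "w \<in> S"
    then obtain s where s: "w = Complex s t" "a n \<le> s" "s \<le> b n" by (auto simp: S_def)
    show "w \<in> Wext"
    proof (cases "s = a n \<or> s = b n")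
      case True
      then show ?thesis using wall_in_Wext[of t s n] t s by auto
    next
      case False
      then show ?thesis using W_tooth[of n w] s W_subset_Wext by auto
    qed
  qed
  have "continuous_on S (\<lambda>w. dist (fext w) x)"
    by (intro continuous_intros continuous_on_subset[OF continuous_on_fext SW])
  then obtain w0 where w0: "w0 \<in> S" "\<And>w. w \<in> S \<Longrightarrow> dist (fext w0) x \<le> dist (fext w) x"
    using continuous_attains_inf[OF S] by blast
  have "fext w0 \<noteq> x"
  proof (cases "w0 \<in> W")
    case True
    then show ?thesis using norm_f_less[of w0] x(1) by (auto simp: fext_def)
  next
    case False
    then have "Re w0 = a n \<or> Re w0 = b n" using w0(1) W_tooth[of n w0] by (force simp: S_def)
    then have "w0 = Complex (a n) t \<or> w0 = Complex (b n) t" using w0(1) by (auto simp: S_def)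
    then show ?thesis using neq by auto
  qed
  then have "0 < dist (fext w0) x" by simp
  moreover have "W \<subseteq> upper_tooth n t \<union> {w \<in> W. w \<in> S} \<union> below_tooth n t"
  proof
    fix w assume w: "w \<in> W"
    show "w \<in> upper_tooth n t \<union> {w \<in> W. w \<in> S} \<union> below_tooth n t"
    proof (cases "a n \<le> Re w \<and> Re w \<le> b n \<and> t \<le> Im w")
      case True
      have "w = Complex (Re w) (Im w)" by simp
      then have "Re w \<noteq> a n" "Re w \<noteq> b n" using wall_not_in_W[of "Im w" "Re w" n] w True t by auto
      then show ?thesis using True w by (cases "Im w = t") (auto simp: upper_tooth_def S_def image_iff complex_eq_iff intro!: bexI[of _ "Re w"])
    qed (use w in \<open>auto simp: below_tooth_def\<close>)
  qed
  ultimately show False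
    using crosscut_ball[OF open_upper_tooth upper_tooth_subset_W open_below_tooth, of n t n t "{w \<in> W. w \<in> S}" "dist (fext w0) x" x]
      w0(2) x by (force simp: below_tooth_def upper_tooth_def fext_def)
qed

text \<open>Schwarz reflection across the wall and the identity theorem.\<close>

lemma wall_not_constant:
  assumes q: "q = a n \<or> q = b n" and h: "0 < h1" "h1 < h2" and x: "norm x = 1"
  shows "\<exists>t\<in>{h1<..<h2}. fext (Complex q t) \<noteq> x"
proof (rule ccontr)
  assume "\<not> ?thesis"
  then have const: "\<And>t. t \<in> {h1<..<h2} \<Longrightarrow> fext (Complex q t) = x" by auto
  \<comment> \<open>The sign records on which side of the wall the tooth lies. With it,
    \<open>m\<close> maps the real axis to the wall and the upper half-plane to the side of the
    tooth.\<close>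
  define \<sigma> where "\<sigma> = (if q = a n then 1 else - 1 :: real)"
  have \<sigma>2: "\<sigma> = 1 \<and> q = a n \<or> \<sigma> = -1 \<and> q = b n" using q by (auto simp: \<sigma>_def)
  define t0 where "t0 = (h1 + h2) / 2"
  define r where "r = min ((h2 - h1) / 2) (b n - a n)"
  have "r \<le> (h2 - h1) / 2" unfolding r_def by (rule min.cobounded1)
  moreover have "r \<le> b n - a n" unfolding r_def by (rule min.cobounded2)
  moreover have "0 < r" using h a_less_b[of n] by (simp add: r_def)
  ultimately have r: "0 < r" "r \<le> (h2 - h1) / 2" "r \<le> b n - a n" by auto
  define m where "m z = Complex q t0 - \<i> * of_real \<sigma> * z" for z
  have m: "Re (m z) = q + \<sigma> * Im z" "Im (m z) = t0 - \<sigma> * Re z" for z by (auto simp: m_def)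
  have bd: "\<bar>Re z\<bar> < r" "\<bar>Im z\<bar> < r" if "z \<in> ball 0 r" for z
    using that abs_Re_le_cmod[of z] abs_Im_le_cmod[of z] by auto
  have im: "h1 < Im (m z)" "Im (m z) < h2" if "z \<in> ball 0 r" for z
    using bd[OF that] r \<sigma>2 h by (auto simp: m t0_def field_simps abs_less_iff)
  have upper: "m z \<in> W" if "z \<in> ball 0 r" "0 < Im z" for z
    using bd[OF that(1)] that(2) \<sigma>2 r by (intro W_tooth[of n]) (auto simp: m)
  have real: "m z = Complex q (Im (m z))" if "Im z = 0" for z using that by (simp add: complex_eq_iff m)
  have ext: "m z \<in> Wext" if "z \<in> ball 0 r" "0 \<le> Im z" for z
  proof (cases "Im z = 0")
    case True
    show ?thesis using real[OF True] wall_in_Wext[of "Im (m z)" q n] im[OF that(1)] h q by simp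
  qed (use upper[of z] that W_subset_Wext in auto)
  define F where "F z = fext (m z) - x" for z
  have F0: "F z = 0" if "z \<in> ball 0 r" "Im z = 0" for z
    using const[of "Im (m z)"] im[OF that(1)] real[OF that(2)] by (simp add: F_def)
  have holm: "m holomorphic_on A" for A unfolding m_def by (intro holomorphic_intros)
  have "(\<lambda>z. if 0 \<le> Im z then F z else cnj (F (cnj z))) holomorphic_on ball 0 r"
  proof (rule Schwarz_reflection)
    have "(\<lambda>z. f (m z) - x) holomorphic_on (ball 0 r \<inter> {z. 0 < Im z})"
      by (intro holomorphic_intros holomorphic_on_compose_gen[OF holm hol_f, unfolded comp_def]) (use upper in auto)
    then show "F holomorphic_on (ball 0 r \<inter> {z. 0 < Im z})"
      by (rule holomorphic_transform) (use upper in \<open>auto simp: F_def fext_def\<close>)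
    show "continuous_on (ball 0 r \<inter> {z. 0 \<le> Im z}) F"
      unfolding F_def
      by (intro continuous_intros continuous_on_compose2[OF continuous_on_fext holomorphic_on_imp_continuous_on[OF holm]])
         (use ext in auto)
    show "F z \<in> \<real>" if "z \<in> ball 0 r" "z \<in> \<real>" for z using F0[OF that(1)] that(2) by (auto simp: complex_is_Real_iff)
  qed auto
  moreover have "(0::complex) islimpt (ball 0 r \<inter> \<real>)"
    unfolding islimpt_approachable
  proof (intro allI impI)
    fix e :: real assume "0 < e"
    define v where "v = min e r / 2"
    have "0 < v" "v < e" "v < r" using \<open>0 < e\<close> r by (auto simp: v_def min_def)
    then have "(of_real v :: complex) \<in> ball 0 r \<inter> \<real>" "dist (of_real v :: complex) 0 < e" "of_real v \<noteq> (0::complex)"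
      by (auto simp: dist_norm)
    then show "\<exists>x'\<in>ball 0 r \<inter> \<real>. x' \<noteq> (0::complex) \<and> dist x' 0 < e" by blast
  qed
  ultimately have z: "(if 0 \<le> Im z then F z else cnj (F (cnj z))) = 0" if "z \<in> ball 0 r" for z
    using analytic_continuation[of "\<lambda>z. if 0 \<le> Im z then F z else cnj (F (cnj z))" "ball 0 r" "ball 0 r \<inter> \<real>" 0 z] that r F0
    by (auto simp: complex_is_Real_iff)
  define z0 where "z0 = Complex 0 (r / 2)"
  have z0: "z0 \<in> ball 0 r" "0 < Im z0" using r by (auto simp: z0_def cmod_def)
  then have "F z0 = 0" using z[of z0] by auto
  then have "f (m z0) = x" using upper[OF z0] by (simp add: F_def fext_def)
  then show False using norm_f_less[OF upper[OF z0]] x by simp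
qed

text \<open>It suffices to find a height at which neither wall takes the value \<open>x\<close>.
  Continuity gives an interval of such heights for the right wall, and every interval contains one
  for the left wall.\<close>

lemma crosscut_separates:
  assumes h: "0 < h1" "h1 < h2" and x: "norm x = 1"
    and U: "x \<in> closure (f ` upper_tooth n h2)" and V: "x \<in> closure (f ` below_tooth n h1)"
  shows False
proof -
  obtain t1 where t1: "t1 \<in> {h1<..<h2}" "fext (Complex (b n) t1) \<noteq> x"
    using wall_not_constant[of "b n" n, OF _ h x] by auto
  have cC: "continuous_on {0<..} (\<lambda>t. fext (Complex (b n) t))"
    by (intro continuous_on_compose2[OF continuous_on_fext]) (auto simp: Complex_eq[abs_def] intro!: continuous_intros,
        simp add: Complex_eq[symmetric] wall_in_Wext[where n = n] less_imp_le)
  have "open ({0<..} \<inter> (\<lambda>t. fext (Complex (b n) t)) -` (- {x}))"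
    by (rule continuous_open_preimage[OF cC]) auto
  moreover have "t1 \<in> {0<..} \<inter> (\<lambda>t. fext (Complex (b n) t)) -` (- {x})" using t1 h by auto
  ultimately obtain d where d: "d > 0" "ball t1 d \<subseteq> {0<..} \<inter> (\<lambda>t. fext (Complex (b n) t)) -` (- {x})"
    using open_contains_ball by blast
  define d' where "d' = min d (min (t1 - h1) (h2 - t1))"
  have d': "d' > 0" "d' \<le> d" "d' \<le> t1 - h1" "d' \<le> h2 - t1" using d t1 by (auto simp: d'_def)
  obtain t where t: "t \<in> {t1 - d'/2<..<t1 + d'/2}" "fext (Complex (a n) t) \<noteq> x"
    using wall_not_constant[of "a n" n "t1 - d'/2" "t1 + d'/2" x] d' t1 h x by auto
  have tt: "h1 < t" "t < h2" using t d' by auto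
  have "t \<in> ball t1 d" using t d' by (auto simp: dist_real_def abs_less_iff)
  then have "fext (Complex (b n) t) \<noteq> x" using d by auto
  moreover have "x \<in> closure (f ` upper_tooth n t)"
    using U tt by (rule_tac subsetD[OF closure_mono]) (auto simp: upper_tooth_def)
  moreover have "x \<in> closure (f ` below_tooth n t)"
    using V tt by (rule_tac subsetD[OF closure_mono]) (auto simp: below_tooth_def)
  ultimately show False using crosscut_wall_value[of t x n] t(2) tt h x by auto
qed

lemma tip_in_closure: "tip n \<in> closure (f ` upper_tooth n h)"
  unfolding closure_approachable
proof (intro allI impI)
  fix e :: real assume "0 < e"
  then obtain T where T: "T > 0" "\<And>w. a n < Re w \<Longrightarrow> Re w < b n \<Longrightarrow> T < Im w \<Longrightarrow> dist (f w) (tip n) < e"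
    using tip_limit by blast
  define w where "w = Complex ((a n + b n) / 2) (max T h + 1)"
  have "w \<in> upper_tooth n h" "dist (f w) (tip n) < e"
    using a_less_b[of n] by (auto simp: w_def upper_tooth_def intro!: T(2))
  then show "\<exists>y\<in>f ` upper_tooth n h. dist y (tip n) < e" by blast
qed

lemma base_in_closure:
  assumes h: "0 < h"
  shows "-1 \<in> closure (f ` below_tooth n h)" "-\<i> \<in> closure (f ` below_tooth n h)"
proof -
  have sub: "w \<in> W \<Longrightarrow> Im w < h \<Longrightarrow> w \<in> below_tooth n h" for w by (auto simp: below_tooth_def)
  have "fext 0 \<in> closure (f ` (W \<inter> {w. Im w < h}))"
    by (rule fext_in_closure) (use h in \<open>auto simp: Wext_def open_halfspace_Im_lt\<close>)
  moreover have "fext 0 = -1" using bval_0 zero_not_in_W by (simp add: fext_def)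
  ultimately show "-1 \<in> closure (f ` below_tooth n h)"
    using closure_mono[of "f ` (W \<inter> {w. Im w < h})" "f ` below_tooth n h"] sub by auto
  show "-\<i> \<in> closure (f ` below_tooth n h)"
    unfolding closure_approachable
  proof (intro allI impI)
    fix e :: real assume "0 < e"
    then obtain R where R: "R \<ge> 1" "\<And>w. 0 < Re w \<Longrightarrow> Im w < 0 \<Longrightarrow> R < norm w \<Longrightarrow> dist (f w) (-\<i>) < e"
      using lower_limit by blast
    define w where "w = Complex 1 (- R - 1)"
    have "R < norm w" using abs_Im_le_cmod[of w] R(1) by (simp add: w_def)
    then have "dist (f w) (-\<i>) < e" using R by (auto simp: w_def)
    moreover have "w \<in> below_tooth n h" using R(1) h by (intro sub) (auto simp: w_def mem_W)
    ultimately show "\<exists>y\<in>f ` below_tooth n h. dist y (-\<i>) < e" by blast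
  qed
qed

lemma tip_neq: "tip n \<noteq> -1" "tip n \<noteq> -\<i>"
  using crosscut_separates[of 1 2 "tip n" n] norm_tip tip_in_closure base_in_closure[of 1 n] by auto

text \<open>A wall point lies above every lower crosscut and below every higher one. The factors 3/2
  and 2, and 1/2 and 2/3, place two crosscuts on the proper side of \<open>h\<close>.\<close>

lemma wall_neq:
  assumes h: "0 < h" and q: "q = a n \<or> q = b n"
  shows "fext (Complex q h) \<noteq> tip n" "fext (Complex q h) \<noteq> -1" "fext (Complex q h) \<noteq> -\<i>"
proof -
  let ?p = "Complex q h"
  have p: "?p \<in> Wext" "?p \<notin> W" using wall_in_Wext[of h q n] wall_not_in_W[of h q n] h q by auto
  have n1: "norm (fext ?p) = 1" using norm_fext_boundary[OF p] .
  have low: "fext ?p \<in> closure (f ` below_tooth n (3/2 * h))"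
    by (rule subsetD[OF closure_mono fext_in_closure[OF p(1), of "{w. Im w < 3/2 * h}"]])
       (use h in \<open>auto simp: below_tooth_def intro!: open_halfspace_Im_lt[of "3/2 * h", simplified]\<close>)
  then show "fext ?p \<noteq> tip n"
    using crosscut_separates[of "3/2 * h" "2 * h" "tip n" n] norm_tip tip_in_closure h by auto
  have up: "fext ?p \<in> closure (f ` upper_tooth n (2/3 * h))"
  proof -
    obtain r where r: "0 < r" "\<And>w. Re w < b n + r \<Longrightarrow> b n \<le> Re w \<Longrightarrow> w \<in> W \<longleftrightarrow> Im w < 0"
      using b_gap by blast
    let ?U = "{w. b (Suc n) < Re w} \<inter> {w. Re w < b n + r} \<inter> {w. 2/3 * h < Im w}"
    have "open ?U" by (intro open_Int open_halfspace_Re_lt open_halfspace_Re_gt open_halfspace_Im_gt)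
    moreover have "?p \<in> ?U" using h q r b_Suc_less[of n] a_less_b[of n] by auto
    ultimately have "fext ?p \<in> closure (f ` (W \<inter> ?U))" by (rule fext_in_closure[OF p(1)])
    moreover have "W \<inter> ?U \<subseteq> upper_tooth n (2/3 * h)"
    proof
      fix w assume w: "w \<in> W \<inter> ?U"
      then have "a n < Re w" "Re w < b n" using W_gap[of n w] r(2)[of w] h by (auto simp: not_le[symmetric])
      then show "w \<in> upper_tooth n (2/3 * h)" using w by (auto simp: upper_tooth_def)
    qed
    ultimately show ?thesis by (meson closure_mono image_mono subsetD)
  qed
  show "fext ?p \<noteq> -1" "fext ?p \<noteq> -\<i>"
    using crosscut_separates[of "1/2 * h" "2/3 * h" "fext ?p" n] n1 up base_in_closure[of "1/2 * h" n] h by auto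
qed

end

section \<open>Arcs and geodesics\<close>

text \<open>In the angle measured from \<open>e\<close>, which is continuous off \<open>e\<close>,
  the connected set has an interval as image. It contains angles smaller than that of
  \<open>y\<close>, near \<open>e\<close> inside \<open>Y\<close>, and larger ones near
  \<open>w\<close>; so it would contain \<open>y\<close>.\<close>

lemma arc_separation:
  assumes con: "connected \<Lambda>" and sph: "\<Lambda> \<subseteq> sphere 0 1" and eL: "e \<notin> \<Lambda>" and yL: "y \<notin> \<Lambda>"
    and Y: "Y = (\<lambda>t. e * cis t) ` {0<..<\<delta>}" and \<delta>: "0 < \<delta>" "\<delta> \<le> 2 * pi" and y: "y \<in> Y"
    and e: "norm e = 1" "\<And>r. r > 0 \<Longrightarrow> \<exists>z\<in>\<Lambda> \<inter> Y. dist z e < r"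
    and w: "norm w = 1" "w \<notin> Y" "w \<noteq> e" "\<And>r. r > 0 \<Longrightarrow> \<exists>z\<in>\<Lambda>. dist z w < r"
  shows False
proof -
  define \<theta> where "\<theta> z = Arg2pi (z / e)" for z
  have e0: "e \<noteq> 0" using e by auto
  have val: "\<theta> (e * cis t) = t" if "0 \<le> t" "t < 2 * pi" for t
    using that e0 Arg2pi_unique[of 1 t "cis t"] by (simp add: \<theta>_def cis_conv_exp)
  have rep: "z = e * cis (\<theta> z)" "0 \<le> \<theta> z" "\<theta> z < 2 * pi" if "norm z = 1" for z
    using Arg2pi[of "z / e"] that e e0 by (auto simp: \<theta>_def norm_divide cis_conv_exp field_simps is_Arg_def)
  have pos: "0 < \<theta> z" if "norm z = 1" "z \<noteq> e" for z
    using rep[OF that(1)] that(2) by (cases "\<theta> z = 0") auto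
  have cont: "continuous (at z) \<theta>" if "norm z = 1" "z \<noteq> e" for z
  proof -
    have "z / e \<notin> \<real>\<^sub>\<ge>\<^sub>0"
    proof
      assume "z / e \<in> \<real>\<^sub>\<ge>\<^sub>0"
      then obtain r where r: "z / e = of_real r" "0 \<le> r" by (auto elim: nonneg_Reals_cases)
      have "norm (z / e) = 1" using that e by (simp add: norm_divide)
      then have "r = 1" using r by simp
      then show False using r e0 that by simp
    qed
    then have "continuous (at (z / e)) Arg2pi" by (rule continuous_at_Arg2pi)
    then show ?thesis unfolding \<theta>_def
      by (intro continuous_at_compose[of z "\<lambda>z. z / e" Arg2pi, unfolded comp_def] continuous_intros) (use e0 in auto)
  qed
  have nL: "norm z = 1" "z \<noteq> e" if "z \<in> \<Lambda>" for z using that sph eL by auto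
  have "continuous_on \<Lambda> \<theta>" using cont nL by (auto intro: continuous_at_imp_continuous_on)
  then have conn: "connected (\<theta> ` \<Lambda>)" using con by (rule connected_continuous_image)
  obtain ty where ty: "y = e * cis ty" "ty \<in> {0<..<\<delta>}" using y unfolding Y by blast
  then have ty: "y = e * cis ty" "0 < ty" "ty < \<delta>" by auto
  have ny: "norm y = 1" using ty e by (simp add: norm_mult)
  have thy: "\<theta> y = ty" using val[of ty] ty \<delta> by simp
  obtain z1 where z1: "z1 \<in> \<Lambda>" "\<theta> z1 < ty"
  proof -
    have "compact ((\<lambda>t. e * cis t) ` {ty..\<delta>})"
      by (intro compact_continuous_image continuous_intros) auto
    show ?thesis
    proof (cases "\<delta> = 2 * pi")
      \<comment> \<open>Then \<open>Y\<close> is the circle without \<open>e\<close> and would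
        contain \<open>w\<close>.\<close>
      case True
      have "\<theta> w \<in> {0<..<\<delta>}" using rep(3)[OF w(1)] pos[OF w(1,3)] True by simp
      with rep(1)[OF w(1)] have "w \<in> Y" unfolding Y by (rule image_eqI)
      then show thesis using w by simp
    next
      case False
      have "e \<notin> (\<lambda>t. e * cis t) ` {ty..\<delta>}"
      proof
        assume "e \<in> (\<lambda>t. e * cis t) ` {ty..\<delta>}"
        then obtain t where t: "t \<in> {ty..\<delta>}" "e = e * cis t" by auto
        then have "\<theta> e = t" using val[of t] ty \<delta> False by auto
        moreover have "\<theta> e = 0" using val[of 0] by simp
        ultimately show False using t ty by auto
      qed
      moreover have "closed ((\<lambda>t. e * cis t) ` {ty..\<delta>})"
        using \<open>compact _\<close> by (rule compact_imp_closed)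
      ultimately obtain r where r: "r > 0" "ball e r \<inter> (\<lambda>t. e * cis t) ` {ty..\<delta>} = {}"
        by (metis Compl_iff disjoint_eq_subset_Compl open_Compl open_contains_ball)
      obtain z where z: "z \<in> \<Lambda> \<inter> Y" "dist z e < r" using e(2)[OF r(1)] by blast
      then obtain t where "z = e * cis t" "t \<in> {0<..<\<delta>}" unfolding Y by blast
      then have t: "z = e * cis t" "0 < t" "t < \<delta>" by auto
      have "z \<in> ball e r" using z by (simp add: dist_commute)
      then have "t < ty" using r(2) t by force
      then show thesis using that[of z] z t val[of t] \<delta> ty by auto
    qed
  qed
  obtain z2 where z2: "z2 \<in> \<Lambda>" "ty < \<theta> z2"
  proof -
    have "ty < \<theta> w"
    proof (rule ccontr)
      assume "\<not> ty < \<theta> w"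
      then have "\<theta> w \<in> {0<..<\<delta>}" using pos[OF w(1,3)] ty by simp
      with rep(1)[OF w(1)] have "w \<in> Y" unfolding Y by (rule image_eqI)
      then show False using w by simp
    qed
    moreover have "(\<theta> \<longlongrightarrow> \<theta> w) (at w)" using cont[OF w(1,3)] by (simp add: continuous_at)
    ultimately have "\<forall>\<^sub>F z in at w. ty < \<theta> z" by (rule order_tendstoD(1)[rotated])
    then obtain r where r: "r > 0" "\<And>z. z \<noteq> w \<Longrightarrow> dist z w < r \<Longrightarrow> ty < \<theta> z" unfolding eventually_at by auto
    obtain z where "z \<in> \<Lambda>" "dist z w < r" using w(4)[OF r(1)] by blast
    then show thesis using that[of z] r(2)[of z] \<open>ty < \<theta> w\<close> by (cases "z = w") auto
  qed
  have "ty \<in> \<theta> ` \<Lambda>"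
    by (rule connectedD_interval[OF conn, of "\<theta> z1" "\<theta> z2"]) (use z1 z2 in auto)
  then obtain z where "z \<in> \<Lambda>" "\<theta> z = ty" by auto
  then have "z = y" using rep(1)[OF nL(1)] ty by metis
  then show False using \<open>z \<in> \<Lambda>\<close> yL by simp
qed

context comb_domain begin

text \<open>
  The boundary points corresponding to the wall form an arc from the foot to the tip. If it met \<open>Y\<close>
  arbitrarily close to the tip, then the tip would be an end of \<open>Y\<close>, and the arc, which does not
  contain \<open>y\<close>, could not reach the foot outside \<open>Y\<close>.
\<close>

lemma wall_avoids_arc:
  assumes X: "closure X \<inter> closure Y = {}" and Y: "open_arc Y" and y: "y \<in> Y" "y = -1 \<or> y = -\<i>"
    and q: "q = a n \<or> q = b n" and eX: "fext (of_real q) \<in> closure X" and tip: "tip n \<notin> Y"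
  shows "\<exists>T>0. \<forall>h\<ge>T. fext (Complex q h) \<notin> Y"
proof (rule ccontr)
  assume "\<not> ?thesis"
  then have meet: "\<exists>h\<ge>T. fext (Complex q h) \<in> Y" if "T > 0" for T using that by blast
  have q0: "of_real q = Complex q 0" by (simp add: complex_eq_iff)
  define e where "e = tip n"
  define w where "w = fext (of_real q)"
  define \<Lambda> where "\<Lambda> = (\<lambda>h. fext (Complex q h)) ` {0<..}"
  have cw: "continuous_on {0..} (\<lambda>h. fext (Complex q h))"
    by (intro continuous_on_compose2[OF continuous_on_fext])
      (auto simp: Complex_eq[abs_def] intro!: continuous_intros, use q in \<open>simp add: Complex_eq[symmetric] wall_in_Wext[where n = n]\<close>)
  have con: "connected \<Lambda>" unfolding \<Lambda>_def
    by (intro connected_continuous_image continuous_on_subset[OF cw]) auto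
  have nh: "norm (fext (Complex q h)) = 1" if "0 \<le> h" for h
    using norm_fext_boundary wall_in_Wext[OF that q] wall_not_in_W[OF that q] by blast
  have sph: "\<Lambda> \<subseteq> sphere 0 1" using nh by (auto simp: \<Lambda>_def)
  have eL: "e \<notin> \<Lambda>" and yL: "y \<notin> \<Lambda>" using wall_neq[OF _ q] y(2) by (auto simp: \<Lambda>_def e_def) metis+
  have e1: "norm e = 1" by (simp add: e_def norm_tip)
  have eY: "\<exists>z\<in>\<Lambda> \<inter> Y. dist z e < r" if "r > 0" for r
  proof -
    obtain T where T: "T > 0" "\<And>p. p \<in> Wext \<Longrightarrow> a n \<le> Re p \<Longrightarrow> Re p \<le> b n \<Longrightarrow> T < Im p \<Longrightarrow> dist (fext p) (tip n) \<le> r / 2"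
      using tip_limit_ext[of "r / 2" n] \<open>r > 0\<close> by auto
    obtain h where h: "h \<ge> T + 1" "fext (Complex q h) \<in> Y" using meet[of "T + 1"] T(1) by auto
    have "dist (fext (Complex q h)) (tip n) \<le> r / 2"
      using wall_in_Wext[OF _ q, of h] h T(1) q a_less_b[of n] by (intro T(2)) auto
    then show ?thesis using h T(1) \<open>r > 0\<close> by (auto simp: \<Lambda>_def e_def intro!: bexI[of _ "fext (Complex q h)"])
  qed
  have wL: "\<exists>z\<in>\<Lambda>. dist z w < r" if "r > 0" for r
  proof -
    obtain d where d: "d > 0" "\<And>h. h \<in> {0..} \<Longrightarrow> dist h 0 < d \<Longrightarrow> dist (fext (Complex q h)) (fext (Complex q 0)) < r"
      using cw[unfolded continuous_on_iff, rule_format, of 0 r] \<open>r > 0\<close> by auto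
    show ?thesis
      using d(2)[of "d/2"] d(1) by (intro bexI[of _ "fext (Complex q (d/2))"]) (auto simp: \<Lambda>_def w_def q0)
  qed
  have w1: "norm w = 1" using nh[of 0] by (simp add: w_def q0)
  have wY: "w \<notin> closure Y" using eX X by (auto simp: w_def)
  have ecl: "e \<in> closure Y" unfolding closure_approachable using eY by blast
  have we: "w \<noteq> e" using ecl wY by auto
  obtain \<alpha> \<beta> where ab: "\<alpha> < \<beta>" "\<beta> \<le> \<alpha> + 2 * pi" "Y = cis ` {\<alpha><..<\<beta>}" using Y by (auto simp: open_arc_def)
  have "closure Y \<subseteq> cis ` {\<alpha>..\<beta>}"
    unfolding ab by (intro closure_minimal image_mono compact_imp_closed compact_continuous_image continuous_intros) auto
  then obtain t where t: "e = cis t" "t \<in> {\<alpha>..\<beta>}" using ecl by auto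
  then have "t = \<alpha> \<or> t = \<beta>" using tip ab by (auto simp: e_def)
  then show False
  proof
    assume "t = \<alpha>"
    have eqY: "Y = (\<lambda>s. e * cis s) ` {0<..<\<beta> - \<alpha>}"
    proof -
      have "{\<alpha><..<\<beta>} = (\<lambda>s. \<alpha> + s) ` {0<..<\<beta> - \<alpha>}"
      proof (intro equalityI subsetI)
        fix x assume "x \<in> {\<alpha><..<\<beta>}"
        then show "x \<in> (\<lambda>s. \<alpha> + s) ` {0<..<\<beta> - \<alpha>}" by (intro image_eqI[of _ _ "x - \<alpha>"]) auto
      qed auto
      then show ?thesis unfolding ab t \<open>t = \<alpha>\<close> by (simp only: image_image cis_mult)
    qed
    have "w \<notin> Y" using wY closure_subset by blast
    show False
      by (rule arc_separation[OF con sph eL yL eqY _ _ y(1) e1 eY w1 \<open>w \<notin> Y\<close> we wL]) (use ab in simp_all)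
  next
    \<comment> \<open>Conjugation reverses the orientation, so that the tip becomes the initial end
      of the reflected arc.\<close>
    assume "t = \<beta>"
    have eqY: "cnj ` Y = (\<lambda>s. cnj e * cis s) ` {0<..<\<beta> - \<alpha>}"
    proof -
      have "{\<alpha><..<\<beta>} = (\<lambda>s. \<beta> - s) ` {0<..<\<beta> - \<alpha>}"
      proof (intro equalityI subsetI)
        fix x assume "x \<in> {\<alpha><..<\<beta>}"
        then show "x \<in> (\<lambda>s. \<beta> - s) ` {0<..<\<beta> - \<alpha>}" by (intro image_eqI[of _ _ "\<beta> - x"]) auto
      qed auto
      moreover have "cnj (cis (\<beta> - s)) = cnj (cis \<beta>) * cis s" for s
        by (simp add: cis_cnj cis_mult)
      ultimately show ?thesis unfolding ab t \<open>t = \<beta>\<close> by (simp only: image_image)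
    qed
    have con': "connected (cnj ` \<Lambda>)" using con by (intro connected_continuous_image continuous_intros)
    have dc: "dist (cnj u) (cnj v) = dist u v" for u v
      by (simp add: dist_norm flip: complex_cnj_diff)
    have eY': "\<exists>z\<in>cnj ` \<Lambda> \<inter> cnj ` Y. dist z (cnj e) < r" if r: "r > 0" for r
    proof -
      obtain z where "z \<in> \<Lambda> \<inter> Y" "dist z e < r" using eY[OF r] by blast
      then show ?thesis by (intro bexI[of _ "cnj z"]) (auto simp: dc)
    qed
    have wL': "\<exists>z\<in>cnj ` \<Lambda>. dist z (cnj w) < r" if r: "r > 0" for r
    proof -
      obtain z where "z \<in> \<Lambda>" "dist z w < r" using wL[OF r] by blast
      then show ?thesis by (intro bexI[of _ "cnj z"]) (auto simp: dc)
    qed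
    have "w \<notin> Y" using wY closure_subset by blast
    then have n: "cnj e \<notin> cnj ` \<Lambda>" "cnj y \<notin> cnj ` \<Lambda>" "cnj y \<in> cnj ` Y" "cnj w \<notin> cnj ` Y"
      using eL yL y(1) by (auto simp: image_iff)
    have s: "cnj ` \<Lambda> \<subseteq> sphere 0 1" using sph by auto
    show False
      by (rule arc_separation[OF con' s n(1,2) eqY _ _ n(3) _ eY' _ n(4) _ wL']) (use ab e1 w1 we in simp_all)
  qed
qed

end

text \<open>An equation of the geodesic that survives passage to the closure. On the unit circle its
  left side, multiplied by \<open>z\<close>, becomes 2 (z - x) (z - y), so it detects the two
  ends.\<close>

lemma Moebius_circle_equation:
  fixes \<theta> s :: real and w :: complex
  assumes "norm w < 1" "-1 \<le> s" "s \<le> 1"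
  defines "x \<equiv> Moebius_function \<theta> w (-1)" and "y \<equiv> Moebius_function \<theta> w 1" and "z \<equiv> Moebius_function \<theta> w (of_real s)"
  shows "(z - x) * (1 - y * cnj z) + (z - y) * (1 - x * cnj z) = 0"
proof -
  define u where "u = exp (\<i> * of_real \<theta>)"
  have nz: "1 - cnj w * of_real r \<noteq> 0" if "\<bar>r\<bar> \<le> 1" for r
  proof
    assume "1 - cnj w * of_real r = 0"
    then have "norm (cnj w * of_real r) = 1" by (metis eq_iff_diff_eq_0 norm_one)
    moreover have "norm w * \<bar>r\<bar> \<le> norm w * 1" using that by (intro mult_left_mono) auto
    ultimately show False using assms(1) by (simp add: norm_mult)
  qed
  have nz': "1 - w * of_real r \<noteq> 0" if "\<bar>r\<bar> \<le> 1" for r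
    using nz[OF that] by (metis complex_cnj_cnj complex_cnj_complex_of_real complex_cnj_diff complex_cnj_mult complex_cnj_one complex_cnj_zero)
  have uu: "u * cnj u = 1" by (simp add: u_def exp_cnj flip: exp_add)
  define d where "d = 1 - cnj w * of_real s"
  define d1 where "d1 = 1 + cnj w"
  define d2 where "d2 = 1 - cnj w"
  define d' where "d' = 1 - w * of_real s"
  have ds: "d \<noteq> 0" "d1 \<noteq> 0" "d2 \<noteq> 0" "d' \<noteq> 0" using nz[of s] nz[of "-1"] nz[of 1] nz'[of s] assms(2,3) by (auto simp: d_def d1_def d2_def d'_def)
  have x: "x = u * (-1 - w) / d1" and y: "y = u * (1 - w) / d2" and z: "z = u * (of_real s - w) / d"
    unfolding x_def y_def z_def Moebius_function_def u_def d_def d1_def d2_def by simp_all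
  have cz: "cnj z = cnj u * (of_real s - cnj w) / d'"
    unfolding z by (simp add: d_def d'_def)
  have 1: "z - x = u * (1 + of_real s) * (1 - w * cnj w) / (d * d1)"
  proof -
    have "(of_real s - w) * d1 - (-1 - w) * d = (1 + of_real s) * (1 - w * cnj w)"
      by (simp add: d_def d1_def algebra_simps)
    then show ?thesis using ds unfolding x z by (simp add: diff_frac_eq mult.assoc flip: right_diff_distrib)
  qed
  have 2: "z - y = u * (of_real s - 1) * (1 - w * cnj w) / (d * d2)"
  proof -
    have "(of_real s - w) * d2 - (1 - w) * d = (of_real s - 1) * (1 - w * cnj w)"
      by (simp add: d_def d2_def algebra_simps)
    then show ?thesis using ds unfolding y z by (simp add: diff_frac_eq mult.assoc flip: right_diff_distrib)
  qed
  have 3: "1 - y * cnj z = (1 - of_real s) * (1 - w * cnj w) / (d2 * d')"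
  proof -
    have "y * cnj z = (u * cnj u) * ((1 - w) * (of_real s - cnj w)) / (d2 * d')" unfolding y cz by simp
    also have "\<dots> = ((1 - w) * (of_real s - cnj w)) / (d2 * d')" by (simp add: uu)
    finally have "1 - y * cnj z = (d2 * d' - (1 - w) * (of_real s - cnj w)) / (d2 * d')"
      using ds by (simp add: diff_divide_distrib)
    also have "d2 * d' - (1 - w) * (of_real s - cnj w) = (1 - of_real s) * (1 - w * cnj w)"
      by (simp add: d'_def d2_def algebra_simps)
    finally show ?thesis .
  qed
  have 4: "1 - x * cnj z = (1 + of_real s) * (1 - w * cnj w) / (d1 * d')"
  proof -
    have "x * cnj z = (u * cnj u) * ((-1 - w) * (of_real s - cnj w)) / (d1 * d')" unfolding x cz by simp
    also have "\<dots> = ((-1 - w) * (of_real s - cnj w)) / (d1 * d')" by (simp add: uu)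
    finally have "1 - x * cnj z = (d1 * d' - (-1 - w) * (of_real s - cnj w)) / (d1 * d')"
      using ds by (simp add: diff_divide_distrib)
    also have "d1 * d' - (-1 - w) * (of_real s - cnj w) = (1 + of_real s) * (1 - w * cnj w)"
      by (simp add: d'_def d1_def algebra_simps)
    finally show ?thesis .
  qed
  show ?thesis unfolding 1 2 3 4 using ds by (simp add: field_simps)
qed

lemma Moebius_ends_neq: "norm w < 1 \<Longrightarrow> Moebius_function \<theta> w (-1) \<noteq> Moebius_function \<theta> w 1"
proof
  assume w: "norm w < 1" and eq: "Moebius_function \<theta> w (-1) = Moebius_function \<theta> w 1"
  have "1 + cnj w \<noteq> 0" "1 - cnj w \<noteq> 0"
    using w by (metis add_eq_0_iff complex_mod_cnj norm_minus_cancel norm_one order_less_irrefl,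
                metis complex_mod_cnj norm_one order_less_irrefl right_minus_eq)
  then have "(-1 - w) * (1 - cnj w) = (1 - w) * (1 + cnj w)"
    using eq by (simp add: Moebius_function_def field_simps)
  then have "w * cnj w = 1" by (simp add: algebra_simps)
  then have "norm w * norm w = 1" by (metis complex_mod_cnj norm_mult norm_one)
  moreover have "norm w * norm w \<le> norm w * 1" using w by (intro mult_left_mono) auto
  ultimately show False using w by simp
qed

text \<open>Leaves are mere point sets, so their ends have to be recovered from them, namely as the
  points of the closure on the unit circle.\<close>

lemma closure_geodesic_circle:
  assumes "z \<in> closure (geodesic x y)" "norm z = 1"
  shows "z = x \<or> z = y"
proof -
  define F where "F z = (z - x) * (1 - y * cnj z) + (z - y) * (1 - x * cnj z)" for z
  have "continuous_on UNIV F" unfolding F_def by (intro continuous_intros)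
  then have "closed (F -` {0})" by (intro continuous_closed_vimage) (auto simp: continuous_on_eq_continuous_at)
  moreover have "geodesic x y \<subseteq> F -` {0}"
    using Moebius_circle_equation by (auto simp: geodesic_def F_def)
  ultimately have "closure (geodesic x y) \<subseteq> F -` {0}" by (simp add: closure_minimal)
  then have F0: "F z = 0" using assms by auto
  have cz: "z * cnj z = 1" using assms(2) by (metis complex_norm_square of_real_1 one_power2)
  have "z * F z = (z - x) * (z - y * (z * cnj z)) + (z - y) * (z - x * (z * cnj z))"
    by (simp add: F_def algebra_simps)
  also have "\<dots> = 2 * ((z - x) * (z - y))" by (simp add: cz algebra_simps)
  finally show ?thesis using F0 by auto
qed

lemma geodesic_ends:
  assumes "geodesic x y \<noteq> {}"
  shows "x \<in> closure (geodesic x y)" "y \<in> closure (geodesic x y)" "x \<noteq> y"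
proof -
  obtain \<theta> w where w: "norm w < 1" "Moebius_function \<theta> w (-1) = x" "Moebius_function \<theta> w 1 = y"
    using assms by (auto simp: geodesic_def)
  show "x \<noteq> y" using Moebius_ends_neq[OF w(1)] w by auto
  have nz: "1 - cnj w * of_real r \<noteq> 0" if "\<bar>r\<bar> \<le> 1" for r
  proof
    assume "1 - cnj w * of_real r = 0"
    then have "norm (cnj w * of_real r) = 1" by (metis eq_iff_diff_eq_0 norm_one)
    moreover have "norm w * \<bar>r\<bar> \<le> norm w * 1" using that by (intro mult_left_mono) auto
    ultimately show False using w(1) by (simp add: norm_mult)
  qed
  have c: "continuous_on {-1..1} (\<lambda>s. Moebius_function \<theta> w (of_real s))"
    unfolding Moebius_function_def using nz by (intro continuous_intros) (auto simp: abs_le_iff)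
  have "(\<lambda>s. Moebius_function \<theta> w (of_real s)) ` closure {-1<..<1} \<subseteq> closure (geodesic x y)"
  proof (rule image_closure_subset)
    have "Moebius_function \<theta> w (of_real s) \<in> geodesic x y" if "-1 < s" "s < 1" for s
      unfolding geodesic_def using w that by blast
    then show "(\<lambda>s. Moebius_function \<theta> w (of_real s)) ` {-1<..<1} \<subseteq> closure (geodesic x y)"
      using closure_subset[of "geodesic x y"] by auto
  qed (use c in auto)
  moreover have "-1 \<in> closure {-1<..<1::real}" "1 \<in> closure {-1<..<1::real}" by auto
  ultimately have "Moebius_function \<theta> w (of_real (-1)) \<in> closure (geodesic x y)"
    "Moebius_function \<theta> w (of_real 1) \<in> closure (geodesic x y)" by blast+
  then show "x \<in> closure (geodesic x y)" "y \<in> closure (geodesic x y)" using w by auto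
qed

lemma geodesic_commute: "geodesic x y = geodesic y x"
proof -
  have "geodesic x y \<subseteq> geodesic y x" for x y
  proof
    fix z assume "z \<in> geodesic x y"
    then obtain \<theta> w s where z: "z = Moebius_function \<theta> w (of_real s)" "norm w < 1"
      "Moebius_function \<theta> w (-1) = x" "Moebius_function \<theta> w 1 = y" "-1 < s" "s < 1" by (auto simp: geodesic_def)
    have neg: "Moebius_function (\<theta> + pi) (- w) v = Moebius_function \<theta> w (- v)" for v
    proof -
      have e: "exp (\<i> * of_real (\<theta> + pi)) = - exp (\<i> * of_real \<theta>)" by (simp add: distrib_left exp_add)
      have "- exp (\<i> * of_real \<theta>) * (v - - w) = exp (\<i> * of_real \<theta>) * (- v - w)" by (simp add: algebra_simps)
      then show ?thesis unfolding Moebius_function_def e by simp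
    qed
    have "z = Moebius_function (\<theta> + pi) (- w) (of_real (- s))" unfolding neg using z(1) by simp
    moreover have "Moebius_function (\<theta> + pi) (- w) (-1) = y" unfolding neg using z(4) by simp
    moreover have "Moebius_function (\<theta> + pi) (- w) 1 = x" unfolding neg by (rule z(3))
    moreover have "norm (- w) < 1" "-1 < - s" "- s < 1" using z by auto
    ultimately show "z \<in> geodesic y x" unfolding geodesic_def by blast
  qed
  then show ?thesis by blast
qed

text \<open>Ends can be recovered from nonempty geodesics only, so one disk automorphism that yields
  this leaf has to be exhibited.\<close>

lemma leaf_g_nonempty: "leaf_g \<noteq> {}"
proof -
  \<comment> \<open>The numbers 1 + \<i> s and 1 - \<i> s have the arguments \<pi>/8 and -\<pi>/8.
    Without rotation, 1 would be turned by -\<pi>/4 and -1 by \<pi>/4; the rotation by \<theta> =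
    -\<pi>/4 then yields -\<i> and -1.\<close>
  define s where "s = tan (pi / 8)"
  define w where "w = \<i> * of_real s"
  have s: "0 \<le> s" "s < 1" unfolding s_def
    using tan_pos_pi2_le[of "pi/8"] tan_mono_lt_eq[of "pi/8" "pi/4"] tan_45 by auto
  have e8: "cis (pi/8) * (1 - of_real s * \<i>) = of_real (cos (pi/8) + s * sin (pi/8))"
  proof -
    have "cos (pi/8) \<noteq> 0" using cos_gt_zero_pi[of "pi/8"] by simp
    then show ?thesis by (simp add: complex_eq_iff s_def tan_def)
  qed
  define k where "k = cos (pi/8) + s * sin (pi/8)"
  have k: "k > 0" unfolding k_def using s sin_ge_zero[of "pi/8"] cos_gt_zero_pi[of "pi/8"] by (simp add: add_pos_nonneg)
  have m: "1 - of_real s * \<i> = of_real k * cis (- (pi/8))"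
  proof -
    have "(cis (- (pi/8)) * cis (pi/8)) * (1 - of_real s * \<i>) = cis (- (pi/8)) * of_real k"
      unfolding mult.assoc e8 k_def ..
    then show ?thesis by (simp add: cis_mult mult.commute)
  qed
  then have "cnj (1 - of_real s * \<i>) = cnj (of_real k * cis (- (pi/8)))" by simp
  then have p: "1 + of_real s * \<i> = of_real k * cis (pi/8)" by (simp add: cis_cnj)
  define \<theta> where "\<theta> = pi / 4 - pi / 2"
  have cs: "exp (\<i> * of_real \<theta>) = cis \<theta>" by (simp add: cis_conv_exp)
  have "Moebius_function \<theta> w 1 = cis \<theta> * (of_real k * cis (- (pi/8))) / (of_real k * cis (pi/8))"
    unfolding Moebius_function_def cs w_def using m p by (simp add: mult.commute)
  also have "\<dots> = cis (\<theta> - pi/8 - pi/8)" using k by (simp add: cis_mult cis_divide)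
  also have "\<dots> = -\<i>" by (simp add: \<theta>_def complex_eq_iff field_simps)
  finally have 1: "Moebius_function \<theta> w 1 = -\<i>" .
  have "Moebius_function \<theta> w (-1) = cis \<theta> * (- (of_real k * cis (pi/8))) / (of_real k * cis (- (pi/8)))"
  proof -
    have "-1 - w = - (of_real k * cis (pi/8))" unfolding p[symmetric] w_def by simp
    moreover have "1 - cnj w * (-1) = of_real k * cis (- (pi/8))" unfolding m[symmetric] w_def by simp
    ultimately show ?thesis unfolding Moebius_function_def cs by simp
  qed
  also have "\<dots> = - cis (\<theta> + pi/8 + pi/8)" using k by (simp add: cis_mult cis_divide)
  also have "\<dots> = -1" by (simp add: \<theta>_def)
  finally have 2: "Moebius_function \<theta> w (-1) = -1" .
  have "norm w < 1" using s by (simp add: w_def norm_mult)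
  then have "Moebius_function \<theta> w (of_real 0) \<in> leaf_g" using 1 2
    unfolding leaf_g_def geodesic_def by (intro CollectI exI[of _ \<theta>] exI[of _ w] exI[of _ 0]) auto
  then show ?thesis by blast
qed

lemma geodesic_eq_leaf_g:
  assumes "geodesic x y = leaf_g" "norm x = 1" "norm y = 1"
  shows "{x, y} = {-1, -\<i>}"
proof -
  have ne: "geodesic x y \<noteq> {}" using assms leaf_g_nonempty by simp
  have "x = -1 \<or> x = -\<i>" "y = -1 \<or> y = -\<i>"
    using geodesic_ends[OF ne] closure_geodesic_circle[of _ "-1" "-\<i>"] assms unfolding leaf_g_def by auto
  then show ?thesis using geodesic_ends(3)[OF ne] by auto
qed

section \<open>The lower bound\<close>

text \<open>The complement of the arc in the circle is the image of the compact interval from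
  \<beta> to \<alpha> + 2\<pi>; hence arcs are relatively open.\<close>

lemma open_arc_sphere:
  assumes "open_arc X"
  obtains K where "closed K" "X = sphere 0 1 \<inter> - K"
proof -
  obtain \<alpha> \<beta> where ab: "\<alpha> < \<beta>" "\<beta> \<le> \<alpha> + 2 * pi" "X = cis ` {\<alpha><..<\<beta>}" using assms by (auto simp: open_arc_def)
  define K where "K = cis ` {\<beta>..\<alpha> + 2 * pi}"
  have "closed K" unfolding K_def
    by (intro compact_imp_closed compact_continuous_image continuous_intros) auto
  moreover have "X = sphere 0 1 \<inter> - K"
  proof (intro equalityI subsetI)
    fix z assume "z \<in> X"
    then obtain t where t: "z = cis t" "t \<in> {\<alpha><..<\<beta>}" unfolding ab by blast
    have "z \<notin> K"
    proof
      assume "z \<in> K"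
      then obtain s where s: "z = cis s" "s \<in> {\<beta>..\<alpha> + 2 * pi}" unfolding K_def by blast
      have "exp (\<i> * of_real s) = exp (\<i> * of_real t)" using s(1) t(1) by (simp add: cis_conv_exp)
      moreover have "\<bar>Im (\<i> * of_real s) - Im (\<i> * of_real t)\<bar> < 2 * pi" using s(2) t(2) by auto
      ultimately have "\<i> * of_real s = \<i> * of_real t" by (rule exp_complex_eqI[rotated])
      then show False using s(2) t(2) by auto
    qed
    then show "z \<in> sphere 0 1 \<inter> - K" using t by auto
  next
    fix z assume z: "z \<in> sphere 0 1 \<inter> - K"
    define s where "s = Arg2pi (z / cis \<alpha>)"
    have "z / cis \<alpha> = of_real (norm (z / cis \<alpha>)) * exp (\<i> * of_real s)" "0 \<le> s" "s < 2 * pi"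
      unfolding s_def using Arg2pi[of "z / cis \<alpha>"] by (auto simp: is_Arg_def)
    moreover have "norm (z / cis \<alpha>) = 1" using z by (simp add: norm_divide)
    ultimately have s: "z / cis \<alpha> = cis s" "0 \<le> s" "s < 2 * pi" by (simp_all add: cis_conv_exp)
    then have zs: "z = cis (\<alpha> + s)" by (simp add: cis_mult[symmetric] field_simps)
    have "s \<noteq> 0"
    proof
      assume "s = 0"
      then have "z = cis (\<alpha> + 2 * pi)" using zs by (simp add: cis_mult[symmetric])
      then have "z \<in> K" unfolding K_def using ab by auto
      then show False using z by simp
    qed
    moreover have "\<not> \<beta> \<le> \<alpha> + s"
    proof
      assume "\<beta> \<le> \<alpha> + s"
      then have "z \<in> K" unfolding K_def zs using s by (intro imageI) auto
      then show False using z by simp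
    qed
    ultimately show "z \<in> X" unfolding ab zs using s by (intro imageI) auto
  qed
  ultimately show thesis using that by blast
qed

lemma open_arc_ball:
  assumes "open_arc X" "x \<in> X"
  obtains d where "d > 0" "\<And>z. norm z = 1 \<Longrightarrow> dist z x \<le> d \<Longrightarrow> z \<in> X"
proof -
  obtain K where K: "closed K" "X = sphere 0 1 \<inter> - K" using open_arc_sphere[OF assms(1)] by blast
  have "open (- K)" using K(1) by auto
  moreover have "x \<in> - K" using assms(2) K(2) by auto
  ultimately obtain d where "d > 0" "cball x d \<subseteq> - K" using open_contains_cball by blast
  then show thesis using that[of d] K(2) by (auto simp: dist_commute subset_iff)
qed

lemma V_map_simps [simp]: "Re (V_map e w) = Re w" "Im (V_map e w) = e * Im w"
  by (auto simp: V_map_def)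

lemma V_map_inverse [simp]: "e \<noteq> 0 \<Longrightarrow> V_map e (V_map (1 / e) w) = w" "e \<noteq> 0 \<Longrightarrow> V_map (1 / e) (V_map e w) = w"
  by (auto simp: complex_eq_iff)

lemma continuous_on_V_map: "continuous_on A (V_map e)"
  unfolding V_map_def Complex_eq by (intro continuous_intros)

context comb_domain begin

lemma V_map_in_W_iff: "0 < e \<Longrightarrow> V_map e w \<in> W \<longleftrightarrow> w \<in> W"
  by (auto simp: mem_W mult_less_0_iff)

lemma V_map_image_W: "0 < e \<Longrightarrow> V_map e ` W = W"
proof (intro equalityI subsetI)
  fix w assume e: "0 < e" and w: "w \<in> W"
  then have "V_map (1 / e) w \<in> W" by (subst V_map_in_W_iff) auto
  moreover have "w = V_map e (V_map (1 / e) w)" using e by simp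
  ultimately show "w \<in> V_map e ` W" by blast
qed (auto simp: V_map_in_W_iff)

text \<open>The point of the circle that belongs to a boundary point of \<open>W\<close> for the
  parameter \<open>e\<close>. The stretching leaves \<open>W\<close> unchanged and acts through this
  correspondence alone.\<close>

definition fscaled :: "real \<Rightarrow> complex \<Rightarrow> complex" where
  "fscaled e w = fext (V_map (1 / e) w)"

text \<open>The composition of \<open>fext\<close> with the rescaled arc is continuous up to its
  ends, hence a connecting curve in the disk; mapping it forward again gives the arc itself.\<close>

lemma circle_in_family:
  assumes e: "0 < e" and c: "\<And>u. c u = of_real r * cis (\<alpha> + \<beta> * u)"
    and inW: "\<And>u. u \<in> {0<..<1} \<Longrightarrow> c u \<in> W"
    and ends: "V_map (1 / e) (c 0) \<in> Wext" "V_map (1 / e) (c 1) \<in> Wext"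
    and IJ: "fscaled e (c 0) \<in> I" "fscaled e (c 1) \<in> J"
  shows "\<exists>\<gamma>\<in>Gamma_eps \<phi> I J e. \<forall>u\<in>{0<..<1}. \<gamma> u = c u"
proof -
  define g where "g u = fext (V_map (1 / e) (c u))" for u
  have W': "V_map (1 / e) (c u) \<in> W" if "u \<in> {0<..<1}" for u
    using inW[OF that] e by (subst V_map_in_W_iff) auto
  have ext: "V_map (1 / e) (c u) \<in> Wext" if "u \<in> {0..1}" for u
    using ends W'[of u] W_subset_Wext that by (cases "u = 0"; cases "u = 1") auto
  have "continuous_on {0..1} c" unfolding c by (intro continuous_intros)
  then have "continuous_on {0..1} (\<lambda>u. V_map (1 / e) (c u))"
    by (rule continuous_on_compose2[OF continuous_on_V_map]) auto
  then have "path g" unfolding path_def g_def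
    by (rule continuous_on_compose2[OF continuous_on_fext]) (use ext in auto)
  moreover have gf: "g u = f (V_map (1 / e) (c u))" if "u \<in> {0<..<1}" for u
    using W'[OF that] by (simp add: g_def fext_def)
  ultimately have "g \<in> connecting_curves I J"
    unfolding connecting_curves_def pathstart_def pathfinish_def
    using IJ f_in_ball[OF W'] by (auto simp: g_def fscaled_def simp del: mem_ball)
  then have "V_map e \<circ> \<phi> \<circ> g \<in> Gamma_eps \<phi> I J e" unfolding Gamma_eps_def by blast
  moreover have "(V_map e \<circ> \<phi> \<circ> g) u = c u" if "u \<in> {0<..<1}" for u
    using gf[OF that] W'[OF that] e by simp
  ultimately show ?thesis by blast
qed

text \<open>The logarithmic length of that part of the gap from \<open>b (Suc n)\<close> to
  \<open>a n\<close> which lies beyond the radius \<open>x\<close>; \<open>tooth_len\<close> is the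
  analogue for the interval of the tooth.\<close>

definition floor_len :: "nat \<Rightarrow> real \<Rightarrow> real" where
  "floor_len n x = max 0 (ln (a n) - ln (max (b (Suc n)) x))"

definition tooth_len :: "nat \<Rightarrow> real \<Rightarrow> real" where
  "tooth_len n x = max 0 (ln (b n) - ln (max (a n) x))"

text \<open>The arc may be run in either direction, according to which of \<open>P\<close> and
  \<open>Q\<close> is \<open>I\<close>. The indicator of \<open>W\<close> extends the metric by
  zero, so that the integral can be taken over a fixed set \<open>T\<close> of angles.\<close>

lemma admissible_arc_ge:
  assumes adm: "admissible W (Gamma_eps \<phi> I J e) \<rho>" and e: "0 < e" and r: "0 < r"
    and IJ: "I = P \<and> J = Q \<or> I = Q \<and> J = P"
    and ang: "t1 < t2" and inW: "\<And>t. t \<in> {t1<..<t2} \<Longrightarrow> of_real r * cis t \<in> W"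
    and ends: "V_map (1 / e) (of_real r * cis t1) \<in> Wext" "V_map (1 / e) (of_real r * cis t2) \<in> Wext"
    and val: "fscaled e (of_real r * cis t1) \<in> Q" "fscaled e (of_real r * cis t2) \<in> P"
    and T: "{t1<..<t2} \<subseteq> T" "T \<in> sets borel"
  shows "1 \<le> (\<integral>\<^sup>+\<theta>\<in>T. ennreal r * (\<rho> (of_real r * cis \<theta>) * indicator W (of_real r * cis \<theta>)) \<partial>lborel)"
proof -
  obtain \<alpha> \<beta> where ab: "\<beta> \<noteq> 0" "\<And>u. u \<in> {0<..<1} \<Longrightarrow> \<alpha> + \<beta> * u \<in> {t1<..<t2}"
    "V_map (1 / e) (of_real r * cis \<alpha>) \<in> Wext" "V_map (1 / e) (of_real r * cis (\<alpha> + \<beta>)) \<in> Wext"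
    "fscaled e (of_real r * cis \<alpha>) \<in> I" "fscaled e (of_real r * cis (\<alpha> + \<beta>)) \<in> J"
  proof (cases "I = Q \<and> J = P")
    case True
    have "t1 + (t2 - t1) * u \<in> {t1<..<t2}" if "u \<in> {0<..<1}" for u
    proof -
      have "0 < (t2 - t1) * u" "(t2 - t1) * u < (t2 - t1) * 1"
        using that ang by (auto intro!: mult_strict_left_mono simp del: mult_1_right)
      then show ?thesis by (auto simp: algebra_simps)
    qed
    then show thesis using that[of "t2 - t1" t1] ang ends val True by simp
  next
    case False
    then have "I = P \<and> J = Q" using IJ by auto
    moreover have "t2 + (t1 - t2) * u \<in> {t1<..<t2}" if "u \<in> {0<..<1}" for u
    proof -
      have "0 < (t2 - t1) * u" "(t2 - t1) * u < (t2 - t1) * 1"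
        using that ang by (auto intro!: mult_strict_left_mono simp del: mult_1_right)
      then show ?thesis by (auto simp: algebra_simps)
    qed
    ultimately show thesis using that[of "t1 - t2" t2] ang ends val by simp
  qed
  define c where "c u = of_real r * cis (\<alpha> + \<beta> * u)" for u
  obtain \<gamma> where \<gamma>: "\<gamma> \<in> Gamma_eps \<phi> I J e" "\<And>u. u \<in> {0<..<1} \<Longrightarrow> \<gamma> u = c u"
    using circle_in_family[OF e c_def, where I = I and J = J] inW ab by (auto simp: c_def)
  have \<gamma>': "\<gamma> u = 0 + of_real r * cis (\<alpha> + \<beta> * u)" if "u \<in> {0<..<1}" for u using \<gamma>(2)[OF that] by (simp add: c_def)
  have W[measurable]: "W \<in> sets borel" using open_W by auto
  have meas: "(\<lambda>w. \<rho> w * indicator W w) \<in> borel_measurable borel"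
    using adm W unfolding admissible_def by (subst (asm) borel_measurable_restrict_space_iff_ennreal) auto
  have eq: "\<rho> (\<gamma> u) = \<rho> (\<gamma> u) * indicator W (\<gamma> u)" if "u \<in> {0<..<1}" for u
    using inW[OF ab(2)[OF that]] \<gamma>'[OF that] by simp
  have rng: "\<alpha> + \<beta> * u \<in> T" if "u \<in> {0<..<1}" for u using ab(2)[OF that] T(1) by blast
  note L = line_integral_circle_le[OF \<gamma>' r ab(1) meas eq rng T(2)]
  have "1 \<le> line_integral \<rho> \<gamma>" using adm \<gamma>(1) L(1) unfolding admissible_def by blast
  also have "\<dots> \<le> (\<integral>\<^sup>+\<theta>\<in>T. ennreal r * (\<rho> (of_real r * cis \<theta>) * indicator W (of_real r * cis \<theta>)) \<partial>lborel)"
    using L(2) by simp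
  finally show ?thesis .
qed

lemma polar_box_norm: "w \<in> polar_box 0 x1 x2 y1 y2 \<Longrightarrow> exp x1 < norm w \<and> norm w < exp x2"
  by (auto simp: polar_box_def in_box_complex_iff)

text \<open>The left side belongs to \<open>Q\<close> beyond the distance C e, and the floor and the
  walls from \<open>N\<close> on belong to \<open>P\<close>. The circular arcs between them sweep
  disjoint annuli, so their energies add up; the finitely many scales before \<open>N\<close> are
  given up.\<close>

lemma modulus_lower_bound:
  assumes PQ: "open_arc P" "open_arc Q" "-1 \<in> P" "-\<i> \<in> Q" and IJ: "I = P \<and> J = Q \<or> I = Q \<and> J = P"
  shows "\<exists>C\<ge>1. \<exists>N. \<forall>e>0. \<forall>k\<ge>N. ennreal (1 / pi * (\<Sum>n\<in>{N..<k}. 2 * floor_len n (C * e) + tooth_len n (C * e)))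
     \<le> curve_modulus W (Gamma_eps \<phi> I J e)"
proof -
  obtain d1 where d1: "d1 > 0" "\<And>z. norm z = 1 \<Longrightarrow> dist z (-1) \<le> d1 \<Longrightarrow> z \<in> P" using open_arc_ball[OF PQ(1,3)] by blast
  obtain d2 where d2: "d2 > 0" "\<And>z. norm z = 1 \<Longrightarrow> dist z (-\<i>) \<le> d2 \<Longrightarrow> z \<in> Q" using open_arc_ball[OF PQ(2,4)] by blast
  obtain c where c: "c > 0" "\<And>p. p \<in> Wext \<Longrightarrow> Re p < c \<Longrightarrow> - c < Im p \<Longrightarrow> dist (fext p) (-1) \<le> d1"
    using zero_limit_ext[OF d1(1)] by blast
  obtain C where C: "C \<ge> 1" "\<And>p. p \<in> Wext \<Longrightarrow> Im p \<le> 0 \<Longrightarrow> C < norm p \<Longrightarrow> dist (fext p) (-\<i>) \<le> d2"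
    using lower_limit_ext[OF d2(1)] by blast
  obtain N where N: "b N < c" using order_tendstoD(2)[OF b_lim c(1)] by (auto simp: eventually_sequentially)
  have main: "ennreal (1 / pi * (\<Sum>n\<in>{N..<k}. 2 * floor_len n (C * e) + tooth_len n (C * e))) \<le> (\<integral>\<^sup>+w\<in>W. (\<rho> w)\<^sup>2 \<partial>lborel)"
    if e: "0 < e" and k: "N \<le> k" and adm: "admissible W (Gamma_eps \<phi> I J e) \<rho>" for e k \<rho>
  proof -
    define h where "h w = \<rho> w * indicator W w" for w
    have W[measurable]: "W \<in> sets borel" using open_W by auto
    have h[measurable]: "h \<in> borel_measurable borel"
      using adm W unfolding admissible_def h_def by (subst (asm) borel_measurable_restrict_space_iff_ennreal) auto
    have Ce: "0 < C * e" using C e by simp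
    have left: "V_map (1 / e) (of_real r * cis (- (pi/2))) \<in> Wext \<and> fscaled e (of_real r * cis (- (pi/2))) \<in> Q" if "C * e < r" for r
    proof -
      have r: "0 < r" "C < r / e" using that Ce e by (auto simp: field_simps)
      have eq: "V_map (1 / e) (of_real r * cis (- (pi/2))) = Complex 0 (- (r / e))" by (simp add: complex_eq_iff)
      have in1: "Complex 0 (- (r / e)) \<in> Wext" using left_in_Wext[of "r / e"] r e by simp
      have "norm (Complex 0 (- (r / e))) = r / e" using r e by (simp add: cmod_def)
      then have "dist (fext (Complex 0 (- (r / e)))) (-\<i>) \<le> d2" using in1 r e by (intro C(2)) auto
      then show ?thesis using in1 norm_fext_boundary[OF in1 left_not_in_W] d2(2) unfolding fscaled_def eq by blast
    qed
    have fl: "ennreal (2 / pi * floor_len n (C * e)) \<le> (\<integral>\<^sup>+w\<in>{w. b (Suc n) < norm w \<and> norm w < a n}. (h w)\<^sup>2 \<partial>lborel)"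
      if n: "N \<le> n" for n
    proof (cases "max (b (Suc n)) (C * e) < a n")
      case True
      define x1 x2 where "x1 = ln (max (b (Suc n)) (C * e))" and "x2 = ln (a n)"
      have x: "x1 < x2" "exp x1 = max (b (Suc n)) (C * e)" "exp x2 = a n"
        using True b_pos[of "Suc n"] a_pos[of n] by (auto simp: x1_def x2_def)
      have "ennreal ((x2 - x1) / (0 - (- (pi/2)))) \<le> (\<integral>\<^sup>+w\<in>polar_box 0 x1 x2 (- (pi/2)) 0. (h w)\<^sup>2 \<partial>lborel)"
      proof (rule polar_box_energy_ge[OF h])
        fix x assume xx: "x \<in> {x1<..<x2}"
        define r where "r = exp x"
        have r: "0 < r" "b (Suc n) < r" "C * e < r" "r < a n"
        proof -
          have "exp x1 < r" "r < exp x2" using xx by (auto simp: r_def)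
          then show "b (Suc n) < r" "C * e < r" "r < a n" "0 < r" unfolding x by (auto simp: r_def)
        qed
        have "1 \<le> (\<integral>\<^sup>+\<theta>\<in>{-(pi/2)<..<0}. ennreal r * (\<rho> (of_real r * cis \<theta>) * indicator W (of_real r * cis \<theta>)) \<partial>lborel)"
        proof (rule admissible_arc_ge[OF adm e r(1) IJ])
          show "of_real r * cis t \<in> W" if "t \<in> {- (pi / 2)<..<0}" for t
            using that r cos_gt_zero_pi[of t] sin_lt_zero[of "t + 2 * pi"] by (auto simp: mem_W mult_less_0_iff)
          have eq: "V_map (1 / e) (of_real r * cis 0) = of_real r" by (simp add: complex_eq_iff)
          show in2: "V_map (1 / e) (of_real r * cis 0) \<in> Wext" unfolding eq using real_in_Wext r by auto
          have "r < c" using r a_less_b[of n] b_decreasing[OF n] N by linarith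
          then have "dist (fext (of_real r)) (-1) \<le> d1" using in2 c unfolding eq by (intro c(2)) auto
          moreover have "of_real r \<notin> W" using W_gap[of n "of_real r"] r by auto
          ultimately show "fscaled e (of_real r * cis 0) \<in> P"
            unfolding fscaled_def eq using norm_fext_boundary[of "of_real r"] in2 eq d1(2) by auto
        qed (use left r in auto)
        then show "1 \<le> (\<integral>\<^sup>+\<theta>\<in>{- (pi / 2)<..<0}. ennreal (exp x) * h (0 + of_real (exp x) * cis \<theta>) \<partial>lborel)"
          by (simp add: h_def r_def)
      qed (use x pi_gt_zero in auto)
      also have "(x2 - x1) / (0 - (- (pi/2))) = 2 / pi * floor_len n (C * e)"
        using x by (simp add: floor_len_def x1_def x2_def)
      also have "(\<integral>\<^sup>+w\<in>polar_box 0 x1 x2 (- (pi/2)) 0. (h w)\<^sup>2 \<partial>lborel) \<le> (\<integral>\<^sup>+w\<in>{w. b (Suc n) < norm w \<and> norm w < a n}. (h w)\<^sup>2 \<partial>lborel)"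
        using polar_box_norm x by (intro nn_integral_mono) (fastforce split: split_indicator)
      finally show ?thesis .
    next
      case False
      then have "floor_len n (C * e) = 0" using a_pos[of n] b_pos[of "Suc n"] by (auto simp: floor_len_def)
      then show ?thesis by simp
    qed
    have to: "ennreal (1 / pi * tooth_len n (C * e)) \<le> (\<integral>\<^sup>+w\<in>{w. a n < norm w \<and> norm w < b n}. (h w)\<^sup>2 \<partial>lborel)"
      if n: "N \<le> n" for n
    proof (cases "max (a n) (C * e) < b n")
      case True
      define x1 x2 where "x1 = ln (max (a n) (C * e))" and "x2 = ln (b n)"
      have x: "x1 < x2" "exp x1 = max (a n) (C * e)" "exp x2 = b n"
        using True b_pos[of n] a_pos[of n] by (auto simp: x1_def x2_def)
      have "ennreal ((x2 - x1) / (pi/2 - (- (pi/2)))) \<le> (\<integral>\<^sup>+w\<in>polar_box 0 x1 x2 (- (pi/2)) (pi/2). (h w)\<^sup>2 \<partial>lborel)"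
      proof (rule polar_box_energy_ge[OF h])
        fix x assume xx: "x \<in> {x1<..<x2}"
        define r where "r = exp x"
        have r: "0 < r" "a n < r" "C * e < r" "r < b n"
        proof -
          have "exp x1 < r" "r < exp x2" using xx by (auto simp: r_def)
          then show "a n < r" "C * e < r" "r < b n" "0 < r" unfolding x by (auto simp: r_def)
        qed
        \<comment> \<open>The circle of radius \<open>r\<close> meets the left wall of the tooth at
          this angle, which is below \<pi>/2; the arc is nevertheless estimated with the full
          opening \<pi>.\<close>
        define t2 where "t2 = arccos (a n / r)"
        have q: "0 < a n / r" "a n / r < 1" using r a_pos[of n] by auto
        have t2: "0 < t2" "t2 < pi / 2" "r * cos t2 = a n"
          using q arccos_lt_bounded[of "a n / r"] arccos_less_arccos[of 0 "a n / r"] r by (auto simp: t2_def)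
        have "1 \<le> (\<integral>\<^sup>+\<theta>\<in>{-(pi/2)<..<pi/2}. ennreal r * (\<rho> (of_real r * cis \<theta>) * indicator W (of_real r * cis \<theta>)) \<partial>lborel)"
        proof (rule admissible_arc_ge[OF adm e r(1) IJ, where ?t2.0 = t2])
          show "of_real r * cis t \<in> W" if t: "t \<in> {- (pi / 2)<..<t2}" for t
          proof (cases "t < 0")
            case True
            then show ?thesis using t r cos_gt_zero_pi[of t] sin_lt_zero[of "t + 2 * pi"] by (auto simp: mem_W mult_less_0_iff)
          next
            case False
            have "cos t2 < cos t" using t t2 False by (intro cos_monotone_0_pi) auto
            then have "a n < r * cos t" using t2(3) r(1) by (metis mult_strict_left_mono)
            moreover have "r * cos t \<le> r * 1" using r(1) by (intro mult_left_mono) auto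
            then have "r * cos t < b n" using r(4) by linarith
            ultimately show ?thesis by (intro W_tooth[of n]) auto
          qed
          have s: "0 < sin t2" using t2 by (intro sin_gt_zero) auto
          have eq: "V_map (1 / e) (of_real r * cis t2) = Complex (a n) (r * sin t2 / e)" using t2(3) by (simp add: complex_eq_iff)
          have hp: "0 \<le> r * sin t2 / e" using r s e by simp
          have in2: "Complex (a n) (r * sin t2 / e) \<in> Wext" "Complex (a n) (r * sin t2 / e) \<notin> W"
            using wall_in_Wext[OF hp, of "a n" n] wall_not_in_W[OF hp, of "a n" n] by auto
          then show "V_map (1 / e) (of_real r * cis t2) \<in> Wext" unfolding eq by simp
          have "a n < c" using a_less_b[of n] b_decreasing[OF n] N by linarith
          then have "dist (fext (Complex (a n) (r * sin t2 / e))) (-1) \<le> d1" using in2 c(1) hp by (intro c(2)) auto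
          then show "fscaled e (of_real r * cis t2) \<in> P"
            unfolding fscaled_def eq using norm_fext_boundary[OF in2] d1(2) by auto
        qed (use left r t2 in auto)
        then show "1 \<le> (\<integral>\<^sup>+\<theta>\<in>{- (pi / 2)<..<pi/2}. ennreal (exp x) * h (0 + of_real (exp x) * cis \<theta>) \<partial>lborel)"
          by (simp add: h_def r_def)
      qed (use x pi_gt_zero in auto)
      also have "(x2 - x1) / (pi/2 - (- (pi/2))) = 1 / pi * tooth_len n (C * e)"
        using x by (simp add: tooth_len_def x1_def x2_def)
      also have "(\<integral>\<^sup>+w\<in>polar_box 0 x1 x2 (- (pi/2)) (pi/2). (h w)\<^sup>2 \<partial>lborel) \<le> (\<integral>\<^sup>+w\<in>{w. a n < norm w \<and> norm w < b n}. (h w)\<^sup>2 \<partial>lborel)"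
        using polar_box_norm x by (intro nn_integral_mono) (fastforce split: split_indicator)
      finally show ?thesis .
    next
      case False
      then have "tooth_len n (C * e) = 0" using a_less_b[of n] a_pos[of n] b_pos[of n] by (auto simp: tooth_len_def)
      then show ?thesis by simp
    qed
    have "ennreal (1 / pi * (\<Sum>n\<in>{N..<k}. 2 * floor_len n (C * e) + tooth_len n (C * e)))
       \<le> (\<integral>\<^sup>+w\<in>{w. b k \<le> norm w}. (h w)\<^sup>2 \<partial>lborel)"
      using k
    proof (induction k rule: dec_induct)
      case (step m)
      have nn: "0 \<le> floor_len m (C * e)" "0 \<le> tooth_len m (C * e)" "0 \<le> (\<Sum>n\<in>{N..<m}. 2 * floor_len n (C * e) + tooth_len n (C * e))"
        by (auto simp: floor_len_def tooth_len_def intro!: sum_nonneg)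
      have "ennreal (1 / pi * (\<Sum>n\<in>{N..<Suc m}. 2 * floor_len n (C * e) + tooth_len n (C * e))) =
         ennreal (1 / pi * (\<Sum>n\<in>{N..<m}. 2 * floor_len n (C * e) + tooth_len n (C * e))) +
         (ennreal (2 / pi * floor_len m (C * e)) + ennreal (1 / pi * tooth_len m (C * e)))"
        using step.hyps nn pi_gt_zero
        by (subst ennreal_plus[symmetric], simp, simp, subst ennreal_plus[symmetric], simp, simp)
           (simp add: distrib_left add_divide_distrib algebra_simps)
      also have "\<dots> \<le> (\<integral>\<^sup>+w\<in>{w. b m \<le> norm w}. (h w)\<^sup>2 \<partial>lborel) +
          ((\<integral>\<^sup>+w\<in>{w. b (Suc m) < norm w \<and> norm w < a m}. (h w)\<^sup>2 \<partial>lborel) + (\<integral>\<^sup>+w\<in>{w. a m < norm w \<and> norm w < b m}. (h w)\<^sup>2 \<partial>lborel))"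
        by (intro add_mono step.IH fl to step.hyps)
      also have "\<dots> = (\<integral>\<^sup>+w. (h w)\<^sup>2 * indicator {w. b m \<le> norm w} w + ((h w)\<^sup>2 * indicator {w. b (Suc m) < norm w \<and> norm w < a m} w
          + (h w)\<^sup>2 * indicator {w. a m < norm w \<and> norm w < b m} w) \<partial>lborel)"
        by (simp add: nn_integral_add)
      also have "\<dots> \<le> (\<integral>\<^sup>+w\<in>{w. b (Suc m) \<le> norm w}. (h w)\<^sup>2 \<partial>lborel)"
        using b_Suc_less[of m] a_less_b[of m] by (intro nn_integral_mono) (auto split: split_indicator)
      finally show ?case .
    qed simp
    also have "\<dots> \<le> (\<integral>\<^sup>+w\<in>W. (\<rho> w)\<^sup>2 \<partial>lborel)"
      by (intro nn_integral_mono) (auto simp: h_def split: split_indicator)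
    finally show ?thesis .
  qed
  show ?thesis
  proof (intro exI[of _ C] exI[of _ N] conjI allI impI)
    fix e :: real and k :: nat assume "0 < e" "N \<le> k"
    then show "ennreal (1 / pi * (\<Sum>n\<in>{N..<k}. 2 * floor_len n (C * e) + tooth_len n (C * e))) \<le> curve_modulus W (Gamma_eps \<phi> I J e)"
      unfolding curve_modulus_def using main by (intro INF_greatest) auto
  qed (use C in auto)
qed

section \<open>Ends of the curves\<close>

lemma regular_V_map: "0 < e \<Longrightarrow> regular (V_map e p) \<longleftrightarrow> regular p"
  by (auto simp: regular_def mult_less_0_iff zero_less_mult_iff)

lemma V_map_in_Wext_iff: "0 < e \<Longrightarrow> V_map e p \<in> Wext \<longleftrightarrow> p \<in> Wext"
  by (auto simp: Wext_def V_map_in_W_iff regular_V_map complex_eq_iff)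

lemma Wext_boundary_cases:
  assumes "A \<in> Wext" "A \<notin> W"
  obtains (left) y where "0 \<le> y" "A = Complex 0 (- y)"
    | (floor) x where "0 < x" "A = of_real x"
    | (wall) n q h where "0 < h" "q = a n \<or> q = b n" "A = Complex q h"
proof -
  have "A = 0 \<or> regular A" using assms by (auto simp: Wext_def)
  then consider "A = 0" | "Re A = 0" "Im A < 0" | "Im A = 0" "0 < Re A" | n where "0 < Im A" "Re A = a n \<or> Re A = b n"
    unfolding regular_def by blast
  then show thesis
  proof cases
    case 1
    then show ?thesis using left[of 0] by (simp add: complex_eq_iff)
  next
    case 2
    then show ?thesis using left[of "- Im A"] by (simp add: complex_eq_iff)
  next
    case 3
    then show ?thesis using floor[of "Re A"] by (simp add: complex_eq_iff)
  next
    case 4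
    then show ?thesis using wall[of "Im A" "Re A" n] by simp
  qed
qed

text \<open>Near a point with positive real part \<open>W\<close> looks like a tooth, a wall or a
  gap, so a limit of points of \<open>W\<close> there lies in \<open>Wext\<close>. Only the
  accumulation of the teeth at the upper imaginary axis escapes.\<close>

lemma closure_W_cases:
  assumes w: "\<And>k. w k \<in> W" and lim: "w \<longlonglongrightarrow> A"
  shows "A \<in> Wext \<or> (Re A = 0 \<and> 0 < Im A)"
proof -
  have re: "(\<lambda>k. Re (w k)) \<longlonglongrightarrow> Re A" and im: "(\<lambda>k. Im (w k)) \<longlonglongrightarrow> Im A" using lim by (auto intro: tendsto_intros)
  have "0 \<le> Re A" using re Re_pos_W[OF w] by (intro LIMSEQ_le_const[OF re]) (auto intro: less_imp_le)
  then consider "Re A = 0" "Im A \<le> 0" | "Re A = 0" "0 < Im A" | "0 < Re A" "Im A < 0" | "0 < Re A" "Im A = 0" | "0 < Re A" "0 < Im A"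
    by linarith
  then show ?thesis
  proof cases
    case 1
    then have "A = 0 \<or> regular A" by (auto simp: regular_def complex_eq_iff)
    then show ?thesis by (auto simp: Wext_def)
  next
    case 3
    then show ?thesis by (auto simp: Wext_def mem_W)
  next
    case 4
    then have "A = of_real (Re A)" by (simp add: complex_eq_iff)
    then show ?thesis using real_in_Wext[OF 4(1)] by simp
  next
    case 5
    show ?thesis
    proof (rule ccontr)
      assume n: "\<not> ?thesis"
      have nW: "\<not> (a m \<le> Re A \<and> Re A \<le> b m)" for m
      proof
        assume "a m \<le> Re A \<and> Re A \<le> b m"
        then consider "Re A = a m" | "Re A = b m" | "a m < Re A" "Re A < b m" by linarith
        then have "A \<in> Wext"
          using wall_in_Wext[of "Im A" "Re A" m, unfolded complex.collapse] 5 W_tooth[of m A] W_subset_Wext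
          by cases (simp_all add: subset_iff)
        then show False using n by simp
      qed
      obtain l u where lu: "l < Re A" "Re A < u" "\<And>v. l < Re v \<Longrightarrow> Re v < u \<Longrightarrow> v \<in> W \<longleftrightarrow> Im v < 0"
      proof (rule tooth_cases[OF 5(1)])
        assume "b 0 \<le> Re A"
        then have "b 0 < Re A" using nW[of 0] a_less_b[of 0] by auto
        then show thesis using that[of "b 0" "Re A + 1"] W_gap0 by auto
      next
        fix m assume "b (Suc m) \<le> Re A" "Re A \<le> a m"
        then have "b (Suc m) < Re A" "Re A < a m"
          using nW[of m] nW[of "Suc m"] a_less_b[of m] a_less_b[of "Suc m"] by auto
        then show thesis using that[of "b (Suc m)" "a m"] W_gap[of m] by auto
      qed (use nW less_imp_le in blast)
      have "\<forall>\<^sub>F k in sequentially. l < Re (w k) \<and> Re (w k) < u \<and> 0 < Im (w k)"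
        using order_tendstoD(1)[OF re lu(1)] order_tendstoD(2)[OF re lu(2)] order_tendstoD(1)[OF im 5(2)]
        by eventually_elim auto
      then obtain k where "l < Re (w k)" "Re (w k) < u" "0 < Im (w k)" by (auto simp: eventually_sequentially)
      then show False using lu(3)[of "w k"] w[of k] by auto
    qed
  qed auto
qed

lemma limit_deep:
  assumes w: "\<And>k. w k \<in> W" and im: "\<And>k. 0 \<le> Im (w k)" and re: "(\<lambda>k. Re (w k)) \<longlonglongrightarrow> 0"
    and fx: "(\<lambda>k. f (w k)) \<longlonglongrightarrow> x"
  shows "x = -1"
proof -
  have "(\<lambda>k. f (w k)) \<longlonglongrightarrow> -1"
  proof (rule tendstoI)
    fix r :: real assume "0 < r"
    then obtain c where c: "c > 0" "\<And>v. v \<in> W \<Longrightarrow> Re v < c \<Longrightarrow> - c < Im v \<Longrightarrow> dist (f v) (-1) < r"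
      using zero_limit by blast
    from order_tendstoD(2)[OF re c(1)] show "\<forall>\<^sub>F k in sequentially. dist (f (w k)) (-1) < r"
    proof eventually_elim
      case (elim k)
      then show ?case using c im[of k] w[of k] by (intro c(2)) auto
    qed
  qed
  then show ?thesis using fx LIMSEQ_unique by blast
qed

text \<open>The substitute for an end at -1 that has no limit in \<open>Wext\<close>: the curve
  enters teeth of arbitrarily large index. As in the next two definitions, the visited places are
  recorded without their order, which is what distance estimates require.\<close>

definition deep_end :: "(real \<Rightarrow> complex) \<Rightarrow> bool" where
  "deep_end \<eta> \<longleftrightarrow> (\<forall>N. \<exists>t\<in>{0<..<1}. \<exists>m\<ge>N. \<eta> t \<in> upper_tooth m 0)"

definition tip_end :: "(real \<Rightarrow> complex) \<Rightarrow> nat \<Rightarrow> bool" where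
  "tip_end \<eta> n \<longleftrightarrow> (\<forall>H. \<exists>t\<in>{0<..<1}. \<eta> t \<in> upper_tooth n H)"

definition lower_end :: "(real \<Rightarrow> complex) \<Rightarrow> bool" where
  "lower_end \<eta> \<longleftrightarrow> (\<forall>R. \<exists>t\<in>{0<..<1}. Im (\<eta> t) < 0 \<and> R < norm (\<eta> t))"

text \<open>A bounded sequence on the curve accumulates in \<open>Wext\<close> or on the upper
  imaginary axis. An unbounded one returns to the lower half-plane again and again, or reaches
  unbounded heights in one tooth, or leaves every finite collection of teeth; the limits of
  \<open>f\<close> along these places determine \<open>x\<close>.\<close>

lemma end_cases:
  assumes e: "0 < e" "e \<le> 1" and \<tau>: "\<And>k. \<tau> k \<in> {0<..<1}" and W: "\<And>t. t \<in> {0<..<1} \<Longrightarrow> \<eta> t \<in> W"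
    and fx: "(\<lambda>k. f (V_map (1 / e) (\<eta> (\<tau> k)))) \<longlonglongrightarrow> x" and x: "norm x = 1"
  shows "(\<exists>A. curve_limit_point \<eta> A \<and> A \<in> Wext \<and> A \<notin> W \<and> fscaled e A = x) \<or>
    (\<exists>n. x = tip n \<and> tip_end \<eta> n) \<or> (x = -\<i> \<and> lower_end \<eta>) \<or> (x = -1 \<and> deep_end \<eta>)"
proof -
  define w where "w k = \<eta> (\<tau> k)" for k
  have wW: "w k \<in> W" for k using W[OF \<tau>] by (simp add: w_def)
  have fw: "(\<lambda>k. f (V_map (1 / e) (w k))) \<longlonglongrightarrow> x" using fx by (simp add: w_def)
  have VW: "V_map (1 / e) (w k) \<in> W" for k using wW e by (subst V_map_in_W_iff) auto
  show ?thesis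
  proof (cases "bounded (range w)")
    case True
    then obtain A \<sigma> where \<sigma>: "strict_mono \<sigma>" "(w \<circ> \<sigma>) \<longlonglongrightarrow> A"
      using bounded_imp_convergent_subsequence[OF True] by blast
    have fs: "(\<lambda>k. f (V_map (1 / e) (w (\<sigma> k)))) \<longlonglongrightarrow> x"
      using LIMSEQ_subseq_LIMSEQ[OF fw \<sigma>(1)] by (simp add: comp_def)
    have lim: "(\<lambda>k. w (\<sigma> k)) \<longlonglongrightarrow> A" using \<sigma>(2) by (simp add: comp_def)
    consider "A \<in> Wext" | "Re A = 0" "0 < Im A" using closure_W_cases[OF _ lim] wW by blast
    then show ?thesis
    proof cases
      case 1
      have "(\<lambda>k. V_map (1 / e) (w (\<sigma> k))) \<longlonglongrightarrow> V_map (1 / e) A"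
        by (rule continuous_on_tendsto_compose[OF continuous_on_V_map[of UNIV] lim]) auto
      then have "(\<lambda>k. fext (V_map (1 / e) (w (\<sigma> k)))) \<longlonglongrightarrow> fext (V_map (1 / e) A)"
        using 1 VW W_subset_Wext e V_map_in_Wext_iff[of "1/e"]
        by (intro continuous_on_tendsto_compose[OF continuous_on_fext]) (auto intro!: always_eventually)
      moreover have "fext (V_map (1 / e) (w (\<sigma> k))) = f (V_map (1 / e) (w (\<sigma> k)))" for k using VW by (simp add: fext_def)
      ultimately have fA: "fscaled e A = x" using fs LIMSEQ_unique unfolding fscaled_def by fastforce
      have "A \<notin> W"
      proof
        assume "A \<in> W"
        then have "V_map (1 / e) A \<in> W" using e by (subst V_map_in_W_iff) auto
        then show False using fA x norm_f_less by (fastforce simp: fscaled_def fext_def)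
      qed
      moreover have "curve_limit_point \<eta> A" unfolding curve_limit_point_def
        using lim \<tau> by (intro exI[of _ "\<lambda>k. \<tau> (\<sigma> k)"]) (auto simp: w_def)
      ultimately show ?thesis using 1 fA by blast
    next
      case 2
      have re: "(\<lambda>k. Re (w (\<sigma> k))) \<longlonglongrightarrow> 0" and im: "(\<lambda>k. Im (w (\<sigma> k))) \<longlonglongrightarrow> Im A"
        using tendsto_Re[OF lim] tendsto_Im[OF lim] 2 by auto
      obtain k0 where k0: "\<And>k. k \<ge> k0 \<Longrightarrow> 0 < Im (w (\<sigma> k))"
        using order_tendstoD(1)[OF im 2(2)] by (auto simp: eventually_sequentially)
      have "x = -1"
        by (rule limit_deep[of "\<lambda>k. V_map (1 / e) (w (\<sigma> (k + k0)))"])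
           (use VW k0 e LIMSEQ_ignore_initial_segment[OF re, of k0] LIMSEQ_ignore_initial_segment[OF fs, of k0] in \<open>auto simp: less_imp_le\<close>)
      moreover have "deep_end \<eta>" unfolding deep_end_def
      proof
        fix N
        obtain k1 where k1: "\<And>k. k \<ge> k1 \<Longrightarrow> Re (w (\<sigma> k)) < a N"
          using order_tendstoD(2)[OF re a_pos[of N]] by (auto simp: eventually_sequentially)
        define k where "k = max k0 k1"
        have k: "0 < Im (w (\<sigma> k))" "Re (w (\<sigma> k)) < a N" using k0 k1 by (auto simp: k_def)
        then obtain m where m: "a m < Re (w (\<sigma> k))" "Re (w (\<sigma> k)) < b m" using W_upper[OF wW] by (auto intro: less_imp_le)
        have "N \<le> m" using m(1) k(2) a_decreasing[of m N] by (cases "m \<le> N") auto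
        then show "\<exists>t\<in>{0<..<1}. \<exists>m\<ge>N. \<eta> t \<in> upper_tooth m 0"
          using m k \<tau>[of "\<sigma> k"] by (intro bexI[of _ "\<tau> (\<sigma> k)"] exI[of _ m]) (auto simp: upper_tooth_def w_def)
      qed
      ultimately show ?thesis by blast
    qed
  next
    case False
    then have unb: "\<exists>k. R < norm (w k)" for R by (auto simp: bounded_iff not_le image_iff)
    have unbk: "\<exists>k\<ge>k0. R < norm (w k)" for R k0
    proof -
      define R' where "R' = Max (insert R ((\<lambda>k. norm (w k)) ` {..k0}))"
      obtain k where k: "R' < norm (w k)" using unb by blast
      have "R \<le> R'" unfolding R'_def by (rule Max_ge) auto
      moreover have "k0 \<le> k"
      proof (rule ccontr)
        assume "\<not> k0 \<le> k"
        then have "norm (w k) \<le> R'" unfolding R'_def by (intro Max_ge) auto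
        then show False using k by simp
      qed
      ultimately show ?thesis using k by (intro exI[of _ k]) auto
    qed
    show ?thesis
    proof (cases "\<forall>R k0. \<exists>k\<ge>k0. R < norm (w k) \<and> Im (w k) < 0")
      case True
      have "lower_end \<eta>" unfolding lower_end_def
      proof
        fix R obtain k where "R < norm (w k)" "Im (w k) < 0" using True by blast
        then show "\<exists>t\<in>{0<..<1}. Im (\<eta> t) < 0 \<and> R < norm (\<eta> t)" using \<tau>[of k] by (auto simp: w_def)
      qed
      moreover have "x = -\<i>"
      proof (rule ccontr)
        assume "x \<noteq> -\<i>"
        define r where "r = dist x (-\<i>) / 2"
        have r: "0 < r" using \<open>x \<noteq> -\<i>\<close> by (simp add: r_def)
        obtain R where R: "\<And>v. 0 < Re v \<Longrightarrow> Im v < 0 \<Longrightarrow> R < norm v \<Longrightarrow> dist (f v) (-\<i>) < r" using lower_limit[OF r] by blast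
        obtain k0 where k0: "\<And>k. k \<ge> k0 \<Longrightarrow> dist (f (V_map (1 / e) (w k))) x < r"
          using tendstoD[OF fw r] by (auto simp: eventually_sequentially)
        obtain k where k: "k \<ge> k0" "R < norm (w k)" "Im (w k) < 0" using True by blast
        \<comment> \<open>Since \<open>e \<le> 1\<close>, undoing the compression does not bring a
          point closer to the origin.\<close>
        have "norm (w k) \<le> norm (V_map (1 / e) (w k))"
        proof -
          have "\<bar>Im (w k)\<bar> * e \<le> \<bar>Im (w k)\<bar> * 1" using e by (intro mult_left_mono) auto
          then have "\<bar>Im (w k)\<bar> \<le> \<bar>Im (w k)\<bar> / e" using e by (simp add: field_simps)
          then have "(Im (w k))\<^sup>2 \<le> (Im (w k) / e)\<^sup>2" using e by (simp add: abs_le_square_iff[symmetric])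
          then show ?thesis by (simp add: cmod_def)
        qed
        then have "dist (f (V_map (1 / e) (w k))) (-\<i>) < r"
          using k e Re_pos_W[OF wW[of k]] by (intro R) (auto simp: divide_neg_pos)
        then show False using k0[OF k(1)] dist_triangle3[of x "-\<i>" "f (V_map (1 / e) (w k))"] unfolding r_def by linarith
      qed
      ultimately show ?thesis by blast
    next
      case False
      then obtain R0 k0 where "\<forall>k\<ge>k0. \<not> (R0 < norm (w k) \<and> Im (w k) < 0)" by blast
      then have R0: "\<And>k. k \<ge> k0 \<Longrightarrow> R0 < norm (w k) \<Longrightarrow> 0 \<le> Im (w k)" by force
      have far: "\<exists>k\<ge>k1. H < Im (w k) \<and> (\<exists>n. a n < Re (w k) \<and> Re (w k) < b n)" if "0 \<le> H" for H k1
      proof -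
        obtain k where k: "k \<ge> max k0 k1" "max R0 (H + 1) < norm (w k)" using unbk by blast
        then have im: "0 \<le> Im (w k)" using R0[of k] by auto
        then obtain n where n: "a n < Re (w k)" "Re (w k) < b n" using W_upper[OF wW] by blast
        have "norm (w k) \<le> \<bar>Re (w k)\<bar> + \<bar>Im (w k)\<bar>" by (rule cmod_le)
        then have "H < Im (w k)" using k im n a_pos[of n] b_le_1[of n] by auto
        then show ?thesis using k n by (intro exI[of _ k]) auto
      qed
      show ?thesis
      proof (cases "\<exists>n. \<forall>H k1. \<exists>k\<ge>k1. H < Im (w k) \<and> a n < Re (w k) \<and> Re (w k) < b n")
        case True
        then obtain n where n: "\<And>H k1. \<exists>k\<ge>k1. H < Im (w k) \<and> a n < Re (w k) \<and> Re (w k) < b n" by blast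
        have "tip_end \<eta> n" unfolding tip_end_def
        proof
          fix H obtain k where "H < Im (w k)" "a n < Re (w k)" "Re (w k) < b n" using n by blast
          then show "\<exists>t\<in>{0<..<1}. \<eta> t \<in> upper_tooth n H" using \<tau>[of k] by (auto simp: upper_tooth_def w_def)
        qed
        moreover have "x = tip n"
        proof (rule ccontr)
          assume "x \<noteq> tip n"
          define r where "r = dist x (tip n) / 2"
          have r: "0 < r" using \<open>x \<noteq> tip n\<close> by (simp add: r_def)
          obtain T where T: "T > 0" "\<And>v. a n < Re v \<Longrightarrow> Re v < b n \<Longrightarrow> T < Im v \<Longrightarrow> dist (f v) (tip n) < r"
            using tip_limit[OF r] by blast
          obtain k0 where k0: "\<And>k. k \<ge> k0 \<Longrightarrow> dist (f (V_map (1 / e) (w k))) x < r"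
            using tendstoD[OF fw r] by (auto simp: eventually_sequentially)
          obtain k where k: "k \<ge> k0" "T * e < Im (w k)" "a n < Re (w k)" "Re (w k) < b n" using n by blast
          have "dist (f (V_map (1 / e) (w k))) (tip n) < r"
            using k e by (intro T(2)) (auto simp: field_simps)
          then show False using k0[OF k(1)] dist_triangle3[of x "tip n" "f (V_map (1 / e) (w k))"] unfolding r_def by linarith
        qed
        ultimately show ?thesis by blast
      next
        case False
        then have fin: "\<exists>H k1. \<forall>k\<ge>k1. H < Im (w k) \<longrightarrow> \<not> (a n < Re (w k) \<and> Re (w k) < b n)" for n by blast
        have deep: "\<exists>k\<ge>k1. 0 < Im (w k) \<and> (\<exists>m\<ge>N. a m < Re (w k) \<and> Re (w k) < b m)" for N k1
        proof -
          \<comment> \<open>Above a common height and from a common index on, the sequence avoids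
            the first \<open>N\<close> teeth; being far up, it then lies in a later one.\<close>
          have "\<exists>H\<ge>0. \<exists>k1. \<forall>k\<ge>k1. H < Im (w k) \<longrightarrow> (\<forall>n<N. \<not> (a n < Re (w k) \<and> Re (w k) < b n))"
          proof (induction N)
            case (Suc N)
            obtain H1 l1 where 1: "H1 \<ge> 0" "\<And>k. k \<ge> l1 \<Longrightarrow> H1 < Im (w k) \<Longrightarrow> (\<forall>n<N. \<not> (a n < Re (w k) \<and> Re (w k) < b n))"
              using Suc by blast
            obtain H2 l2 where 2: "\<And>k. k \<ge> l2 \<Longrightarrow> H2 < Im (w k) \<Longrightarrow> \<not> (a N < Re (w k) \<and> Re (w k) < b N)" using fin by blast
            show ?case using 1 2
              by (intro exI[of _ "max H1 H2"] conjI exI[of _ "max l1 l2"]) (auto simp: less_Suc_eq)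
          qed auto
          then obtain H l1 where H: "H \<ge> 0" "\<And>k. k \<ge> l1 \<Longrightarrow> H < Im (w k) \<Longrightarrow> (\<forall>n<N. \<not> (a n < Re (w k) \<and> Re (w k) < b n))"
            by blast
          obtain k n where k: "k \<ge> max k1 l1" "H < Im (w k)" "a n < Re (w k)" "Re (w k) < b n" using far[OF H(1)] by blast
          then have "N \<le> n" using H(2)[of k] by (auto simp: not_less[symmetric])
          then show ?thesis using k H(1) by (intro exI[of _ k]) auto
        qed
        have "deep_end \<eta>" unfolding deep_end_def
        proof
          fix N obtain k m where "0 < Im (w k)" "m \<ge> N" "a m < Re (w k)" "Re (w k) < b m" using deep by blast
          then show "\<exists>t\<in>{0<..<1}. \<exists>m\<ge>N. \<eta> t \<in> upper_tooth m 0"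
            using \<tau>[of k] by (intro bexI[of _ "\<tau> k"] exI[of _ m]) (auto simp: upper_tooth_def w_def)
        qed
        moreover have "x = -1"
        proof (rule ccontr)
          assume "x \<noteq> -1"
          define r where "r = dist x (-1) / 2"
          have r: "0 < r" using \<open>x \<noteq> -1\<close> by (simp add: r_def)
          obtain c where c: "c > 0" "\<And>v. v \<in> W \<Longrightarrow> Re v < c \<Longrightarrow> - c < Im v \<Longrightarrow> dist (f v) (-1) < r"
            using zero_limit[OF r] by blast
          obtain k0 where k0: "\<And>k. k \<ge> k0 \<Longrightarrow> dist (f (V_map (1 / e) (w k))) x < r"
            using tendstoD[OF fw r] by (auto simp: eventually_sequentially)
          obtain N where N: "b N < c" using order_tendstoD(2)[OF b_lim c(1)] by (auto simp: eventually_sequentially)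
          obtain k m where k: "k \<ge> k0" "0 < Im (w k)" "m \<ge> N" "a m < Re (w k)" "Re (w k) < b m" using deep by blast
          have "0 < Im (w k) / e" using k e by simp
          then have "- c < Im (w k) / e" using c(1) by linarith
          then have "dist (f (V_map (1 / e) (w k))) (-1) < r"
            using k e c(1) VW[of k] N b_decreasing[OF k(3)] by (intro c(2)) auto
          then show False using k0[OF k(1)] dist_triangle3[of x "-1" "f (V_map (1 / e) (w k))"] unfolding r_def by linarith
        qed
        ultimately show ?thesis by blast
      qed
    qed
  qed
qed

section \<open>Separation constants of the walls\<close>

lemma fext_wall_continuous: "q = a n \<or> q = b n \<Longrightarrow> continuous_on {0..} (\<lambda>h. fext (Complex q h))"
proof -
  assume q: "q = a n \<or> q = b n"
  have "continuous_on {0..} (\<lambda>h. Complex q h)" unfolding Complex_eq by (intro continuous_intros)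
  then show ?thesis
    by (rule continuous_on_compose2[OF continuous_on_fext]) (use wall_in_Wext[OF _ q] in auto)
qed

lemma fext_real_continuous: "continuous_on {0<..} (\<lambda>x. fext (of_real x))"
  by (rule continuous_on_compose2[OF continuous_on_fext continuous_on_of_real[OF continuous_on_id]])
     (use real_in_Wext in auto)

lemma separated_on_compact:
  fixes g :: "real \<Rightarrow> complex"
  assumes X: "compact X" and g: "continuous_on X g" and PQ: "closure P \<inter> closure Q = {}"
  obtains d where "d > 0" "\<And>x y. x \<in> X \<Longrightarrow> y \<in> X \<Longrightarrow> g x \<in> closure P \<Longrightarrow> g y \<in> closure Q \<Longrightarrow> d \<le> \<bar>x - y\<bar>"
proof -
  have c: "closed X" using X by (rule compact_imp_closed)
  have "closed (X \<inter> g -` closure P)" "closed (X \<inter> g -` closure Q)"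
    by (auto intro: continuous_closed_preimage[OF g c])
  moreover have "compact (X \<inter> g -` closure P)"
    using compact_Int_closed[OF X \<open>closed (X \<inter> g -` closure P)\<close>] by (simp add: Int_assoc[symmetric])
  ultimately obtain d where "d > 0" "\<And>x y. x \<in> X \<inter> g -` closure P \<Longrightarrow> y \<in> X \<inter> g -` closure Q \<Longrightarrow> d \<le> dist x y"
    using separate_compact_closed[of "X \<inter> g -` closure P" "X \<inter> g -` closure Q"] PQ by blast
  then show thesis using that by (auto simp: dist_real_def)
qed

lemma tip_far:
  assumes "tip n \<notin> closure X"
  obtains T where "T > 0" "\<And>q h. q = a n \<or> q = b n \<Longrightarrow> T \<le> h \<Longrightarrow> fext (Complex q h) \<notin> closure X"
proof -
  obtain r where r: "r > 0" "cball (tip n) r \<inter> closure X = {}"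
  proof -
    have "open (- closure X)" by auto
    then obtain r where "r > 0" "cball (tip n) r \<subseteq> - closure X"
      using assms open_contains_cball by blast
    then show thesis using that[of r] by auto
  qed
  obtain T where T: "T > 0" "\<And>p. p \<in> Wext \<Longrightarrow> a n \<le> Re p \<Longrightarrow> Re p \<le> b n \<Longrightarrow> T < Im p \<Longrightarrow> dist (fext p) (tip n) \<le> r"
    using tip_limit_ext[OF r(1)] by blast
  show thesis
  proof (rule that[of "T + 1"])
    fix q h assume q: "q = a n \<or> q = b n" and h: "T + 1 \<le> h"
    have "dist (fext (Complex q h)) (tip n) \<le> r"
      using T(1) wall_in_Wext[OF _ q, of h] h q a_less_b[of n] by (intro T(2)) auto
    then have "fext (Complex q h) \<in> cball (tip n) r" by (simp add: dist_commute)
    then show "fext (Complex q h) \<notin> closure X" using r(2) by blast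
  qed (use T in auto)
qed

text \<open>
  \<open>1/K\<close> is a distance, before the map \<open>V_map e\<close> is applied, at which the points corresponding to
  \<open>P\<close> and \<open>Q\<close> are separated on and near the wall; heights above \<open>K\<close> count as close to the tip.
\<close>

definition wall_const :: "complex set \<Rightarrow> complex set \<Rightarrow> nat \<Rightarrow> real \<Rightarrow> real \<Rightarrow> bool" where
  "wall_const P Q n q K \<longleftrightarrow>
     (\<forall>h\<ge>0. \<forall>h'\<ge>0. fext (Complex q h) \<in> closure P \<longrightarrow> fext (Complex q h') \<in> closure Q \<longrightarrow> 1 / K \<le> \<bar>h - h'\<bar>) \<and>
     (fext (of_real q) \<in> closure P \<longrightarrow> tip n \<notin> Q \<and> (\<forall>h\<ge>K. fext (Complex q h) \<notin> Q)) \<and>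
     (tip n \<in> closure P \<longrightarrow> (\<forall>h\<ge>K. fext (Complex q h) \<notin> closure Q)) \<and>
     (tip n \<notin> closure P \<longrightarrow> (\<forall>h\<ge>K. fext (Complex q h) \<notin> closure P)) \<and>
     (\<forall>x>0. \<bar>x - q\<bar> < 1 / K \<longrightarrow> fext (of_real x) \<in> closure P \<longrightarrow> fext (of_real q) \<in> closure P)"

text \<open>For a floor point within 1/K of one foot, the width 2/K leaves the distance 1/K to the
  other wall. The gap of width 1/K separates the mouth from that of the following tooth.\<close>

definition tooth_const :: "complex set \<Rightarrow> complex set \<Rightarrow> nat \<Rightarrow> real \<Rightarrow> bool" where
  "tooth_const P Q n K \<longleftrightarrow> (\<forall>q\<in>{a n, b n}. wall_const P Q n q K \<and> wall_const Q P n q K) \<and>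
     2 / K \<le> b n - a n \<and> 1 / K \<le> a n - b (Suc n)"

lemma tooth_const_commute: "tooth_const P Q n K \<longleftrightarrow> tooth_const Q P n K"
  by (auto simp: tooth_const_def)

lemma eventually_inverse_le: "d > 0 \<Longrightarrow> \<forall>\<^sub>F K in at_top. s / K \<le> (d :: real)"
  using eventually_ge_at_top[of "max 1 (s / d)"]
  by (elim eventually_mono) (auto simp: field_simps)

text \<open>Every clause holds for large \<open>K\<close>. On bounded heights the separation comes
  from compactness; near the tip at most one of the two closures can be met, because they are
  disjoint.\<close>

lemma eventually_wall_const:
  assumes q: "q = a n \<or> q = b n" and PQ: "closure P \<inter> closure Q = {}"
    and nc: "fext (of_real q) \<in> closure P \<Longrightarrow> tip n \<notin> Q \<and> (\<exists>T>0. \<forall>h\<ge>T. fext (Complex q h) \<notin> Q)"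
  shows "\<forall>\<^sub>F K in at_top. wall_const P Q n q K"
proof -
  have far: "\<exists>T>0. \<forall>h\<ge>T. fext (Complex q h) \<notin> closure X" if "tip n \<notin> closure X" for X
    using tip_far[OF that] q by metis
  have one: "\<exists>T>0. (\<forall>h\<ge>T. fext (Complex q h) \<notin> closure P) \<or> (\<forall>h\<ge>T. fext (Complex q h) \<notin> closure Q)"
    using far[of P] far[of Q] PQ by (cases "tip n \<in> closure P") blast+
  have 1: "\<forall>\<^sub>F K in at_top. \<forall>h\<ge>0. \<forall>h'\<ge>0. fext (Complex q h) \<in> closure P \<longrightarrow> fext (Complex q h') \<in> closure Q \<longrightarrow> 1 / K \<le> \<bar>h - h'\<bar>"
  proof -
    obtain T where T: "T > 0" "(\<forall>h\<ge>T. fext (Complex q h) \<notin> closure P) \<or> (\<forall>h\<ge>T. fext (Complex q h) \<notin> closure Q)" using one by blast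
    obtain d where d: "d > 0" "\<And>x y. x \<in> {0..T+1} \<Longrightarrow> y \<in> {0..T+1} \<Longrightarrow> fext (Complex q x) \<in> closure P \<Longrightarrow> fext (Complex q y) \<in> closure Q \<Longrightarrow> d \<le> \<bar>x - y\<bar>"
      by (rule separated_on_compact[of "{0..T+1}" "\<lambda>h. fext (Complex q h)", OF _ _ PQ])
         (use continuous_on_subset[OF fext_wall_continuous[OF q]] in auto)
    have "min d 1 \<le> \<bar>h - h'\<bar>" if "h \<ge> 0" "h' \<ge> 0" "fext (Complex q h) \<in> closure P" "fext (Complex q h') \<in> closure Q" for h h'
    proof (cases "h \<le> T + 1 \<and> h' \<le> T + 1")
      case True
      then show ?thesis using d(2)[of h h'] that by auto
    next
      case False
      have "h < T \<or> h' < T" using T(2) that by (meson not_le)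
      then show ?thesis using False by (auto simp: abs_if)
    qed
    moreover have "\<forall>\<^sub>F K in at_top. 1 / K \<le> min d 1" by (rule eventually_inverse_le) (use d in auto)
    ultimately show ?thesis by (elim eventually_mono) (meson order_trans)
  qed
  have 2: "\<forall>\<^sub>F K in at_top. fext (of_real q) \<in> closure P \<longrightarrow> tip n \<notin> Q \<and> (\<forall>h\<ge>K. fext (Complex q h) \<notin> Q)"
  proof (cases "fext (of_real q) \<in> closure P")
    case True
    then obtain T where "tip n \<notin> Q" "\<forall>h\<ge>T. fext (Complex q h) \<notin> Q" using nc by blast
    then show ?thesis using eventually_ge_at_top[of T] by (elim eventually_mono) auto
  qed simp
  have 3: "\<forall>\<^sub>F K in at_top. tip n \<in> closure P \<longrightarrow> (\<forall>h\<ge>K. fext (Complex q h) \<notin> closure Q)"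
  proof (cases "tip n \<in> closure P")
    case True
    then have "tip n \<notin> closure Q" using PQ by auto
    then obtain T where "\<forall>h\<ge>T. fext (Complex q h) \<notin> closure Q" using far by blast
    then show ?thesis using eventually_ge_at_top[of T] by (elim eventually_mono) auto
  qed simp
  have 4: "\<forall>\<^sub>F K in at_top. tip n \<notin> closure P \<longrightarrow> (\<forall>h\<ge>K. fext (Complex q h) \<notin> closure P)"
  proof (cases "tip n \<notin> closure P")
    case True
    then obtain T where "\<forall>h\<ge>T. fext (Complex q h) \<notin> closure P" using far by blast
    then show ?thesis using eventually_ge_at_top[of T] by (elim eventually_mono) auto
  qed simp
  have 5: "\<forall>\<^sub>F K in at_top. \<forall>x>0. \<bar>x - q\<bar> < 1 / K \<longrightarrow> fext (of_real x) \<in> closure P \<longrightarrow> fext (of_real q) \<in> closure P"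
  proof (cases "fext (of_real q) \<in> closure P")
    case False
    have q0: "q \<in> {0<..}" using q a_pos b_pos by auto
    have "open ({0<..} \<inter> (\<lambda>x. fext (of_real x)) -` (- closure P))"
      by (rule continuous_open_preimage[OF fext_real_continuous]) auto
    moreover have "q \<in> {0<..} \<inter> (\<lambda>x. fext (of_real x)) -` (- closure P)" using False q0 by auto
    ultimately obtain d where d: "d > 0" "ball q d \<subseteq> {0<..} \<inter> (\<lambda>x. fext (of_real x)) -` (- closure P)"
      using open_contains_ball by blast
    have "x \<notin> ball q d" if "fext (of_real x) \<in> closure P" for x using d(2) that by auto
    moreover have "\<forall>\<^sub>F K in at_top. 1 / K \<le> d" by (rule eventually_inverse_le[OF d(1)])
    ultimately show ?thesis by (elim eventually_mono) (force simp: dist_real_def abs_minus_commute)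
  qed auto
  show ?thesis unfolding wall_const_def using 1 2 3 4 5 by (intro eventually_conj)
qed

lemma eventually_tooth_const:
  assumes PQ: "closure P \<inter> closure Q = {}"
    and ncP: "\<And>q. q = a n \<or> q = b n \<Longrightarrow> fext (of_real q) \<in> closure P \<Longrightarrow> tip n \<notin> Q \<and> (\<exists>T>0. \<forall>h\<ge>T. fext (Complex q h) \<notin> Q)"
    and ncQ: "\<And>q. q = a n \<or> q = b n \<Longrightarrow> fext (of_real q) \<in> closure Q \<Longrightarrow> tip n \<notin> P \<and> (\<exists>T>0. \<forall>h\<ge>T. fext (Complex q h) \<notin> P)"
  shows "\<forall>\<^sub>F K in at_top. tooth_const P Q n K"
proof -
  have PQ': "closure Q \<inter> closure P = {}" using PQ by auto
  have "\<forall>\<^sub>F K in at_top. wall_const P Q n q K \<and> wall_const Q P n q K" if q: "q = a n \<or> q = b n" for q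
    by (intro eventually_conj eventually_wall_const[OF q PQ ncP[OF q]] eventually_wall_const[OF q PQ' ncQ[OF q]])
  then show ?thesis unfolding tooth_const_def
    using a_less_b[of n] b_Suc_less[of n]
    by (intro eventually_conj eventually_inverse_le eventually_ball_finite) auto
qed

end

section \<open>A single curve and the discs that catch it\<close>

locale comb_curve = comb_domain +
  fixes \<eta> :: "real \<Rightarrow> complex" and e :: real
  assumes cont: "continuous_on {0<..<1} \<eta>" and rect: "locally_rectifiable \<eta>"
    and inW: "\<And>t. t \<in> {0<..<1} \<Longrightarrow> \<eta> t \<in> W_dom a b" and e: "0 < e" "e \<le> 1"
begin

text \<open>\<open>D\<close> collects centres and radii; \<open>d\<close> is the distance to be
  covered in units of the radius.\<close>

definition hit :: "(complex \<times> real) set \<Rightarrow> real \<Rightarrow> bool" where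
  "hit D d \<longleftrightarrow> (\<exists>(p, r)\<in>D. 1 \<le> line_integral (disc_metric p r (1 / (d * r))) \<eta>)"

lemma hitI:
  assumes "(p, r) \<in> D" "0 < d" "d \<le> 1/2" "0 < r"
    "curve_limit_point \<eta> X" "curve_limit_point \<eta> Y" "dist X p \<le> r / 2" "d * r \<le> dist X Y"
  shows "hit D d"
  unfolding hit_def using line_integral_disc_ge_1[OF cont rect assms(5,6,2,3,4,7,8)] assms(1) by blast

text \<open>Without a point on the mouth the curve would be divided between two disjoint open sets,
  the upper tooth and the part of \<open>W\<close> below it, contrary to connectedness.\<close>

lemma mouth:
  assumes t: "t \<in> {0<..<1}" "\<eta> t \<in> upper_tooth n 0" and s: "s \<in> {0<..<1}" "\<eta> s \<notin> upper_tooth n 0"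
  obtains x where "a n < x" "x < b n" "curve_limit_point \<eta> (of_real x)"
proof -
  have "\<exists>u\<in>{0<..<1}. a n < Re (\<eta> u) \<and> Re (\<eta> u) < b n \<and> Im (\<eta> u) = 0"
  proof (rule ccontr)
    assume no: "\<not> ?thesis"
    have cover: "\<eta> u \<in> upper_tooth n 0 \<union> below_tooth n 0" if u: "u \<in> {0<..<1}" for u
    proof (cases "a n \<le> Re (\<eta> u) \<and> Re (\<eta> u) \<le> b n \<and> 0 \<le> Im (\<eta> u)")
      case True
      have "\<eta> u = Complex (Re (\<eta> u)) (Im (\<eta> u))" by simp
      then have "Re (\<eta> u) \<noteq> a n" "Re (\<eta> u) \<noteq> b n"
        using wall_not_in_W[of "Im (\<eta> u)" "Re (\<eta> u)" n] inW[OF u] True by auto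
      then have "a n < Re (\<eta> u)" "Re (\<eta> u) < b n" using True by auto
      then show ?thesis using no u True by (cases "Im (\<eta> u) = 0") (auto simp: upper_tooth_def)
    qed (use inW[OF u] in \<open>auto simp: below_tooth_def\<close>)
    have "connected (\<eta> ` {0<..<1})" using cont by (rule connected_continuous_image) auto
    moreover have "\<eta> ` {0<..<1} \<subseteq> upper_tooth n 0 \<union> below_tooth n 0" by (rule image_subsetI) (rule cover)
    moreover have "upper_tooth n 0 \<inter> below_tooth n 0 \<inter> \<eta> ` {0<..<1} = {}"
      by (auto simp: upper_tooth_def below_tooth_def)
    moreover have "upper_tooth n 0 \<inter> \<eta> ` {0<..<1} \<noteq> {}" "below_tooth n 0 \<inter> \<eta> ` {0<..<1} \<noteq> {}"
      using t s cover by blast+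
    ultimately show False
      using open_upper_tooth[of n 0] open_below_tooth[of n 0] unfolding connected_def by blast
  qed
  then obtain u where u: "u \<in> {0<..<1}" "a n < Re (\<eta> u)" "Re (\<eta> u) < b n" "Im (\<eta> u) = 0" by blast
  then have "\<eta> u = of_real (Re (\<eta> u))" by (simp add: complex_eq_iff)
  then show thesis using that[OF u(2,3)] curve_limit_pointI[OF u(1), of \<eta>] by simp
qed

lemma limit_point_open:
  assumes "curve_limit_point \<eta> A" "open U" "A \<in> U"
  obtains t where "t \<in> {0<..<1}" "\<eta> t \<in> U"
proof -
  obtain \<tau> where \<tau>: "\<And>k. \<tau> k \<in> {0<..<1}" "(\<lambda>k::nat. \<eta> (\<tau> k)) \<longlonglongrightarrow> A" using assms(1) by (auto simp: curve_limit_point_def)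
  from topological_tendstoD[OF \<tau>(2) assms(2,3)] obtain k where "\<eta> (\<tau> k) \<in> U" by (auto simp: eventually_sequentially)
  then show thesis using that \<tau>(1) by blast
qed

lemma limit_outside_tooth:
  assumes "curve_limit_point \<eta> A" "\<not> (a n \<le> Re A \<and> Re A \<le> b n \<and> 0 \<le> Im A)"
  obtains s where "s \<in> {0<..<1}" "\<eta> s \<notin> upper_tooth n 0"
proof -
  have "closed ({w. a n \<le> Re w} \<inter> {w. Re w \<le> b n} \<inter> {w. 0 \<le> Im w})"
    by (intro closed_Int closed_halfspace_Re_ge closed_halfspace_Re_le closed_halfspace_Im_ge)
  then have "open (- ({w. a n \<le> Re w} \<inter> {w. Re w \<le> b n} \<inter> {w. 0 \<le> Im w}))" by (rule open_Compl)
  then obtain s where "s \<in> {0<..<1}" "\<eta> s \<in> - ({w. a n \<le> Re w} \<inter> {w. Re w \<le> b n} \<inter> {w. 0 \<le> Im w})"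
    using limit_point_open[OF assms(1)] assms(2) by blast
  then show thesis using that by (auto simp: upper_tooth_def)
qed

lemma wall_limit_upper:
  assumes "curve_limit_point \<eta> (Complex q h)" "0 < h" "q = a n \<or> q = b n"
  obtains t where "t \<in> {0<..<1}" "\<eta> t \<in> upper_tooth n 0"
proof -
  obtain r where r: "0 < r" "\<And>w. Re w < b n + r \<Longrightarrow> b n \<le> Re w \<Longrightarrow> w \<in> W \<longleftrightarrow> Im w < 0"
    using b_gap by blast
  let ?U = "{w. b (Suc n) < Re w} \<inter> {w. Re w < b n + r} \<inter> {w. 0 < Im w}"
  have "open ?U" by (intro open_Int open_halfspace_Re_lt open_halfspace_Re_gt open_halfspace_Im_gt)
  moreover have "Complex q h \<in> ?U" using assms r b_Suc_less[of n] a_less_b[of n] by auto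
  ultimately obtain t where t: "t \<in> {0<..<1}" "\<eta> t \<in> ?U" using limit_point_open[OF assms(1)] by blast
  then have "a n < Re (\<eta> t)" "Re (\<eta> t) < b n"
    using W_gap[of n "\<eta> t"] r(2)[of "\<eta> t"] inW[of t] by (auto simp: not_le[symmetric])
  then show thesis using that t by (auto simp: upper_tooth_def)
qed

text \<open>An end in \<open>S\<close> on the walls or at the tip. The feet are excluded and count
  as points of the floor.\<close>

definition in_tooth :: "complex set \<Rightarrow> nat \<Rightarrow> bool" where
  "in_tooth S n \<longleftrightarrow> (\<exists>q h. (q = a n \<or> q = b n) \<and> 0 < h \<and> curve_limit_point \<eta> (Complex q h) \<and> fext (Complex q (h / e)) \<in> S)
     \<or> (tip n \<in> S \<and> tip_end \<eta> n)"

lemma in_tooth_upper: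
  assumes "in_tooth S n"
  obtains t where "t \<in> {0<..<1}" "\<eta> t \<in> upper_tooth n 0"
  using assms wall_limit_upper unfolding in_tooth_def tip_end_def by metis

lemma tip_end_far:
  assumes "tip_end \<eta> n" "0 \<le> R"
  obtains Y where "curve_limit_point \<eta> Y" "dist X Y \<ge> R"
proof -
  obtain t where t: "t \<in> {0<..<1}" "\<eta> t \<in> upper_tooth n (norm X + R)" using assms(1) unfolding tip_end_def by blast
  have "norm X + R < norm (\<eta> t)" using t(2) abs_Im_le_cmod[of "\<eta> t"] by (auto simp: upper_tooth_def)
  then have "dist X (\<eta> t) \<ge> R" using norm_triangle_ineq3[of "\<eta> t" X] by (simp add: dist_norm norm_minus_commute)
  then show thesis using that curve_limit_pointI[OF t(1)] by blast
qed

text \<open>If the floor point keeps the distance 1/K from both feet, the curve still has to pass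
  the mouth. If it is close to a foot, then this foot belongs to the closure of \<open>P\<close>;
  the wall above it can meet \<open>Q\<close> only below the height K e, and there
  \<open>wall_const\<close> guarantees the distance e/K from the foot.\<close>

lemma floor_tooth_hit:
  assumes tc: "tooth_const P Q n K" and K: "2 \<le> K" "K * e \<le> 1" and PQ: "closure P \<inter> closure Q = {}"
    and B: "curve_limit_point \<eta> (of_real x)" "0 < x" "of_real x \<notin> W" "fext (of_real x) \<in> P"
    and A: "in_tooth Q n"
    and D: "(0, 2 * K) \<in> D" "\<And>q. q = a n \<or> q = b n \<Longrightarrow> (of_real q, 2 * (K * e)) \<in> D"
  shows "hit D (1 / (2 * K\<^sup>2))"
proof -
  have K0: "0 < K" using K by simp
  have "2\<^sup>2 \<le> K\<^sup>2" using K by (intro power_mono) auto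
  then have d: "0 < 1 / (2 * K\<^sup>2)" "1 / (2 * K\<^sup>2) \<le> 1 / 2" using K0 by (auto simp: field_simps)
  \<comment> \<open>One relative distance serves both scales: for the radii 2 K and 2 K e it amounts
    to 1/K and e/K.\<close>
  have dK: "1 / (2 * K\<^sup>2) * (2 * K) = 1 / K" "1 / (2 * K\<^sup>2) * (2 * (K * e)) = e / K" using K0 by (auto simp: power2_eq_square)
  have xW: "\<not> (a n < x \<and> x < b n)" using B(3) W_tooth[of n "of_real x"] by auto
  show ?thesis
  proof (cases "\<bar>x - a n\<bar> < 1 / K \<or> \<bar>x - b n\<bar> < 1 / K")
    case False
    moreover have "0 < 1 / K" using K0 by simp
    ultimately have x: "x < a n \<or> b n < x" using xW by linarith
    obtain t where t: "t \<in> {0<..<1}" "\<eta> t \<in> upper_tooth n 0" using in_tooth_upper[OF A] by blast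
    have "\<not> (a n \<le> Re (of_real x) \<and> Re (of_real x) \<le> b n \<and> 0 \<le> Im (of_real x))" using x by auto
    then obtain s where s: "s \<in> {0<..<1}" "\<eta> s \<notin> upper_tooth n 0" by (rule limit_outside_tooth[OF B(1)])
    obtain y where y: "a n < y" "y < b n" "curve_limit_point \<eta> (of_real y)" using mouth[OF t s] by blast
    have "1 / K \<le> \<bar>x - y\<bar>" using False x y by auto
    moreover have "dist (of_real y :: complex) (of_real x) = \<bar>x - y\<bar>" by (simp add: dist_norm abs_minus_commute flip: of_real_diff)
    moreover have "\<bar>y\<bar> \<le> K" using y a_pos[of n] b_le_1[of n] K by auto
    ultimately show ?thesis using D(1) d dK K0 y(3) B(1)
      by (intro hitI[where p = 0 and r = "2 * K" and X = "of_real y" and Y = "of_real x"]) auto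
  next
    case True
    then obtain q where q: "q = a n \<or> q = b n" "\<bar>x - q\<bar> < 1 / K" by auto
    have wc: "wall_const P Q n q K" using tc q by (auto simp: tooth_const_def)
    have "fext (of_real x) \<in> closure P" using B(4) closure_subset by blast
    then have qP: "fext (of_real q) \<in> closure P" using wc q(2) B(2) by (auto simp: wall_const_def)
    then have no: "tip n \<notin> Q" "\<And>h. h \<ge> K \<Longrightarrow> fext (Complex q h) \<notin> Q" using wc by (auto simp: wall_const_def)
    then obtain q' h where A': "q' = a n \<or> q' = b n" "0 < h" "curve_limit_point \<eta> (Complex q' h)" "fext (Complex q' (h / e)) \<in> Q"
      using A unfolding in_tooth_def by blast
    show ?thesis
    proof (cases "q' = q")
      case False
      have "2 / K \<le> b n - a n" using tc by (simp add: tooth_const_def)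
      then have "2 / K \<le> \<bar>q' - q\<bar>" using False q A' by auto
      moreover have "2 / K = 1 / K + 1 / K" by simp
      ultimately have "1 / K \<le> \<bar>x - q'\<bar>" using q(2) by linarith
      also have "\<dots> \<le> dist (of_real x) (Complex q' h)"
        using abs_Re_le_cmod[of "of_real x - Complex q' h"] by (simp add: dist_norm)
      finally have "1 / K \<le> dist (of_real x) (Complex q' h)" .
      moreover have "\<bar>x\<bar> \<le> K"
      proof -
        have "1 / K \<le> 1" using K by simp
        moreover have "\<bar>q\<bar> \<le> 1" using q(1) a_pos[of n] b_pos[of n] b_le_1[of n] a_less_b[of n] by auto
        ultimately show ?thesis using q(2) K by linarith
      qed
      ultimately show ?thesis using D(1) d dK K0 A'(3) B(1)
        by (intro hitI[where p = 0 and r = "2 * K" and X = "of_real x" and Y = "Complex q' h"]) auto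
    next
      case True
      then have "h / e < K" using no(2)[of "h / e"] A'(4) by (force simp: not_le[symmetric])
      then have hK: "h \<le> K * e" using e by (simp add: field_simps)
      have qq: "of_real q = Complex q 0" by (simp add: complex_eq_iff)
      have "fext (Complex q (h / e)) \<in> closure Q" using A'(4) True closure_subset by blast
      then have "1 / K \<le> \<bar>0 - h / e\<bar>" using wc qP A'(2) e unfolding wall_const_def qq by (auto simp del: diff_0)
      then have "e / K \<le> h" using e A'(2) K0 by (simp add: field_simps)
      also have "h \<le> dist (Complex q' h) (of_real x)"
        using abs_Im_le_cmod[of "Complex q' h - of_real x"] A'(2) by (simp add: dist_norm)
      finally have "e / K \<le> dist (Complex q' h) (of_real x)" .
      moreover have "dist (Complex q' h) (of_real q) = h" unfolding qq True using A'(2) by (simp add: dist_norm cmod_def complex_diff)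
      ultimately show ?thesis using D(2)[OF q(1)] d dK K0 e A'(3) B(1) hK
        by (intro hitI[where p = "of_real q" and r = "2 * (K * e)" and X = "Complex q' h" and Y = "of_real x"]) auto
    qed
  qed
qed

text \<open>The tip belongs to the closure of at most one of the arcs, so one of the two ends lies
  on a wall below the height K e. From there the other end is at least e/K away on the same wall,
  and at least 1/K away on the other wall or if the curve runs to the tip.\<close>

lemma same_tooth_hit:
  assumes tc: "tooth_const P Q n K" and K: "2 \<le> K" "K * e \<le> 1" and PQ: "closure P \<inter> closure Q = {}"
    and B: "in_tooth P n" and A: "in_tooth Q n"
    and D: "(0, 2 * K) \<in> D" "\<And>q. q = a n \<or> q = b n \<Longrightarrow> (of_real q, 2 * (K * e)) \<in> D"
  shows "hit D (1 / (2 * K\<^sup>2))"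
proof -
  have K0: "0 < K" using K by simp
  have "2\<^sup>2 \<le> K\<^sup>2" using K by (intro power_mono) auto
  then have d: "0 < 1 / (2 * K\<^sup>2)" "1 / (2 * K\<^sup>2) \<le> 1 / 2" using K0 by (auto simp: field_simps)
  have dK: "1 / (2 * K\<^sup>2) * (2 * K) = 1 / K" "1 / (2 * K\<^sup>2) * (2 * (K * e)) = e / K" using K0 by (auto simp: power2_eq_square)
  have wc: "wall_const P Q n q K" "wall_const Q P n q K" if "q = a n \<or> q = b n" for q
    using tc that by (auto simp: tooth_const_def)
  have small: "norm (Complex q h) \<le> K" if "q = a n \<or> q = b n" "0 < h" "h \<le> K * e" for q h
  proof -
    have "\<bar>q\<bar> \<le> 1" using that(1) a_pos[of n] b_pos[of n] b_le_1[of n] a_less_b[of n] by auto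
    moreover have "norm (Complex q h) \<le> \<bar>q\<bar> + \<bar>h\<bar>" using cmod_le[of "Complex q h"] by simp
    ultimately show ?thesis using that K by linarith
  qed
  have wall_tip: "hit D (1 / (2 * K\<^sup>2))"
    if q: "q = a n \<or> q = b n" "0 < h" "curve_limit_point \<eta> (Complex q h)" "\<not> K \<le> h / e" and t: "tip_end \<eta> n" for q h
  proof -
    have "h \<le> K * e" using q(4) e by (simp add: field_simps)
    then have s: "norm (Complex q h) \<le> K" using small q by auto
    obtain Y where "curve_limit_point \<eta> Y" "1 \<le> dist (Complex q h) Y" using tip_end_far[OF t, of 1 "Complex q h"] by auto
    moreover have "1 / K \<le> 1" using K by simp
    ultimately have "curve_limit_point \<eta> Y" "1 / K \<le> dist (Complex q h) Y" by linarith+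
    then show ?thesis using D(1) d dK K0 q(3) s
      by (intro hitI[where p = 0 and r = "2 * K" and X = "Complex q h" and Y = Y]) auto
  qed
  have wall_wall: "hit D (1 / (2 * K\<^sup>2))"
    if q: "q = a n \<or> q = b n" "0 < h" "curve_limit_point \<eta> (Complex q h)" "\<not> K \<le> h / e"
      and q': "q' = a n \<or> q' = b n" "0 < h'" "curve_limit_point \<eta> (Complex q' h')"
      and sep: "q = q' \<Longrightarrow> 1 / K \<le> \<bar>h / e - h' / e\<bar>" for q h q' h'
  proof -
    have hK: "h \<le> K * e" using q(4) e by (simp add: field_simps)
    show ?thesis
    proof (cases "q = q'")
      case True
      have "1 / K \<le> \<bar>h - h'\<bar> / e" using sep[OF True] e by (simp add: diff_divide_distrib[symmetric])
      then have "e / K \<le> \<bar>h - h'\<bar>" using e K0 by (simp add: field_simps)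
      also have "\<dots> \<le> dist (Complex q h) (Complex q' h')"
        using abs_Im_le_cmod[of "Complex q h - Complex q' h'"] by (simp add: dist_norm)
      finally have "e / K \<le> dist (Complex q h) (Complex q' h')" .
      moreover have "dist (Complex q h) (of_real q) = h" using q(2) by (simp add: dist_norm cmod_def)
      ultimately show ?thesis using D(2)[OF q(1)] d dK K0 e q q' hK
        by (intro hitI[where p = "of_real q" and r = "2 * (K * e)" and X = "Complex q h" and Y = "Complex q' h'"]) auto
    next
      case False
      have "2 / K \<le> b n - a n" using tc by (simp add: tooth_const_def)
      moreover have "1 / K \<le> 2 / K" using K0 by (simp add: divide_right_mono)
      ultimately have "1 / K \<le> \<bar>q - q'\<bar>" using False q q' by auto
      also have "\<dots> \<le> dist (Complex q h) (Complex q' h')"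
        using abs_Re_le_cmod[of "Complex q h - Complex q' h'"] by (simp add: dist_norm)
      finally show ?thesis using D(1) d dK K0 q q' small[OF q(1,2) hK]
        by (intro hitI[where p = 0 and r = "2 * K" and X = "Complex q h" and Y = "Complex q' h'"]) auto
    qed
  qed
  have PQc: "P \<subseteq> closure P" "Q \<subseteq> closure Q" by (auto simp: closure_subset)
  consider (ww) q h q' h' where "q = a n \<or> q = b n" "0 < h" "curve_limit_point \<eta> (Complex q h)" "fext (Complex q (h / e)) \<in> P"
      "q' = a n \<or> q' = b n" "0 < h'" "curve_limit_point \<eta> (Complex q' h')" "fext (Complex q' (h' / e)) \<in> Q"
    | (wt) q h where "q = a n \<or> q = b n" "0 < h" "curve_limit_point \<eta> (Complex q h)" "fext (Complex q (h / e)) \<in> P"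
      "tip n \<in> Q" "tip_end \<eta> n"
    | (tw) q' h' where "q' = a n \<or> q' = b n" "0 < h'" "curve_limit_point \<eta> (Complex q' h')" "fext (Complex q' (h' / e)) \<in> Q"
      "tip n \<in> P" "tip_end \<eta> n"
    | (tt) "tip n \<in> P" "tip n \<in> Q"
    using A B unfolding in_tooth_def by blast
  then show ?thesis
  proof cases
    case ww
    have c: "fext (Complex q (h / e)) \<in> closure P" "fext (Complex q' (h' / e)) \<in> closure Q" using ww PQc by auto
    have sep: "1 / K \<le> \<bar>h / e - h' / e\<bar>" if "q = q'"
      using wc(1)[OF ww(1)] c that ww(2,6) e unfolding wall_const_def by auto
    show ?thesis
    proof (cases "tip n \<in> closure P")
      case True
      then have "\<not> K \<le> h' / e" using wc(1)[OF ww(5)] c unfolding wall_const_def by auto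
      then show ?thesis using wall_wall[OF ww(5-7) _ ww(1-3)] sep by (auto simp: abs_minus_commute)
    next
      case False
      then have "\<not> K \<le> h / e" using wc(1)[OF ww(1)] c unfolding wall_const_def by auto
      then show ?thesis using wall_wall[OF ww(1-3) _ ww(5-7)] sep by auto
    qed
  next
    case wt
    then have "tip n \<in> closure Q" "fext (Complex q (h / e)) \<in> closure P" using PQc by auto
    then have "\<not> K \<le> h / e" using wc(2)[OF wt(1)] unfolding wall_const_def by auto
    then show ?thesis using wall_tip wt by blast
  next
    case tw
    then have "tip n \<in> closure P" "fext (Complex q' (h' / e)) \<in> closure Q" using PQc by auto
    then have "\<not> K \<le> h' / e" using wc(1)[OF tw(1)] unfolding wall_const_def by auto
    then show ?thesis using wall_tip tw by blast
  next
    case tt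
    then show ?thesis using PQ PQc by auto
  qed
qed

end

section \<open>The upper bound\<close>

definition floor_metric :: "real \<Rightarrow> real \<Rightarrow> complex \<Rightarrow> ennreal" where
  "floor_metric L U w = ennreal (2 / pi / norm w) * indicator {w. 0 < Re w \<and> Im w < 0 \<and> L < norm w \<and> norm w < U} w"

text \<open>
  The angle is measured from \<open>p = a n\<close>, so that it is \<open>\<pi>/2\<close> along the left wall and at most
  \<open>-\<pi>/2\<close> on the left side of the quadrant.
\<close>

definition tooth_metric :: "real \<Rightarrow> real \<Rightarrow> real \<Rightarrow> complex \<Rightarrow> ennreal" where
  "tooth_metric p L U w = ennreal (1 / pi / norm (w - of_real p)) * indicator {w. p \<le> Re w \<and> L < norm w \<and> norm w < U} w"

lemma deriv_scaled_Ln: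
  assumes "w - p \<notin> \<real>\<^sub>\<le>\<^sub>0" "0 \<le> k"
  shows "norm (deriv (\<lambda>w. of_real k * Ln (w - p)) w) = k / norm (w - p)"
proof -
  have "((\<lambda>w. of_real k * Ln (w - p)) has_field_derivative of_real k * inverse (w - p)) (at w)"
    using assms(1) by (auto intro!: derivative_eq_intros simp: divide_inverse)
  then have "deriv (\<lambda>w. of_real k * Ln (w - p)) w = of_real k * inverse (w - p)" by (rule DERIV_imp_deriv)
  then show ?thesis using assms(2) by (simp add: norm_mult norm_inverse divide_inverse)
qed

lemma Ln_scaled_diff_ge:
  assumes "0 \<le> k"
  shows "k * \<bar>Im (Ln z) - Im (Ln w)\<bar> \<le> norm (of_real k * Ln z - of_real k * Ln w)"
proof -
  have "norm (of_real k * Ln z - of_real k * Ln w) = k * norm (Ln z - Ln w)"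
    using assms by (simp flip: right_diff_distrib add: norm_mult)
  then show ?thesis using abs_Im_le_cmod[of "Ln z - Ln w"] assms by (simp add: mult_left_mono)
qed

context comb_curve begin

definition bounded_up :: "complex \<Rightarrow> bool" where
  "bounded_up B \<longleftrightarrow> curve_limit_point \<eta> B \<and> B \<notin> W \<and> 0 \<le> Im B \<and> 0 < Re B"

lemma norm_limit_bounds:
  assumes "curve_limit_point \<eta> B" "\<And>t. t \<in> {0<..<1} \<Longrightarrow> L < norm (\<eta> t) \<and> norm (\<eta> t) < U"
  shows "L \<le> norm B" "norm B \<le> U"
proof -
  obtain \<tau> where \<tau>: "\<And>k. \<tau> k \<in> {0<..<1}" "(\<lambda>k::nat. \<eta> (\<tau> k)) \<longlonglongrightarrow> B" using assms(1) by (auto simp: curve_limit_point_def)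
  have n: "(\<lambda>k. norm (\<eta> (\<tau> k))) \<longlonglongrightarrow> norm B" by (intro tendsto_intros \<tau>)
  show "L \<le> norm B" using assms(2)[OF \<tau>(1)] by (intro LIMSEQ_le_const[OF n]) (auto intro: less_imp_le)
  show "norm B \<le> U" using assms(2)[OF \<tau>(1)] by (intro LIMSEQ_le_const2[OF n]) (auto intro: less_imp_le)
qed

text \<open>Between these radii the real axis is floor, so the curve, which accumulates at the left
  side, stays in the quadrant and has its other limit point on the floor. Between the two the
  argument varies from -\<pi>/2 to 0, which the factor 2/\<pi> turns into 1.\<close>

lemma floor_zone:
  assumes L: "b (Suc n) \<le> L" "0 < L" and U: "U \<le> a n" and A: "curve_limit_point \<eta> (Complex 0 (- y))" "0 < y"
    and conf: "\<And>t. t \<in> {0<..<1} \<Longrightarrow> L < norm (\<eta> t) \<and> norm (\<eta> t) < U"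
    and B: "(\<exists>B. bounded_up B) \<or> (\<exists>m. tip_end \<eta> m) \<or> deep_end \<eta>"
  shows "1 \<le> line_integral (floor_metric L U) \<eta>"
proof -
  have nz: "Im (\<eta> t) \<noteq> 0" if t: "t \<in> {0<..<1}" for t
  proof
    assume z: "Im (\<eta> t) = 0"
    then have "norm (\<eta> t) = Re (\<eta> t)" using Re_pos_W[OF inW[OF t]] by (simp add: cmod_eq_Re)
    then show False using conf[OF t] L U W_gap[of n "\<eta> t"] inW[OF t] z by auto
  qed
  have neg: "Im (\<eta> t) < 0" if t: "t \<in> {0<..<1}" for t
  proof (rule ccontr)
    assume "\<not> Im (\<eta> t) < 0"
    then have pos: "0 < Im (\<eta> t)" using nz[OF t] by linarith
    obtain s where s: "s \<in> {0<..<1}" "\<eta> s \<in> {w. Im w < 0}"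
      using limit_point_open[OF A(1) open_halfspace_Im_lt[of 0]] A(2) by auto
    have "connected (\<eta> ` {0<..<1})" using cont by (rule connected_continuous_image) auto
    moreover have "\<eta> ` {0<..<1} \<subseteq> {w. Im w < 0} \<union> {w. 0 < Im w}" using nz by force
    moreover have "{w. Im w < 0} \<inter> {w. 0 < Im w} \<inter> \<eta> ` {0<..<1} = {}" by auto
    moreover have "{w. Im w < 0} \<inter> \<eta> ` {0<..<1} \<noteq> {}" "{w. 0 < Im w} \<inter> \<eta> ` {0<..<1} \<noteq> {}" using s t pos by auto
    ultimately show False using open_halfspace_Im_lt[of 0] open_halfspace_Im_gt[of 0] unfolding connected_def by blast
  qed
  have "\<not> tip_end \<eta> m" for m
  proof
    assume "tip_end \<eta> m"
    then obtain t where "t \<in> {0<..<1}" "\<eta> t \<in> upper_tooth m 0" unfolding tip_end_def by blast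
    then show False using neg[of t] by (simp add: upper_tooth_def)
  qed
  moreover have "\<not> deep_end \<eta>"
  proof
    assume "deep_end \<eta>"
    then obtain t m where "t \<in> {0<..<1}" "\<eta> t \<in> upper_tooth m 0" unfolding deep_end_def by blast
    then show False using neg[of t] by (simp add: upper_tooth_def)
  qed
  ultimately obtain B where B: "curve_limit_point \<eta> B" "0 \<le> Im B" "0 < Re B" using assms(7) unfolding bounded_up_def by blast
  obtain \<sigma> where \<sigma>: "\<And>k. \<sigma> k \<in> {0<..<1}" "(\<lambda>k::nat. \<eta> (\<sigma> k)) \<longlonglongrightarrow> B" using B(1) by (auto simp: curve_limit_point_def)
  obtain \<tau> where \<tau>: "\<And>k. \<tau> k \<in> {0<..<1}" "(\<lambda>k::nat. \<eta> (\<tau> k)) \<longlonglongrightarrow> Complex 0 (- y)" using A(1) by (auto simp: curve_limit_point_def)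
  have "Im B \<le> 0" using neg[OF \<sigma>(1)] by (intro LIMSEQ_le_const2[OF tendsto_Im[OF \<sigma>(2)]]) (auto intro: less_imp_le)
  then have imB: "Im B = 0" using B(2) by simp
  define h where "h w = of_real (2 / pi) * Ln (w - 0)" for w
  have le: "ennreal (norm (h (\<eta> (\<sigma> k)) - h (\<eta> (\<tau> k)))) \<le> line_integral (floor_metric L U) \<eta>" for k
  proof (rule line_integral_ge_holomorphic_segment[OF cont rect \<tau>(1) \<sigma>(1)])
    have seg: "closed_segment (\<tau> k) (\<sigma> k) \<subseteq> {0<..<1}" using \<tau>(1)[of k] \<sigma>(1)[of k]
      by (auto simp: closed_segment_eq_real_ivl split: if_splits)
    show "open {w. 0 < Re w}" by (rule open_halfspace_Re_gt)
    show "h holomorphic_on {w. 0 < Re w}" unfolding h_def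
      by (intro holomorphic_intros) (auto simp: complex_nonpos_Reals_iff)
    show "\<eta> ` closed_segment (\<tau> k) (\<sigma> k) \<subseteq> {w. 0 < Re w}" using seg inW Re_pos_W by blast
    fix w assume "w \<in> \<eta> ` closed_segment (\<tau> k) (\<sigma> k)"
    then obtain t where t: "t \<in> {0<..<1}" "w = \<eta> t" using seg by blast
    have re: "0 < Re w" using Re_pos_W[OF inW[OF t(1)]] t by simp
    then have "w - 0 \<notin> \<real>\<^sub>\<le>\<^sub>0" by (auto simp: complex_nonpos_Reals_iff)
    then have "norm (deriv h w) = 2 / pi / norm (w - 0)" unfolding h_def by (rule deriv_scaled_Ln) auto
    then show "ennreal (norm (deriv h w)) \<le> floor_metric L U w"
      using neg[OF t(1)] conf[OF t(1)] re t(2) by (simp add: floor_metric_def)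
  qed
  have AB: "Complex 0 (- y) \<notin> \<real>\<^sub>\<le>\<^sub>0" "B \<notin> \<real>\<^sub>\<le>\<^sub>0" using A(2) B(3) by (auto simp: complex_nonpos_Reals_iff)
  have "(\<lambda>k. norm (h (\<eta> (\<sigma> k)) - h (\<eta> (\<tau> k)))) \<longlonglongrightarrow> norm (h B - h (Complex 0 (- y)))"
    unfolding h_def diff_0_right by (intro tendsto_intros \<sigma> \<tau> AB)
  then have "ennreal (norm (h B - h (Complex 0 (- y)))) \<le> line_integral (floor_metric L U) \<eta>"
    by (intro tendsto_upperbound[OF tendsto_ennrealI]) (use le in auto)
  moreover have "1 \<le> norm (h B - h (Complex 0 (- y)))"
  proof -
    have "B = of_real (Re B)" using imB by (simp add: complex_eq_iff)
    then have "Im (Ln B) = 0" using B(3) by (metis Im_complex_of_real Ln_of_real)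
    moreover have "Im (Ln (Complex 0 (- y))) = - (pi / 2)"
    proof -
      have "Complex 0 (- y) = of_real y * (- \<i>)" by (simp add: complex_eq_iff)
      then have "Ln (Complex 0 (- y)) = ln y + Ln (- \<i>)" using Ln_times_of_real[of y "-\<i>"] A(2) by (simp add: Ln_of_real)
      then show ?thesis by simp
    qed
    ultimately show ?thesis
      using Ln_scaled_diff_ge[of "2 / pi" B "Complex 0 (- y)"] pi_gt_zero by (simp add: h_def)
  qed
  ultimately show ?thesis using ennreal_leI[of 1] by (metis ennreal_1 order_trans)
qed

text \<open>Between these radii the region above the axis and to the left of the tooth cannot be
  entered. So the other limit point is on the left wall, where the argument seen from
  \<open>a n\<close> is \<pi>/2, unless it is the right foot, in which case the disc of radius
  \<open>b n\<close> catches the curve. Followed back from the wall until it is vertically below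
  \<open>a n\<close>, the curve reaches the argument -\<pi>/2.\<close>

lemma tooth_zone:
  assumes L: "2 * a n \<le> L" and A: "curve_limit_point \<eta> (Complex 0 (- y))" "0 < y" "y \<le> b n / 2"
    and conf: "\<And>t. t \<in> {0<..<1} \<Longrightarrow> L < norm (\<eta> t) \<and> norm (\<eta> t) < b n"
    and B: "(\<exists>B. bounded_up B) \<or> (\<exists>m. tip_end \<eta> m) \<or> deep_end \<eta>"
    and D: "(0, b n) \<in> D" "0 < d" "d \<le> 1/2"
  shows "hit D d \<or> 1 \<le> line_integral (tooth_metric (a n) L (b n)) \<eta>"
proof -
  let ?O1 = "{w. Im w < 0} \<union> {w. a n < Re w}" and ?O2 = "{w. 0 < Im w} \<inter> {w. Re w < a n}"
  have oO: "open ?O1" "open ?O2"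
    by (intro open_Un open_Int open_halfspace_Re_gt open_halfspace_Re_lt open_halfspace_Im_gt open_halfspace_Im_lt)+
  have cover: "\<eta> t \<in> ?O1 \<union> ?O2" if t: "t \<in> {0<..<1}" for t
  proof (cases "Im (\<eta> t) = 0")
    case True
    then have "norm (\<eta> t) = Re (\<eta> t)" using Re_pos_W[OF inW[OF t]] by (simp add: cmod_eq_Re)
    then show ?thesis using conf[OF t] L a_pos[of n] by auto
  next
    case False
    have "Re (\<eta> t) \<noteq> a n" if "0 < Im (\<eta> t)"
    proof
      assume "Re (\<eta> t) = a n"
      then have "\<eta> t = Complex (a n) (Im (\<eta> t))" by (simp add: complex_eq_iff)
      then show False using wall_not_in_W[of "Im (\<eta> t)" "a n" n] that inW[OF t] by simp
    qed
    then show ?thesis using False by force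
  qed
  have O1: "\<eta> t \<in> ?O1" if t: "t \<in> {0<..<1}" for t
  proof (rule ccontr)
    assume no: "\<eta> t \<notin> ?O1"
    obtain s where s: "s \<in> {0<..<1}" "\<eta> s \<in> ?O1"
      using limit_point_open[OF A(1) oO(1)] A(2) by auto
    have "connected (\<eta> ` {0<..<1})" using cont by (rule connected_continuous_image) auto
    moreover have "\<eta> ` {0<..<1} \<subseteq> ?O1 \<union> ?O2" using cover by blast
    moreover have "?O1 \<inter> ?O2 \<inter> \<eta> ` {0<..<1} = {}" by auto
    moreover have "?O1 \<inter> \<eta> ` {0<..<1} \<noteq> {}" using s by blast
    moreover have "?O2 \<inter> \<eta> ` {0<..<1} \<noteq> {}" using cover[OF t] no t by blast
    ultimately show False using oO unfolding connected_def by blast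
  qed
  have "\<not> tip_end \<eta> m" for m
  proof
    assume "tip_end \<eta> m"
    then obtain t where t: "t \<in> {0<..<1}" "\<eta> t \<in> upper_tooth m (b n)" unfolding tip_end_def by blast
    then have "b n < Im (\<eta> t)" by (simp add: upper_tooth_def)
    then show False using conf[OF t(1)] abs_Im_le_cmod[of "\<eta> t"] by linarith
  qed
  moreover have "\<not> deep_end \<eta>"
  proof
    assume "deep_end \<eta>"
    then obtain t m where t: "t \<in> {0<..<1}" "m \<ge> Suc n" "\<eta> t \<in> upper_tooth m 0" unfolding deep_end_def by blast
    then show False using O1[OF t(1)] b_less_a[of n m] by (auto simp: upper_tooth_def)
  qed
  ultimately obtain B where B: "curve_limit_point \<eta> B" "B \<notin> W" "0 \<le> Im B" "0 < Re B" using B unfolding bounded_up_def by blast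
  have nB: "L \<le> norm B" "norm B \<le> b n" using norm_limit_bounds[OF B(1) conf] by auto
  show ?thesis
  proof (cases "Im B = 0")
    case True
    then have "norm B = Re B" using B(4) by (simp add: cmod_eq_Re)
    then have "Re B = b n" using nB L B(2) W_tooth[of n B] a_pos[of n] by force
    then have nB': "norm B = b n" using \<open>norm B = Re B\<close> by simp
    have nA: "norm (Complex 0 (- y)) = y" using A(2) by (simp add: cmod_def)
    have "d * b n \<le> 1/2 * b n" using D(3) b_pos[of n] by (intro mult_right_mono) auto
    also have "\<dots> \<le> dist (Complex 0 (- y)) B"
      using norm_triangle_ineq3[of "Complex 0 (- y)" B] nA nB' A(3) by (simp add: dist_norm)
    finally have "hit D d" using D(1,2,3) A b_pos[of n] nA B(1)
      by (intro hitI[where p = 0 and r = "b n" and X = "Complex 0 (- y)" and Y = B]) auto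
    then show ?thesis by simp
  next
    case False
    then have imB: "0 < Im B" using B(3) by simp
    have "a n \<le> Re B"
    proof (rule ccontr)
      assume "\<not> a n \<le> Re B"
      then obtain t where t: "t \<in> {0<..<1}" "\<eta> t \<in> ?O2" using limit_point_open[OF B(1) oO(2)] imB by auto
      then show False using O1[OF t(1)] by auto
    qed
    moreover have "Re B < b n"
    proof -
      have "(Re B)\<^sup>2 < (Re B)\<^sup>2 + (Im B)\<^sup>2" using imB by simp
      also have "\<dots> = (norm B)\<^sup>2" by (simp add: cmod_power2)
      finally have "Re B < norm B" by (rule power_less_imp_less_base) simp
      then show ?thesis using nB by simp
    qed
    ultimately have reB: "Re B = a n" using B(2) W_tooth[of n B] by force
    obtain \<sigma> where \<sigma>: "\<And>k. \<sigma> k \<in> {0<..<1}" "(\<lambda>k::nat. \<eta> (\<sigma> k)) \<longlonglongrightarrow> B" using B(1) by (auto simp: curve_limit_point_def)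
    obtain s where s: "s \<in> {0<..<1}" "Re (\<eta> s) < a n"
      using limit_point_open[OF A(1) open_halfspace_Re_lt[of "a n"]] a_pos[of n] by auto
    let ?p = "of_real (a n) :: complex"
    define h where "h w = of_real (1 / pi) * Ln (w - ?p)" for w
    have ImB: "Im (Ln (B - ?p)) = pi / 2"
    proof -
      have "B - ?p = of_real (Im B) * \<i>" using reB by (simp add: complex_eq_iff)
      then have "Ln (B - ?p) = ln (Im B) + Ln \<i>" using Ln_times_of_real[of "Im B" \<i>] imB by (simp add: Ln_of_real)
      then show ?thesis by simp
    qed
    have ev: "\<forall>\<^sub>F k in sequentially. ennreal ((Im (Ln (\<eta> (\<sigma> k) - ?p)) + pi / 2) / pi) \<le> line_integral (tooth_metric (a n) L (b n)) \<eta>"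
    proof -
      have "\<forall>\<^sub>F k in sequentially. 0 < Im (\<eta> (\<sigma> k))" using order_tendstoD(1)[OF tendsto_Im[OF \<sigma>(2)] imB] .
      then show ?thesis
      proof eventually_elim
        case (elim k)
        have re: "a n < Re (\<eta> (\<sigma> k))" using O1[OF \<sigma>(1)[of k]] elim by auto
        have seg: "closed_segment (\<sigma> k) s \<subseteq> {0<..<1}" using \<sigma>(1)[of k] s(1)
          by (auto simp: closed_segment_eq_real_ivl split: if_splits)
        \<comment> \<open>The curve is stopped at the first moment, counted from the wall, at which
          the abscissa is \<open>a n\<close>. By the shape of \<open>W\<close> this point has
          negative imaginary part.\<close>
        have c: "continuous_on (closed_segment (\<sigma> k) s) (\<lambda>u. - Re (\<eta> u))"
          by (intro continuous_intros continuous_on_subset[OF cont seg])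
        obtain z where z: "z \<in> closed_segment (\<sigma> k) s" "- Re (\<eta> z) = - a n"
          "\<And>u. u \<in> closed_segment (\<sigma> k) z \<Longrightarrow> - Re (\<eta> u) \<le> - a n"
          using exists_first_reach_segment[OF c, of "- a n"] re s(2) by auto
        have z01: "z \<in> {0<..<1}" using z(1) seg by blast
        have seg': "closed_segment (\<sigma> k) z \<subseteq> {0<..<1}"
          using seg z(1) subset_closed_segment[of "\<sigma> k" z "\<sigma> k" s] by auto
        have imz: "Im (\<eta> z) < 0" using W_gap[of n "\<eta> z"] inW[OF z01] z(2) b_Suc_less[of n] by auto
        have np: "w - ?p \<notin> \<real>\<^sub>\<le>\<^sub>0 \<and> a n \<le> Re w" if w: "w \<in> \<eta> ` closed_segment (\<sigma> k) z" for w
        proof -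
          obtain u where u: "u \<in> closed_segment (\<sigma> k) z" "w = \<eta> u" using w by blast
          then have "a n \<le> Re w" "w \<in> W" using z(3)[OF u(1)] seg' inW by auto
          moreover have "Im w \<noteq> 0 \<or> Re w \<noteq> a n"
            using W_gap[of n w] \<open>w \<in> W\<close> b_Suc_less[of n] by auto
          ultimately show ?thesis by (auto simp: complex_nonpos_Reals_iff)
        qed
        have "ennreal (norm (h (\<eta> z) - h (\<eta> (\<sigma> k)))) \<le> line_integral (tooth_metric (a n) L (b n)) \<eta>"
        proof (rule line_integral_ge_holomorphic_segment[OF cont rect \<sigma>(1) z01])
          show "open ((\<lambda>w. w - ?p) -` (- \<real>\<^sub>\<le>\<^sub>0))"
            by (rule open_vimage) (auto intro!: continuous_intros open_Compl closed_nonpos_Reals_complex)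
          show "h holomorphic_on (\<lambda>w. w - ?p) -` (- \<real>\<^sub>\<le>\<^sub>0)" unfolding h_def
            by (intro holomorphic_intros) auto
          show "\<eta> ` closed_segment (\<sigma> k) z \<subseteq> (\<lambda>w. w - ?p) -` (- \<real>\<^sub>\<le>\<^sub>0)" using np by blast
          fix w assume w: "w \<in> \<eta> ` closed_segment (\<sigma> k) z"
          then obtain u where u: "u \<in> {0<..<1}" "w = \<eta> u" using seg' by blast
          have "norm (deriv h w) = 1 / pi / norm (w - ?p)" unfolding h_def
            using np[OF w] by (intro deriv_scaled_Ln) auto
          then show "ennreal (norm (deriv h w)) \<le> tooth_metric (a n) L (b n) w"
            using np[OF w] conf[OF u(1)] u(2) by (simp add: tooth_metric_def)
        qed
        moreover have "(Im (Ln (\<eta> (\<sigma> k) - ?p)) + pi / 2) / pi \<le> norm (h (\<eta> z) - h (\<eta> (\<sigma> k)))"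
        proof -
          have "\<eta> z - ?p = of_real (- Im (\<eta> z)) * (- \<i>)" using z(2) by (simp add: complex_eq_iff)
          then have "Ln (\<eta> z - ?p) = ln (- Im (\<eta> z)) + Ln (- \<i>)" using Ln_times_of_real[of "- Im (\<eta> z)" "-\<i>"] imz Ln_of_real[of "- Im (\<eta> z)"] by simp
          then have "Im (Ln (\<eta> z - ?p)) = - (pi / 2)" by simp
          then have "1 / pi * \<bar>- (pi / 2) - Im (Ln (\<eta> (\<sigma> k) - ?p))\<bar> \<le> norm (h (\<eta> z) - h (\<eta> (\<sigma> k)))"
            using Ln_scaled_diff_ge[of "1 / pi" "\<eta> z - ?p" "\<eta> (\<sigma> k) - ?p"] pi_gt_zero by (simp add: h_def)
          moreover have "(Im (Ln (\<eta> (\<sigma> k) - ?p)) + pi / 2) / pi \<le> 1 / pi * \<bar>- (pi / 2) - Im (Ln (\<eta> (\<sigma> k) - ?p))\<bar>"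
          proof -
            have "1 / pi * (Im (Ln (\<eta> (\<sigma> k) - ?p)) + pi / 2) \<le> 1 / pi * \<bar>- (pi / 2) - Im (Ln (\<eta> (\<sigma> k) - ?p))\<bar>"
              by (intro mult_left_mono) auto
            then show ?thesis by simp
          qed
          ultimately show ?thesis by linarith
        qed
        ultimately show ?case by (meson ennreal_leI order_trans)
      qed
    qed
    have "B - ?p \<notin> \<real>\<^sub>\<le>\<^sub>0" using imB by (auto simp: complex_nonpos_Reals_iff)
    then have "(\<lambda>k. (Im (Ln (\<eta> (\<sigma> k) - ?p)) + pi / 2) / pi) \<longlonglongrightarrow> (Im (Ln (B - ?p)) + pi / 2) / pi"
      by (intro tendsto_intros \<sigma>) auto
    moreover have "(Im (Ln (B - ?p)) + pi / 2) / pi = 1" using ImB by simp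
    ultimately have "ennreal 1 \<le> line_integral (tooth_metric (a n) L (b n)) \<eta>"
      by (intro tendsto_upperbound[OF tendsto_ennrealI ev]) auto
    then show ?thesis by simp
  qed
qed

end

context comb_domain begin

text \<open>The constants of the upper estimate. Over the teeth from \<open>N\<close> on, everything
  that is not well below the floor is away from \<open>Q\<close>, and in the lower half-plane
  everything beyond the radius \<open>K\<close> is away from \<open>P\<close>. Finitely many teeth
  remain, and one \<open>K\<close> serves them all.\<close>

definition comb_const :: "complex set \<Rightarrow> complex set \<Rightarrow> real \<Rightarrow> nat \<Rightarrow> bool" where
  "comb_const P Q K N \<longleftrightarrow> 2 \<le> K \<and> 2 / K \<le> b N \<and>
     (\<forall>p\<in>Wext. Im p \<le> 0 \<longrightarrow> K < norm p \<longrightarrow> fext p \<notin> closure P) \<and>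
     (\<forall>p\<in>Wext. Re p \<le> b N + 1 / K \<longrightarrow> - (1 / K) < Im p \<longrightarrow> fext p \<notin> closure Q) \<and>
     (\<forall>n\<ge>N. tip n \<notin> Q) \<and>
     (\<forall>y\<ge>0. \<forall>y'\<ge>0. fext (Complex 0 (- y)) \<in> P \<longrightarrow> fext (Complex 0 (- y')) \<in> Q \<longrightarrow> 1 / K \<le> \<bar>y - y'\<bar>) \<and>
     (\<forall>x>0. \<forall>x'>0. fext (of_real x) \<in> P \<longrightarrow> fext (of_real x') \<in> Q \<longrightarrow> 1 / K \<le> \<bar>x - x'\<bar>) \<and>
     (\<forall>n<N. tooth_const P Q n K)"

lemma cball_disjoint_closure:
  assumes "x \<in> P" "closure P \<inter> closure Q = {}"
  obtains r where "r > 0" "cball x r \<inter> closure Q = {}"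
proof -
  have "x \<in> - closure Q" using assms closure_subset by blast
  then obtain r where "r > 0" "cball x r \<subseteq> - closure Q"
    using open_contains_cball[of "- closure Q"] by auto
  then show thesis using that[of r] by auto
qed

text \<open>The limit at 0 determines \<open>N\<close>; afterwards \<open>K\<close> can be taken so
  large that it suits the finitely many teeth before \<open>N\<close>.\<close>

lemma exists_comb_const:
  assumes P: "-1 \<in> P" and Q: "-\<i> \<in> Q" and PQ: "closure P \<inter> closure Q = {}"
    and ncP: "\<And>n q. q = a n \<or> q = b n \<Longrightarrow> fext (of_real q) \<in> closure P \<Longrightarrow> tip n \<notin> Q \<and> (\<exists>T>0. \<forall>h\<ge>T. fext (Complex q h) \<notin> Q)"
    and ncQ: "\<And>n q. q = a n \<or> q = b n \<Longrightarrow> fext (of_real q) \<in> closure Q \<Longrightarrow> tip n \<notin> P \<and> (\<exists>T>0. \<forall>h\<ge>T. fext (Complex q h) \<notin> P)"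
  shows "\<exists>K N. comb_const P Q K N"
proof -
  have QP: "closure Q \<inter> closure P = {}" using PQ by auto
  obtain r1 where r1: "r1 > 0" "cball (-1) r1 \<inter> closure Q = {}" using cball_disjoint_closure[OF P PQ] by blast
  obtain r2 where r2: "r2 > 0" "cball (-\<i>) r2 \<inter> closure P = {}" using cball_disjoint_closure[OF Q QP] by blast
  obtain c where c: "c > 0" "\<And>p. p \<in> Wext \<Longrightarrow> Re p < c \<Longrightarrow> - c < Im p \<Longrightarrow> dist (fext p) (-1) \<le> r1"
    using zero_limit_ext[OF r1(1)] by blast
  have cQ: "fext p \<notin> closure Q" if "p \<in> Wext" "Re p < c" "- c < Im p" for p
  proof -
    have "fext p \<in> cball (-1) r1" using c(2)[OF that] by (simp add: dist_commute)
    then show ?thesis using r1(2) by blast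
  qed
  obtain R where R: "R \<ge> 1" "\<And>p. p \<in> Wext \<Longrightarrow> Im p \<le> 0 \<Longrightarrow> R < norm p \<Longrightarrow> dist (fext p) (-\<i>) \<le> r2"
    using lower_limit_ext[OF r2(1)] by blast
  have RP: "fext p \<notin> closure P" if "p \<in> Wext" "Im p \<le> 0" "R < norm p" for p
  proof -
    have "fext p \<in> cball (-\<i>) r2" using R(2)[OF that] by (simp add: dist_commute)
    then show ?thesis using r2(2) by blast
  qed
  have clos: "P \<subseteq> closure P" "Q \<subseteq> closure Q" by (auto simp: closure_subset)
  \<comment> \<open>Half of \<open>c\<close> is kept in reserve: together with
    \<open>1 / K \<le> c / 4\<close> this gives b N + 1/K < c.\<close>
  obtain N where N: "b N < c / 2" using order_tendstoD(2)[OF b_lim, of "c / 2"] c(1) by (auto simp: eventually_sequentially)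
  have tipQ: "tip n \<notin> Q" if n: "n \<ge> N" for n
  proof -
    have "f ` upper_tooth n 0 \<subseteq> cball (-1) r1"
    proof (rule image_subsetI)
      fix w assume w: "w \<in> upper_tooth n 0"
      then have "w \<in> W" using upper_tooth_subset_W by auto
      then have "dist (fext w) (-1) \<le> r1"
        using w n N b_decreasing[OF n] c(1) W_subset_Wext by (intro c(2)) (auto simp: upper_tooth_def)
      then show "f w \<in> cball (-1) r1" using \<open>w \<in> W\<close> by (simp add: fext_def dist_commute)
    qed
    then have "closure (f ` upper_tooth n 0) \<subseteq> cball (-1) r1" by (intro closure_minimal) auto
    then have "tip n \<in> cball (-1) r1" using tip_in_closure[of n 0] by blast
    then show ?thesis using r1(2) clos by blast
  qed
  have nl: "norm (Complex 0 (- y)) = y" if "0 \<le> y" for y using that by (simp add: cmod_def)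
  have Py: "y \<le> R" if "0 \<le> y" "fext (Complex 0 (- y)) \<in> P" for y
    using RP[of "Complex 0 (- y)"] left_in_Wext[OF that(1)] nl[OF that(1)] that clos by force
  have Px: "x \<le> R" if "0 < x" "fext (of_real x) \<in> P" for x
    using RP[of "of_real x"] real_in_Wext[OF that(1)] that clos by force
  have Qx: "c \<le> x" if "0 < x" "fext (of_real x) \<in> Q" for x
    using cQ[of "of_real x"] real_in_Wext[OF that(1)] that c(1) clos by force
  \<comment> \<open>On the left side and on the floor, points of \<open>P\<close> are at distance at
    most \<open>R\<close> from 0. Compact intervals up to \<open>R + 1\<close> therefore suffice;
    beyond them the separation is at least 1.\<close>
  obtain d1 where d1: "d1 > 0" "\<And>y y'. y \<in> {0..R+1} \<Longrightarrow> y' \<in> {0..R+1} \<Longrightarrow>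
      fext (Complex 0 (- y)) \<in> closure P \<Longrightarrow> fext (Complex 0 (- y')) \<in> closure Q \<Longrightarrow> d1 \<le> \<bar>y - y'\<bar>"
  proof (rule separated_on_compact[of "{0..R+1}" "\<lambda>y. fext (Complex 0 (- y))", OF _ _ PQ])
    have "continuous_on {0..R+1} (\<lambda>y. Complex 0 (- y))" unfolding Complex_eq by (intro continuous_intros)
    then show "continuous_on {0..R+1} (\<lambda>y. fext (Complex 0 (- y)))"
      by (rule continuous_on_compose2[OF continuous_on_fext]) (use left_in_Wext in auto)
  qed auto
  obtain d2 where d2: "d2 > 0" "\<And>x x'. x \<in> {c/2..R+1} \<Longrightarrow> x' \<in> {c/2..R+1} \<Longrightarrow>
      fext (of_real x) \<in> closure P \<Longrightarrow> fext (of_real x') \<in> closure Q \<Longrightarrow> d2 \<le> \<bar>x - x'\<bar>"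
  proof (rule separated_on_compact[of "{c/2..R+1}" "\<lambda>x. fext (of_real x)", OF _ _ PQ])
    have "{c/2..R+1} \<subseteq> {0<..}" using c(1) by force
    then show "continuous_on {c/2..R+1} (\<lambda>x. fext (of_real x))" by (rule continuous_on_subset[OF fext_real_continuous])
  qed auto
  have sepy: "min d1 1 \<le> \<bar>y - y'\<bar>" if y: "0 \<le> y" "0 \<le> y'" "fext (Complex 0 (- y)) \<in> P" "fext (Complex 0 (- y')) \<in> Q" for y y'
  proof (cases "y' \<le> R + 1")
    case True
    then have "d1 \<le> \<bar>y - y'\<bar>" using y Py[OF y(1,3)] clos by (intro d1(2)) auto
    then show ?thesis by simp
  next
    case False
    then have "1 \<le> \<bar>y - y'\<bar>" using Py[OF y(1,3)] by linarith
    then show ?thesis by simp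
  qed
  have sepx: "min d2 (min 1 (c/2)) \<le> \<bar>x - x'\<bar>" if x: "0 < x" "0 < x'" "fext (of_real x) \<in> P" "fext (of_real x') \<in> Q" for x x'
  proof (cases "x' \<le> R + 1 \<and> c/2 \<le> x")
    case True
    then have "d2 \<le> \<bar>x - x'\<bar>" using x Px[OF x(1,3)] Qx[OF x(2,4)] clos c(1) by (intro d2(2)) auto
    then show ?thesis by simp
  next
    case False
    then have "1 \<le> \<bar>x - x'\<bar> \<or> c/2 \<le> \<bar>x - x'\<bar>" using Px[OF x(1,3)] Qx[OF x(2,4)] by linarith
    then show ?thesis by linarith
  qed
  have "\<forall>\<^sub>F K in at_top. \<forall>n\<in>{..<N}. tooth_const P Q n K"
    by (intro eventually_ball_finite) (auto intro: eventually_tooth_const[OF PQ ncP ncQ])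
  moreover have "\<forall>\<^sub>F K in at_top. max 2 R \<le> K" by (rule eventually_ge_at_top)
  moreover have "\<forall>\<^sub>F K in at_top. 2 / K \<le> b N" "\<forall>\<^sub>F K in at_top. 1 / K \<le> min (c / 4) (min (min d1 1) (min d2 (min 1 (c/2))))"
    by (rule eventually_inverse_le; use b_pos c(1) d1(1) d2(1) in auto)+
  ultimately have "\<forall>\<^sub>F K in at_top. comb_const P Q K N"
  proof eventually_elim
    case (elim K)
    have K: "2 \<le> K" "R \<le> K" "1 / K \<le> c / 4" "1 / K \<le> min d1 1" "1 / K \<le> min d2 (min 1 (c/2))" using elim by auto
    show ?case unfolding comb_const_def
    proof (intro conjI ballI allI impI)
      fix p assume p: "p \<in> Wext"
      show "fext p \<notin> closure P" if "Im p \<le> 0" "K < norm p" using RP[OF p that(1)] that K by simp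
      show "fext p \<notin> closure Q" if "Re p \<le> b N + 1 / K" "- (1 / K) < Im p"
        using that K(3) N c(1) by (intro cQ[OF p]) linarith+
    next
      fix y y' :: real assume "0 \<le> y" "0 \<le> y'" "fext (Complex 0 (- y)) \<in> P" "fext (Complex 0 (- y')) \<in> Q"
      then show "1 / K \<le> \<bar>y - y'\<bar>" using sepy K(4) by fastforce
    next
      fix x x' :: real assume "0 < x" "0 < x'" "fext (of_real x) \<in> P" "fext (of_real x') \<in> Q"
      then show "1 / K \<le> \<bar>x - x'\<bar>" using sepx K(5) by fastforce
    qed (use elim K tipQ in auto)
  qed
  then have "\<exists>K. comb_const P Q K N" by (rule eventually_happens'[rotated]) simp
  then show ?thesis by blast
qed

end

context comb_curve begin

text \<open>The curve comes from the left side at distance \<open>y\<close> from 0 and also reaches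
  the closed upper half-plane. If \<open>y\<close> is comparable to one of the radii, or if the
  curve leaves the annulus, then it covers a distance comparable to the radius of one of the four
  discs.\<close>

lemma zone_or_hit:
  assumes D: "(0, 4 * L) \<in> D" "(0, 2 * L) \<in> D" "(0, 2 * U) \<in> D" "(0, U) \<in> D"
    and d: "0 < d" "d \<le> 1/8" and L: "0 < L" "L < 2 * y" and U: "y \<le> U"
    and A: "curve_limit_point \<eta> (Complex 0 (- y))" and Z: "curve_limit_point \<eta> Z" "0 \<le> Im Z"
  shows "hit D d \<or> (2 * L < y \<and> y < U / 2 \<and> (\<forall>t\<in>{0<..<1}. L < norm (\<eta> t) \<and> norm (\<eta> t) < U))"
proof -
  have y: "0 < y" using L by simp
  have nA: "norm (Complex 0 (- y)) = y" using y by (simp add: cmod_def)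
  have AZ: "y \<le> dist (Complex 0 (- y)) Z" using abs_Im_le_cmod[of "Complex 0 (- y) - Z"] y Z(2) by (simp add: dist_norm)
  have dm: "d * x \<le> x / 8" if "0 \<le> x" for x using mult_right_mono[OF d(2) that] by simp
  have d': "d \<le> 1/2" using d by simp
  show ?thesis
  proof (cases "y \<le> 2 * L")
    case True
    have "d * (4 * L) \<le> dist (Complex 0 (- y)) Z" using dm[of "4 * L"] L AZ by linarith
    then have "hit D d" using D(1) d(1) d' L True A Z(1) nA
      by (intro hitI[where p = 0 and r = "4 * L" and X = "Complex 0 (- y)" and Y = Z]) auto
    then show ?thesis ..
  next
    case L2: False
    show ?thesis
    proof (cases "U \<le> 2 * y")
      case True
      have "d * (2 * U) \<le> dist (Complex 0 (- y)) Z" using dm[of "2 * U"] y U AZ True by linarith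
      then have "hit D d" using D(3) d(1) d' y U A Z(1) nA
        by (intro hitI[where p = 0 and r = "2 * U" and X = "Complex 0 (- y)" and Y = Z]) auto
      then show ?thesis ..
    next
      case U2: False
      show ?thesis
      proof (cases "\<exists>t\<in>{0<..<1}. \<not> (L < norm (\<eta> t) \<and> norm (\<eta> t) < U)")
        case True
        then obtain t where t: "t \<in> {0<..<1}" "norm (\<eta> t) \<le> L \<or> U \<le> norm (\<eta> t)" by force
        have tri: "\<bar>norm (\<eta> t) - y\<bar> \<le> dist (\<eta> t) (Complex 0 (- y))"
          using norm_triangle_ineq3[of "\<eta> t" "Complex 0 (- y)"] nA by (simp add: dist_norm)
        have "hit D d"
        proof (cases "norm (\<eta> t) \<le> L")
          case True
          have "d * (2 * L) \<le> dist (\<eta> t) (Complex 0 (- y))" using dm[of "2 * L"] L L2 tri True by linarith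
          then show ?thesis using D(2) d(1) d' L True A curve_limit_pointI[OF t(1)]
            by (intro hitI[where p = 0 and r = "2 * L" and X = "\<eta> t" and Y = "Complex 0 (- y)"]) auto
        next
          case False
          then have "U \<le> norm (\<eta> t)" using t(2) by blast
          then have "d * U \<le> dist (\<eta> t) (Complex 0 (- y))" using dm[of U] y U U2 tri by linarith
          then have "d * U \<le> dist (Complex 0 (- y)) (\<eta> t)" by (simp only: dist_commute)
          then show ?thesis using D(4) d(1) d' U2 y U A nA curve_limit_pointI[OF t(1)]
            by (intro hitI[where p = 0 and r = U and X = "Complex 0 (- y)" and Y = "\<eta> t"]) auto
        qed
        then show ?thesis ..
      qed (use L2 U2 in auto)
    qed
  qed
qed

lemma between_teeth:
  assumes "b k < y" "y \<le> b N"
  obtains n where "N \<le> n" "n < k" "b (Suc n) < y" "y \<le> b n"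
proof -
  define j where "j = (LEAST j. b j < y)"
  have j: "b j < y" unfolding j_def by (rule LeastI[of _ k]) (rule assms(1))
  have jk: "j \<le> k" unfolding j_def by (rule Least_le) (rule assms(1))
  have "N < j"
  proof (rule ccontr)
    assume "\<not> N < j"
    then show False using b_decreasing[of j N] j assms(2) by auto
  qed
  then obtain n where n: "j = Suc n" by (cases j) auto
  have "\<not> b n < y" using not_less_Least[of n "\<lambda>j. b j < y"] n unfolding j_def by auto
  then show thesis using that[of n] n j jk \<open>N < j\<close> by auto
qed

text \<open>Goes through all places of the two ends. If they are told apart at the unit scale or at
  the scale \<open>e\<close>, a disc of that scale catches the curve. What remains is an end in
  \<open>Q\<close> on the left side at a distance between K e and \<open>b N\<close>, with the end
  in \<open>P\<close> on the floor or in a tooth: this is where the zone metrics act.\<close>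

lemma curve_hit:
  assumes cc: "comb_const P Q K N" and PQ: "closure P \<inter> closure Q = {}" and P: "-1 \<in> P" and Q: "-\<i> \<in> Q"
    and Ke: "K * e \<le> 1" and k: "b k \<le> K * e"
    and endP: "(\<exists>B. curve_limit_point \<eta> B \<and> B \<in> Wext \<and> B \<notin> W \<and> fscaled e B \<in> P) \<or>
      (\<exists>n. tip n \<in> P \<and> tip_end \<eta> n) \<or> (-\<i> \<in> P \<and> lower_end \<eta>) \<or> (-1 \<in> P \<and> deep_end \<eta>)"
    and endQ: "(\<exists>B. curve_limit_point \<eta> B \<and> B \<in> Wext \<and> B \<notin> W \<and> fscaled e B \<in> Q) \<or>
      (\<exists>n. tip n \<in> Q \<and> tip_end \<eta> n) \<or> (-\<i> \<in> Q \<and> lower_end \<eta>) \<or> (-1 \<in> Q \<and> deep_end \<eta>)"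
    and D: "(0, 2 * (K * e)) \<in> D" "(0, 4 * K) \<in> D" "(0, 2 * K) \<in> D"
    and Dq: "\<And>n q. n < N \<Longrightarrow> q = a n \<or> q = b n \<Longrightarrow> (of_real q, 2 * (K * e)) \<in> D"
    and Df: "\<And>n. N \<le> n \<Longrightarrow> n < k \<Longrightarrow> {(0, 4 * max (b (Suc n)) (K * e)), (0, 2 * max (b (Suc n)) (K * e)), (0, 2 * a n), (0, a n)} \<subseteq> D"
    and Dt: "\<And>n. N \<le> n \<Longrightarrow> n < k \<Longrightarrow> {(0, 4 * max (2 * a n) (K * e)), (0, 2 * max (2 * a n) (K * e)), (0, 2 * b n), (0, b n)} \<subseteq> D"
  shows "hit D (1 / (2 * K\<^sup>2)) \<or> (\<exists>n\<in>{N..<k}. 1 \<le> line_integral (floor_metric (max (b (Suc n)) (K * e)) (a n)) \<eta> \<or>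
     1 \<le> line_integral (tooth_metric (a n) (max (2 * a n) (K * e)) (b n)) \<eta>)"
proof -
  define d where "d = 1 / (2 * K\<^sup>2)"
  have K: "2 \<le> K" and bN: "2 / K \<le> b N" using cc by (auto simp: comb_const_def)
  have cP: "\<And>p. p \<in> Wext \<Longrightarrow> Im p \<le> 0 \<Longrightarrow> K < norm p \<Longrightarrow> fext p \<notin> closure P"
    and cQ: "\<And>p. p \<in> Wext \<Longrightarrow> Re p \<le> b N + 1 / K \<Longrightarrow> - (1 / K) < Im p \<Longrightarrow> fext p \<notin> closure Q"
    and tipQ: "\<And>n. N \<le> n \<Longrightarrow> tip n \<notin> Q"
    and sepy: "\<And>y y'. 0 \<le> y \<Longrightarrow> 0 \<le> y' \<Longrightarrow> fext (Complex 0 (- y)) \<in> P \<Longrightarrow> fext (Complex 0 (- y')) \<in> Q \<Longrightarrow> 1 / K \<le> \<bar>y - y'\<bar>"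
    and sepx: "\<And>x x'. 0 < x \<Longrightarrow> 0 < x' \<Longrightarrow> fext (of_real x) \<in> P \<Longrightarrow> fext (of_real x') \<in> Q \<Longrightarrow> 1 / K \<le> \<bar>x - x'\<bar>"
    and tc: "\<And>n. n < N \<Longrightarrow> tooth_const P Q n K"
    using cc by (auto simp: comb_const_def)
  have K0: "0 < K" using K by simp
  have "2\<^sup>2 \<le> K\<^sup>2" using K by (intro power_mono) auto
  then have d: "0 < d" "d \<le> 1 / 8" "d \<le> 1 / 2" using K0 by (auto simp: d_def field_simps)
  have dK: "d * (2 * K) = 1 / K" "d * (4 * K) = 2 / K" "d * (2 * (K * e)) = e / K" using K0 by (auto simp: d_def power2_eq_square)
  have eK: "e / K \<le> 1 / K" "1 / K \<le> 1" "0 < e / K" "1 / K \<le> 2 / K" using e K K0 by (auto simp: divide_right_mono)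
  have clos: "P \<subseteq> closure P" "Q \<subseteq> closure Q" by (auto simp: closure_subset)
  have QP: "closure Q \<inter> closure P = {}" using PQ by auto
  have Vl: "V_map (1 / e) (Complex 0 (- y)) = Complex 0 (- (y / e))" for y by (simp add: complex_eq_iff)
  have Vf: "V_map (1 / e) (of_real x) = of_real x" for x by (simp add: complex_eq_iff)
  have Vw: "V_map (1 / e) (Complex q h) = Complex q (h / e)" for q h by (simp add: complex_eq_iff)
  have nl: "norm (Complex 0 (- y)) = y" if "0 \<le> y" for y using that by (simp add: cmod_def)
  have cases: "(\<exists>y\<ge>0. curve_limit_point \<eta> (Complex 0 (- y)) \<and> fext (Complex 0 (- (y / e))) \<in> S) \<or>
     (\<exists>x>0. curve_limit_point \<eta> (of_real x) \<and> of_real x \<notin> W \<and> fext (of_real x) \<in> S) \<or> (\<exists>n. in_tooth S n)"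
    if B: "curve_limit_point \<eta> B" "B \<in> Wext" "B \<notin> W" "fscaled e B \<in> S" for S B
    using B(2,3)
  proof (cases rule: Wext_boundary_cases)
    case (left y)
    then show ?thesis using B unfolding fscaled_def by (auto simp: Vl)
  next
    case (floor x)
    then show ?thesis using B unfolding fscaled_def by (auto simp: Vf)
  next
    case (wall n q h)
    then have "in_tooth S n" using B unfolding fscaled_def in_tooth_def by (auto simp: Vw)
    then show ?thesis by blast
  qed
  have ends: "(\<exists>y\<ge>0. curve_limit_point \<eta> (Complex 0 (- y)) \<and> fext (Complex 0 (- (y / e))) \<in> S) \<or>
     (\<exists>x>0. curve_limit_point \<eta> (of_real x) \<and> of_real x \<notin> W \<and> fext (of_real x) \<in> S) \<or> (\<exists>n. in_tooth S n) \<or> E"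
    if "(\<exists>B. curve_limit_point \<eta> B \<and> B \<in> Wext \<and> B \<notin> W \<and> fscaled e B \<in> S) \<or> (\<exists>n. tip n \<in> S \<and> tip_end \<eta> n) \<or> E" for S E
    using that
  proof (elim disjE exE conjE)
    fix B assume "curve_limit_point \<eta> B" "B \<in> Wext" "B \<notin> W" "fscaled e B \<in> S"
    from cases[OF this] show ?thesis by blast
  next
    fix n assume "tip n \<in> S" "tip_end \<eta> n"
    then have "in_tooth S n" unfolding in_tooth_def by blast
    then show ?thesis by blast
  qed blast
  have nPQ: "-\<i> \<notin> P" "-1 \<notin> Q" using P Q PQ clos by blast+
  have "(\<exists>y\<ge>0. curve_limit_point \<eta> (Complex 0 (- y)) \<and> fext (Complex 0 (- (y / e))) \<in> P) \<or>
     (\<exists>x>0. curve_limit_point \<eta> (of_real x) \<and> of_real x \<notin> W \<and> fext (of_real x) \<in> P) \<or> (\<exists>n. in_tooth P n) \<or> deep_end \<eta>"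
    using ends[OF endP] nPQ(1) by blast
  then consider (BL) y where "y \<ge> 0" "curve_limit_point \<eta> (Complex 0 (- y))" "fext (Complex 0 (- (y / e))) \<in> P"
    | (BR) "(\<exists>x>0. curve_limit_point \<eta> (of_real x) \<and> of_real x \<notin> W \<and> fext (of_real x) \<in> P) \<or> (\<exists>n. in_tooth P n) \<or> deep_end \<eta>"
    by blast
  note Bcases = this
  have "(\<exists>y\<ge>0. curve_limit_point \<eta> (Complex 0 (- y)) \<and> fext (Complex 0 (- (y / e))) \<in> Q) \<or>
     (\<exists>x>0. curve_limit_point \<eta> (of_real x) \<and> of_real x \<notin> W \<and> fext (of_real x) \<in> Q) \<or> (\<exists>n. in_tooth Q n) \<or> lower_end \<eta>"
    using ends[OF endQ] nPQ(2) by blast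
  then consider (AL) y where "y \<ge> 0" "curve_limit_point \<eta> (Complex 0 (- y))" "fext (Complex 0 (- (y / e))) \<in> Q"
    | (AF) x where "x > 0" "curve_limit_point \<eta> (of_real x)" "of_real x \<notin> W" "fext (of_real x) \<in> Q"
    | (AT) n where "in_tooth Q n" | (AI) "lower_end \<eta>"
    by blast
  note Acases = this
  \<comment> \<open>This and the next two facts confine \<open>Q\<close>: it stays away from the
    deep part of the comb, and on the left side it has at least the distance e/K from 0.\<close>
  have AFx: "b N + 1 / K < x" if "x > 0" "fext (of_real x) \<in> Q" for x
    using cQ[of "of_real x"] real_in_Wext[OF that(1)] that clos K0 by force
  have ATn: "n < N" if "in_tooth Q n" for n
  proof (rule ccontr)
    assume n: "\<not> n < N"
    then have "tip n \<notin> Q" using tipQ[of n] by simp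
    then have "\<exists>q h. (q = a n \<or> q = b n) \<and> 0 < h \<and> curve_limit_point \<eta> (Complex q h) \<and> fext (Complex q (h / e)) \<in> Q"
      using that[unfolded in_tooth_def] by argo
    then obtain q h where "(q = a n \<or> q = b n) \<and> 0 < h \<and> curve_limit_point \<eta> (Complex q h) \<and> fext (Complex q (h / e)) \<in> Q"
      by (elim exE)
    then have q: "q = a n \<or> q = b n" "0 < h" "fext (Complex q (h / e)) \<in> Q" by simp_all
    have h: "0 \<le> h / e" using q(2) e by simp
    have "q \<le> b n" using q a_less_b[of n] by auto
    also have "b n \<le> b N" using n by (intro b_decreasing) auto
    finally have "q \<le> b N + 1 / K" using K0 by (simp add: add_increasing2)
    moreover have "- (1 / K) < h / e" using h K0 by (rule_tac less_le_trans[of _ 0]) simp_all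
    ultimately have "fext (Complex q (h / e)) \<notin> closure Q" using cQ[OF wall_in_Wext[OF h q(1)]] by simp
    then show False using q(3) clos by blast
  qed
  have ALy: "e / K \<le> y" if "y \<ge> 0" "fext (Complex 0 (- (y / e))) \<in> Q" for y
  proof (rule ccontr)
    assume "\<not> e / K \<le> y"
    then have "y / e < 1 / K" using e K0 by (simp add: field_simps)
    then have "fext (Complex 0 (- (y / e))) \<notin> closure Q"
      using that e K0 b_pos[of N] left_in_Wext[of "y / e"] by (intro cQ) (auto simp: add_nonneg_nonneg less_imp_le)
    then show False using that(2) clos by blast
  qed
  from Bcases have "hit D d \<or> (\<exists>n\<in>{N..<k}. 1 \<le> line_integral (floor_metric (max (b (Suc n)) (K * e)) (a n)) \<eta> \<or>
     1 \<le> line_integral (tooth_metric (a n) (max (2 * a n) (K * e)) (b n)) \<eta>)"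
  proof cases
    case BL
    have ye: "0 \<le> y / e" using BL(1) e by simp
    have "\<not> K < y / e" using cP[OF left_in_Wext[OF ye]] BL(3) clos nl[OF ye] ye by auto
    then have yK: "y \<le> K * e" using e by (simp add: field_simps)
    \<comment> \<open>An end in \<open>P\<close> on the left side lies within K e of 0, so moving
      away from it by e/K is detected by the disc of radius 2 K e.\<close>
    have fin: "hit D d" if "curve_limit_point \<eta> Y" "e / K \<le> dist (Complex 0 (- y)) Y" for Y
      using D(1) d dK K0 e yK BL(1,2) that nl[OF BL(1)]
      by (intro hitI[where p = 0 and r = "2 * (K * e)" and X = "Complex 0 (- y)" and Y = Y]) auto
    have finRe: "hit D d" if "curve_limit_point \<eta> Y" "1 / K \<le> Re Y" for Y
    proof (rule fin[OF that(1)])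
      show "e / K \<le> dist (Complex 0 (- y)) Y"
        using abs_Re_le_cmod[of "Complex 0 (- y) - Y"] that(2) eK by (simp add: dist_norm)
    qed
    from Acases have "hit D d"
    proof cases
      case (AL y')
      have "1 / K \<le> \<bar>y / e - y' / e\<bar>" using sepy[OF ye _ BL(3) AL(3)] AL(1) e by simp
      also have "\<dots> = \<bar>y - y'\<bar> / e" using e by (simp add: diff_divide_distrib[symmetric])
      finally have "e / K \<le> \<bar>y - y'\<bar>" using e K0 by (simp add: field_simps)
      also have "\<dots> \<le> dist (Complex 0 (- y)) (Complex 0 (- y'))"
        using abs_Im_le_cmod[of "Complex 0 (- y) - Complex 0 (- y')"] by (simp add: dist_norm)
      finally show ?thesis using fin AL(2) by blast
    next
      case (AF x)
      then show ?thesis using AFx[OF AF(1,4)] b_pos[of N] by (intro finRe[OF AF(2)]) auto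
    next
      case (AT n)
      obtain t where t: "t \<in> {0<..<1}" "\<eta> t \<in> upper_tooth n 0" using in_tooth_upper[OF AT] by blast
      have "b N < a n" using ATn[OF AT] by (rule b_less_a)
      then have "1 / K \<le> Re (\<eta> t)" using t(2) bN eK by (simp add: upper_tooth_def)
      then show ?thesis using finRe curve_limit_pointI[OF t(1)] by blast
    next
      case AI
      then obtain t where t: "t \<in> {0<..<1}" "y + 1 < norm (\<eta> t)" unfolding lower_end_def by blast
      have "1 \<le> dist (Complex 0 (- y)) (\<eta> t)"
        using norm_triangle_ineq3[of "\<eta> t" "Complex 0 (- y)"] t(2) nl[OF BL(1)] by (simp add: dist_norm norm_minus_commute)
      then show ?thesis using fin curve_limit_pointI[OF t(1)] eK by force
    qed
    then show ?thesis ..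
  next
    case BR
    have up: "(\<exists>B. bounded_up B) \<or> (\<exists>m. tip_end \<eta> m) \<or> deep_end \<eta>"
    proof -
      have "bounded_up (of_real x)" if "x > 0" "curve_limit_point \<eta> (of_real x)" "of_real x \<notin> W" for x
        using that by (simp add: bounded_up_def)
      moreover have "(\<exists>B. bounded_up B) \<or> (\<exists>m. tip_end \<eta> m)" if it: "in_tooth P n" for n
      proof (cases "tip_end \<eta> n")
        case False
        then obtain q h where q: "q = a n \<or> q = b n" "0 < h" "curve_limit_point \<eta> (Complex q h)"
          using it unfolding in_tooth_def by blast
        then have "bounded_up (Complex q h)"
          using wall_not_in_W[of h q n] a_pos[of n] b_pos[of n] by (auto simp: bounded_up_def)
        then show ?thesis by blast
      qed blast
      ultimately show ?thesis using BR by blast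
    qed
    have xK: "x \<le> K" if "x > 0" "fext (of_real x) \<in> P" for x
      using cP[of "of_real x"] real_in_Wext[OF that(1)] that clos by force
    \<comment> \<open>As the end in \<open>P\<close> is not on the left side, the curve shows up at
      a floor point not beyond \<open>K\<close> or inside some tooth.\<close>
    have upper: "(\<exists>x>0. x \<le> K \<and> curve_limit_point \<eta> (of_real x)) \<or> (\<exists>m. \<exists>t\<in>{0<..<1}. \<eta> t \<in> upper_tooth m 0)"
      using BR
    proof (elim disjE exE conjE)
      fix x assume "x > 0" "curve_limit_point \<eta> (of_real x)" "fext (of_real x) \<in> P"
      then show ?thesis using xK[of x] by blast
    next
      fix n assume "in_tooth P n"
      then show ?thesis using in_tooth_upper[of P n] by blast
    next
      assume "deep_end \<eta>"
      then show ?thesis unfolding deep_end_def by blast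
    qed
    have Z: "\<exists>Z. curve_limit_point \<eta> Z \<and> 0 \<le> Im Z"
      using upper
    proof
      assume "\<exists>x>0. x \<le> K \<and> curve_limit_point \<eta> (of_real x)"
      then show ?thesis by force
    next
      assume "\<exists>m. \<exists>t\<in>{0<..<1}. \<eta> t \<in> upper_tooth m 0"
      then obtain m t where "t \<in> {0<..<1}" "\<eta> t \<in> upper_tooth m 0" by blast
      then show ?thesis using curve_limit_pointI[of t \<eta>] by (intro exI[of _ "\<eta> t"]) (auto simp: upper_tooth_def)
    qed
    \<comment> \<open>A curve that visits both a tooth and the lower half-plane passes through a
      mouth.\<close>
    have real: "\<exists>z>0. z \<le> K \<and> curve_limit_point \<eta> (of_real z)" if s: "s \<in> {0<..<1}" "Im (\<eta> s) < 0" for s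
      using upper
    proof
      assume "\<exists>m. \<exists>t\<in>{0<..<1}. \<eta> t \<in> upper_tooth m 0"
      then obtain m t where t: "t \<in> {0<..<1}" "\<eta> t \<in> upper_tooth m 0" by blast
      have "\<eta> s \<notin> upper_tooth m 0" using s by (simp add: upper_tooth_def)
      then obtain x where "a m < x" "x < b m" "curve_limit_point \<eta> (of_real x)" using mouth[OF t s(1)] by blast
      then show ?thesis using a_pos[of m] b_le_1[of m] K by (intro exI[of _ x]) auto
    qed
    have finK: "hit D d" if "curve_limit_point \<eta> (of_real z)" "0 < z" "z \<le> K" "curve_limit_point \<eta> Y" "1 / K \<le> dist (of_real z) Y" for z Y
      using D(3) d dK K0 that by (intro hitI[where p = 0 and r = "2 * K" and X = "of_real z" and Y = Y]) auto
    \<comment> \<open>Two different teeth force the curve through two mouths. One tooth has index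
      less than \<open>N\<close>; hence the gap between the mouths is at least 1/K wide.\<close>
    have mouths: "hit D d"
      if t: "t \<in> {0<..<1}" "\<eta> t \<in> upper_tooth m 0" and s: "s \<in> {0<..<1}" "\<eta> s \<in> upper_tooth n 0" and mn: "m \<noteq> n" "n < N" for t s m n
    proof -
      have "\<eta> s \<notin> upper_tooth m 0" "\<eta> t \<notin> upper_tooth n 0"
        using t s mn tooth_unique[of m _ n] by (auto simp: upper_tooth_def)
      obtain x where x: "a m < x" "x < b m" "curve_limit_point \<eta> (of_real x)"
        using mouth[OF t s(1) \<open>\<eta> s \<notin> upper_tooth m 0\<close>] by blast
      obtain z where z: "a n < z" "z < b n" "curve_limit_point \<eta> (of_real z)"
        using mouth[OF s t(1) \<open>\<eta> t \<notin> upper_tooth n 0\<close>] by blast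
      have "1 / K \<le> \<bar>x - z\<bar>"
      proof (cases "m < n")
        case True
        then have "1 / K \<le> a m - b (Suc m)" "b n \<le> b (Suc m)"
          using tc[of m] mn(2) by (auto simp: tooth_const_def intro: b_decreasing)
        then show ?thesis using x z by linarith
      next
        case False
        then have "n < m" using mn by simp
        then have "1 / K \<le> a n - b (Suc n)" "b m \<le> b (Suc n)"
          using tc[of n] mn(2) by (auto simp: tooth_const_def intro: b_decreasing)
        then show ?thesis using x z by linarith
      qed
      then show ?thesis using x z a_pos[of m] b_le_1[of m] K by (intro finK[of x "of_real z"]) (auto simp: dist_real_def)
    qed
    from Acases show ?thesis
    proof cases
      case (AL y)
      obtain Z where Z: "curve_limit_point \<eta> Z" "0 \<le> Im Z" using Z by blast
      have y: "e / K \<le> y" "0 < y" using ALy[OF AL(1,3)] eK by auto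
      have AZ: "y \<le> dist (Complex 0 (- y)) Z'" if "0 \<le> Im Z'" for Z'
        using abs_Im_le_cmod[of "Complex 0 (- y) - Z'"] y that by (simp add: dist_norm)
      \<comment> \<open>The transitional scale, the range of the zone metrics, and the unit
        scale.\<close>
      consider "y \<le> K * e" | "K * e < y" "y \<le> b N" | "b N < y" by linarith
      then show ?thesis
      proof cases
        case 1
        then have "hit D d" using D(1) d dK K0 e AL(2) Z(1) y nl[OF AL(1)] AZ[OF Z(2)]
          by (intro hitI[where p = 0 and r = "2 * (K * e)" and X = "Complex 0 (- y)" and Y = Z]) auto
        then show ?thesis ..
      next
        case 2
        obtain n where n: "N \<le> n" "n < k" "b (Suc n) < y" "y \<le> b n" using between_teeth[of k y N] k 2 by auto
        show ?thesis
        proof (cases "y \<le> a n")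
          case True
          let ?L = "max (b (Suc n)) (K * e)"
          have L: "0 < ?L" "?L < 2 * y" using b_pos[of "Suc n"] n(3) 2(1) y by auto
          have "hit D d \<or> (2 * ?L < y \<and> y < a n / 2 \<and> (\<forall>t\<in>{0<..<1}. ?L < norm (\<eta> t) \<and> norm (\<eta> t) < a n))"
            by (rule zone_or_hit[OF _ _ _ _ d(1,2) L True AL(2) Z]) (use Df[OF n(1,2)] in auto)
          moreover have "1 \<le> line_integral (floor_metric ?L (a n)) \<eta>" if "\<forall>t\<in>{0<..<1}. ?L < norm (\<eta> t) \<and> norm (\<eta> t) < a n"
            by (rule floor_zone[where n = n and y = y]) (use that L AL(2) y up in auto)
          ultimately show ?thesis using n(1,2) by auto
        next
          case False
          \<comment> \<open>The zone starts at 2 a n because its metric is centred at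
            \<open>a n\<close> and not at 0; values of \<open>y\<close> close to \<open>a n\<close>
            are left to the discs.\<close>
          let ?L = "max (2 * a n) (K * e)"
          have L: "0 < ?L" "?L < 2 * y" using a_pos[of n] False 2(1) y by auto
          have "hit D d \<or> (2 * ?L < y \<and> y < b n / 2 \<and> (\<forall>t\<in>{0<..<1}. ?L < norm (\<eta> t) \<and> norm (\<eta> t) < b n))"
            by (rule zone_or_hit[OF _ _ _ _ d(1,2) L n(4) AL(2) Z]) (use Dt[OF n(1,2)] in auto)
          moreover have "hit D d \<or> 1 \<le> line_integral (tooth_metric (a n) ?L (b n)) \<eta>"
            if "y < b n / 2" "\<forall>t\<in>{0<..<1}. ?L < norm (\<eta> t) \<and> norm (\<eta> t) < b n"
            by (rule tooth_zone[where y = y]) (use that AL(2) y up Dt[OF n(1,2)] d in auto)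
          ultimately show ?thesis using n(1,2) by auto
        qed
      next
        case 3
        obtain s where s: "s \<in> {0<..<1}" "Im (\<eta> s) < 0"
          using limit_point_open[OF AL(2) open_halfspace_Im_lt[of 0]] y by auto
        obtain z where z: "0 < z" "z \<le> K" "curve_limit_point \<eta> (of_real z)" using real[OF s] by blast
        have "hit D d"
        proof (cases "y \<le> 2 * K")
          case True
          have "d * (4 * K) \<le> dist (Complex 0 (- y)) Z" using AZ[OF Z(2)] 3 bN dK by linarith
          then show ?thesis using D(2) d K0 AL(2) Z(1) nl[OF AL(1)] True
            by (intro hitI[where p = 0 and r = "4 * K" and X = "Complex 0 (- y)" and Y = Z]) auto
        next
          case False
          have "1 / K \<le> y" using False K eK by linarith
          then show ?thesis using AZ[of "of_real z"] AL(2) z by (intro finK[of z "Complex 0 (- y)"]) (auto simp: dist_commute)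
        qed
        then show ?thesis ..
      qed
    next
      case AI
      obtain t where t: "t \<in> {0<..<1}" "Im (\<eta> t) < 0" "K + 1 < norm (\<eta> t)" using AI unfolding lower_end_def by blast
      obtain z where z: "0 < z" "z \<le> K" "curve_limit_point \<eta> (of_real z)" using real[OF t(1,2)] by blast
      have "1 \<le> dist (of_real z) (\<eta> t)"
        using norm_triangle_ineq3[of "\<eta> t" "of_real z"] t(3) z by (simp add: dist_norm norm_minus_commute)
      then have "1 / K \<le> dist (of_real z) (\<eta> t)" using eK(2) by linarith
      then have "hit D d" using z curve_limit_pointI[OF t(1)] finK by blast
      then show ?thesis ..
    next
      case (AF x)
      have x: "b N + 1 / K < x" using AFx[OF AF(1,4)] .
      have deep: "hit D d" if t: "t \<in> {0<..<1}" "\<eta> t \<in> upper_tooth m 0" and m: "N \<le> m" for t m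
      proof -
        have "b m \<le> b N" using m by (rule b_decreasing)
        moreover have "0 < 1 / K" using K0 by simp
        ultimately have "b m < x" using x by linarith
        then have "\<not> (a m \<le> Re (of_real x) \<and> Re (of_real x) \<le> b m \<and> 0 \<le> Im (of_real x))" by simp
        then obtain s where s: "s \<in> {0<..<1}" "\<eta> s \<notin> upper_tooth m 0" by (rule limit_outside_tooth[OF AF(2)])
        obtain z where z: "a m < z" "z < b m" "curve_limit_point \<eta> (of_real z)" using mouth[OF t s] by blast
        have "1 / K \<le> \<bar>z - x\<bar>" using x z(2) \<open>b m \<le> b N\<close> by linarith
        then show ?thesis using z a_pos[of m] b_le_1[of m] K AF(2) by (intro finK[of z "of_real x"]) (auto simp: dist_real_def)
      qed
      have "hit D d" using BR
      proof (elim disjE exE conjE)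
        fix x' assume x': "x' > 0" "curve_limit_point \<eta> (of_real x')" "fext (of_real x') \<in> P"
        have "1 / K \<le> \<bar>x' - x\<bar>" using sepx x' AF by blast
        then show ?thesis using x' xK AF(2) by (intro finK[of x' "of_real x"]) (auto simp: dist_real_def)
      next
        fix n assume it: "in_tooth P n"
        show ?thesis
        proof (cases "n < N")
          case True
          have "tooth_const Q P n K" using tc[OF True] tooth_const_commute by blast
          then show ?thesis unfolding d_def
            by (rule floor_tooth_hit[OF _ K Ke QP AF(2,1,3,4) it]) (use D Dq[OF True] in auto)
        next
          case False
          obtain t where "t \<in> {0<..<1}" "\<eta> t \<in> upper_tooth n 0" using in_tooth_upper[OF it] by blast
          then show ?thesis using deep False by (meson not_le)
        qed
      next
        assume "deep_end \<eta>"
        then obtain t m where "t \<in> {0<..<1}" "m \<ge> N" "\<eta> t \<in> upper_tooth m 0" unfolding deep_end_def by blast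
        then show ?thesis using deep by blast
      qed
      then show ?thesis ..
    next
      case (AT n)
      have n: "n < N" using ATn[OF AT] .
      obtain s where s: "s \<in> {0<..<1}" "\<eta> s \<in> upper_tooth n 0" using in_tooth_upper[OF AT] by blast
      have "hit D d" using BR
      proof (elim disjE exE conjE)
        fix x assume x: "x > 0" "curve_limit_point \<eta> (of_real x)" "of_real x \<notin> W" "fext (of_real x) \<in> P"
        show ?thesis unfolding d_def
          by (rule floor_tooth_hit[OF tc[OF n] K Ke PQ x(2,1,3,4) AT]) (use D Dq[OF n] in auto)
      next
        fix m assume it: "in_tooth P m"
        show ?thesis
        proof (cases "m = n")
          case True
          then show ?thesis unfolding d_def
            using same_tooth_hit[OF tc[OF n] K Ke PQ _ AT D(3) Dq[OF n]] it by blast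
        next
          case False
          obtain t where "t \<in> {0<..<1}" "\<eta> t \<in> upper_tooth m 0" using in_tooth_upper[OF it] by blast
          then show ?thesis using mouths s False n by blast
        qed
      next
        assume "deep_end \<eta>"
        then obtain t m where "t \<in> {0<..<1}" "m \<ge> N" "\<eta> t \<in> upper_tooth m 0" unfolding deep_end_def by blast
        then show ?thesis using mouths[of t m s n] s n by auto
      qed
      then show ?thesis ..
    qed
  qed
  then show ?thesis by (simp add: d_def)
qed

end

section \<open>Energies of the zone metrics\<close>

lemma abs_angle_le_half_pi:
  assumes "\<bar>y\<bar> < pi" "0 \<le> cos y"
  shows "\<bar>y\<bar> \<le> pi / 2"
proof (rule ccontr)
  assume "\<not> \<bar>y\<bar> \<le> pi / 2"
  then have "0 < cos (pi - \<bar>y\<bar>)" using assms(1) pi_gt_zero by (intro cos_gt_zero_pi) linarith+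
  then show False using assms(2) by (simp add: cos_diff)
qed

lemma floor_metric_measurable [measurable]: "floor_metric L U \<in> borel_measurable borel"
  and tooth_metric_measurable [measurable]: "tooth_metric p L U \<in> borel_measurable borel"
proof -
  have [measurable]: "{w. 0 < Re w \<and> Im w < 0 \<and> L < norm w \<and> norm w < U} \<in> sets borel"
    "{w. p \<le> Re w \<and> L < norm w \<and> norm w < U} \<in> sets borel" by measurable
  show "floor_metric L U \<in> borel_measurable borel" "tooth_metric p L U \<in> borel_measurable borel"
    unfolding floor_metric_def[abs_def] tooth_metric_def[abs_def] by measurable
qed

text \<open>The squared factor (2/\<pi>)^2 times the opening \<pi>/2 gives 2/\<pi> per unit of
  logarithmic length: a gap counts twice.\<close>

lemma floor_metric_energy:
  assumes L: "0 < L"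
  shows "(\<integral>\<^sup>+w\<in>X. (floor_metric L U w)\<^sup>2 \<partial>lborel) \<le> ennreal (2 / pi * max 0 (ln U - ln L))"
proof (cases "L < U")
  case True
  define Y where "Y = {w. 0 < Re w \<and> Im w < 0 \<and> L < norm w \<and> norm w < U}"
  have Y: "Y \<in> sets borel" unfolding Y_def by measurable
  have LU: "ln L \<le> ln U" using True L by simp
  have "(\<integral>\<^sup>+w\<in>X. (floor_metric L U w)\<^sup>2 \<partial>lborel) \<le> (\<integral>\<^sup>+w\<in>Y. ennreal ((2 / pi / norm (w - 0))\<^sup>2) \<partial>lborel)"
    by (intro nn_integral_mono) (auto simp: floor_metric_def Y_def ennreal_power split: split_indicator)
  also have "\<dots> \<le> ennreal ((2 / pi)\<^sup>2 * ((ln U - ln L) * (0 - (- (pi / 2)))))"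
  proof (rule polar_box_energy_le[OF _ LU _ Y])
    show "Y \<subseteq> polar_box 0 (ln L) (ln U) (- pi) pi"
    proof
      fix w assume "w \<in> Y"
      then show "w \<in> polar_box 0 (ln L) (ln U) (- pi) pi"
        using L True by (intro mem_polar_box_pi) (auto simp: Y_def complex_nonpos_Reals_iff)
    qed
    fix x y assume y: "y \<in> {-pi<..<pi}" "0 + of_real (exp x) * cis y \<in> Y"
    then have s: "0 < cos y" "sin y < 0" by (auto simp: Y_def zero_less_mult_iff mult_less_0_iff)
    have "y \<le> 0" using sin_ge_zero[of y] y(1) s(2) by (cases "0 \<le> y") auto
    moreover have "\<bar>y\<bar> < pi" using y(1) by (simp add: abs_less_iff)
    then have "\<bar>y\<bar> \<le> pi / 2" using s(1) by (intro abs_angle_le_half_pi) auto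
    ultimately show "y \<in> {- (pi / 2)..0}" unfolding atLeastAtMost_iff abs_le_iff by linarith
  qed (use pi_gt_zero in auto)
  also have "(2 / pi)\<^sup>2 * ((ln U - ln L) * (0 - (- (pi / 2)))) = 2 / pi * max 0 (ln U - ln L)"
    using LU by (simp add: power2_eq_square field_simps)
  finally show ?thesis .
next
  case False
  then have "floor_metric L U w = 0" for w by (auto simp: floor_metric_def)
  then show ?thesis by simp
qed

text \<open>The opening seen from \<open>p\<close> is \<pi>, which gives 1/\<pi> per unit of
  logarithmic length. Since 2 p \<le> L, moving the centre from 0 to \<open>p\<close> enlarges the
  range of radii at most to L/2 and 2 U, and this costs an additional log 4.\<close>

lemma tooth_metric_energy:
  assumes L: "0 < L" "0 \<le> p" "2 * p \<le> L"
  shows "(\<integral>\<^sup>+w\<in>X. (tooth_metric p L U w)\<^sup>2 \<partial>lborel) \<le> ennreal (1 / pi * (max 0 (ln U - ln L) + ln 4))"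
proof (cases "L < U")
  case True
  define Y where "Y = {w. p \<le> Re w \<and> L < norm w \<and> norm w < U}"
  have Y: "Y \<in> sets borel" unfolding Y_def by measurable
  have "ln L \<le> ln U" using True L by simp
  have LU: "ln (L / 2) \<le> ln (2 * U)" using True L by (intro ln_mono) auto
  have "(\<integral>\<^sup>+w\<in>X. (tooth_metric p L U w)\<^sup>2 \<partial>lborel) \<le> (\<integral>\<^sup>+w\<in>Y. ennreal ((1 / pi / norm (w - of_real p))\<^sup>2) \<partial>lborel)"
    by (intro nn_integral_mono) (auto simp: tooth_metric_def Y_def ennreal_power split: split_indicator)
  also have "\<dots> \<le> ennreal ((1 / pi)\<^sup>2 * ((ln (2 * U) - ln (L / 2)) * (pi / 2 - (- (pi / 2)))))"
  proof (rule polar_box_energy_le[OF _ LU _ Y])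
    show "Y \<subseteq> polar_box (of_real p) (ln (L / 2)) (ln (2 * U)) (- pi) pi"
    proof
      fix w assume w: "w \<in> Y"
      have "norm w - p \<le> norm (w - of_real p)" "norm (w - of_real p) \<le> norm w + p"
        using norm_triangle_ineq2[of w "of_real p"] norm_triangle_ineq4[of w "of_real p"] L(2) by simp_all
      then have n: "L / 2 < norm (w - of_real p)" "norm (w - of_real p) < 2 * U"
        using w L True by (auto simp: Y_def)
      have "w - of_real p \<notin> \<real>\<^sub>\<le>\<^sub>0"
      proof
        assume "w - of_real p \<in> \<real>\<^sub>\<le>\<^sub>0"
        then have "Re w - p \<le> 0" "Im w = 0" by (auto simp: complex_nonpos_Reals_iff)
        then have "w - of_real p = 0" using w by (simp add: Y_def complex_eq_iff)
        then show False using n(1) L(1) by simp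
      qed
      then show "w \<in> polar_box (of_real p) (ln (L / 2)) (ln (2 * U)) (- pi) pi"
        using n L True by (intro mem_polar_box_pi) auto
    qed
    fix x y assume y: "y \<in> {-pi<..<pi}" "of_real p + of_real (exp x) * cis y \<in> Y"
    then have "0 \<le> cos y" by (simp add: Y_def zero_le_mult_iff)
    moreover have "\<bar>y\<bar> < pi" using y(1) by (simp add: abs_less_iff)
    ultimately have "\<bar>y\<bar> \<le> pi / 2" by (rule abs_angle_le_half_pi[rotated])
    then show "y \<in> {- (pi / 2)..pi / 2}" unfolding atLeastAtMost_iff abs_le_iff by linarith
  qed (use pi_gt_zero in auto)
  also have "(1 / pi)\<^sup>2 * ((ln (2 * U) - ln (L / 2)) * (pi / 2 - (- (pi / 2)))) = 1 / pi * (ln U - ln L + 2 * ln 2)"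
    using L True by (simp add: ln_mult ln_div power2_eq_square field_simps)
  also have "2 * ln 2 = ln (4::real)" using ln_powr[of 2 2] by simp
  also have "ln U - ln L = max 0 (ln U - ln L)" using \<open>ln L \<le> ln U\<close> by simp
  finally show ?thesis .
next
  case False
  then have "tooth_metric p L U w = 0" for w by (auto simp: tooth_metric_def)
  then show ?thesis by simp
qed

context comb_domain begin

lemma end_in:
  assumes e: "0 < e" "e \<le> 1" and \<tau>: "\<And>k. \<tau> k \<in> {0<..<1}" and W: "\<And>t. t \<in> {0<..<1} \<Longrightarrow> \<eta> t \<in> W"
    and fx: "(\<lambda>k. f (V_map (1 / e) (\<eta> (\<tau> k)))) \<longlonglongrightarrow> x" and x: "norm x = 1" "x \<in> S"
  shows "(\<exists>A. curve_limit_point \<eta> A \<and> A \<in> Wext \<and> A \<notin> W \<and> fscaled e A \<in> S) \<or>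
    (\<exists>n. tip n \<in> S \<and> tip_end \<eta> n) \<or> (-\<i> \<in> S \<and> lower_end \<eta>) \<or> (-1 \<in> S \<and> deep_end \<eta>)"
  using end_cases[OF e \<tau> W fx x(1)] x(2) by blast

text \<open>Origin of the error constant: a zone of a tooth loses log 4 / \<pi>, there are at most 8
  (k + 1) discs, and a disc has energy at most \<pi> / d^2 = 4 \<pi> K^4.\<close>

lemma modulus_upper_bound:
  fixes N k :: nat
  assumes cc: "comb_const P Q K N" and PQ: "closure P \<inter> closure Q = {}" and P: "-1 \<in> P" and Q: "-\<i> \<in> Q"
    and sph: "P \<subseteq> sphere 0 1" "Q \<subseteq> sphere 0 1" and IJ: "I = P \<and> J = Q \<or> I = Q \<and> J = P"
    and e: "0 < e" and Ke: "K * e \<le> 1" and Nk: "N \<le> k" and k: "b k \<le> K * e"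
  shows "curve_modulus W (Gamma_eps \<phi> I J e) \<le>
    ennreal (1 / pi * (\<Sum>n\<in>{N..<k}. 2 * floor_len n (K * e) + tooth_len n (K * e)) + (ln 4 / pi + 32 * pi * K ^ 4) * (real k + 1))"
proof -
  have K: "2 \<le> K" using cc by (auto simp: comb_const_def)
  define d where "d = 1 / (2 * K\<^sup>2)"
  have d: "0 < d" using K by (simp add: d_def)
  have "e * 1 \<le> e * K" using K e by (intro mult_left_mono) auto
  then have e1: "e \<le> 1" using Ke by (simp add: mult.commute)
  have Ke0: "0 < K * e" using K e by simp
  \<comment> \<open>Lists are used because entries may coincide: the length bounds the cardinality
    without a case distinction.\<close>
  define F :: "nat \<Rightarrow> (complex \<times> real) list" where
    "F n = [(0, 4 * max (b (Suc n)) (K * e)), (0, 2 * max (b (Suc n)) (K * e)), (0, 2 * a n), (0, a n),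
       (0, 4 * max (2 * a n) (K * e)), (0, 2 * max (2 * a n) (K * e)), (0, 2 * b n), (0, b n)]" for n
  define G :: "nat \<Rightarrow> (complex \<times> real) list" where
    "G n = [(of_real (a n), 2 * (K * e)), (of_real (b n), 2 * (K * e))]" for n
  define Ds where "Ds = [(0, 2 * (K * e)), (0, 4 * K), (0, 2 * K)] @ concat (map G [0..<N]) @ concat (map F [N..<k])"
  define D where "D = set Ds"
  \<comment> \<open>The three initial discs are paid for by the summand 1 in \<open>k + 1\<close>,
    and the two discs of a tooth before \<open>N\<close> are fewer than eight.\<close>
  have "length Ds = 3 + 2 * N + 8 * (k - N)"
    by (simp add: Ds_def length_concat comp_def F_def G_def sum_list_triv)
  then have card: "card D \<le> 8 * (k + 1)" using card_length[of Ds] Nk unfolding D_def by simp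
  define \<rho> where "\<rho> i = (case i of Inl (Inl n) \<Rightarrow> floor_metric (max (b (Suc n)) (K * e)) (a n)
     | Inl (Inr n) \<Rightarrow> tooth_metric (a n) (max (2 * a n) (K * e)) (b n)
     | Inr (p, r) \<Rightarrow> disc_metric p r (1 / (d * r)))" for i :: "(nat + nat) + (complex \<times> real)"
  define A where "A = {N..<k}"
  have "curve_modulus W (Gamma_eps \<phi> I J e) \<le> (\<Sum>i\<in>(A <+> A) <+> D. \<integral>\<^sup>+w\<in>W. (\<rho> i w)\<^sup>2 \<partial>lborel)"
  proof (rule curve_modulus_le_sum)
    show "finite ((A <+> A) <+> D)" by (simp add: A_def D_def)
    show "\<rho> i \<in> borel_measurable borel" for i by (auto simp: \<rho>_def split: sum.split)
    show "W \<in> sets borel" using open_W by simp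
    fix \<eta> assume \<eta>: "\<eta> \<in> Gamma_eps \<phi> I J e" and rect: "locally_rectifiable \<eta>"
    obtain \<gamma> where \<gamma>: "\<gamma> \<in> connecting_curves I J" "\<eta> = V_map e \<circ> \<phi> \<circ> \<gamma>" using \<eta> unfolding Gamma_eps_def by blast
    have \<gamma>': "continuous_on {0..1} \<gamma>" "\<gamma> 0 \<in> I" "\<gamma> 1 \<in> J" "\<And>t. t \<in> {0<..<1} \<Longrightarrow> \<gamma> t \<in> ball 0 1"
      using \<gamma>(1) unfolding connecting_curves_def path_def pathstart_def pathfinish_def by blast+
    have inW: "\<eta> t \<in> W" if "t \<in> {0<..<1}" for t
      using phi_in_W[OF \<gamma>'(4)[OF that]] e by (simp add: \<gamma>(2) V_map_in_W_iff)
    have cont: "continuous_on {0<..<1} \<eta>"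
    proof -
      have "continuous_on {0<..<1} \<gamma>" by (rule continuous_on_subset[OF \<gamma>'(1)]) auto
      then have "continuous_on {0<..<1} (\<phi> \<circ> \<gamma>)"
        by (rule continuous_on_compose) (rule continuous_on_subset[OF cont_phi], use \<gamma>'(4) in blast)
      then show ?thesis unfolding \<gamma>(2) comp_assoc by (rule continuous_on_compose) (rule continuous_on_V_map)
    qed
    interpret comb_curve a b \<phi> \<eta> e
      by unfold_locales (fact cont rect inW e e1)+
    have f\<eta>: "f (V_map (1 / e) (\<eta> t)) = \<gamma> t" if "t \<in> {0<..<1}" for t
      using e \<gamma>'(4)[OF that] by (simp add: \<gamma>(2))
    have endp: "(\<exists>A. curve_limit_point \<eta> A \<and> A \<in> Wext \<and> A \<notin> W \<and> fscaled e A \<in> S) \<or>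
        (\<exists>n. tip n \<in> S \<and> tip_end \<eta> n) \<or> (-\<i> \<in> S \<and> lower_end \<eta>) \<or> (-1 \<in> S \<and> deep_end \<eta>)"
      if S: "S \<subseteq> sphere 0 1" "\<gamma> s \<in> S" "s \<in> {0..1}" and \<tau>: "\<And>k. \<tau> k \<in> {0<..<1}" "\<tau> \<longlonglongrightarrow> s" for S s \<tau>
    proof (rule end_in[OF e(1) e1 \<tau>(1) inW _ _ S(2)])
      have "\<forall>k. \<tau> k \<in> {0..1}" using \<tau>(1) by (auto simp: less_imp_le)
      then have "(\<lambda>k. \<gamma> (\<tau> k)) \<longlonglongrightarrow> \<gamma> s"
        using \<gamma>'(1) S(3) \<tau>(2) unfolding continuous_on_sequentially comp_def by blast
      then show "(\<lambda>k. f (V_map (1 / e) (\<eta> (\<tau> k)))) \<longlonglongrightarrow> \<gamma> s" by (simp add: f\<eta>[OF \<tau>(1)])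
    qed (use S in auto)
    \<comment> \<open>Parameters that tend to the two ends of the interval. The curve in the disk is
      continuous up to its ends, so along them it converges to points of the arcs.\<close>
    have \<tau>0: "1 / (real k + 2) \<in> {0<..<1}" for k by (auto simp: field_simps)
    have l0: "(\<lambda>k. 1 / (real k + 2)) \<longlonglongrightarrow> 0" by real_asymp
    have \<tau>1: "1 - 1 / (real k + 2) \<in> {0<..<1}" for k using \<tau>0[of k] by auto
    have l1: "(\<lambda>k. 1 - 1 / (real k + 2)) \<longlonglongrightarrow> 1" by real_asymp
    have "hit D (1 / (2 * K\<^sup>2)) \<or> (\<exists>n\<in>{N..<k}. 1 \<le> line_integral (floor_metric (max (b (Suc n)) (K * e)) (a n)) \<eta> \<or>
       1 \<le> line_integral (tooth_metric (a n) (max (2 * a n) (K * e)) (b n)) \<eta>)"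
    proof (rule curve_hit[OF cc PQ P Q Ke k])
      show "(\<exists>B. curve_limit_point \<eta> B \<and> B \<in> Wext \<and> B \<notin> W \<and> fscaled e B \<in> P) \<or>
        (\<exists>n. tip n \<in> P \<and> tip_end \<eta> n) \<or> (-\<i> \<in> P \<and> lower_end \<eta>) \<or> (-1 \<in> P \<and> deep_end \<eta>)"
        using IJ endp[OF sph(1) _ _ \<tau>0 l0] endp[OF sph(1) _ _ \<tau>1 l1] \<gamma>'(2,3) by (elim disjE conjE) simp_all
      show "(\<exists>B. curve_limit_point \<eta> B \<and> B \<in> Wext \<and> B \<notin> W \<and> fscaled e B \<in> Q) \<or>
        (\<exists>n. tip n \<in> Q \<and> tip_end \<eta> n) \<or> (-\<i> \<in> Q \<and> lower_end \<eta>) \<or> (-1 \<in> Q \<and> deep_end \<eta>)"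
        using IJ endp[OF sph(2) _ _ \<tau>0 l0] endp[OF sph(2) _ _ \<tau>1 l1] \<gamma>'(2,3) by (elim disjE conjE) simp_all
      fix n q
      show "n < N \<Longrightarrow> q = a n \<or> q = b n \<Longrightarrow> (of_real q, 2 * (K * e)) \<in> D"
        unfolding D_def Ds_def by (auto simp: G_def)
      assume n: "N \<le> n" "n < k"
      then have "set (F n) \<subseteq> D" unfolding D_def Ds_def by auto
      then show "{(0, 4 * max (b (Suc n)) (K * e)), (0, 2 * max (b (Suc n)) (K * e)), (0, 2 * a n), (0, a n)} \<subseteq> D"
        "{(0, 4 * max (2 * a n) (K * e)), (0, 2 * max (2 * a n) (K * e)), (0, 2 * b n), (0, b n)} \<subseteq> D"
        by (simp_all add: F_def)
    qed (simp_all add: D_def Ds_def)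
    then show "\<exists>i\<in>(A <+> A) <+> D. 1 \<le> line_integral (\<rho> i) \<eta>"
    proof (elim disjE bexE)
      assume "hit D (1 / (2 * K\<^sup>2))"
      then obtain p r where "(p, r) \<in> D" "1 \<le> line_integral (disc_metric p r (1 / (d * r))) \<eta>"
        unfolding hit_def d_def by blast
      then show ?thesis by (intro bexI[of _ "Inr (p, r)"]) (auto simp: \<rho>_def)
    next
      fix n assume "n \<in> {N..<k}" "1 \<le> line_integral (floor_metric (max (b (Suc n)) (K * e)) (a n)) \<eta>"
      then show ?thesis by (intro bexI[of _ "Inl (Inl n)"]) (auto simp: \<rho>_def A_def)
    next
      fix n assume "n \<in> {N..<k}" "1 \<le> line_integral (tooth_metric (a n) (max (2 * a n) (K * e)) (b n)) \<eta>"
      then show ?thesis by (intro bexI[of _ "Inl (Inr n)"]) (auto simp: \<rho>_def A_def)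
    qed
  qed
  also have "\<dots> = (\<Sum>n\<in>A. \<integral>\<^sup>+w\<in>W. (floor_metric (max (b (Suc n)) (K * e)) (a n) w)\<^sup>2 \<partial>lborel) +
      (\<Sum>n\<in>A. \<integral>\<^sup>+w\<in>W. (tooth_metric (a n) (max (2 * a n) (K * e)) (b n) w)\<^sup>2 \<partial>lborel) +
      (\<Sum>i\<in>D. \<integral>\<^sup>+w\<in>W. (disc_metric (fst i) (snd i) (1 / (d * snd i)) w)\<^sup>2 \<partial>lborel)"
    by (simp add: sum.Plus A_def D_def \<rho>_def split_beta)
  also have "\<dots> \<le> (\<Sum>n\<in>A. ennreal (2 / pi * floor_len n (K * e))) + (\<Sum>n\<in>A. ennreal (1 / pi * (tooth_len n (K * e) + ln 4))) +
      (\<Sum>i\<in>D. ennreal (4 * pi * K ^ 4))"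
  proof (intro add_mono sum_mono)
    fix n
    have "0 < max (b (Suc n)) (K * e)" using Ke0 by simp
    from floor_metric_energy[OF this, of "a n" W]
    show "(\<integral>\<^sup>+w\<in>W. (floor_metric (max (b (Suc n)) (K * e)) (a n) w)\<^sup>2 \<partial>lborel) \<le> ennreal (2 / pi * floor_len n (K * e))"
      by (simp add: floor_len_def)
    let ?L = "max (2 * a n) (K * e)"
    have L: "0 < ?L" "0 \<le> a n" "2 * a n \<le> ?L" using Ke0 a_pos[of n] by auto
    have "ln (max (a n) (K * e)) \<le> ln ?L" using a_pos[of n] by (subst ln_le_cancel_iff) auto
    then have "max 0 (ln (b n) - ln ?L) \<le> tooth_len n (K * e)" unfolding tooth_len_def by linarith
    then have "1 / pi * (max 0 (ln (b n) - ln ?L) + ln 4) \<le> 1 / pi * (tooth_len n (K * e) + ln 4)"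
      using pi_gt_zero by (intro mult_left_mono) auto
    then show "(\<integral>\<^sup>+w\<in>W. (tooth_metric (a n) ?L (b n) w)\<^sup>2 \<partial>lborel) \<le> ennreal (1 / pi * (tooth_len n (K * e) + ln 4))"
      using tooth_metric_energy[OF L, of "b n" W] by (meson ennreal_leI order_trans)
  next
    fix i assume "i \<in> D"
    have r: "0 \<le> snd i"
      using \<open>i \<in> D\<close> K Ke0 a_pos b_pos unfolding D_def Ds_def F_def G_def by (auto simp: less_imp_le le_max_iff_disj)
    then have "(\<integral>\<^sup>+w\<in>W. (disc_metric (fst i) (snd i) (1 / (d * snd i)) w)\<^sup>2 \<partial>lborel) \<le> ennreal ((1 / (d * snd i))\<^sup>2 * (snd i)\<^sup>2 * pi)"
      using d by (intro nn_integral_disc_metric_le) auto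
    also have "(1 / (d * snd i))\<^sup>2 * (snd i)\<^sup>2 * pi \<le> 4 * pi * K ^ 4"
      using K by (cases "snd i = 0") (auto simp: d_def power2_eq_square power4_eq_xxxx field_simps)
    finally show "(\<integral>\<^sup>+w\<in>W. (disc_metric (fst i) (snd i) (1 / (d * snd i)) w)\<^sup>2 \<partial>lborel) \<le> ennreal (4 * pi * K ^ 4)"
      by (simp add: ennreal_leI)
  qed
  also have "\<dots> = ennreal ((\<Sum>n\<in>A. 2 / pi * floor_len n (K * e)) + (\<Sum>n\<in>A. 1 / pi * (tooth_len n (K * e) + ln 4)) + real (card D) * (4 * pi * K ^ 4))"
  proof -
    have nn: "0 \<le> 2 / pi * floor_len n (K * e)" "0 \<le> 1 / pi * (tooth_len n (K * e) + ln 4)" for n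
      using pi_gt_zero by (auto simp: floor_len_def tooth_len_def)
    have "(\<Sum>i\<in>D. ennreal (4 * pi * K ^ 4)) = ennreal (\<Sum>i\<in>D. 4 * pi * K ^ 4)" using K by (intro sum_ennreal) auto
    moreover have "(\<Sum>n\<in>A. ennreal (2 / pi * floor_len n (K * e))) = ennreal (\<Sum>n\<in>A. 2 / pi * floor_len n (K * e))"
      "(\<Sum>n\<in>A. ennreal (1 / pi * (tooth_len n (K * e) + ln 4))) = ennreal (\<Sum>n\<in>A. 1 / pi * (tooth_len n (K * e) + ln 4))"
      by (intro sum_ennreal nn)+
    moreover have "0 \<le> (\<Sum>n\<in>A. 2 / pi * floor_len n (K * e))" "0 \<le> (\<Sum>n\<in>A. 1 / pi * (tooth_len n (K * e) + ln 4))"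
      by (intro sum_nonneg nn)+
    moreover have "0 \<le> (\<Sum>i\<in>D. 4 * pi * K ^ 4)" using K by (intro sum_nonneg) auto
    ultimately show ?thesis by (simp only: ennreal_plus[symmetric] add_nonneg_nonneg) simp
  qed
  also have "\<dots> \<le> ennreal (1 / pi * (\<Sum>n\<in>{N..<k}. 2 * floor_len n (K * e) + tooth_len n (K * e)) + (ln 4 / pi + 32 * pi * K ^ 4) * (real k + 1))"
  proof (rule ennreal_leI)
    have "(\<Sum>n\<in>A. 1 / pi * (tooth_len n (K * e) + ln 4)) = (\<Sum>n\<in>A. 1 / pi * tooth_len n (K * e)) + real (card A) * (ln 4 / pi)"
      by (simp add: distrib_left add_divide_distrib sum.distrib)
    moreover have "real (card A) * (ln 4 / pi) \<le> (real k + 1) * (ln 4 / pi)"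
      using pi_gt_zero by (intro mult_right_mono) (auto simp: A_def)
    moreover have "real (card D) * (4 * pi * K ^ 4) \<le> real (8 * (k + 1)) * (4 * pi * K ^ 4)"
      using card K pi_gt_zero by (intro mult_right_mono) (simp only: of_nat_le_iff, simp)
    moreover have "1 / pi * (\<Sum>n\<in>{N..<k}. 2 * floor_len n (K * e) + tooth_len n (K * e)) =
       (\<Sum>n\<in>A. 2 / pi * floor_len n (K * e)) + (\<Sum>n\<in>A. 1 / pi * tooth_len n (K * e))"
      by (simp add: A_def sum_distrib_left sum.distrib[symmetric] add_divide_distrib distrib_left)
    ultimately show "(\<Sum>n\<in>A. 2 / pi * floor_len n (K * e)) + (\<Sum>n\<in>A. 1 / pi * (tooth_len n (K * e) + ln 4)) + real (card D) * (4 * pi * K ^ 4)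
       \<le> 1 / pi * (\<Sum>n\<in>{N..<k}. 2 * floor_len n (K * e) + tooth_len n (K * e)) + (ln 4 / pi + 32 * pi * K ^ 4) * (real k + 1)"
      by (simp add: algebra_simps)
  qed
  finally show ?thesis .
qed

end

section \<open>Asymptotics\<close>

text \<open>Inequalities up to an arbitrarily small constant suffice for both limits; this absorbs
  the error terms.\<close>

lemma Liminf_Limsup_le_of_eventually:
  fixes X Y :: "'a \<Rightarrow> ereal"
  assumes F: "F \<noteq> bot" and le: "\<And>d::real. 0 < d \<Longrightarrow> eventually (\<lambda>x. X x \<le> Y x + ereal d) F"
  shows "Liminf F X \<le> Liminf F Y" "Limsup F X \<le> Limsup F Y"
proof -
  have "Liminf F X \<le> Liminf F Y + ereal d" if "0 < d" for d
    using Liminf_mono[OF le[OF that]] Liminf_add_ereal_right[OF F, of "ereal d" Y] by simp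
  then show "Liminf F X \<le> Liminf F Y" by (rule ereal_le_epsilon2)
  have "Limsup F X \<le> Limsup F Y + ereal d" if "0 < d" for d
    using Limsup_mono[OF le[OF that]] Limsup_add_ereal_right[OF F, of "ereal d" Y] by simp
  then show "Limsup F X \<le> Limsup F Y" by (rule ereal_le_epsilon2)
qed

lemma
  fixes X :: "'a \<Rightarrow> ereal"
  assumes "filterlim h F G"
  shows Liminf_le_compose: "Liminf F X \<le> Liminf G (\<lambda>n. X (h n))"
    and Limsup_ge_compose: "Limsup G (\<lambda>n. X (h n)) \<le> Limsup F X"
  unfolding le_Liminf_iff Limsup_le_iff
  using le_Liminf_iff[of "Liminf F X" F X] Limsup_le_iff[of F X "Limsup F X"] assms
  by (auto simp: filterlim_iff)

context comb_domain begin

section \<open>Logarithmic length of the gaps\<close>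

definition tooth_index :: "real \<Rightarrow> nat" where "tooth_index x = (LEAST k. b k \<le> x)"

text \<open>The logarithmic length of all gaps beyond \<open>x\<close>. By
  \<open>floor_sum_eq\<close> the sum may be extended to any \<open>k\<close> with
  \<open>b k \<le> x\<close>, as further gaps contribute nothing.\<close>

definition floor_sum :: "real \<Rightarrow> real" where "floor_sum x = (\<Sum>n<tooth_index x. floor_len n x)"

lemma b_tooth_index: "0 < x \<Longrightarrow> b (tooth_index x) \<le> x"
  unfolding tooth_index_def
  by (rule LeastI_ex) (use order_tendstoD(2)[OF b_lim, of x] in \<open>auto simp: eventually_sequentially intro: less_imp_le\<close>)

lemma tooth_index_le_iff: "0 < x \<Longrightarrow> tooth_index x \<le> k \<longleftrightarrow> b k \<le> x"
  using b_tooth_index[of x] b_decreasing[of "tooth_index x" k] Least_le[of "\<lambda>k. b k \<le> x" k]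
  unfolding tooth_index_def by force

lemma len_nonneg: "0 \<le> floor_len n x" "0 \<le> tooth_len n x"
  by (auto simp: floor_len_def tooth_len_def)

lemma floor_sum_eq:
  assumes "0 < x" "b k \<le> x"
  shows "floor_sum x = (\<Sum>n<k. floor_len n x)"
  unfolding floor_sum_def
proof (rule sum.mono_neutral_left)
  show "{..<tooth_index x} \<subseteq> {..<k}" using tooth_index_le_iff[OF assms(1), of k] assms(2) by auto
  show "\<forall>n\<in>{..<k} - {..<tooth_index x}. floor_len n x = 0"
  proof
    fix n assume "n \<in> {..<k} - {..<tooth_index x}"
    then have "a n < x" using tooth_index_le_iff[OF assms(1), of n] a_less_b[of n] by auto
    then have "ln (a n) \<le> ln (max (b (Suc n)) x)" using a_pos[of n] by (intro ln_mono) auto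
    then show "floor_len n x = 0" unfolding floor_len_def by linarith
  qed
qed simp

lemma len_antimono:
  assumes "0 < x" "x \<le> y"
  shows "floor_len n y \<le> floor_len n x" "tooth_len n y \<le> tooth_len n x"
proof -
  have "ln (max (b (Suc n)) x) \<le> ln (max (b (Suc n)) y)" "ln (max (a n) x) \<le> ln (max (a n) y)"
    using assms by (intro ln_mono; auto)+
  then show "floor_len n y \<le> floor_len n x" "tooth_len n y \<le> tooth_len n x"
    unfolding floor_len_def tooth_len_def by linarith+
qed

lemma len_add:
  assumes "0 < x"
  shows "floor_len n x + tooth_len n x = ln (max (b n) x) - ln (max (b (Suc n)) x)"
proof -
  have o: "0 < b (Suc n)" "b (Suc n) < a n" "a n < b n" using b_pos b_Suc_less a_less_b by auto
  have m: "ln u \<le> ln v" if "0 < u" "u \<le> v" for u v :: real using that by (simp add: ln_mono)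
  consider "x \<le> b (Suc n)" | "b (Suc n) < x" "x \<le> a n" | "a n < x" "x \<le> b n" | "b n < x" by linarith
  then show ?thesis
  proof cases
    case 1
    then show ?thesis using o m[of "b (Suc n)" "a n"] m[of "a n" "b n"] by (simp add: floor_len_def tooth_len_def max_def)
  next
    case 2
    then show ?thesis using o assms m[of x "a n"] m[of "a n" "b n"] by (simp add: floor_len_def tooth_len_def max_def)
  next
    case 3
    then show ?thesis using o assms m[of "a n" x] m[of x "b n"] by (simp add: floor_len_def tooth_len_def max_def)
  next
    case 4
    then show ?thesis using o assms m[of "a n" x] m[of "b n" x] by (simp add: floor_len_def tooth_len_def max_def)
  qed
qed

lemma sum_len_add:
  assumes "0 < x"
  shows "(\<Sum>n<k. floor_len n x + tooth_len n x) = ln (max 1 x) - ln (max (b k) x)"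
  using sum_lessThan_telescope'[of "\<lambda>n. ln (max (b n) x)" k] by (simp add: len_add[OF assms] b_zero)

lemma sum_len_double:
  assumes "0 < x" "x \<le> 1" "b k \<le> x"
  shows "(\<Sum>n<k. 2 * floor_len n x + tooth_len n x) = ln (1 / x) + floor_sum x"
proof -
  have "(\<Sum>n<k. 2 * floor_len n x + tooth_len n x) = (\<Sum>n<k. floor_len n x) + (\<Sum>n<k. floor_len n x + tooth_len n x)"
    by (simp add: sum.distrib[symmetric] algebra_simps)
  then show ?thesis using assms sum_len_add[OF assms(1), of k] floor_sum_eq[OF assms(1,3)]
    by (simp add: max_absorb2 max_absorb1 ln_div)
qed

text \<open>Multiplying the cutoff by \<open>C\<close> shortens gaps and teeth together by exactly
  log C. Neither of them grows, so the gaps alone lose at most log C.\<close>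

lemma floor_sum_scale:
  assumes "0 < x" "1 \<le> C" "C * x \<le> 1"
  shows "floor_sum (C * x) \<le> floor_sum x" "floor_sum x - ln C \<le> floor_sum (C * x)"
proof -
  define k where "k = tooth_index x"
  have k: "b k \<le> x" using b_tooth_index[OF assms(1)] by (simp add: k_def)
  have le: "x \<le> C * x" using assms mult_right_mono[of 1 C x] by simp
  have kC: "b k \<le> C * x" using k le by linarith
  have Cx: "0 < C * x" using assms by simp
  have fs: "floor_sum x = (\<Sum>n<k. floor_len n x)" "floor_sum (C * x) = (\<Sum>n<k. floor_len n (C * x))"
    using floor_sum_eq[OF assms(1) k] floor_sum_eq[OF Cx kC] by auto
  show "floor_sum (C * x) \<le> floor_sum x" unfolding fs by (intro sum_mono len_antimono assms le)
  have "(\<Sum>n<k. tooth_len n (C * x)) \<le> (\<Sum>n<k. tooth_len n x)" by (intro sum_mono len_antimono assms le)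
  moreover have "floor_sum x + (\<Sum>n<k. tooth_len n x) = - ln x"
    using sum_len_add[OF assms(1), of k] k assms(3) le unfolding fs
    by (simp add: sum.distrib max_absorb2 max_absorb1)
  moreover have "floor_sum (C * x) + (\<Sum>n<k. tooth_len n (C * x)) = - (ln C + ln x)"
    using sum_len_add[OF Cx, of k] kC assms unfolding fs
    by (simp add: sum.distrib max_absorb2 max_absorb1 ln_mult)
  ultimately show "floor_sum x - ln C \<le> floor_sum (C * x)" by linarith
qed

text \<open>The product over \<open>k < n\<close> is A with index n - 1, read as 1 for n = 0. Since
  \<open>b 0 = 1\<close>, the logarithm is the logarithmic length of all gaps beyond
  \<open>b n\<close>.\<close>

definition log_ratio :: "nat \<Rightarrow> real" where
  "log_ratio n = ln ((\<Prod>k<n. a k) / (\<Prod>k\<le>n. b k))"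

lemma log_ratio_Suc: "log_ratio (Suc n) = log_ratio n + (ln (a n) - ln (b (Suc n)))"
proof -
  define A B where "A = (\<Prod>k<n. a k)" and "B = (\<Prod>k\<le>n. b k)"
  have "0 < A" "0 < B" using a_pos b_pos by (auto simp: A_def B_def intro: prod_pos)
  moreover have "log_ratio (Suc n) = ln (A * a n / (B * b (Suc n)))" "log_ratio n = ln (A / B)"
    by (simp_all add: log_ratio_def A_def B_def)
  ultimately show ?thesis using a_pos[of n] b_pos[of "Suc n"] by (simp add: ln_div ln_mult)
qed

lemma log_ratio_sum: "log_ratio n = (\<Sum>m<n. ln (a m) - ln (b (Suc m)))"
  by (induction n) (simp_all add: log_ratio_Suc, simp add: log_ratio_def b_zero)

lemma floor_sum_between:
  assumes "b (Suc n) \<le> x" "x \<le> b n"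
  shows "floor_sum x = log_ratio n + max 0 (ln (a n) - ln x)"
proof -
  have x: "0 < x" using assms b_pos[of "Suc n"] by linarith
  have "floor_len m x = ln (a m) - ln (b (Suc m))" if "m < n" for m
  proof -
    have "x \<le> b (Suc m)" using assms(2) b_decreasing[of "Suc m" n] that by simp
    moreover have "ln (b (Suc m)) \<le> ln (a m)" using b_Suc_less[of m] b_pos[of "Suc m"] by (intro ln_mono) auto
    ultimately show ?thesis by (simp add: floor_len_def max_absorb1)
  qed
  then have "(\<Sum>m<n. floor_len m x) = log_ratio n" by (simp add: log_ratio_sum)
  moreover have "floor_len n x = max 0 (ln (a n) - ln x)" using assms(1) by (simp add: floor_len_def max_absorb2)
  ultimately show ?thesis using floor_sum_eq[OF x assms(1)] by simp
qed

text \<open>The gaps beyond \<open>b n\<close> are disjoint subintervals of the interval from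
  \<open>b n\<close> to 1, which has logarithmic length at most log(1/a n).\<close>

lemma log_ratio_bounds: "0 \<le> log_ratio n" "log_ratio n \<le> ln (1 / a n)"
proof -
  have "ln (b (Suc m)) \<le> ln (a m)" "ln (a m) \<le> ln (b m)" for m
    using b_Suc_less[of m] b_pos[of "Suc m"] a_pos[of m] a_less_b[of m] by (intro ln_mono; simp)+
  note o = this
  show "0 \<le> log_ratio n" unfolding log_ratio_sum by (intro sum_nonneg) (use o in simp)
  have "log_ratio n \<le> (\<Sum>m<n. ln (b m) - ln (b (Suc m)))" unfolding log_ratio_sum by (intro sum_mono) (use o in simp)
  also have "\<dots> = - ln (b n)" using sum_lessThan_telescope'[of "\<lambda>n. ln (b n)" n] by (simp add: b_zero)
  also have "\<dots> \<le> ln (1 / a n)" using o(2)[of n] a_pos[of n] by (simp add: ln_div)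
  finally show "log_ratio n \<le> ln (1 / a n)" .
qed

abbreviation rel_floor :: "real \<Rightarrow> real" where "rel_floor x \<equiv> floor_sum x / ln (1 / x)"

lemma rel_floor_a: "rel_floor (a n) = log_ratio n / ln (1 / a n)"
  using floor_sum_between[of n "a n"] b_Suc_less[of n] a_less_b[of n] by simp

lemma rel_floor_b: "rel_floor (b n) = log_ratio n / ln (1 / b n)"
  using floor_sum_between[of n "b n"] b_Suc_less[of n] a_less_b[of n] ln_mono[of "a n" "b n"] a_pos[of n] by simp

text \<open>With u = log(1/x) and \<alpha> = log(1/a n), the quotient is s/u up to u = \<alpha> and
  (s + u - \<alpha>)/u afterwards. It decreases first and then increases, the latter because s \<le>
  \<alpha>; so the minimum is at \<open>a n\<close>.\<close>

lemma rel_floor_lower: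
  assumes "b (Suc n) \<le> x" "x < b n"
  shows "log_ratio n / ln (1 / a n) \<le> rel_floor x"
proof -
  have x: "0 < x" "x < 1" using assms b_pos[of "Suc n"] b_le_1[of n] by linarith+
  have a: "0 < a n" "a n < 1" using a_pos[of n] a_less_b[of n] b_le_1[of n] by linarith+
  define u \<alpha> s where "u = ln (1 / x)" and "\<alpha> = ln (1 / a n)" and "s = log_ratio n"
  have u: "0 < u" "0 < \<alpha>" "0 \<le> s" "s \<le> \<alpha>"
    using x a log_ratio_bounds[of n] by (auto simp: u_def \<alpha>_def s_def)
  have "floor_sum x = s + max 0 (u - \<alpha>)"
    using floor_sum_between[OF assms(1) less_imp_le[OF assms(2)]] x a by (simp add: u_def \<alpha>_def s_def ln_div)
  moreover have "s / \<alpha> \<le> (s + max 0 (u - \<alpha>)) / u"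
  proof (cases "u \<le> \<alpha>")
    case True
    then show ?thesis using u by (simp add: frac_le)
  next
    case False
    then have "0 \<le> (u - \<alpha>) * (\<alpha> - s)" using u by simp
    then show ?thesis using u False by (simp add: divide_simps algebra_simps)
  qed
  ultimately show ?thesis by (simp add: u_def \<alpha>_def s_def)
qed

text \<open>By the same monotonicity the maximum over the interval is at one of its ends. The index
  0 is excluded since log(1/b 0) vanishes.\<close>

lemma rel_floor_upper:
  assumes "0 < n" "b (Suc n) \<le> x" "x < b n"
  shows "rel_floor x \<le> max (log_ratio n / ln (1 / b n)) (log_ratio (Suc n) / ln (1 / b (Suc n)))"
proof -
  have bn: "0 < b n" "b n < 1" using b_pos[of n] b_less_a[OF assms(1)] a_less_b[of 0] b_zero by auto
  have x: "0 < x" "x < 1" using assms b_pos[of "Suc n"] bn by linarith+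
  have b': "0 < b (Suc n)" "b (Suc n) < 1" using assms b_pos[of "Suc n"] x by linarith+
  have a: "0 < a n" using a_pos .
  define u \<alpha> \<beta> \<beta>' s where "u = ln (1 / x)" and "\<alpha> = ln (1 / a n)" and "\<beta> = ln (1 / b n)" and "\<beta>' = ln (1 / b (Suc n))" and "s = log_ratio n"
  have u: "0 < u" "0 < \<beta>" "0 < \<beta>'" "0 \<le> s" "s \<le> \<alpha>" "\<beta> \<le> u" "u \<le> \<beta>'"
    using x bn b' log_ratio_bounds[of n] assms by (auto simp: u_def \<alpha>_def \<beta>_def \<beta>'_def s_def ln_div)
  have s': "log_ratio (Suc n) = s + \<beta>' - \<alpha>" using a b' by (simp add: log_ratio_Suc \<beta>'_def \<alpha>_def s_def ln_div)
  have fs: "floor_sum x = s + max 0 (u - \<alpha>)"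
    using floor_sum_between[OF assms(2) less_imp_le[OF assms(3)]] x a by (simp add: u_def \<alpha>_def s_def ln_div)
  have "(s + max 0 (u - \<alpha>)) / u \<le> s / \<beta> \<or> (s + max 0 (u - \<alpha>)) / u \<le> (s + \<beta>' - \<alpha>) / \<beta>'"
  proof (cases "u \<le> \<alpha>")
    case True
    then show ?thesis using u by (simp add: frac_le)
  next
    case False
    have "0 \<le> (\<beta>' - u) * (\<alpha> - s)" using u by simp
    then have "(s + (u - \<alpha>)) / u \<le> (s + \<beta>' - \<alpha>) / \<beta>'" using u by (simp add: divide_simps algebra_simps)
    then show ?thesis using False by simp
  qed
  then show ?thesis unfolding fs s' u_def[symmetric] \<beta>_def[symmetric] \<beta>'_def[symmetric] s_def[symmetric] by auto
qed

lemma filterlim_tooth_index: "filterlim (\<lambda>x. tooth_index x - 1) sequentially (at_right 0)"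
  unfolding filterlim_at_top
proof
  fix n :: nat
  have "\<forall>\<^sub>F x in at_right 0. x \<in> {0<..<b (Suc n)}" using b_pos[of "Suc n"] by (rule eventually_at_right_real)
  then show "\<forall>\<^sub>F x in at_right 0. n \<le> tooth_index x - 1"
  proof eventually_elim
    case (elim x)
    then show ?case using tooth_index_le_iff[of x "Suc n"] by auto
  qed
qed

text \<open>\<open>x < 1 = b 0\<close> makes the index positive, so the subtraction of natural
  numbers is a true one.\<close>

lemma tooth_index_between:
  assumes "0 < x" "x < 1"
  shows "b (Suc (tooth_index x - 1)) \<le> x" "x < b (tooth_index x - 1)"
proof -
  have "0 < tooth_index x" using tooth_index_le_iff[OF assms(1), of 0] assms b_zero by auto
  then show "b (Suc (tooth_index x - 1)) \<le> x" "x < b (tooth_index x - 1)"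
    using b_tooth_index[OF assms(1)] tooth_index_le_iff[OF assms(1), of "tooth_index x - 1"] by auto
qed

text \<open>The value for n is attained at \<open>a n\<close>, and conversely the quotient at
  \<open>x\<close> is at least the value for the interval that contains \<open>x\<close>.\<close>

lemma Liminf_rel_floor:
  "Liminf (at_right 0) (\<lambda>x. ereal (rel_floor x)) = liminf (\<lambda>n. ereal (log_ratio n / ln (1 / a n)))"
proof (rule antisym)
  have "filterlim a (at_right 0) sequentially"
  proof (rule tendsto_imp_filterlim_at_right)
    show "a \<longlonglongrightarrow> 0"
      by (rule tendsto_sandwich[OF always_eventually always_eventually tendsto_const b_lim])
        (use a_pos a_less_b in \<open>auto intro: less_imp_le\<close>)
  qed (use a_pos in auto)
  from Liminf_le_compose[OF this, of "\<lambda>x. ereal (rel_floor x)"]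
  show "Liminf (at_right 0) (\<lambda>x. ereal (rel_floor x)) \<le> liminf (\<lambda>n. ereal (log_ratio n / ln (1 / a n)))"
    unfolding rel_floor_a .
  have "liminf (\<lambda>n. ereal (log_ratio n / ln (1 / a n))) \<le>
      Liminf (at_right 0) (\<lambda>x. ereal (log_ratio (tooth_index x - 1) / ln (1 / a (tooth_index x - 1))))"
    by (rule Liminf_le_compose[OF filterlim_tooth_index])
  also have "\<dots> \<le> Liminf (at_right 0) (\<lambda>x. ereal (rel_floor x))"
  proof (rule Liminf_mono)
    have "\<forall>\<^sub>F x in at_right 0. x \<in> {0<..<1::real}" by (rule eventually_at_right_real) simp
    then show "\<forall>\<^sub>F x in at_right 0. ereal (log_ratio (tooth_index x - 1) / ln (1 / a (tooth_index x - 1))) \<le> ereal (rel_floor x)"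
    proof eventually_elim
      case (elim x)
      then show ?case using rel_floor_lower[OF tooth_index_between[of x]] by simp
    qed
  qed
  finally show "liminf (\<lambda>n. ereal (log_ratio n / ln (1 / a n))) \<le> Liminf (at_right 0) (\<lambda>x. ereal (rel_floor x))" .
qed

lemma Limsup_rel_floor:
  "Limsup (at_right 0) (\<lambda>x. ereal (rel_floor x)) = limsup (\<lambda>n. ereal (log_ratio n / ln (1 / b n)))"
proof (rule antisym)
  have "filterlim b (at_right 0) sequentially" by (rule tendsto_imp_filterlim_at_right[OF b_lim]) (use b_pos in auto)
  from Limsup_ge_compose[OF this, of "\<lambda>x. ereal (rel_floor x)"]
  show "limsup (\<lambda>n. ereal (log_ratio n / ln (1 / b n))) \<le> Limsup (at_right 0) (\<lambda>x. ereal (rel_floor x))"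
    unfolding rel_floor_b .
  define X where "X n = ereal (log_ratio n / ln (1 / b n))" for n
  show "Limsup (at_right 0) (\<lambda>x. ereal (rel_floor x)) \<le> limsup (\<lambda>n. ereal (log_ratio n / ln (1 / b n)))"
    unfolding Limsup_le_iff[of "at_right 0"] X_def[symmetric]
  proof (intro allI impI)
    fix y assume "limsup X < y"
    then have X: "\<forall>\<^sub>F n in sequentially. X n < y" using Limsup_le_iff[of sequentially X "limsup X"] by simp
    \<comment> \<open>The bound for an interval involves both of its ends, so the estimate is also
      required at the successor.\<close>
    then have "\<forall>\<^sub>F n in sequentially. X (Suc n) < y" using eventually_sequentially_Suc[of "\<lambda>n. X n < y"] by simp
    then have "\<forall>\<^sub>F n in sequentially. X n < y \<and> X (Suc n) < y \<and> 0 < n"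
      using X by (intro eventually_conj eventually_gt_at_top)
    from eventually_compose_filterlim[OF this filterlim_tooth_index]
    have "\<forall>\<^sub>F x in at_right 0. X (tooth_index x - 1) < y \<and> X (Suc (tooth_index x - 1)) < y \<and> 0 < tooth_index x - 1" .
    moreover have "\<forall>\<^sub>F x in at_right 0. x \<in> {0<..<1::real}" by (rule eventually_at_right_real) simp
    ultimately show "\<forall>\<^sub>F x in at_right 0. ereal (rel_floor x) < y"
    proof eventually_elim
      case (elim x)
      let ?n = "tooth_index x - 1"
      have "rel_floor x \<le> max (log_ratio ?n / ln (1 / b ?n)) (log_ratio (Suc ?n) / ln (1 / b (Suc ?n)))"
        by (rule rel_floor_upper) (use elim tooth_index_between[of x] in auto)
      then have "ereal (rel_floor x) \<le> max (X ?n) (X (Suc ?n))" unfolding X_def max_def by (simp split: if_splits)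
      also have "\<dots> < y" using elim unfolding max_less_iff_conj by blast
      finally show ?case .
    qed
  qed
qed

lemma eventually_ln_at_right:
  assumes "0 < d"
  shows "\<forall>\<^sub>F x in at_right 0. (c::real) \<le> d * ln (1 / x)"
proof -
  have "\<forall>\<^sub>F x in at_right 0. x \<in> {0<..<exp (- (c / d))}" by (rule eventually_at_right_real) simp
  then show ?thesis
  proof eventually_elim
    case (elim x)
    then have "ln x \<le> - (c / d)" using ln_mono[of x "exp (- (c / d))"] by simp
    then show ?case using elim assms by (simp add: ln_div field_simps)
  qed
qed

text \<open>The number of scales beyond \<open>x\<close> is of smaller order than log(1/x), because
  \<open>b\<close> decays faster than every geometric sequence. The factor 2 compares the index with
  its predecessor.\<close>

lemma eventually_tooth_index:
  assumes growth: "\<And>M. 0 < M \<Longrightarrow> \<forall>\<^sub>F n in sequentially. M * (real n + 1) \<le> ln (1 / b n)" and c: "0 < c" and d: "0 < d"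
  shows "\<forall>\<^sub>F x in at_right 0. c * (real (tooth_index x) + 1) \<le> d * ln (1 / x)"
proof -
  have "\<forall>\<^sub>F n in sequentially. 2 * c / d * (real n + 1) \<le> ln (1 / b n)" using c d by (intro growth) simp
  from eventually_compose_filterlim[OF this filterlim_tooth_index]
  have "\<forall>\<^sub>F x in at_right 0. 2 * c / d * (real (tooth_index x - 1) + 1) \<le> ln (1 / b (tooth_index x - 1))" .
  moreover have "\<forall>\<^sub>F x in at_right 0. x \<in> {0<..<1::real}" by (rule eventually_at_right_real) simp
  ultimately show ?thesis
  proof eventually_elim
    case (elim x)
    let ?n = "tooth_index x - 1"
    have x: "0 < x" "x < b ?n" using elim tooth_index_between[of x] by auto
    have "ln (1 / b ?n) \<le> ln (1 / x)" using x b_pos[of ?n] by (simp add: ln_div)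
    then have "2 * c / d * (real ?n + 1) \<le> ln (1 / x)" using elim by linarith
    then have "2 * c * (real ?n + 1) \<le> d * ln (1 / x)" using d by (simp add: field_simps)
    moreover have "c * (real (tooth_index x) + 1) \<le> c * (2 * (real ?n + 1))" using c by (intro mult_left_mono) auto
    ultimately show ?case by (simp add: algebra_simps)
  qed
qed

section \<open>Passage to the limit\<close>

lemma mod_ratio_eq: "0 < e \<Longrightarrow> mod_ratio W \<phi> I J e = enn2ereal (curve_modulus W (Gamma_eps \<phi> I J e)) / ereal (1 / pi * ln (1 / e))"
  by (simp add: mod_ratio_def V_map_image_W)

text \<open>The scales before \<open>N\<close> cost at most 2 log(1/b N), and the cutoff at C e
  instead of \<open>e\<close> at most 2 log C. Both are constants and hence small against
  log(1/e).\<close>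

lemma mod_ratio_lower:
  assumes PQ: "open_arc P" "open_arc Q" "-1 \<in> P" "-\<i> \<in> Q" and IJ: "I = P \<and> J = Q \<or> I = Q \<and> J = P" and d: "0 < d"
  shows "\<forall>\<^sub>F e in at_right 0. 1 + ereal (rel_floor e) \<le> mod_ratio W \<phi> I J e + ereal d"
proof -
  obtain C N where C: "C \<ge> 1" and lower: "\<And>e k. 0 < e \<Longrightarrow> k \<ge> N \<Longrightarrow>
      ennreal (1 / pi * (\<Sum>n\<in>{N..<k}. 2 * floor_len n (C * e) + tooth_len n (C * e))) \<le> curve_modulus W (Gamma_eps \<phi> I J e)"
    using modulus_lower_bound[OF PQ IJ] by blast
  have "\<forall>\<^sub>F e in at_right 0. 2 * ln C + 2 * ln (1 / b N) \<le> d * ln (1 / e)" by (rule eventually_ln_at_right[OF d])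
  moreover have "\<forall>\<^sub>F e in at_right 0. e \<in> {0<..<min (1 / C) (min (1 / 2) (b N))}"
    using C b_pos[of N] by (intro eventually_at_right_real) auto
  ultimately show ?thesis
  proof eventually_elim
    case (elim e)
    have e: "0 < e" "e < 1" "e < b N" "C * e \<le> 1" using elim C by (auto simp: field_simps)
    have l: "0 < ln (1 / e)" using e by simp
    define k where "k = tooth_index e"
    have "b k \<le> e" using b_tooth_index[OF e(1)] by (simp add: k_def)
    moreover have "e \<le> C * e" using e C mult_right_mono[of 1 C e] by simp
    ultimately have k: "b k \<le> C * e" by linarith
    have Nk: "N \<le> k" using tooth_index_le_iff[OF e(1), of N] e by (simp add: k_def)
    have Ce: "0 < C * e" using e C by simp
    define g where "g n = 2 * floor_len n (C * e) + tooth_len n (C * e)" for n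
    have "sum g {..<N} \<le> (\<Sum>n<N. 2 * (floor_len n (C * e) + tooth_len n (C * e)))"
      unfolding g_def by (intro sum_mono) (simp add: len_nonneg)
    also have "\<dots> = 2 * (ln (max 1 (C * e)) - ln (max (b N) (C * e)))"
      unfolding sum_distrib_left[symmetric] sum_len_add[OF Ce] ..
    also have "\<dots> \<le> 2 * ln (1 / b N)" using e ln_mono[of "b N" "max (b N) (C * e)"] b_pos[of N] by (simp add: max_absorb1 ln_div)
    finally have "sum g {..<N} \<le> 2 * ln (1 / b N)" .
    moreover have "sum g {..<k} = sum g {..<N} + sum g {N..<k}"
      using sum.atLeastLessThan_concat[of 0 N k g] Nk by (simp add: atLeast0LessThan)
    moreover have "sum g {..<k} = ln (1 / (C * e)) + floor_sum (C * e)"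
      unfolding g_def by (rule sum_len_double[OF Ce e(4) k])
    moreover have "ln (1 / (C * e)) = ln (1 / e) - ln C" using e C by (simp add: ln_div ln_mult)
    moreover have "floor_sum e - ln C \<le> floor_sum (C * e)" using floor_sum_scale(2)[OF e(1) C e(4)] .
    ultimately have "ln (1 / e) + floor_sum e \<le> sum g {N..<k} + d * ln (1 / e)" using elim by linarith
    then have "(ln (1 / e) + floor_sum e) / ln (1 / e) \<le> (sum g {N..<k} + d * ln (1 / e)) / ln (1 / e)"
      using l by (intro divide_right_mono) auto
    then have "1 + rel_floor e \<le> sum g {N..<k} / ln (1 / e) + d" using l by (simp add: add_divide_distrib)
    then have "1 + ereal (rel_floor e) \<le> ereal (sum g {N..<k} / ln (1 / e)) + ereal d" by (simp add: one_ereal_def)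
    also have "ereal (sum g {N..<k} / ln (1 / e)) \<le> mod_ratio W \<phi> I J e"
    proof -
      have "0 \<le> sum g {N..<k}" unfolding g_def by (intro sum_nonneg) (simp add: len_nonneg)
      then have "ereal (1 / pi * sum g {N..<k}) \<le> enn2ereal (curve_modulus W (Gamma_eps \<phi> I J e))"
        using lower[OF e(1) Nk] pi_gt_zero unfolding g_def[symmetric] less_eq_ennreal.rep_eq by (simp add: enn2ereal_ennreal)
      then have "ereal (1 / pi * sum g {N..<k}) / ereal (1 / pi * ln (1 / e)) \<le> mod_ratio W \<phi> I J e"
        unfolding mod_ratio_eq[OF e(1)] using l pi_gt_zero by (intro ereal_divide_right_mono) auto
      moreover have "ereal (1 / pi * sum g {N..<k}) / ereal (1 / pi * ln (1 / e)) = ereal (sum g {N..<k} / ln (1 / e))"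
        using l pi_gt_zero by simp
      ultimately show ?thesis by simp
    qed
    finally show ?case by (simp add: add_right_mono)
  qed
qed

text \<open>Enlarging the cutoff from e to K e only decreases the main term. The error is
  proportional to the number of scales and is absorbed by the growth assumption.\<close>

lemma mod_ratio_upper:
  assumes cc: "comb_const P Q K N" and PQ: "closure P \<inter> closure Q = {}" and P: "-1 \<in> P" and Q: "-\<i> \<in> Q"
    and sph: "P \<subseteq> sphere 0 1" "Q \<subseteq> sphere 0 1" and IJ: "I = P \<and> J = Q \<or> I = Q \<and> J = P" and d: "0 < d"
    and growth: "\<And>M. 0 < M \<Longrightarrow> \<forall>\<^sub>F n in sequentially. M * (real n + 1) \<le> ln (1 / b n)"
  shows "\<forall>\<^sub>F e in at_right 0. mod_ratio W \<phi> I J e \<le> 1 + ereal (rel_floor e) + ereal d"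
proof -
  have K: "2 \<le> K" using cc by (auto simp: comb_const_def)
  define c where "c = ln 4 / pi + 32 * pi * K ^ 4"
  have c: "0 < c" using K pi_gt_zero by (auto simp: c_def intro!: add_pos_pos)
  have "0 < pi * c" using c pi_gt_zero by simp
  then have "\<forall>\<^sub>F e in at_right 0. pi * c * (real (tooth_index e) + 1) \<le> d * ln (1 / e)"
    using eventually_tooth_index[OF growth _ d] by blast
  moreover have "\<forall>\<^sub>F e in at_right 0. e \<in> {0<..<min (1 / K) (b N)}"
    using K b_pos[of N] by (intro eventually_at_right_real) auto
  ultimately show ?thesis
  proof eventually_elim
    case (elim e)
    have e: "0 < e" "e < b N" "K * e \<le> 1" using elim K by (auto simp: field_simps)
    have le: "2 * e \<le> K * e" using K e by (intro mult_right_mono) auto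
    have "e < 1" using e le by linarith
    then have l: "0 < ln (1 / e)" using e by simp
    define k where "k = tooth_index e"
    have "b k \<le> e" using b_tooth_index[OF e(1)] by (simp add: k_def)
    then have k: "b k \<le> K * e" using e le by linarith
    have Nk: "N \<le> k" using tooth_index_le_iff[OF e(1), of N] e by (simp add: k_def)
    have Ke: "0 < K * e" using e K by simp
    define g where "g n = 2 * floor_len n (K * e) + tooth_len n (K * e)" for n
    have g0: "0 \<le> g n" for n by (simp add: g_def len_nonneg)
    have "sum g {N..<k} \<le> sum g {..<k}" by (rule sum_mono2) (use g0 in auto)
    also have "sum g {..<k} = ln (1 / (K * e)) + floor_sum (K * e)"
      unfolding g_def by (rule sum_len_double[OF Ke e(3) k])
    also have "\<dots> \<le> ln (1 / e) + floor_sum e"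
    proof (rule add_mono)
      show "ln (1 / (K * e)) \<le> ln (1 / e)" using e K le by (intro ln_mono) (auto simp: field_simps)
      show "floor_sum (K * e) \<le> floor_sum e" using K by (intro floor_sum_scale(1) e) auto
    qed
    finally have g: "sum g {N..<k} \<le> ln (1 / e) + floor_sum e" .
    define v where "v = 1 / pi * sum g {N..<k} + c * (real k + 1)"
    have v0: "0 \<le> v" using c pi_gt_zero sum_nonneg[of "{N..<k}" g] g0 by (simp add: v_def)
    have "pi * v = sum g {N..<k} + pi * c * (real k + 1)" using pi_gt_zero by (simp add: v_def algebra_simps)
    then have "pi * v \<le> ln (1 / e) + floor_sum e + d * ln (1 / e)" using g elim by (simp add: k_def)
    then have "pi * v / ln (1 / e) \<le> (ln (1 / e) + floor_sum e + d * ln (1 / e)) / ln (1 / e)"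
      using l by (intro divide_right_mono) auto
    then have "pi * v / ln (1 / e) \<le> 1 + rel_floor e + d" using l by (simp add: add_divide_distrib)
    then have v: "ereal (pi * v / ln (1 / e)) \<le> 1 + ereal (rel_floor e) + ereal d" by (simp add: one_ereal_def)
    have "curve_modulus W (Gamma_eps \<phi> I J e) \<le> ennreal v"
      using modulus_upper_bound[OF cc PQ P Q sph IJ e(1,3) Nk k] unfolding v_def c_def g_def .
    then have "enn2ereal (curve_modulus W (Gamma_eps \<phi> I J e)) \<le> ereal v"
      using v0 unfolding less_eq_ennreal.rep_eq by (simp add: enn2ereal_ennreal)
    then have "mod_ratio W \<phi> I J e \<le> ereal v / ereal (1 / pi * ln (1 / e))"
      unfolding mod_ratio_eq[OF e(1)] using l pi_gt_zero by (intro ereal_divide_right_mono) auto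
    also have "\<dots> = ereal (pi * v / ln (1 / e))" using l pi_gt_zero by simp
    finally show ?case using v by (rule order_trans)
  qed
qed

text \<open>In the first case b (n+1) < a n bounds the ratio of consecutive terms of
  \<open>b\<close> by a n / b n, which tends to 0; in the second the n-th root of \<open>b n\<close>
  tends to 0. Either way \<open>b\<close> decays faster than every geometric sequence.\<close>

lemma ln_b_growth:
  assumes growth: "((\<lambda>n. a n / b n) \<longlonglongrightarrow> 0) \<or> ((\<lambda>n. max (root n (a n)) (root n (b n))) \<longlonglongrightarrow> 0)" and M: "0 < M"
  shows "\<forall>\<^sub>F n in sequentially. M * (real n + 1) \<le> ln (1 / b n)"
  using growth
proof
  assume "(\<lambda>n. a n / b n) \<longlonglongrightarrow> 0"
  then have "\<forall>\<^sub>F n in sequentially. a n / b n < exp (- (2 * M))" by (rule order_tendstoD) simp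
  then obtain n0 where n0: "\<And>n. n \<ge> n0 \<Longrightarrow> a n / b n < exp (- (2 * M))" by (auto simp: eventually_sequentially)
  \<comment> \<open>From \<open>n0\<close> on, each index gains 2 M in the logarithm. The doubled
    rate makes up for the first \<open>n0\<close> indices as soon as n > 2 n0.\<close>
  have lin: "2 * M * (real n - real n0) \<le> ln (1 / b n)" if "n0 \<le> n" for n
    using that
  proof (induction n rule: dec_induct)
    case base
    have "ln (b n0) \<le> 0" using b_pos[of n0] b_le_1[of n0] by simp
    then show ?case using b_pos[of n0] by (simp add: ln_div)
  next
    case (step n)
    have "b (Suc n) < exp (- (2 * M)) * b n"
      using n0[OF step.hyps(1)] b_Suc_less[of n] b_pos[of n] by (simp add: field_simps)
    then have "ln (b (Suc n)) \<le> ln (exp (- (2 * M)) * b n)" using b_pos[of "Suc n"] by (intro ln_mono) auto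
    also have "\<dots> = - (2 * M) + ln (b n)" using b_pos[of n] by (simp add: ln_mult)
    finally show ?case using step.IH b_pos[of n] b_pos[of "Suc n"] by (simp add: ln_div algebra_simps)
  qed
  have "\<forall>\<^sub>F n in sequentially. 2 * n0 + 1 \<le> n" by (rule eventually_ge_at_top)
  then show ?thesis
  proof eventually_elim
    case (elim n)
    have "M * (real n + 1) \<le> M * (2 * (real n - real n0))" using M elim by (intro mult_left_mono) auto
    also have "\<dots> = 2 * M * (real n - real n0)" by (simp only: mult.assoc mult.left_commute)
    also have "\<dots> \<le> ln (1 / b n)" using elim by (intro lin) simp
    finally show ?case .
  qed
next
  assume "(\<lambda>n. max (root n (a n)) (root n (b n))) \<longlonglongrightarrow> 0"
  then have "\<forall>\<^sub>F n in sequentially. max (root n (a n)) (root n (b n)) < exp (- (2 * M))" by (rule order_tendstoD) simp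
  then show ?thesis using eventually_gt_at_top[of 0]
  proof eventually_elim
    case (elim n)
    have "b n = root n (b n) ^ n" using elim b_pos[of n] by simp
    also have "\<dots> \<le> exp (- (2 * M)) ^ n" using elim b_pos[of n] by (intro power_mono) auto
    also have "\<dots> = exp (- (2 * M * real n))" by (simp add: exp_of_nat_mult[symmetric] mult.commute)
    finally have "ln (b n) \<le> - (2 * M * real n)" using b_pos[of n] by (subst (asm) ln_le_cancel_iff[symmetric]) auto
    moreover have "M * (real n + 1) \<le> M * (2 * real n)" using M elim by (intro mult_left_mono) auto
    ultimately show ?case using b_pos[of n] by (simp add: ln_div)
  qed
qed

lemma real_not_in_W: "q = a n \<or> q = b n \<Longrightarrow> of_real q \<notin> W"
  using wall_not_in_W[of 0 q n] by (simp add: Complex_eq)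

lemma fext_wall_foot: "q = a n \<or> q = b n \<Longrightarrow> fext (of_real q) = bdry_pt W \<phi> q"
  using real_not_in_W[of q n] by (simp add: fext_def bval_def bdry_pt_def)

lemma mod_ratio_limits:
  assumes PQ: "open_arc P" "open_arc Q" "-1 \<in> P" "-\<i> \<in> Q" and IJ: "I = P \<and> J = Q \<or> I = Q \<and> J = P"
    and disj: "closure P \<inter> closure Q = {}"
    and ncP: "\<And>n q. q = a n \<or> q = b n \<Longrightarrow> fext (of_real q) \<in> closure P \<Longrightarrow> tip n \<notin> Q"
    and ncQ: "\<And>n q. q = a n \<or> q = b n \<Longrightarrow> fext (of_real q) \<in> closure Q \<Longrightarrow> tip n \<notin> P"
    and growth: "((\<lambda>n. a n / b n) \<longlonglongrightarrow> 0) \<or> ((\<lambda>n. max (root n (a n)) (root n (b n))) \<longlonglongrightarrow> 0)"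
  shows "Liminf (at_right 0) (mod_ratio W \<phi> I J) = 1 + liminf (\<lambda>n. ereal (log_ratio n / ln (1 / a n)))"
    and "Limsup (at_right 0) (mod_ratio W \<phi> I J) = 1 + limsup (\<lambda>n. ereal (log_ratio n / ln (1 / b n)))"
proof -
  have disj': "closure Q \<inter> closure P = {}" using disj by blast
  \<comment> \<open>\<open>wall_avoids_arc\<close> is applied in both orders, because a foot may
    correspond to either arc.\<close>
  obtain K N where cc: "comb_const P Q K N"
    using exists_comb_const[OF PQ(3,4) disj] ncP ncQ wall_avoids_arc[OF disj PQ(2,4)] wall_avoids_arc[OF disj' PQ(1,3)] by metis
  have sph: "P \<subseteq> sphere 0 1" "Q \<subseteq> sphere 0 1" using PQ(1,2) by (auto simp: open_arc_def)
  have nb: "at_right (0::real) \<noteq> bot" by simp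
  have lo: "\<forall>\<^sub>F e in at_right 0. 1 + ereal (rel_floor e) \<le> mod_ratio W \<phi> I J e + ereal d" if "0 < d" for d
    by (rule mod_ratio_lower[OF PQ IJ that])
  have up: "\<forall>\<^sub>F e in at_right 0. mod_ratio W \<phi> I J e \<le> 1 + ereal (rel_floor e) + ereal d" if "0 < d" for d
    by (rule mod_ratio_upper[OF cc disj PQ(3,4) sph IJ that ln_b_growth[OF growth]])
  have "Liminf (at_right 0) (mod_ratio W \<phi> I J) = Liminf (at_right 0) (\<lambda>e. 1 + ereal (rel_floor e))"
    by (intro antisym Liminf_Limsup_le_of_eventually(1)[OF nb] lo up)
  also have "\<dots> = 1 + Liminf (at_right 0) (\<lambda>e. ereal (rel_floor e))" by (rule Liminf_add_ereal_left[OF nb]) simp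
  finally show "Liminf (at_right 0) (mod_ratio W \<phi> I J) = 1 + liminf (\<lambda>n. ereal (log_ratio n / ln (1 / a n)))"
    unfolding Liminf_rel_floor .
  have "Limsup (at_right 0) (mod_ratio W \<phi> I J) = Limsup (at_right 0) (\<lambda>e. 1 + ereal (rel_floor e))"
    by (intro antisym Liminf_Limsup_le_of_eventually(2)[OF nb] lo up)
  also have "\<dots> = 1 + Limsup (at_right 0) (\<lambda>e. ereal (rel_floor e))" by (rule Limsup_add_ereal_left[OF nb]) simp
  finally show "Limsup (at_right 0) (mod_ratio W \<phi> I J) = 1 + limsup (\<lambda>n. ereal (log_ratio n / ln (1 / b n)))"
    unfolding Limsup_rel_floor .
qed

end

theorem lemma1p3:
  fixes a b :: "nat \<Rightarrow> real"
    and \<phi> :: "complex \<Rightarrow> complex"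
    and I J :: "complex set"
  assumes pos: "\<And>n. a n > 0" "\<And>n. b n > 0"
    and b0: "b 0 = 1"
    and interlace: "\<And>n. b (Suc n) < a n" "\<And>n. a n < b n"
    and lim0: "a \<longlonglongrightarrow> 0" "b \<longlonglongrightarrow> 0"
    and growth:
      "((\<lambda>n. a n / b n) \<longlonglongrightarrow> 0 \<and> (\<lambda>n. b (Suc n) / a n) \<longlonglongrightarrow> 0) \<or>
       ((\<exists>c. 0 < c \<and> c < 1 \<and> (\<forall>n. max (b (Suc n) / a n) (a n / b n) < c)) \<and>
        (\<lambda>n. max (root n (a n)) (root n (b n))) \<longlonglongrightarrow> 0)"
    and conformal: "normalized_conformal_map (W_dom a b) \<phi>"
    and arcs: "open_arc I" "open_arc J" "I \<inter> J = {}"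
    and position: "general_position a b \<phi> I J"
    and only_g: "{\<gamma> \<in> lamination a b \<phi>. belongs_to \<gamma> I J} = {leaf_g}"
  shows "Liminf (at_right 0) (mod_ratio (W_dom a b) \<phi> I J) =
           1 + liminf (\<lambda>n. ereal (ln ((\<Prod>k<n. a k) / (\<Prod>k\<le>n. b k)) / ln (1 / a n))) \<and>
         Limsup (at_right 0) (mod_ratio (W_dom a b) \<phi> I J) =
           1 + limsup (\<lambda>n. ereal (ln ((\<Prod>k<n. a k) / (\<Prod>k\<le>n. b k)) / ln (1 / b n)))"
proof -
  interpret comb_domain a b \<phi> by unfold_locales (fact pos(1) b0 interlace lim0(2) conformal)+
  have g: "belongs_to leaf_g I J" and unique: "\<And>\<gamma>. \<gamma> \<in> lamination a b \<phi> \<Longrightarrow> belongs_to \<gamma> I J \<Longrightarrow> \<gamma> = leaf_g"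
    using only_g by blast+
  have sph: "I \<subseteq> sphere 0 1" "J \<subseteq> sphere 0 1" using arcs by (auto simp: open_arc_def)
  obtain x y where xy: "x \<in> I" "y \<in> J" "leaf_g = geodesic x y" using g unfolding belongs_to_def by blast
  then have ends: "{x, y} = {-1, -\<i>}" using sph by (intro geodesic_eq_leaf_g) auto
  have disj: "closure I \<inter> closure J = {}" using position by (simp add: general_position_def)
  \<comment> \<open>If a tip is in one arc and a foot in the closure of the other, then general
    position puts the foot into that arc itself. The leaf joining them belongs to the box and must
    be \<open>leaf_g\<close>, although no tip is -1 or -\<i>.\<close>
  have foot: "fext (of_real q) \<notin> closure X" if "q = a n \<or> q = b n" "tip n \<in> Y" "X = I \<and> Y = J \<or> X = J \<and> Y = I" for n q X Y
  proof
    assume cl: "fext (of_real q) \<in> closure X"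
    have e: "fext (of_real q) = bdry_pt W \<phi> q" using that(1) by (rule fext_wall_foot)
    have "q \<in> {a n, b n}" using that(1) by simp
    then have "\<not> (tip n \<in> I \<and> bdry_pt W \<phi> q \<in> closure J - J)" "\<not> (tip n \<in> J \<and> bdry_pt W \<phi> q \<in> closure I - I)"
      using position unfolding general_position_def Let_def by blast+
    then have X: "bdry_pt W \<phi> q \<in> X" using cl that(2,3) unfolding e by blast
    let ?\<gamma> = "geodesic (tip n) (bdry_pt W \<phi> q)"
    have "?\<gamma> \<in> lamination a b \<phi>" using that(1) unfolding lamination_def by blast
    moreover have "belongs_to ?\<gamma> I J"
      using that(2,3) X geodesic_commute[of "tip n" "bdry_pt W \<phi> q"] unfolding belongs_to_def by blast
    ultimately have "?\<gamma> = leaf_g" by (rule unique)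
    moreover have "norm (bdry_pt W \<phi> q) = 1" using X sph that(3) by auto
    ultimately have "{tip n, bdry_pt W \<phi> q} = {-1, -\<i>}" using norm_tip by (intro geodesic_eq_leaf_g)
    then have "tip n \<in> {-1, -\<i>}" by blast
    then show False using tip_neq[of n] by simp
  qed
  \<comment> \<open>The leaf is unoriented, so either of the two arcs may be the one that contains
    -1.\<close>
  obtain P Q where PQ: "open_arc P" "open_arc Q" "-1 \<in> P" "-\<i> \<in> Q" "I = P \<and> J = Q \<or> I = Q \<and> J = P" "closure P \<inter> closure Q = {}"
  proof -
    have "x = -1 \<and> y = -\<i> \<or> x = -\<i> \<and> y = -1" using ends by (auto simp: doubleton_eq_iff)
    then show thesis using that[of I J] that[of J I] arcs xy disj by blast
  qed
  have tips: "tip n \<notin> Q" if "q = a n \<or> q = b n" "fext (of_real q) \<in> closure P" for n q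
    using foot[OF that(1), of Q P] that(2) PQ(5) by blast
  have tips': "tip n \<notin> P" if "q = a n \<or> q = b n" "fext (of_real q) \<in> closure Q" for n q
    using foot[OF that(1), of P Q] that(2) PQ(5) by blast
  have gr: "((\<lambda>n. a n / b n) \<longlonglongrightarrow> 0) \<or> ((\<lambda>n. max (root n (a n)) (root n (b n))) \<longlonglongrightarrow> 0)"
    using growth by blast
  have "Liminf (at_right 0) (mod_ratio W \<phi> I J) = 1 + liminf (\<lambda>n. ereal (log_ratio n / ln (1 / a n)))"
    by (rule mod_ratio_limits(1)[OF PQ(1-6) _ _ gr]) (use tips tips' in blast)+
  moreover have "Limsup (at_right 0) (mod_ratio W \<phi> I J) = 1 + limsup (\<lambda>n. ereal (log_ratio n / ln (1 / b n)))"
    by (rule mod_ratio_limits(2)[OF PQ(1-6) _ _ gr]) (use tips tips' in blast)+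
  ultimately show ?thesis unfolding log_ratio_def by blast
qed

end
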